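(* Let $N\ge0$, $\varepsilon>0$, and let $U_N(t,x,y)=(2\pi\alpha)^{-2}\int_{\mathbb R^2}e^{i\varphi(t,x,y,\eta)/\alpha}u_N(t,y,\eta)\,d\eta$ with $u_N=\sum_{k=0}^N\alpha^ku_{(k)}$, $u_{(0)}(t,y,\eta)=\theta_\varepsilon(x^t(y,\eta))\theta_\varepsilon(y)(\det Z(t,y,\eta))^{1/2}$ and $u_{(1)},\dots,u_{(N)}$ smooth amplitudes (independent of $x$). For $\sin(\omega t)\ne0$ put $$\eta_*(t,x,y)=A(y)+\frac{\omega}{\sin(\omega t)}\big(x-\cos(\omega t)y\big),$$ the unique solution $\eta$ of $x=x^t(y,\eta)$. Let $K$ be a compact subset of the set of $(t,x,y)$ with $\sin(\omega t)\ne0$, $y\neq 0$, such that the trajectory $\{x^s(y,\eta_*(t,x,y)):0\le s\le t\}$ avoids the origin. Then, uniformly on $K$, $$U_N(t,x,y)=\frac{\omega\,e^{iS(t,y,\eta_* )/\alpha}}{2\pi i\alpha\sin(\omega t)}\sum_{k=0}^N\alpha^kC_k(t,x,y)+O(\alpha^N),$$ where $$S(t,y,\eta_*(t,x,y))=\frac{\omega}{2\sin(\omega t)}\Big(\cos(\omega t)(|x|^2+|y|^2)-2x\cdot y\Big)+b(\operatorname{Arg}x-\operatorname{Arg}y+2\ell\pi),$$ with $\ell\in\mathbb Z$ determined by a continuous lift of the argument along the trajectory from $y$ to $x$, and for $0\le m\le N$ $$C_m(t,x,y)=(\det Z(t,y,\eta_* ))^{-1/2}\sum_{k=0}^mL_{m-k}u_{(k)}(t,y,\eta)\Big|_{\eta=\eta_*(t,x,y)},$$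 $$L_jf=\sum_{\mu=0}^{2j}\frac{i^{-j}2^{-j-\mu}}{(j+\mu)!\,\mu!}\Big[\big\langle\varphi_{\eta\eta}^{-1}D_\eta,D_\eta\big\rangle^{j+\mu}\big(\varphi_{\ge3}^{\mu}f\big)\Big]_{\eta=\eta_*},$$ $$\varphi_{\ge3}(t,x,y,\eta)=\varphi(t,x,y,\eta)-\varphi(t,x,y,\eta_* )-\tfrac12(\eta-\eta_* )\cdot\varphi_{\eta\eta}(t,x,y,\eta_* )(\eta-\eta_* ).$$ In particular, in the region where the cut-offs are identically one, $$U_N(t,x,y)=\frac{\omega\,e^{iS(t,y,\eta_* )/\alpha}}{2\pi i\alpha\sin(\omega t)}\big(1+O(\alpha)\big).$$
   Context: $\alpha>0$ is a small semiclassical parameter, $\omega>0$, $b\in\mathbb R$, $\mathcal B>0$. $A(x)=\big(-b\,x_2/|x|^2,\ b\,x_1/|x|^2\big)$ for $x\ne0$; $u\wedge v=u_1v_2-u_2v_1$. The Hamiltonian is $h(x,\xi)=\frac12|\xi-A(x)|^2+\frac{\omega^2}{2}|x|^2$; $(x^t,\xi^t)=(x^t(y,\eta),\xi^t(y,\eta))$ solves $\dot x^t=\xi^t-A(x^t)$, $\dot\xi^t=-h_x(x^t,\xi^t)$, $x^0=y$, $\xi^0=\eta$; away from the origin it is given by $x^t=\cos(\omega t)y+\frac{\sin(\omega t)}{\omega}(\eta-A(y))$, $\xi^t=\dot x^t+A(x^t)$. The action is $S(t,y,\eta)=\int_0^t(h_\xi\cdot\xi-h)(x^s,\xi^s)\,ds$;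 the phase is $\varphi(t,x,y,\eta)=S(t,y,\eta)+(x-x^t)\cdot\xi^t+i\mathcal B|x-x^t|^2/2$; $Z=\xi^t_\eta-i\mathcal Bx^t_\eta$ (Jacobians in $\eta$), and $(\det Z)^{1/2}$ is the branch continuous in $t$ with $\arg\det Z|_{t=0}=0$. $\theta\in C^\infty(\mathbb R^2)$ with $\theta=1$ for $|x|>2$, $\theta=0$ for $|x|<1$, $\theta_\varepsilon(x)=\theta(x/\varepsilon)$. $D_\eta=-i\partial_\eta$, $\varphi_{\eta\eta}$ is the Hessian in $\eta$ evaluated at $\eta_*$, and $\langle\varphi_{\eta\eta}^{-1}D_\eta,D_\eta\rangle$ is the second-order operator $\sum_{j,k}(\varphi_{\eta\eta}^{-1})_{jk}D_{\eta_j}D_{\eta_k}$.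
   Formalization: The smooth amplitudes u_(1),…,u_(N) are additionally assumed to grow at most polynomially in η, locally uniformly in (t,y); without a growth condition the integral defining U_N may diverge, e.g. for u_(1)=exp(|η|^4). *)

theory Defs
  imports "HOL-Analysis.Analysis"
begin

type_synonym R2 = "real \<times> real"

definition pd :: "'a::real_normed_vector \<Rightarrow> ('a \<Rightarrow> 'b::real_normed_vector) \<Rightarrow> 'a \<Rightarrow> 'b" where
  "pd v f p = vector_derivative (\<lambda>s. f (p + s *\<^sub>R v)) (at 0)"

fun pds :: "'a::real_normed_vector list \<Rightarrow> ('a \<Rightarrow> 'b::real_normed_vector) \<Rightarrow> 'a \<Rightarrow> 'b" where
  "pds [] f = f"
| "pds (v # vs) f = pd v (pds vs f)"

definition smooth_fun :: "('a::euclidean_space \<Rightarrow> 'b::real_normed_vector) \<Rightarrow> bool" where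
  "smooth_fun f \<longleftrightarrow> (\<forall>vs. set vs \<subseteq> Basis \<longrightarrow> (\<forall>p. pds vs f differentiable (at p)))"

definition e2 :: "nat \<Rightarrow> R2" where
  "e2 j = (if j = 0 then (1, 0) else (0, 1))"

definition comp2 :: "nat \<Rightarrow> R2 \<Rightarrow> real" where
  "comp2 j v = (if j = 0 then fst v else snd v)"

text \<open>Vector potential; A(0) is not defined in the paper, we put A(0) = 0 (irrelevant).\<close>
definition Avec :: "real \<Rightarrow> R2 \<Rightarrow> R2" where
  "Avec b x = (if x = 0 then 0 else (- b * snd x / (norm x)^2, b * fst x / (norm x)^2))"

definition ham :: "real \<Rightarrow> real \<Rightarrow> R2 \<Rightarrow> R2 \<Rightarrow> real" where
  "ham om b x \<xi> = (norm (\<xi> - Avec b x))^2 / 2 + om^2 / 2 * (norm x)^2"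

text \<open>h_xi . xi - h, with h_xi = xi - A(x).\<close>
definition lagr :: "real \<Rightarrow> real \<Rightarrow> R2 \<Rightarrow> R2 \<Rightarrow> real" where
  "lagr om b x \<xi> = inner (\<xi> - Avec b x) \<xi> - ham om b x \<xi>"

definition xt :: "real \<Rightarrow> real \<Rightarrow> real \<Rightarrow> R2 \<Rightarrow> R2 \<Rightarrow> R2" where
  "xt om b t y \<eta> = cos (om * t) *\<^sub>R y + (sin (om * t) / om) *\<^sub>R (\<eta> - Avec b y)"

definition xdot :: "real \<Rightarrow> real \<Rightarrow> real \<Rightarrow> R2 \<Rightarrow> R2 \<Rightarrow> R2" where
  "xdot om b t y \<eta> = (- om * sin (om * t)) *\<^sub>R y + cos (om * t) *\<^sub>R (\<eta> - Avec b y)"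

definition xit :: "real \<Rightarrow> real \<Rightarrow> real \<Rightarrow> R2 \<Rightarrow> R2 \<Rightarrow> R2" where
  "xit om b t y \<eta> = xdot om b t y \<eta> + Avec b (xt om b t y \<eta>)"

definition action :: "real \<Rightarrow> real \<Rightarrow> real \<Rightarrow> R2 \<Rightarrow> R2 \<Rightarrow> real" where
  "action om b t y \<eta> =
     (if 0 \<le> t then integral {0..t} (\<lambda>s. lagr om b (xt om b s y \<eta>) (xit om b s y \<eta>))
      else - integral {t..0} (\<lambda>s. lagr om b (xt om b s y \<eta>) (xit om b s y \<eta>)))"

definition phi :: "real \<Rightarrow> real \<Rightarrow> real \<Rightarrow> real \<Rightarrow> R2 \<Rightarrow> R2 \<Rightarrow> R2 \<Rightarrow> complex" where
  "phi om b B t x y \<eta> =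
     complex_of_real (action om b t y \<eta>)
     + complex_of_real (inner (x - xt om b t y \<eta>) (xit om b t y \<eta>))
     + \<i> * complex_of_real B * complex_of_real ((norm (x - xt om b t y \<eta>))^2) / 2"

definition Zent :: "real \<Rightarrow> real \<Rightarrow> real \<Rightarrow> real \<Rightarrow> R2 \<Rightarrow> R2 \<Rightarrow> nat \<Rightarrow> nat \<Rightarrow> complex" where
  "Zent om b B t y \<eta> i j =
     complex_of_real (comp2 i (pd (e2 j) (xit om b t y) \<eta>))
     - \<i> * complex_of_real B * complex_of_real (comp2 i (pd (e2 j) (xt om b t y) \<eta>))"

definition detZ :: "real \<Rightarrow> real \<Rightarrow> real \<Rightarrow> real \<Rightarrow> R2 \<Rightarrow> R2 \<Rightarrow> complex" where
  "detZ om b B t y \<eta> = Zent om b B t y \<eta> 0 0 * Zent om b B t y \<eta> 1 1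
                        - Zent om b B t y \<eta> 0 1 * Zent om b B t y \<eta> 1 0"

definition sqrtdetZ :: "real \<Rightarrow> real \<Rightarrow> real \<Rightarrow> real \<Rightarrow> R2 \<Rightarrow> R2 \<Rightarrow> complex" where
  "sqrtdetZ om b B t y \<eta> =
     (THE w. \<exists>(g::real \<Rightarrow> complex). continuous_on (closed_segment 0 t) g \<and> g 0 = 1
        \<and> (\<forall>s\<in>closed_segment 0 t. (g s)^2 = detZ om b B s y \<eta>) \<and> g t = w)"

definition theta_eps :: "(R2 \<Rightarrow> real) \<Rightarrow> real \<Rightarrow> R2 \<Rightarrow> real" where
  "theta_eps \<theta> \<epsilon> x = \<theta> ((1 / \<epsilon>) *\<^sub>R x)"

definition uzero :: "real \<Rightarrow> real \<Rightarrow> real \<Rightarrow> (R2 \<Rightarrow> real) \<Rightarrow> real \<Rightarrow> real \<times> R2 \<times> R2 \<Rightarrow> complex" where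
  "uzero om b B \<theta> \<epsilon> p = (case p of (t, y, \<eta>) \<Rightarrow>
     complex_of_real (theta_eps \<theta> \<epsilon> (xt om b t y \<eta>) * theta_eps \<theta> \<epsilon> y) * sqrtdetZ om b B t y \<eta>)"

definition Uprop :: "real \<Rightarrow> real \<Rightarrow> real \<Rightarrow> nat \<Rightarrow> (nat \<Rightarrow> real \<times> R2 \<times> R2 \<Rightarrow> complex)
                   \<Rightarrow> real \<Rightarrow> real \<Rightarrow> R2 \<Rightarrow> R2 \<Rightarrow> complex" where
  "Uprop om b B N u \<alpha> t x y =
     complex_of_real ((2 * pi * \<alpha>) powr (-2)) *
     integral UNIV (\<lambda>\<eta>. exp (\<i> * phi om b B t x y \<eta> / complex_of_real \<alpha>)
                          * (\<Sum>k\<le>N. complex_of_real (\<alpha>^k) * u k (t, y, \<eta>)))"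

definition etastar :: "real \<Rightarrow> real \<Rightarrow> real \<Rightarrow> R2 \<Rightarrow> R2 \<Rightarrow> R2" where
  "etastar om b t x y = Avec b y + (om / sin (om * t)) *\<^sub>R (x - cos (om * t) *\<^sub>R y)"

definition hess :: "real \<Rightarrow> real \<Rightarrow> real \<Rightarrow> real \<Rightarrow> R2 \<Rightarrow> R2 \<Rightarrow> nat \<Rightarrow> nat \<Rightarrow> complex" where
  "hess om b B t x y j k = pd (e2 j) (pd (e2 k) (phi om b B t x y)) (etastar om b t x y)"

definition inv2 :: "(nat \<Rightarrow> nat \<Rightarrow> complex) \<Rightarrow> nat \<Rightarrow> nat \<Rightarrow> complex" where
  "inv2 M j k = (let d = M 0 0 * M 1 1 - M 0 1 * M 1 0 in
     (if j = 0 \<and> k = 0 then M 1 1 / d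
      else if j = 0 then - M 0 1 / d
      else if k = 0 then - M 1 0 / d
      else M 0 0 / d))"

definition Deta :: "nat \<Rightarrow> (R2 \<Rightarrow> complex) \<Rightarrow> R2 \<Rightarrow> complex" where
  "Deta j f = (\<lambda>\<eta>. - \<i> * pd (e2 j) f \<eta>)"

definition Qop :: "(nat \<Rightarrow> nat \<Rightarrow> complex) \<Rightarrow> (R2 \<Rightarrow> complex) \<Rightarrow> R2 \<Rightarrow> complex" where
  "Qop M f = (\<lambda>\<eta>. \<Sum>j<2. \<Sum>k<2. M j k * Deta j (Deta k f) \<eta>)"

definition phi3 :: "real \<Rightarrow> real \<Rightarrow> real \<Rightarrow> real \<Rightarrow> R2 \<Rightarrow> R2 \<Rightarrow> R2 \<Rightarrow> complex" where
  "phi3 om b B t x y \<eta> =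
     phi om b B t x y \<eta> - phi om b B t x y (etastar om b t x y)
     - (\<Sum>j<2. \<Sum>k<2. complex_of_real (comp2 j (\<eta> - etastar om b t x y))
           * hess om b B t x y j k * complex_of_real (comp2 k (\<eta> - etastar om b t x y))) / 2"

definition Lop :: "real \<Rightarrow> real \<Rightarrow> real \<Rightarrow> real \<Rightarrow> R2 \<Rightarrow> R2 \<Rightarrow> nat \<Rightarrow> (R2 \<Rightarrow> complex) \<Rightarrow> complex" where
  "Lop om b B t x y j f =
     (\<Sum>\<mu>\<le>2*j. inverse (\<i> ^ j) * complex_of_real ((1/2) ^ (j + \<mu>) / (fact (j + \<mu>) * fact \<mu>))
        * ((Qop (inv2 (hess om b B t x y)) ^^ (j + \<mu>)) (\<lambda>\<eta>. (phi3 om b B t x y \<eta>) ^ \<mu> * f \<eta>))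
            (etastar om b t x y))"

definition Ccoef :: "real \<Rightarrow> real \<Rightarrow> real \<Rightarrow> (nat \<Rightarrow> real \<times> R2 \<times> R2 \<Rightarrow> complex)
                     \<Rightarrow> nat \<Rightarrow> real \<Rightarrow> R2 \<Rightarrow> R2 \<Rightarrow> complex" where
  "Ccoef om b B u m t x y =
     inverse (sqrtdetZ om b B t y (etastar om b t x y))
     * (\<Sum>k\<le>m. Lop om b B t x y (m - k) (\<lambda>\<eta>. u k (t, y, \<eta>)))"

definition prefac :: "real \<Rightarrow> real \<Rightarrow> real \<Rightarrow> real \<Rightarrow> R2 \<Rightarrow> R2 \<Rightarrow> complex" where
  "prefac om b \<alpha> t x y =
     complex_of_real om * exp (\<i> * complex_of_real (action om b t y (etastar om b t x y)) / complex_of_real \<alpha>)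
     / (2 * complex_of_real pi * \<i> * complex_of_real \<alpha> * complex_of_real (sin (om * t)))"

end

theory Submission
  imports Defs "HOL-Probability.Characteristic_Functions"
begin

text \<open>Put \<open>s = sin(\<omega>t)/\<omega>\<close>. Since \<open>x\<^sup>t = x + s(\<eta> - \<eta>\<^sub>*)\<close> is affine in \<open>\<eta>\<close>, the imaginary part of the phase
  is exactly \<open>B s\<^sup>2|\<eta> - \<eta>\<^sub>*|\<^sup>2/2\<close>. Hence \<open>\<phi>\<close> minus its second order Taylor polynomial is real, and
  \<open>e\<^sup>i\<^sup>\<phi>\<^sup>/\<^sup>\<alpha>\<close> is a complex Gaussian times a factor of modulus one, on all of the plane. Expanding that
  factor and the amplitude in Taylor polynomials at \<open>\<eta>\<^sub>*\<close> leaves Gaussian moments, which Wick's rule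
  turns into the operators \<open>L\<^sub>j\<close>; the errors are absorbed by the Gaussian.
  A null set of momenta has trajectories through the origin. Elsewhere the square root of
  \<open>det Z\<close> is \<open>m (1 - (s b/(m|x\<^sup>t|\<^sup>2))\<^sup>2)\<^sup>1\<^sup>/\<^sup>2\<close> with \<open>m = cos(\<omega>t) - iBs\<close> and the principal root, which is
  also the root produced by the Gaussian integral.\<close>

subsection \<open>Uniformly smooth families\<close>

text \<open>The natural scale is a distance of order sqrt \<alpha> from the critical point: a
  remainder vanishing to third order makes each factor \<open>R / \<alpha>\<close> worth sqrt
  \<alpha>, and the area of the Gaussian bump contributes one more factor \<alpha>. Far from the
  critical point nothing oscillatory is exploited; polynomial bounds on the amplitude lose against
  the Gaussian there. Two obstacles shape the development. Every constant has to be uniform over the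
  compact set of (t, x, y), so smoothness is treated for whole indexed families that share one bound
  per derivative, on balls of a common radius. Moreover the action may jump across the line of
  momenta with zero angular momentum, where the root of det Z may lose its meaning as well.
  Continuity of the integrand is therefore claimed only off that null line, while derivative bounds
  are required only on a ball around the critical momentum, whose trajectories keep a fixed distance
  from the origin.\<close>

lemma pd_eq:
  assumes "(f has_derivative f') (at p)"
  shows "pd v f p = f' v"
proof -
  have 1: "((\<lambda>s. p + s *\<^sub>R v) has_derivative (\<lambda>s. s *\<^sub>R v)) (at 0)"
    by (auto intro!: derivative_eq_intros)
  have "((\<lambda>s. f (p + s *\<^sub>R v)) has_derivative (\<lambda>s. f' (s *\<^sub>R v))) (at 0)"
    using has_derivative_compose[OF 1, of f f'] assms by simp
  moreover have "(\<lambda>s. f' (s *\<^sub>R v)) = (\<lambda>s. s *\<^sub>R f' v)"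
    using has_derivative_linear[OF assms] by (simp add: linear_cmul)
  ultimately show ?thesis
    unfolding pd_def by (intro vector_derivative_at) (simp add: has_vector_derivative_def)
qed

lemma has_derivative_pd:
  "f differentiable (at p) \<Longrightarrow> (f has_derivative (\<lambda>v. pd v f p)) (at p)"
  using pd_eq by (metis (no_types, lifting) differentiable_def ext)

lemma pd_cong:
  assumes "open S" "p \<in> S" "\<And>q. q \<in> S \<Longrightarrow> f q = g q"
  shows "pd v f p = pd v g p"
proof -
  have "open ((\<lambda>s::real. p + s *\<^sub>R v) -` S)"
    by (intro open_vimage assms continuous_intros)
  then have "eventually (\<lambda>s. s \<in> (\<lambda>s. p + s *\<^sub>R v) -` S) (nhds 0)"
    by (rule eventually_nhds_in_open) (use assms in simp)
  then have "eventually (\<lambda>s. f (p + s *\<^sub>R v) = g (p + s *\<^sub>R v)) (nhds 0)"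
    by (rule eventually_mono) (use assms in auto)
  then show ?thesis unfolding pd_def
    by (intro vector_derivative_cong_eq) (auto elim: eventually_mono)
qed

lemma differentiable_cong_open:
  assumes "open S" "p \<in> S" "\<And>q. q \<in> S \<Longrightarrow> f q = g q" "f differentiable (at p)"
  shows "g differentiable (at p)"
  using assms unfolding differentiable_def
  by (meson has_derivative_transform_within_open)

text \<open>One constant per derivative serves all indices in \<open>K\<close> and all points of the
  sets \<open>S i\<close>; this is how uniformity over the compact parameter set is carried along.
  At level 0 only boundedness is asked, so that the Leibniz rule becomes a plain induction on the
  level.\<close>

primrec unif_smooth ::
  "nat \<Rightarrow> 'i set \<Rightarrow> ('i \<Rightarrow> 'a::euclidean_space set) \<Rightarrow> ('i \<Rightarrow> 'a \<Rightarrow> 'b::real_normed_vector) \<Rightarrow> bool" where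
  "unif_smooth 0 K S f \<longleftrightarrow> (\<exists>C. \<forall>i\<in>K. \<forall>p\<in>S i. norm (f i p) \<le> C)"
| "unif_smooth (Suc n) K S f \<longleftrightarrow> (\<exists>C. \<forall>i\<in>K. \<forall>p\<in>S i. norm (f i p) \<le> C)
     \<and> (\<forall>i\<in>K. \<forall>p\<in>S i. f i differentiable (at p))
     \<and> (\<forall>v\<in>Basis. unif_smooth n K S (\<lambda>i. pd v (f i)))"

section \<open>Stability of uniform derivative bounds under algebraic operations\<close>

lemma unif_smooth_bounded:
  "unif_smooth n K S f \<Longrightarrow> \<exists>C. \<forall>i\<in>K. \<forall>p\<in>S i. norm (f i p) \<le> C"
  by (cases n) auto

lemma unif_smooth_mono: "unif_smooth n K S f \<Longrightarrow> m \<le> n \<Longrightarrow> unif_smooth m K S f"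
proof (induction n arbitrary: m f)
  case (Suc n)
  then show ?case by (cases m) auto
qed simp

lemma unif_smooth_subset:
  "unif_smooth n K S f \<Longrightarrow> L \<subseteq> K \<Longrightarrow> unif_smooth n L S f"
proof (induction n arbitrary: f)
  case 0 then show ?case by (auto intro: subsetD)
next
  case (Suc n)
  then show ?case by (simp add: subset_eq) blast
qed

lemma unif_smooth_const:
  fixes c :: "'i \<Rightarrow> 'b::real_normed_vector" and S :: "'i \<Rightarrow> 'a::euclidean_space set"
  assumes "\<And>i. i \<in> K \<Longrightarrow> norm (c i) \<le> C"
  shows "unif_smooth n K S (\<lambda>i _. c i)"
proof -
  have pd0: "pd v (\<lambda>_. d) = (\<lambda>_. 0)" for v :: 'a and d :: 'b
    using pd_eq[of "\<lambda>_. d" "\<lambda>_. 0"] by (auto simp: fun_eq_iff)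
  have zero: "unif_smooth n K S (\<lambda>i _. 0 :: 'b)" for n
    by (induction n) (auto simp: pd0)
  show ?thesis using assms zero by (cases n) (auto simp: pd0 )
qed

lemma smooth_fun_continuous: "smooth_fun F \<Longrightarrow> continuous_on A F"
  unfolding smooth_fun_def
  by (metis differentiable_imp_continuous_on differentiable_on_def differentiable_at_withinI empty_set empty_subsetI pds.simps(1))

lemma pds_append: "pds (vs @ ws) f = pds vs (pds ws f)"
  by (induction vs) auto

lemma smooth_fun_pd:
  fixes F :: "'e::euclidean_space \<Rightarrow> 'b::real_normed_vector"
  assumes "smooth_fun F" "w \<in> Basis" shows "smooth_fun (pd w F)"
  unfolding smooth_fun_def
proof (intro allI impI)
  fix vs p assume "set vs \<subseteq> (Basis :: 'e set)"
  then have "pds (vs @ [w]) F differentiable at p"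
    using assms unfolding smooth_fun_def by auto
  then show "pds vs (pd w F) differentiable at p" by (simp add: pds_append)
qed

context
  fixes K :: "'i set" and S :: "'i \<Rightarrow> 'a::euclidean_space set"
  assumes op: "\<And>i. i \<in> K \<Longrightarrow> open (S i)"
begin

text \<open>Openness of \<open>S i\<close> makes \<open>pd\<close> insensitive to values outside
  \<open>S i\<close>. Derivative formulas that hold only there can thus replace the derivatives
  themselves.\<close>

lemma unif_smooth_cong:
  assumes "unif_smooth n K S f" "\<And>i p. i \<in> K \<Longrightarrow> p \<in> S i \<Longrightarrow> f i p = g i p"
  shows "unif_smooth n K S g"
  using assms
proof (induction n arbitrary: f g)
  case 0
  then show ?case by simp
next
  case (Suc n)
  have "unif_smooth n K S (\<lambda>i. pd v (g i))" if "v \<in> Basis" for v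
  proof (rule Suc.IH)
    show "unif_smooth n K S (\<lambda>i. pd v (f i))" using Suc that by simp
    show "pd v (f i) p = pd v (g i) p" if "i \<in> K" "p \<in> S i" for i p
      by (rule pd_cong[OF op]) (use Suc.prems(2) that in auto)
  qed
  moreover have "g i differentiable (at p)" if "i \<in> K" "p \<in> S i" for i p
    using Suc.prems that differentiable_cong_open[OF op[OF that(1)] that(2), of "f i" "g i"] by auto
  ultimately show ?case using Suc.prems by simp
qed

lemma unif_smooth_add:
  assumes "unif_smooth n K S f" "unif_smooth n K S g"
  shows "unif_smooth n K S (\<lambda>i p. f i p + g i p)"
proof -
  have bd: "\<exists>C. \<forall>i\<in>K. \<forall>p\<in>S i. norm (f i p + g i p) \<le> C"
    if f: "unif_smooth n K S f" and g: "unif_smooth n K S g" for n and f g :: "'i \<Rightarrow> 'a \<Rightarrow> 'c::real_normed_vector"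
    using unif_smooth_bounded[OF f] unif_smooth_bounded[OF g] by (meson norm_triangle_mono)
  show ?thesis using assms
  proof (induction n arbitrary: f g)
    case 0
    then show ?case using bd[of 0] by simp
  next
    case (Suc n)
    have d: "f i differentiable (at p)" "g i differentiable (at p)" if "i \<in> K" "p \<in> S i" for i p
      using Suc.prems that by auto
    have "unif_smooth n K S (\<lambda>i. pd v (\<lambda>p. f i p + g i p))" if v: "v \<in> Basis" for v
    proof (rule unif_smooth_cong)
      show "unif_smooth n K S (\<lambda>i p. pd v (f i) p + pd v (g i) p)"
        by (rule Suc.IH) (use Suc.prems v in auto)
      show "pd v (f i) p + pd v (g i) p = pd v (\<lambda>p. f i p + g i p) p" if "i \<in> K" "p \<in> S i" for i p
        using has_derivative_add[OF has_derivative_pd[OF d(1)[OF that]] has_derivative_pd[OF d(2)[OF that]]]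
        by (simp add: pd_eq)
    qed
    then show ?case using bd[OF Suc.prems] d by (auto intro: differentiable_add)
  qed
qed

text \<open>The operator bound \<open>B\<close> is common to the family, so the linear maps may vary
  with the index, as the scaling factors in the chain rule do.\<close>

lemma unif_smooth_linear_family:
  assumes L: "\<And>i. i \<in> K \<Longrightarrow> bounded_linear (L i)"
    and B: "\<And>i x. i \<in> K \<Longrightarrow> norm (L i x) \<le> B * norm x" and "unif_smooth n K S f"
  shows "unif_smooth n K S (\<lambda>i p. L i (f i p))"
proof -
  have bd: "\<exists>C. \<forall>i\<in>K. \<forall>p\<in>S i. norm (L i (f i p)) \<le> C" if f: "unif_smooth n K S f" for n f
  proof -
    obtain C where C: "\<And>i p. i \<in> K \<Longrightarrow> p \<in> S i \<Longrightarrow> norm (f i p) \<le> C"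
      using unif_smooth_bounded[OF f] by blast
    have "norm (L i (f i p)) \<le> \<bar>B\<bar> * \<bar>C\<bar>" if "i \<in> K" "p \<in> S i" for i p
    proof -
      have "norm (L i (f i p)) \<le> \<bar>B\<bar> * norm (f i p)"
        using B[OF that(1)] by (meson abs_ge_self mult_right_mono norm_ge_zero order_trans)
      also have "\<dots> \<le> \<bar>B\<bar> * \<bar>C\<bar>"
        using C[OF that] by (intro mult_left_mono) auto
      finally show ?thesis .
    qed
    then show ?thesis by blast
  qed
  show ?thesis using assms(3)
  proof (induction n arbitrary: f)
    case 0
    then show ?case using bd[of 0] by simp
  next
    case (Suc n)
    have dL: "((\<lambda>p. L i (f i p)) has_derivative (\<lambda>v. L i (pd v (f i) p))) (at p)"
      if "i \<in> K" "p \<in> S i" for i p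
      by (rule bounded_linear.has_derivative[OF L[OF that(1)] has_derivative_pd])
        (use Suc.prems that in auto)
    have "unif_smooth n K S (\<lambda>i. pd v (\<lambda>p. L i (f i p)))" if v: "v \<in> Basis" for v
    proof (rule unif_smooth_cong)
      show "unif_smooth n K S (\<lambda>i p. L i (pd v (f i) p))"
        by (rule Suc.IH) (use Suc.prems v in auto)
    qed (use pd_eq[OF dL] in auto)
    then show ?case using bd[OF Suc.prems] dL by (auto simp: differentiable_def)
  qed
qed

lemma unif_smooth_linear:
  assumes L: "bounded_linear L" and "unif_smooth n K S f"
  shows "unif_smooth n K S (\<lambda>i p. L (f i p))"
proof -
  obtain B where "\<And>x. norm (L x) \<le> B * norm x"
    using bounded_linear.bounded[OF L] by (metis mult.commute)
  then show ?thesis using unif_smooth_linear_family[of "\<lambda>_. L" B] assms by blast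
qed

lemma unif_smooth_mult:
  fixes f g :: "'i \<Rightarrow> 'a \<Rightarrow> 'b::real_normed_algebra"
  assumes "unif_smooth n K S f" "unif_smooth n K S g"
  shows "unif_smooth n K S (\<lambda>i p. f i p * g i p)"
proof -
  have bd: "\<exists>C. \<forall>i\<in>K. \<forall>p\<in>S i. norm (f i p * g i p) \<le> C"
    if fg: "unif_smooth n K S f" "unif_smooth n K S g" for n and f g :: "'i \<Rightarrow> 'a \<Rightarrow> 'b"
  proof -
    obtain C D where "\<forall>i\<in>K. \<forall>p\<in>S i. norm (f i p) \<le> C" "\<forall>i\<in>K. \<forall>p\<in>S i. norm (g i p) \<le> D"
      using fg[THEN unif_smooth_bounded] by auto
    then have "\<forall>i\<in>K. \<forall>p\<in>S i. norm (f i p * g i p) \<le> \<bar>C\<bar> * \<bar>D\<bar>"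
      by (smt (verit) mult_mono norm_ge_zero norm_mult_ineq)
    then show ?thesis by blast
  qed
  show ?thesis using assms
  proof (induction n arbitrary: f g)
    case 0
    then show ?case using bd[of 0] by simp
  next
    case (Suc n)
    have d: "f i differentiable (at p)" "g i differentiable (at p)" if "i \<in> K" "p \<in> S i" for i p
      using Suc.prems that by auto
    have lower: "unif_smooth n K S f" "unif_smooth n K S g"
      using Suc.prems by (auto intro: unif_smooth_mono[of "Suc n"] simp del: unif_smooth.simps)
    have "unif_smooth n K S (\<lambda>i. pd v (\<lambda>p. f i p * g i p))" if v: "v \<in> Basis" for v
    proof (rule unif_smooth_cong)
      show "unif_smooth n K S (\<lambda>i p. f i p * pd v (g i) p + pd v (f i) p * g i p)"
        by (intro unif_smooth_add Suc.IH lower) (use Suc.prems v in auto)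
      show "f i p * pd v (g i) p + pd v (f i) p * g i p = pd v (\<lambda>p. f i p * g i p) p"
        if "i \<in> K" "p \<in> S i" for i p
        using has_derivative_mult[OF has_derivative_pd[OF d(1)[OF that]] has_derivative_pd[OF d(2)[OF that]]]
        by (simp add: pd_eq)
    qed
    then show ?case using bd[OF Suc.prems] d by (auto intro: differentiable_mult)
  qed
qed

lemma unif_smooth_cmult:
  fixes f :: "'i \<Rightarrow> 'a \<Rightarrow> 'b::real_normed_algebra"
  assumes "\<And>i. i \<in> K \<Longrightarrow> norm (c i) \<le> C" "unif_smooth n K S f"
  shows "unif_smooth n K S (\<lambda>i p. c i * f i p)"
  by (intro unif_smooth_mult unif_smooth_const[where C=C] assms)

lemma unif_smooth_uminus: "unif_smooth n K S f \<Longrightarrow> unif_smooth n K S (\<lambda>i p. - f i p)"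
  by (rule unif_smooth_linear[OF bounded_linear_minus[OF bounded_linear_ident]])

lemma unif_smooth_diff:
  "unif_smooth n K S f \<Longrightarrow> unif_smooth n K S g \<Longrightarrow> unif_smooth n K S (\<lambda>i p. f i p - g i p)"
  using unif_smooth_add[OF _ unif_smooth_uminus, of n f g] by simp

lemma unif_smooth_power:
  fixes f :: "'i \<Rightarrow> 'a \<Rightarrow> 'b::real_normed_algebra_1"
  shows "unif_smooth n K S f \<Longrightarrow> unif_smooth n K S (\<lambda>i p. f i p ^ m)"
proof (induction m)
  case 0
  show ?case using unif_smooth_const[of K "\<lambda>_. 1::'b" 1] by simp
qed (simp add: unif_smooth_mult)

text \<open>A family solving an equation \<open>\<partial>\<^sub>v g = R v g\<close> whose right-hand side preserves the class is
  itself in the class; this covers reciprocals and square roots.\<close>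
lemma unif_smooth_bootstrap:
  assumes "unif_smooth 0 K S g"
    and "\<And>i p. i \<in> K \<Longrightarrow> p \<in> S i \<Longrightarrow> (g i has_derivative (\<lambda>v. D v i p)) (at p)"
    and "\<And>n v. v \<in> Basis \<Longrightarrow> unif_smooth n K S g \<Longrightarrow> unif_smooth n K S (D v)"
  shows "unif_smooth n K S g"
proof (induction n)
  case 0 then show ?case using assms by simp
next
  case (Suc n)
  have "unif_smooth n K S (\<lambda>i. pd v (g i))" if "v \<in> Basis" for v
    by (rule unif_smooth_cong[OF assms(3)[OF that Suc]]) (simp add: pd_eq[OF assms(2)])
  then show ?case using assms(1,2) by (auto simp: differentiable_def)
qed

lemma unif_smooth_inverse:
  fixes f :: "'i \<Rightarrow> 'a \<Rightarrow> 'b::real_normed_field"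
  assumes f: "\<And>n. unif_smooth n K S f" and c: "c > 0"
    and "\<And>i p. i \<in> K \<Longrightarrow> p \<in> S i \<Longrightarrow> norm (f i p) \<ge> c"
  shows "unif_smooth n K S (\<lambda>i p. inverse (f i p))"
proof (rule unif_smooth_bootstrap[where D = "\<lambda>v i p. - (inverse (f i p) * pd v (f i) p * inverse (f i p))"])
  have "norm (inverse (f i p)) \<le> inverse c" if "i \<in> K" "p \<in> S i" for i p
    using assms(3)[OF that] c by (simp add: norm_inverse le_imp_inverse_le)
  then show "unif_smooth 0 K S (\<lambda>i p. inverse (f i p))" by auto
  show "((\<lambda>p. inverse (f i p)) has_derivative (\<lambda>v. - (inverse (f i p) * pd v (f i) p * inverse (f i p)))) (at p)"
    if "i \<in> K" "p \<in> S i" for i p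
  proof (rule Deriv.has_derivative_inverse)
    show "f i p \<noteq> 0" using assms(3)[OF that] c by auto
    show "(f i has_derivative (\<lambda>v. pd v (f i) p)) (at p)"
      using f[of 1] that by (intro has_derivative_pd) auto
  qed
next
  fix n and v :: 'a assume "v \<in> Basis" "unif_smooth n K S (\<lambda>i p. inverse (f i p))"
  moreover have "unif_smooth n K S (\<lambda>i. pd v (f i))" using f[of "Suc n"] \<open>v \<in> Basis\<close> by simp
  ultimately show "unif_smooth n K S (\<lambda>i p. - (inverse (f i p) * pd v (f i) p * inverse (f i p)))"
    by (intro unif_smooth_uminus unif_smooth_mult)
qed

text \<open>The uniform bounds come from the lower bound on \<open>norm (f i p)\<close> alone;
  avoiding the cut provides differentiability at each point.\<close>

lemma unif_smooth_csqrt: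
  assumes f: "\<And>n. unif_smooth n K S f" and c: "c > 0"
    and lower: "\<And>i p. i \<in> K \<Longrightarrow> p \<in> S i \<Longrightarrow> norm (f i p) \<ge> c"
    and branch: "\<And>i p. i \<in> K \<Longrightarrow> p \<in> S i \<Longrightarrow> f i p \<notin> \<real>\<^sub>\<le>\<^sub>0"
  shows "unif_smooth n K S (\<lambda>i p. csqrt (f i p))"
\<comment> \<open>Writing f' / (2 sqrt f) as f' sqrt f / (2 f) expresses the derivative by the root
  itself and the reciprocal of \<open>f\<close>, which is already known to be in the class.\<close>
proof (rule unif_smooth_bootstrap[where D = "\<lambda>v i p. (1/2) * (pd v (f i) p * (csqrt (f i p) * inverse (f i p)))"])
  obtain C where C: "\<And>i p. i \<in> K \<Longrightarrow> p \<in> S i \<Longrightarrow> norm (f i p) \<le> C"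
    using f[of 0] by auto
  have "norm (csqrt (f i p)) \<le> sqrt C" if "i \<in> K" "p \<in> S i" for i p
    using C[OF that] by (simp add: norm_csqrt)
  then show "unif_smooth 0 K S (\<lambda>i p. csqrt (f i p))" by (simp del: norm_csqrt) blast
  show "((\<lambda>p. csqrt (f i p)) has_derivative (\<lambda>v. (1/2) * (pd v (f i) p * (csqrt (f i p) * inverse (f i p))))) (at p)"
    if ip: "i \<in> K" "p \<in> S i" for i p
  proof -
    have d: "(f i has_derivative (\<lambda>v. pd v (f i) p)) (at p)"
      using f[of 1] ip by (intro has_derivative_pd) auto
    have nz: "f i p \<noteq> 0" using branch[OF ip] by auto
    have "(csqrt has_derivative (\<lambda>z. z * inverse (2 * csqrt (f i p)))) (at (f i p))"
      using has_field_derivative_csqrt[OF branch[OF ip]]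
      unfolding has_field_derivative_def mult_commute_abs[of "inverse (2 * csqrt (f i p))", symmetric] .
    from has_derivative_compose[OF d this]
    have "((\<lambda>p. csqrt (f i p)) has_derivative (\<lambda>v. pd v (f i) p * inverse (2 * csqrt (f i p)))) (at p)" .
    moreover have "inverse (2 * csqrt (f i p)) = (1/2) * (csqrt (f i p) * inverse (f i p))"
      using nz by (simp add: field_simps flip: power2_eq_square)
    ultimately show ?thesis by (simp add: mult_ac)
  qed
next
  fix n and v :: 'a assume v: "v \<in> Basis" "unif_smooth n K S (\<lambda>i p. csqrt (f i p))"
  moreover have "unif_smooth n K S (\<lambda>i. pd v (f i))" using f[of "Suc n"] v by simp
  moreover have "unif_smooth n K S (\<lambda>i p. inverse (f i p))"
    by (rule unif_smooth_inverse[OF f c lower])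
  ultimately show "unif_smooth n K S (\<lambda>i p. (1/2) * (pd v (f i) p * (csqrt (f i p) * inverse (f i p))))"
    by (intro unif_smooth_cmult[where C="1/2"] unif_smooth_mult) auto
qed

text \<open>All arguments stay in one compact set, on which each derivative of \<open>F\<close> is
  bounded by continuity. Since \<open>J\<close> sends basis vectors to basis vectors,
  differentiating gives the same situation for another basis derivative of \<open>F\<close>. The two
  uses are the cut-off along the affine map from momentum to position, and an amplitude with (t, y)
  frozen.\<close>

lemma unif_smooth_compose:
  fixes F :: "'e::euclidean_space \<Rightarrow> 'b::real_normed_vector"
  assumes F: "smooth_fun F" and C: "compact C"
    and aff: "\<And>i p. i \<in> K \<Longrightarrow> p \<in> S i \<Longrightarrow> q i + r i *\<^sub>R J p \<in> C"
    and r: "\<And>i. i \<in> K \<Longrightarrow> \<bar>r i\<bar> \<le> R"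
    and J: "bounded_linear J" "J ` Basis \<subseteq> Basis"
  shows "unif_smooth n K S (\<lambda>i p. F (q i + r i *\<^sub>R J p))"
  using F
proof (induction n arbitrary: F)
  case (0 F)
  then have "continuous_on C F" by (intro smooth_fun_continuous)
  then have "compact (F ` C)" using C compact_continuous_image by blast
  then obtain D where "\<forall>z\<in>C. norm (F z) \<le> D" by (metis bounded_iff compact_imp_bounded image_eqI)
  then show ?case using aff by auto
next
  case (Suc n)
  have bd: "unif_smooth 0 K S (\<lambda>i p. F (q i + r i *\<^sub>R J p))"
  proof -
    have "continuous_on C F" by (rule smooth_fun_continuous[OF Suc.prems])
    then have "compact (F ` C)" using C compact_continuous_image by blast
    then obtain D where "\<forall>z\<in>C. norm (F z) \<le> D" by (metis bounded_iff compact_imp_bounded image_eqI)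
    then show ?thesis using aff by auto
  qed
  have d: "((\<lambda>p. F (q i + r i *\<^sub>R J p)) has_derivative (\<lambda>v. r i *\<^sub>R pd (J v) F (q i + r i *\<^sub>R J p))) (at p)" for i p
  proof -
    have "F differentiable (at z)" for z
      using Suc.prems unfolding smooth_fun_def by (metis empty_set empty_subsetI pds.simps(1))
    note dF = has_derivative_pd[OF this]
    have a: "((\<lambda>p. q i + r i *\<^sub>R J p) has_derivative (\<lambda>v. r i *\<^sub>R J v)) (at p)"
      by (auto intro!: derivative_eq_intros bounded_linear_imp_has_derivative J)
    from has_derivative_compose[OF a dF]
    have "((\<lambda>p. F (q i + r i *\<^sub>R J p)) has_derivative (\<lambda>v. pd (r i *\<^sub>R J v) F (q i + r i *\<^sub>R J p))) (at p)" .
    then show ?thesis using linear_cmul[OF has_derivative_linear[OF dF]] by simp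
  qed
  have "unif_smooth n K S (\<lambda>i. pd v (\<lambda>p. F (q i + r i *\<^sub>R J p)))" if v: "v \<in> Basis" for v
  proof (rule unif_smooth_cong)
    have "unif_smooth n K S (\<lambda>i p. pd (J v) F (q i + r i *\<^sub>R J p))"
      by (rule Suc.IH[OF smooth_fun_pd[OF Suc.prems]]) (use J v in auto)
    then show "unif_smooth n K S (\<lambda>i p. r i *\<^sub>R pd (J v) F (q i + r i *\<^sub>R J p))"
      by (intro unif_smooth_linear_family[where L = "\<lambda>i x. r i *\<^sub>R x" and B = R])
        (auto simp: bounded_linear_scaleR_right intro: mult_right_mono[OF r])
  qed (simp add: pd_eq[OF d])
  then show ?case using bd d by (auto simp: differentiable_def)
qed

end

section \<open>Order of vanishing, symmetry of derivatives and Taylor's formula\<close>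

definition usmooth :: "'i set \<Rightarrow> ('i \<Rightarrow> 'a::euclidean_space set) \<Rightarrow> ('i \<Rightarrow> 'a \<Rightarrow> 'b::real_normed_vector) \<Rightarrow> bool" where
  "usmooth K S f \<longleftrightarrow> (\<forall>n. unif_smooth n K S f)"

lemma usmooth_pd: "usmooth K S f \<Longrightarrow> v \<in> Basis \<Longrightarrow> usmooth K S (\<lambda>i. pd v (f i))"
  unfolding usmooth_def by (metis unif_smooth.simps(2))

lemma usmooth_differentiable: "usmooth K S f \<Longrightarrow> i \<in> K \<Longrightarrow> p \<in> S i \<Longrightarrow> f i differentiable (at p)"
  unfolding usmooth_def by (metis unif_smooth.simps(2))

lemma usmooth_single: "usmooth K S f \<Longrightarrow> i \<in> K \<Longrightarrow> usmooth {i} S f"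
  unfolding usmooth_def by (auto intro: unif_smooth_subset)

text \<open>All iterated basis derivatives of order below n vanish at the point, so that a smooth
  function is O(|h|^n) there.\<close>

primrec vanishes :: "nat \<Rightarrow> ('a::euclidean_space \<Rightarrow> 'b::real_normed_vector) \<Rightarrow> 'a \<Rightarrow> bool" where
  "vanishes 0 g p \<longleftrightarrow> True"
| "vanishes (Suc n) g p \<longleftrightarrow> g p = 0 \<and> (\<forall>v\<in>Basis. vanishes n (pd v g) p)"

lemma vanishes_Suc: "vanishes (Suc n) g p \<Longrightarrow> vanishes n g p"
proof (induction n arbitrary: g)
  case (Suc n)
  then show ?case by (metis vanishes.simps(2))
qed simp

lemma vanishes_mono: "vanishes n g p \<Longrightarrow> m \<le> n \<Longrightarrow> vanishes m g p"
  by (induction n) (metis le_zero_eq, metis le_Suc_eq vanishes_Suc)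

lemma vanishes_cong:
  assumes "open S" "p \<in> S" "\<And>q. q \<in> S \<Longrightarrow> f q = g q" "vanishes n f p"
  shows "vanishes n g p"
  using assms(3,4)
proof (induction n arbitrary: f g)
  case (Suc n)
  have "vanishes n (pd v g) p" if "v \<in> Basis" for v
    by (rule Suc.IH[of "pd v f"], rule pd_cong[OF assms(1)]) (use Suc.prems that in auto)
  then show ?case using Suc.prems assms by auto
qed simp

text \<open>This is the symmetric k-th derivative evaluated on (h, ..., h). The weights
  \<open>h \<bullet> v\<close> are not differentiated, so the value can be read as a homogeneous
  polynomial in \<open>h\<close> for Gaussian means, or as a function of \<open>p\<close> along a
  line for Taylor's formula.\<close>

primrec dirpow :: "nat \<Rightarrow> ('a::euclidean_space \<Rightarrow> 'b::real_normed_vector) \<Rightarrow> 'a \<Rightarrow> 'a \<Rightarrow> 'b" where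
  "dirpow 0 g h p = g p"
| "dirpow (Suc k) g h p = (\<Sum>v\<in>Basis. (h \<bullet> v) *\<^sub>R dirpow k (pd v g) h p)"

lemma dirpow_vanishes: "vanishes (Suc k) g p \<Longrightarrow> dirpow k g h p = 0"
proof (induction k arbitrary: g)
  case (Suc k)
  then show ?case by (auto intro!: sum.neutral)
qed simp

lemma dirpow_cong:
  assumes "open S" "p \<in> S" "\<And>q. q \<in> S \<Longrightarrow> f q = g q"
  shows "dirpow k f h p = dirpow k g h p"
  using assms(3)
proof (induction k arbitrary: f g)
  case 0 then show ?case using assms by simp
next
  case (Suc k)
  have "dirpow k (pd v f) h p = dirpow k (pd v g) h p" for v
    by (rule Suc.IH, rule pd_cong[OF assms(1)]) (use Suc.prems in auto)
  then show ?case by simp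
qed

lemma dirpow_continuous: "continuous_on A (\<lambda>h. dirpow k g h p)"
  by (induction k arbitrary: g) (auto intro!: continuous_intros)

text \<open>Both mixed partials are the limit of the same second difference quotient.\<close>
lemma pd_commute:
  fixes f :: "'a::euclidean_space \<Rightarrow> 'b::real_normed_vector"
  assumes S: "open S" "p \<in> S"
    and f: "\<And>q. q \<in> S \<Longrightarrow> f differentiable (at q)"
    and fv: "\<And>u q. u \<in> {v, w} \<Longrightarrow> q \<in> S \<Longrightarrow> pd u f differentiable (at q)"
    and fvw: "\<And>u u' . u \<in> {v, w} \<Longrightarrow> u' \<in> {v, w} \<Longrightarrow> isCont (pd u (pd u' f)) p"
  shows "pd v (pd w f) p = pd w (pd v f) p"
proof -
  define W where "W s = f (p + s *\<^sub>R v + s *\<^sub>R w) - f (p + s *\<^sub>R v) - f (p + s *\<^sub>R w) + f p" for s :: real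
  have line: "((\<lambda>s. g (a + s *\<^sub>R x)) has_derivative (\<lambda>t. t *\<^sub>R pd x g (a + s *\<^sub>R x))) (at s within T)"
    if "g differentiable (at (a + s *\<^sub>R x))" for g :: "'a \<Rightarrow> 'b" and a x s T
  proof -
    note dg = has_derivative_pd[OF that]
    have 1: "((\<lambda>s. a + s *\<^sub>R x) has_derivative (\<lambda>s. s *\<^sub>R x)) (at s within T)"
      by (auto intro!: derivative_eq_intros)
    show ?thesis using has_derivative_compose[OF 1 dg] linear_cmul[OF has_derivative_linear[OF dg]] by simp
  qed
  \<comment> \<open>The second difference is symmetric in \<open>x\<close> and \<open>y\<close>
    whereas its claimed approximation is not; using the estimate in both orders yields the symmetry
    of the mixed derivative.\<close>
  have key: "\<exists>d>0. \<forall>s. 0 < s \<and> s < d \<longrightarrow> norm (f (p + s *\<^sub>R x + s *\<^sub>R y) - f (p + s *\<^sub>R x) - f (p + s *\<^sub>R y) + f p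
        - (s * s) *\<^sub>R pd y (pd x f) p) \<le> e * (s * s)"
    if xy: "x \<in> {v, w}" "y \<in> {v, w}" and e: "e > 0" for x y e
  proof -
    obtain r1 where r1: "r1 > 0" "ball p r1 \<subseteq> S" using S by (meson open_contains_ball)
    obtain r2 where r2: "r2 > 0" "\<And>q. dist q p < r2 \<Longrightarrow> norm (pd y (pd x f) q - pd y (pd x f) p) < e"
      using fvw[OF xy(2,1)] e unfolding continuous_at dist_norm LIM_eq
      by (metis diff_self norm_zero)
    define r where "r = min r1 r2"
    define d where "d = r / (norm x + norm y + 1)"
    have pos: "norm x + norm y + 1 > 0" by (simp add: add_nonneg_pos)
    \<comment> \<open>The summand 1 in the denominator of \<open>d\<close> covers zero
      directions.\<close>
    have d: "d > 0" using r1 r2 pos by (simp add: d_def r_def)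
    have near: "p + a *\<^sub>R x + b *\<^sub>R y \<in> S \<and> norm (pd y (pd x f) (p + a *\<^sub>R x + b *\<^sub>R y) - pd y (pd x f) p) < e"
      if "0 \<le> a" "a \<le> s" "0 \<le> b" "b \<le> s" "0 < s" "s < d" for a b s
    proof -
      have "norm (a *\<^sub>R x + b *\<^sub>R y) \<le> a * norm x + b * norm y"
        using that by (metis abs_of_nonneg norm_scaleR norm_triangle_ineq)
      also have "\<dots> \<le> s * norm x + s * norm y" using that by (intro add_mono mult_right_mono) auto
      also have "\<dots> \<le> s * (norm x + norm y + 1)" using that by (simp add: algebra_simps)
      also have "\<dots> < d * (norm x + norm y + 1)" using that pos by simp
      also have "\<dots> = r" using pos by (simp add: d_def)
      finally have "dist (p + a *\<^sub>R x + b *\<^sub>R y) p < r" by (simp add: dist_norm add.assoc)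
      then show ?thesis using r1 r2 by (auto simp: r_def dist_commute subset_eq)
    qed
    have "norm (f (p + s *\<^sub>R x + s *\<^sub>R y) - f (p + s *\<^sub>R x) - f (p + s *\<^sub>R y) + f p
        - (s * s) *\<^sub>R pd y (pd x f) p) \<le> e * (s * s)" if s: "0 < s" "s < d" for s
    proof -
      let ?H = "pd y (pd x f) p"
      \<comment> \<open>The mean value inequality is applied twice: here in direction
        \<open>y\<close> to \<open>pd x f\<close>, and afterwards in direction \<open>x\<close> to
        the difference of \<open>f\<close> along two parallel segments.\<close>
      have in1: "norm (pd x f (p + a *\<^sub>R x + s *\<^sub>R y) - pd x f (p + a *\<^sub>R x) - s *\<^sub>R ?H) \<le> e * s"
        if a: "0 \<le> a" "a \<le> s" for a
      proof -
        let ?g = "\<lambda>b. pd x f (p + a *\<^sub>R x + b *\<^sub>R y) - b *\<^sub>R ?H"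
        have "norm (?g s - ?g 0) \<le> e * norm (s - 0)"
        proof (rule differentiable_bound[of "{0..s}"])
          fix b assume b: "b \<in> {0..s}"
          note n = near[OF a(1,2), of b]
          have "pd x f differentiable (at (p + a *\<^sub>R x + b *\<^sub>R y))" using fv[OF xy(1)] n b s by auto
          note dl = line[OF this, of "{0..s}"]
          show "(?g has_derivative (\<lambda>t. t *\<^sub>R pd y (pd x f) (p + a *\<^sub>R x + b *\<^sub>R y) - t *\<^sub>R ?H)) (at b within {0..s})"
            by (rule has_derivative_diff[OF dl]) (auto intro!: derivative_eq_intros)
          show "onorm (\<lambda>t. t *\<^sub>R pd y (pd x f) (p + a *\<^sub>R x + b *\<^sub>R y) - t *\<^sub>R ?H) \<le> e"
          proof (rule onorm_le)
            fix t :: real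
            have "norm (t *\<^sub>R (pd y (pd x f) (p + a *\<^sub>R x + b *\<^sub>R y) - ?H)) \<le> e * norm t"
              using n b s by (auto simp: mult.commute[of e] intro!: mult_left_mono)
            then show "norm (t *\<^sub>R pd y (pd x f) (p + a *\<^sub>R x + b *\<^sub>R y) - t *\<^sub>R ?H) \<le> e * norm t"
              by (simp add: scaleR_diff_right)
          qed
        qed (use s in auto)
        then show ?thesis using s by (simp add: algebra_simps)
      qed
      let ?g = "\<lambda>a. f (p + s *\<^sub>R y + a *\<^sub>R x) - f (p + a *\<^sub>R x) - a *\<^sub>R (s *\<^sub>R ?H)"
      have "norm (?g s - ?g 0) \<le> (e * s) * norm (s - 0)"
      proof (rule differentiable_bound[of "{0..s}"])
        fix a assume a: "a \<in> {0..s}"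
        have n: "p + s *\<^sub>R y + a *\<^sub>R x \<in> S" "p + a *\<^sub>R x \<in> S"
          using near[of a s s] near[of a s 0] a s by (auto simp: add_ac)
        note dl = line[OF f[OF n(1)], of "{0..s}"] line[OF f[OF n(2)], of "{0..s}"]
        show "(?g has_derivative (\<lambda>t. t *\<^sub>R pd x f (p + s *\<^sub>R y + a *\<^sub>R x) - t *\<^sub>R pd x f (p + a *\<^sub>R x) - t *\<^sub>R (s *\<^sub>R ?H))) (at a within {0..s})"
          by (rule has_derivative_diff[OF has_derivative_diff[OF dl]]) (auto intro!: derivative_eq_intros)
        show "onorm (\<lambda>t. t *\<^sub>R pd x f (p + s *\<^sub>R y + a *\<^sub>R x) - t *\<^sub>R pd x f (p + a *\<^sub>R x) - t *\<^sub>R (s *\<^sub>R ?H)) \<le> e * s"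
        proof (rule onorm_le)
          fix t :: real
          have "norm (t *\<^sub>R (pd x f (p + s *\<^sub>R y + a *\<^sub>R x) - pd x f (p + a *\<^sub>R x) - s *\<^sub>R ?H)) \<le> (e * s) * norm t"
            using in1[of a] a by (auto simp: mult.commute[of "e * s"] add_ac intro!: mult_left_mono)
          then show "norm (t *\<^sub>R pd x f (p + s *\<^sub>R y + a *\<^sub>R x) - t *\<^sub>R pd x f (p + a *\<^sub>R x) - t *\<^sub>R (s *\<^sub>R ?H)) \<le> (e * s) * norm t"
            by (simp add: scaleR_diff_right)
        qed
      qed (use s in auto)
      then show ?thesis using s by (simp add: algebra_simps)
    qed
    then show ?thesis using d by blast
  qed
  have "norm (pd v (pd w f) p - pd w (pd v f) p) \<le> e" if e: "e > 0" for e
  proof -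
    obtain d1 where d1: "d1 > 0" "\<And>s. 0 < s \<Longrightarrow> s < d1 \<Longrightarrow> norm (W s - (s * s) *\<^sub>R pd w (pd v f) p) \<le> (e/2) * (s * s)"
      using key[of v w "e/2"] e unfolding W_def by auto
    obtain d2 where d2: "d2 > 0" "\<And>s. 0 < s \<Longrightarrow> s < d2 \<Longrightarrow> norm (W s - (s * s) *\<^sub>R pd v (pd w f) p) \<le> (e/2) * (s * s)"
      using key[of w v "e/2"] e unfolding W_def by (auto simp: algebra_simps)
    define s where "s = min d1 d2 / 2"
    have s: "0 < s" "s < d1" "s < d2" using d1(1) d2(1) by (auto simp: s_def)
    have "norm ((s * s) *\<^sub>R (pd v (pd w f) p - pd w (pd v f) p))
        = norm ((W s - (s * s) *\<^sub>R pd w (pd v f) p) - (W s - (s * s) *\<^sub>R pd v (pd w f) p))"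
      by (simp add: algebra_simps)
    also have "\<dots> \<le> (e/2) * (s * s) + (e/2) * (s * s)"
      using d1(2)[OF s(1,2)] d2(2)[OF s(1,3)] by (smt (verit) norm_triangle_ineq4)
    finally have "(s * s) * norm (pd v (pd w f) p - pd w (pd v f) p) \<le> (s * s) * e"
      unfolding norm_scaleR by (simp add: mult.commute)
    then show ?thesis using s(1) by simp
  qed
  then have "norm (pd v (pd w f) p - pd w (pd v f) p) \<le> 0" by (rule field_le_epsilon) simp
  then show ?thesis by simp
qed

lemma euclidean_derivative_expand:
  fixes g :: "'a::euclidean_space \<Rightarrow> 'b::real_normed_vector"
  assumes "g differentiable (at p)"
  shows "pd h g p = (\<Sum>v\<in>Basis. (h \<bullet> v) *\<^sub>R pd v g p)"
proof -
  note d = has_derivative_pd[OF assms]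
  have "pd h g p = pd (\<Sum>v\<in>Basis. (h \<bullet> v) *\<^sub>R v) g p" by (simp add: euclidean_representation)
  also have "\<dots> = (\<Sum>v\<in>Basis. (h \<bullet> v) *\<^sub>R pd v g p)"
    by (simp add: linear_sum[OF has_derivative_linear[OF d]] linear_cmul[OF has_derivative_linear[OF d]])
  finally show ?thesis .
qed

context
  fixes K :: "'i set" and S :: "'i \<Rightarrow> 'a::euclidean_space set"
  assumes op: "\<And>i. i \<in> K \<Longrightarrow> open (S i)"
begin

lemma usmooth_pd_commute:
  assumes "usmooth K S f" "i \<in> K" "p \<in> S i" "v \<in> Basis" "w \<in> Basis"
  shows "pd v (pd w (f i)) p = pd w (pd v (f i)) p"
proof (rule pd_commute[OF op[OF assms(2)] assms(3)])
  show "f i differentiable at q" if "q \<in> S i" for q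
    using usmooth_differentiable[OF assms(1,2)] that .
  show "pd u (f i) differentiable at q" if "u \<in> {v, w}" "q \<in> S i" for u q
    using usmooth_differentiable[OF usmooth_pd[OF assms(1)] assms(2)] that assms by auto
  show "isCont (pd u (pd u' (f i))) p" if "u \<in> {v, w}" "u' \<in> {v, w}" for u u'
    using usmooth_differentiable[OF usmooth_pd[OF usmooth_pd[OF assms(1)]] assms(2)] that assms
    by (auto intro!: differentiable_imp_continuous_within)
qed

lemma usmooth_cong:
  assumes "usmooth K S f" "\<And>i p. i \<in> K \<Longrightarrow> p \<in> S i \<Longrightarrow> f i p = g i p"
  shows "usmooth K S g"
  unfolding usmooth_def
proof
  show "unif_smooth n K S g" for n
    by (rule unif_smooth_cong[of K S n f, OF op]) (use assms in \<open>auto simp: usmooth_def\<close>)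
qed

lemma pd_add_at:
  "f differentiable (at p) \<Longrightarrow> g differentiable (at p) \<Longrightarrow> pd v (\<lambda>p. f p + g p) p = pd v f p + pd v g p"
  by (rule pd_eq[OF has_derivative_add[OF has_derivative_pd has_derivative_pd]])

lemma pd_mult_at:
  fixes f g :: "_ \<Rightarrow> 'b::real_normed_algebra"
  shows "f differentiable (at p) \<Longrightarrow> g differentiable (at p) \<Longrightarrow> pd v (\<lambda>p. f p * g p) p = f p * pd v g p + pd v f p * g p"
  by (rule pd_eq[OF has_derivative_mult[OF has_derivative_pd has_derivative_pd]])

lemma vanishes_add:
  assumes "usmooth K S f" "usmooth K S g" "i \<in> K" "p \<in> S i" "vanishes n (f i) p" "vanishes n (g i) p"
  shows "vanishes n (\<lambda>p. f i p + g i p) p"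
  using assms(1,2,5,6)
proof (induction n arbitrary: f g)
  case (Suc n)
  have "vanishes n (pd v (\<lambda>p. f i p + g i p)) p" if v: "v \<in> Basis" for v
  proof (rule vanishes_cong[OF op[OF assms(3)] assms(4)])
    show "vanishes n (\<lambda>p. pd v (f i) p + pd v (g i) p) p"
      by (rule Suc.IH[OF usmooth_pd[OF Suc.prems(1) v] usmooth_pd[OF Suc.prems(2) v]]) (use Suc.prems v in simp_all)
    show "pd v (f i) q + pd v (g i) q = pd v (\<lambda>p. f i p + g i p) q" if "q \<in> S i" for q
      using pd_add_at[OF usmooth_differentiable[OF Suc.prems(1) assms(3) that] usmooth_differentiable[OF Suc.prems(2) assms(3) that]] by simp
  qed
  then show ?case using Suc.prems by simp
qed simp

lemma usmooth_mult:
  fixes f g :: "'i \<Rightarrow> 'a \<Rightarrow> 'b::real_normed_algebra"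
  shows "usmooth K S f \<Longrightarrow> usmooth K S g \<Longrightarrow> usmooth K S (\<lambda>i p. f i p * g i p)"
  unfolding usmooth_def by (intro allI unif_smooth_mult[OF op]) auto

lemma usmooth_add: "usmooth K S f \<Longrightarrow> usmooth K S g \<Longrightarrow> usmooth K S (\<lambda>i p. f i p + g i p)"
  unfolding usmooth_def by (intro allI unif_smooth_add[OF op]) auto

text \<open>Induction on the total order. By Leibniz a derivative lowers the order of one factor by
  one and leaves the other; a factor of order 0 has nothing to lose, and then the other factor alone
  carries the total.\<close>

lemma vanishes_mult:
  fixes f g :: "'i \<Rightarrow> 'a \<Rightarrow> 'b::real_normed_algebra"
  assumes "usmooth K S f" "usmooth K S g" "i \<in> K" "p \<in> S i" "vanishes m (f i) p" "vanishes n (g i) p"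
  shows "vanishes (m + n) (\<lambda>p. f i p * g i p) p"
  using assms(1,2,5,6)
proof (induction l \<equiv> "m + n" arbitrary: m n f g)
  case 0
  then show ?case by simp
next
  case (Suc l)
  have "vanishes l (pd v (\<lambda>p. f i p * g i p)) p" if v: "v \<in> Basis" for v
  proof (rule vanishes_cong[OF op[OF assms(3)] assms(4)])
    have df: "usmooth K S (\<lambda>i. pd v (f i))" and dg: "usmooth K S (\<lambda>i. pd v (g i))"
      by (rule usmooth_pd[OF Suc.prems(1) v], rule usmooth_pd[OF Suc.prems(2) v])
    have "vanishes l (\<lambda>p. f i p * pd v (g i) p) p"
    proof (cases n)
      case 0
      have "vanishes l (f i) p" by (rule vanishes_mono[OF Suc.prems(3)]) (use 0 Suc.hyps(2) in simp)
      from Suc.hyps(1)[OF _ Suc.prems(1) dg this vanishes.simps(1)[THEN iffD2, OF TrueI]]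
      show ?thesis by simp
    next
      case (Suc n')
      have "vanishes n' (pd v (g i)) p" using Suc.prems(4) v Suc by simp
      from Suc.hyps(1)[OF _ Suc.prems(1) dg Suc.prems(3) this]
      show ?thesis using Suc Suc.hyps(2) by simp
    qed
    moreover have "vanishes l (\<lambda>p. pd v (f i) p * g i p) p"
    proof (cases m)
      case 0
      have "vanishes l (g i) p" by (rule vanishes_mono[OF Suc.prems(4)]) (use 0 Suc.hyps(2) in simp)
      from Suc.hyps(1)[OF _ df Suc.prems(2) vanishes.simps(1)[THEN iffD2, OF TrueI] this]
      show ?thesis by simp
    next
      case (Suc m')
      have "vanishes m' (pd v (f i)) p" using Suc.prems(3) v Suc by simp
      from Suc.hyps(1)[OF _ df Suc.prems(2) this Suc.prems(4)]
      show ?thesis using Suc Suc.hyps(2) by simp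
    qed
    ultimately show "vanishes l (\<lambda>p. f i p * pd v (g i) p + pd v (f i) p * g i p) p"
      by (intro vanishes_add[where f = "\<lambda>i p. f i p * pd v (g i) p" and g = "\<lambda>i p. pd v (f i) p * g i p"]
          usmooth_mult df dg Suc.prems(1,2) assms)
    show "f i q * pd v (g i) q + pd v (f i) q * g i q = pd v (\<lambda>p. f i p * g i p) q" if "q \<in> S i" for q
      using pd_mult_at[OF usmooth_differentiable[OF Suc.prems(1) assms(3) that] usmooth_differentiable[OF Suc.prems(2) assms(3) that]] by simp
  qed
  moreover have "f i p * g i p = 0"
    using Suc.prems(3,4) Suc.hyps(2) by (cases m; cases n) auto
  ultimately show ?case unfolding Suc.hyps(2)[symmetric] by simp
qed

lemma usmooth_power:
  fixes f :: "'i \<Rightarrow> 'a \<Rightarrow> 'b::real_normed_algebra_1"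
  shows "usmooth K S f \<Longrightarrow> usmooth K S (\<lambda>i p. f i p ^ m)"
  unfolding usmooth_def by (intro allI unif_smooth_power[OF op]) auto

lemma vanishes_power:
  fixes f :: "'i \<Rightarrow> 'a \<Rightarrow> 'b::real_normed_algebra_1"
  assumes "usmooth K S f" "i \<in> K" "p \<in> S i" "vanishes n (f i) p"
  shows "vanishes (n * m) (\<lambda>p. f i p ^ m) p"
proof (induction m)
  case (Suc m)
  then show ?case
    using vanishes_mult[OF assms(1) usmooth_power[OF assms(1)] assms(2,3,4) Suc] by simp
qed simp

lemma dirpow_linear:
  assumes "usmooth K S f" "usmooth K S g" "i \<in> K" "p \<in> S i"
  shows "dirpow k (\<lambda>p. f i p + g i p) h p = dirpow k (f i) h p + dirpow k (g i) h p"
  using assms(1,2)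
proof (induction k arbitrary: f g)
  case (Suc k)
  have "dirpow k (pd v (\<lambda>p. f i p + g i p)) h p = dirpow k (pd v (f i)) h p + dirpow k (pd v (g i)) h p"
    if v: "v \<in> Basis" for v
  proof -
    have "dirpow k (pd v (\<lambda>p. f i p + g i p)) h p = dirpow k (\<lambda>p. pd v (f i) p + pd v (g i) p) h p"
      by (rule dirpow_cong[OF op[OF assms(3)] assms(4)])
        (rule pd_add_at[OF usmooth_differentiable[OF Suc.prems(1) assms(3)] usmooth_differentiable[OF Suc.prems(2) assms(3)]])
    also have "\<dots> = dirpow k (pd v (f i)) h p + dirpow k (pd v (g i)) h p"
      by (rule Suc.IH[OF usmooth_pd[OF Suc.prems(1) v] usmooth_pd[OF Suc.prems(2) v]])
    finally show ?thesis .
  qed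
  then show ?case by (simp add: scaleR_right_distrib sum.distrib)
qed simp

lemma dirpow_cmult:
  fixes f :: "'i \<Rightarrow> 'a \<Rightarrow> 'b::real_normed_algebra_1"
  assumes "usmooth K S f" "i \<in> K" "p \<in> S i"
  shows "dirpow k (\<lambda>p. c * f i p) h p = c * dirpow k (f i) h p"
  using assms(1)
proof (induction k arbitrary: f)
  case (Suc k)
  have "dirpow k (pd v (\<lambda>p. c * f i p)) h p = c * dirpow k (pd v (f i)) h p" if v: "v \<in> Basis" for v
  proof -
    have "dirpow k (pd v (\<lambda>p. c * f i p)) h p = dirpow k (\<lambda>p. c * pd v (f i) p) h p"
    proof (rule dirpow_cong[OF op[OF assms(2)] assms(3)])
      fix q assume q: "q \<in> S i"
      show "pd v (\<lambda>p. c * f i p) q = c * pd v (f i) q"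
        by (rule pd_eq[OF bounded_linear.has_derivative[OF bounded_linear_mult_right
              has_derivative_pd[OF usmooth_differentiable[OF Suc.prems(1) assms(2) q]]]])
    qed
    also have "\<dots> = c * dirpow k (pd v (f i)) h p"
      by (rule Suc.IH[OF usmooth_pd[OF Suc.prems v]])
    finally show ?thesis .
  qed
  then show ?case by (simp add: sum_distrib_left)
qed simp

lemma dirpow_bound:
  assumes "unif_smooth k K S f"
  shows "\<exists>C\<ge>0. \<forall>i\<in>K. \<forall>p\<in>S i. \<forall>h. norm (dirpow k (f i) h p) \<le> C * norm h ^ k"
  using assms
proof (induction k arbitrary: f)
  case 0
  then obtain C where "\<forall>i\<in>K. \<forall>p\<in>S i. norm (f i p) \<le> C" by auto
  then have "\<forall>i\<in>K. \<forall>p\<in>S i. norm (f i p) \<le> \<bar>C\<bar>" by fastforce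
  then show ?case by (intro exI[of _ "\<bar>C\<bar>"]) auto
next
  case (Suc k)
  have "\<forall>v\<in>Basis. \<exists>C\<ge>0. \<forall>i\<in>K. \<forall>p\<in>S i. \<forall>h. norm (dirpow k (pd v (f i)) h p) \<le> C * norm h ^ k"
    using Suc.IH[of "\<lambda>i. pd v (f i)" for v] Suc.prems by simp
  then obtain C where C: "\<And>v. v \<in> Basis \<Longrightarrow> C v \<ge> 0"
    "\<And>v i p h. v \<in> Basis \<Longrightarrow> i \<in> K \<Longrightarrow> p \<in> S i \<Longrightarrow> norm (dirpow k (pd v (f i)) h p) \<le> C v * norm h ^ k"
    by metis
  have "norm (dirpow (Suc k) (f i) h p) \<le> sum C Basis * norm h ^ Suc k" if ip: "i \<in> K" "p \<in> S i" for i p h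
  proof -
    have "norm (dirpow (Suc k) (f i) h p) \<le> (\<Sum>v\<in>Basis. norm h * (C v * norm h ^ k))"
      unfolding dirpow.simps
    proof (rule sum_norm_le)
      fix v :: 'a assume v: "v \<in> Basis"
      have "norm ((h \<bullet> v) *\<^sub>R dirpow k (pd v (f i)) h p) = \<bar>h \<bullet> v\<bar> * norm (dirpow k (pd v (f i)) h p)" by simp
      also have "\<dots> \<le> norm h * (C v * norm h ^ k)"
        using Basis_le_norm[OF v, of h] C(2)[OF v ip] C(1)[OF v] by (intro mult_mono) auto
      finally show "norm ((h \<bullet> v) *\<^sub>R dirpow k (pd v (f i)) h p) \<le> norm h * (C v * norm h ^ k)" .
    qed
    then show ?thesis by (simp add: sum_distrib_left sum_distrib_right mult_ac)
  qed
  then show ?case using C(1) by (intro exI[of _ "sum C Basis"]) (auto intro: sum_nonneg)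
qed

lemma dirpow_line_derivative:
  assumes "usmooth K S f" "i \<in> K" "e + s *\<^sub>R h \<in> S i"
  shows "((\<lambda>s. dirpow k (f i) h (e + s *\<^sub>R h)) has_vector_derivative dirpow (Suc k) (f i) h (e + s *\<^sub>R h)) (at s within T)"
  using assms(1)
proof (induction k arbitrary: f)
  case 0
  have d: "f i differentiable (at (e + s *\<^sub>R h))" using usmooth_differentiable[OF 0 assms(2,3)] .
  have 1: "((\<lambda>s. e + s *\<^sub>R h) has_derivative (\<lambda>s. s *\<^sub>R h)) (at s within T)"
    by (auto intro!: derivative_eq_intros)
  note dg = has_derivative_pd[OF d]
  show ?case using has_derivative_compose[OF 1 dg] linear_cmul[OF has_derivative_linear[OF dg]]
      euclidean_derivative_expand[OF d, of h]
    by (simp add: has_vector_derivative_def)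
next
  case (Suc k)
  have "((\<lambda>s. \<Sum>v\<in>Basis. (h \<bullet> v) *\<^sub>R dirpow k (pd v (f i)) h (e + s *\<^sub>R h)) has_vector_derivative
      (\<Sum>v\<in>Basis. (h \<bullet> v) *\<^sub>R dirpow (Suc k) (pd v (f i)) h (e + s *\<^sub>R h))) (at s within T)"
    by (intro has_vector_derivative_sum bounded_linear.has_vector_derivative[OF bounded_linear_scaleR_right]
        Suc.IH usmooth_pd Suc.prems)
  then show ?case by simp
qed

text \<open>Differentiating a symmetric form on the diagonal gives k equal contributions; their
  equality is the symmetry of mixed partials. For k = 0 the truncated \<open>k - 1\<close> is
  harmless because the factor k is zero.\<close>

lemma dirpow_derivative:
  fixes f :: "'i \<Rightarrow> 'a \<Rightarrow> 'b::real_normed_vector"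
  assumes "usmooth K S f" "i \<in> K" "p \<in> S i"
  shows "((\<lambda>h. dirpow k (f i) h p) has_derivative
     (\<lambda>x. \<Sum>w\<in>Basis. (real k * (x \<bullet> w)) *\<^sub>R dirpow (k - 1) (pd w (f i)) h p)) (at h)"
  using assms(1)
proof (induction k arbitrary: f)
  case 0
  then show ?case by simp
next
  case (Suc k)
  have "((\<lambda>h. \<Sum>v\<in>Basis. (h \<bullet> v) *\<^sub>R dirpow k (pd v (f i)) h p) has_derivative
     (\<lambda>x. \<Sum>v\<in>Basis. (h \<bullet> v) *\<^sub>R (\<Sum>w\<in>Basis. (real k * (x \<bullet> w)) *\<^sub>R dirpow (k - 1) (pd w (pd v (f i))) h p)
         + (x \<bullet> v) *\<^sub>R dirpow k (pd v (f i)) h p)) (at h)"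
    by (intro has_derivative_sum has_derivative_scaleR has_derivative_inner_left has_derivative_ident
        Suc.IH usmooth_pd Suc.prems)
  moreover have "(\<Sum>v\<in>Basis. (h \<bullet> v) *\<^sub>R (\<Sum>w\<in>Basis. (real k * (x \<bullet> w)) *\<^sub>R dirpow (k - 1) (pd w (pd v (f i))) h p)
         + (x \<bullet> v) *\<^sub>R dirpow k (pd v (f i)) h p)
      = (\<Sum>w\<in>Basis. (real (Suc k) * (x \<bullet> w)) *\<^sub>R dirpow k (pd w (f i)) h p)" for x
  proof (cases k)
    case 0
    then show ?thesis by simp
  next
    case (Suc k')
    have comm: "dirpow k' (pd w (pd v (f i))) h p = dirpow k' (pd v (pd w (f i))) h p"
      if "v \<in> Basis" "w \<in> Basis" for v w
      by (rule dirpow_cong[OF op[OF assms(2)] assms(3)])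
        (rule usmooth_pd_commute[OF Suc.prems assms(2) _ that(2,1)])
    have "(\<Sum>v\<in>Basis. (h \<bullet> v) *\<^sub>R (\<Sum>w\<in>Basis. (real k * (x \<bullet> w)) *\<^sub>R dirpow k' (pd w (pd v (f i))) h p))
        = (\<Sum>w\<in>Basis. (real k * (x \<bullet> w)) *\<^sub>R (\<Sum>v\<in>Basis. (h \<bullet> v) *\<^sub>R dirpow k' (pd v (pd w (f i))) h p))"
      unfolding scaleR_sum_right by (subst sum.swap) (simp add: comm mult_ac)
    also have "\<dots> = (\<Sum>w\<in>Basis. (real k * (x \<bullet> w)) *\<^sub>R dirpow k (pd w (f i)) h p)"
      by (simp add: Suc)
    finally have "(\<Sum>v\<in>Basis. (h \<bullet> v) *\<^sub>R (\<Sum>w\<in>Basis. (real k * (x \<bullet> w)) *\<^sub>R dirpow (k - 1) (pd w (pd v (f i))) h p))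
        = (\<Sum>w\<in>Basis. (real k * (x \<bullet> w)) *\<^sub>R dirpow k (pd w (f i)) h p)" by (simp add: Suc)
    moreover have "(real (Suc k) * (x \<bullet> w)) *\<^sub>R z = (real k * (x \<bullet> w)) *\<^sub>R z + (x \<bullet> w) *\<^sub>R z" for w and z :: 'b
      by (simp add: algebra_simps)
    ultimately show ?thesis by (simp only: sum.distrib)
  qed
  ultimately show ?case by simp
qed

end

text \<open>The integral remainder along the segment is controlled by the n-th symmetric derivative,
  whose bound C |h|^n is common to the family.\<close>

lemma usmooth_taylor:
  fixes f :: "'i \<Rightarrow> 'a::euclidean_space \<Rightarrow> 'b::banach"
  assumes "usmooth K S f" and S: "\<And>i. i \<in> K \<Longrightarrow> S i = ball (e i) \<delta>" and "\<delta> > 0"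
  shows "\<exists>C\<ge>0. \<forall>i\<in>K. \<forall>h. norm h < \<delta> \<longrightarrow>
     norm (f i (e i + h) - (\<Sum>k<n. (1 / fact k) *\<^sub>R dirpow k (f i) h (e i))) \<le> C * norm h ^ n"
proof -
  have op: "open (S i)" if "i \<in> K" for i using S[OF that] by simp
  obtain C where C: "C \<ge> 0" "\<And>i p h. i \<in> K \<Longrightarrow> p \<in> S i \<Longrightarrow> norm (dirpow n (f i) h p) \<le> C * norm h ^ n"
    using dirpow_bound[of K S n f, OF op] assms(1) unfolding usmooth_def by blast
  have "norm (f i (e i + h) - (\<Sum>k<n. (1 / fact k) *\<^sub>R dirpow k (f i) h (e i))) \<le> C * norm h ^ n"
    if i: "i \<in> K" and h: "norm h < \<delta>" for i h
  \<comment> \<open>The integral form of the remainder starts at order one; order zero is mere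
    boundedness.\<close>
  proof (cases "n = 0")
    case True
    have "e i + h \<in> S i" using S[OF i] h by (simp add: dist_norm)
    then show ?thesis using C(2)[OF i, of "e i + h" h] True by simp
  next
    case False
    have seg: "e i + s *\<^sub>R h \<in> S i" if "s \<in> {0..1}" for s
    proof -
      have "norm (s *\<^sub>R h) \<le> norm h" using that by (simp add: mult_left_le_one_le)
      then show ?thesis using S[OF i] h by (simp add: dist_norm)
    qed
    have hi: "((\<lambda>x. ((1 - x) ^ (n - 1) / fact (n - 1)) *\<^sub>R dirpow n (f i) h (e i + x *\<^sub>R h)) has_integral
       f i (e i + 1 *\<^sub>R h) - (\<Sum>k<n. ((1 - 0) ^ k / fact k) *\<^sub>R dirpow k (f i) h (e i + 0 *\<^sub>R h))) {0..1}"
    proof (rule Taylor_has_integral[where Df = "\<lambda>k s. dirpow k (f i) h (e i + s *\<^sub>R h)" and f = "\<lambda>s. f i (e i + s *\<^sub>R h)"])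
      show "((\<lambda>s. dirpow k (f i) h (e i + s *\<^sub>R h)) has_vector_derivative dirpow (Suc k) (f i) h (e i + s *\<^sub>R h)) (at s within {0..1})"
        if "k < n" "0 \<le> s" "s \<le> 1" for k s
        by (rule dirpow_line_derivative[of K S, OF op assms(1) i]) (use seg that in auto)
    qed (use False in auto)
    have bd: "norm (((1 - x) ^ (n - 1) / fact (n - 1)) *\<^sub>R dirpow n (f i) h (e i + x *\<^sub>R h)) \<le> C * norm h ^ n"
      if x: "x \<in> {0..1}" for x :: real
    proof -
      have "(1 - x) ^ (n - 1) \<le> 1" using x by (intro power_le_one) auto
      also have "1 \<le> (fact (n - 1) :: real)" by (rule fact_ge_1)
      finally have "\<bar>(1 - x) ^ (n - 1) / fact (n - 1)\<bar> \<le> 1"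
        using x by (simp add: divide_le_eq)
      then have "norm (((1 - x) ^ (n - 1) / fact (n - 1)) *\<^sub>R dirpow n (f i) h (e i + x *\<^sub>R h)) \<le> 1 * (C * norm h ^ n)"
        unfolding norm_scaleR by (intro mult_mono C(2)[OF i seg[OF x]]) auto
      then show ?thesis by simp
    qed
    have "norm (f i (e i + 1 *\<^sub>R h) - (\<Sum>k<n. ((1 - 0) ^ k / fact k) *\<^sub>R dirpow k (f i) h (e i + 0 *\<^sub>R h)))
        \<le> C * norm h ^ n * Henstock_Kurzweil_Integration.content {0..1::real}"
      by (rule has_integral_bound_real[OF _ finite.emptyI hi]) (use bd C(1) in auto)
    then show ?thesis by simp
  qed
  then show ?thesis using C(1) by blast
qed

subsection \<open>Complex Gaussian integrals in the plane\<close>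

lemma norm_R2_sq: "(norm (h :: real \<times> real))^2 = (fst h)^2 + (snd h)^2"
  by (simp add: norm_prod_def)

text \<open>A single term of the exponential series is at most the exponential.\<close>

lemma power_mult_exp_le:
  fixes x :: real assumes "x \<ge> 0" "c > 0"
  shows "x ^ k * exp (- c * x) \<le> fact k / c ^ k"
proof -
  have "(c * x) ^ k / fact k \<le> exp (c * x)"
  proof -
    have s: "(\<lambda>n. (c * x) ^ n /\<^sub>R fact n) sums exp (c * x)" by (rule exp_converges)
    have "(\<Sum>n\<in>{k}. (c * x) ^ n /\<^sub>R fact n) \<le> (\<Sum>n. (c * x) ^ n /\<^sub>R fact n)"
      by (rule sum_le_suminf) (use s assms in \<open>auto simp: sums_iff\<close>)
    then show ?thesis using s by (simp add: sums_iff divide_inverse mult.commute)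
  qed
  then have "x ^ k \<le> exp (c * x) * (fact k / c ^ k)"
    using assms by (simp add: field_simps power_mult_distrib)
  then have "x ^ k * exp (- c * x) \<le> exp (c * x) * (fact k / c ^ k) * exp (- c * x)"
    by (rule mult_right_mono) simp
  also have "\<dots> = fact k / c ^ k" by (simp add: exp_minus)
  finally show ?thesis .
qed

lemma real_gaussian_1D:
  assumes c: "c > 0"
  shows "integrable lborel (\<lambda>x::real. exp (- c * x^2))" "(\<integral>x. exp (- c * x^2) \<partial>lborel) = sqrt (pi / c)"
proof -
  \<comment> \<open>The standard deviation for which the integrand is a multiple of a normal
    density.\<close>
  define \<sigma> where "\<sigma> = sqrt (1 / (2 * c))"
  have s: "\<sigma> > 0" "\<sigma>^2 = 1 / (2 * c)" using c by (auto simp: \<sigma>_def)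
  have e: "exp (- c * x^2) = sqrt (pi / c) * normal_density 0 \<sigma> x" for x
    using c by (simp add: normal_density_def s field_simps real_sqrt_divide)
  show "integrable lborel (\<lambda>x::real. exp (- c * x^2))"
    unfolding e using s by (intro integrable_mult_right) auto
  show "(\<integral>x. exp (- c * x^2) \<partial>lborel) = sqrt (pi / c)"
    unfolding e using s by simp
qed

lemma real_gaussian_2D:
  assumes c: "c > 0"
  shows "integrable lborel (\<lambda>h::real\<times>real. exp (- c * (norm h)^2))"
    "(\<integral>h. exp (- c * (norm h)^2) \<partial>(lborel :: (real\<times>real) measure)) = pi / c"
proof -
  have e: "exp (- c * (norm (x, y))^2) = exp (- c * x^2) * exp (- c * y^2)" for x y :: real
    by (simp add: norm_R2_sq exp_add[symmetric] algebra_simps)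
  have m: "(\<lambda>h::real\<times>real. exp (- c * (norm h)^2)) \<in> borel_measurable (lborel \<Otimes>\<^sub>M lborel)"
    unfolding lborel_prod by measurable
  have i: "integrable (lborel \<Otimes>\<^sub>M lborel) (\<lambda>h::real\<times>real. exp (- c * (norm h)^2))"
    by (rule lborel_pair.Fubini_integrable[OF m])
      (simp_all only: e norm_mult norm_exp real_norm_def abs_exp_cancel,
       auto intro!: integrable_mult_right integrable_mult_left real_gaussian_1D[OF c, simplified])
  then show "integrable lborel (\<lambda>h::real\<times>real. exp (- c * (norm h)^2))" unfolding lborel_prod .
  have "(\<integral>h. exp (- c * (norm h)^2) \<partial>(lborel \<Otimes>\<^sub>M lborel :: (real\<times>real) measure))
      = (\<integral>x. (\<integral>y. exp (- c * (norm (x::real, y::real))^2) \<partial>lborel) \<partial>lborel)"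
    using lborel_pair.integral_fst'[OF i] by simp
  also have "\<dots> = sqrt (pi / c) * sqrt (pi / c)"
    unfolding e using real_gaussian_1D(2)[OF c] by simp
  also have "\<dots> = pi / c" using c by simp
  finally show "(\<integral>h. exp (- c * (norm h)^2) \<partial>(lborel :: (real\<times>real) measure)) = pi / c"
    unfolding lborel_prod .
qed

text \<open>Half of the exponent pays for the polynomial factor and the other half is kept for
  integration.\<close>

lemma gaussian_moment_pointwise:
  fixes h :: "real \<times> real" assumes "c > 0"
  shows "((norm h)^2)^k * exp (- c * (norm h)^2) \<le> fact k * (2 / c)^k * exp (- (c/2) * (norm h)^2)"
proof -
  have "((norm h)^2)^k * exp (- (c/2) * (norm h)^2) \<le> fact k / (c/2)^k"
    by (rule power_mult_exp_le) (use assms in auto)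
  then have "(((norm h)^2)^k * exp (- (c/2) * (norm h)^2)) * exp (- (c/2) * (norm h)^2) \<le> fact k / (c/2)^k * exp (- (c/2) * (norm h)^2)"
    by (rule mult_right_mono) simp
  then show ?thesis
    by (simp add: mult.assoc exp_add[symmetric] power_divide)
qed

text \<open>The constants are crude but the power of c is sharp: with c proportional to 1/\<alpha>
  the bound becomes a multiple of \<alpha>^(k+1).\<close>

lemma gaussian_moment_bound:
  assumes c: "c > 0"
  shows "integrable lborel (\<lambda>h::real\<times>real. ((norm h)^2)^k * exp (- c * (norm h)^2))"
    "(\<integral>h. ((norm h)^2)^k * exp (- c * (norm h)^2) \<partial>(lborel :: (real\<times>real) measure))
       \<le> fact k * (2 / c)^k * (2 * pi / c)"
proof -
  have g: "integrable lborel (\<lambda>h::real\<times>real. fact k * (2 / c)^k * exp (- (c/2) * (norm h)^2))"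
    using real_gaussian_2D(1)[of "c/2"] c by (intro integrable_mult_right) simp
  show i: "integrable lborel (\<lambda>h::real\<times>real. ((norm h)^2)^k * exp (- c * (norm h)^2))"
  proof (rule Bochner_Integration.integrable_bound[OF g])
    show "AE h in lborel. norm (((norm (h::real\<times>real))\<^sup>2) ^ k * exp (- c * (norm h)\<^sup>2)) \<le> norm (fact k * (2 / c) ^ k * exp (- (c / 2) * (norm h)\<^sup>2))"
      using gaussian_moment_pointwise[OF c, of _ k] c by (auto simp: abs_mult)
  qed measurable
  have "(\<integral>h. ((norm h)^2)^k * exp (- c * (norm h)^2) \<partial>(lborel :: (real\<times>real) measure))
     \<le> (\<integral>h. fact k * (2 / c)^k * exp (- (c/2) * (norm h)^2) \<partial>(lborel :: (real\<times>real) measure))"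
    by (rule integral_mono[OF i g gaussian_moment_pointwise[OF c]])
  also have "\<dots> = fact k * (2 / c)^k * (2 * pi / c)"
    using real_gaussian_2D(2)[of "c/2"] c by simp
  finally show "(\<integral>h. ((norm h)^2)^k * exp (- c * (norm h)^2) \<partial>(lborel :: (real\<times>real) measure))
       \<le> fact k * (2 / c)^k * (2 * pi / c)" .
qed

section \<open>Integration by parts against a Gaussian weight\<close>

definition gaussian_decay :: "(real \<times> real \<Rightarrow> complex) \<Rightarrow> bool" where
  "gaussian_decay g \<longleftrightarrow> continuous_on UNIV g \<and> (\<exists>C c. c > 0 \<and> (\<forall>h. norm (g h) \<le> C * exp (- c * (norm h)^2)))"

lemma gaussian_decay_integrable:
  assumes "gaussian_decay g" shows "integrable lborel g"
proof -
  obtain C c where c: "c > 0" "\<And>h. norm (g h) \<le> C * exp (- c * (norm h)^2)"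
    using assms unfolding gaussian_decay_def by blast
  show ?thesis
  proof (rule Bochner_Integration.integrable_bound)
    show "integrable lborel (\<lambda>h::real\<times>real. C * exp (- c * (norm h)^2))"
      using real_gaussian_2D(1)[OF c(1)] by (rule integrable_mult_right)
    show "g \<in> borel_measurable lborel"
      using assms unfolding gaussian_decay_def by (simp add: borel_measurable_continuous_onI)
    show "AE h in lborel. norm (g h) \<le> norm (C * exp (- c * (norm h)^2))"
      unfolding real_norm_def by (rule AE_I2) (rule order_trans[OF c(2) abs_ge_self])
  qed
qed

lemma line_integral_zero:
  fixes F :: "real \<Rightarrow> complex"
  assumes F: "\<And>x. (F has_vector_derivative F' x) (at x)" and F': "continuous_on UNIV F'" "integrable lborel F'"
    and c: "c > 0" "\<And>x. norm (F x) \<le> C * exp (- c * x^2)"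
  shows "(\<integral>x. F' x \<partial>lborel) = 0"
proof -
  have lim: "((\<lambda>x. C * exp (- c * x^2)) \<longlongrightarrow> 0) at_top" "((\<lambda>x. C * exp (- c * x^2)) \<longlongrightarrow> 0) at_bot"
    using c(1) by real_asymp+
  have "(F \<longlongrightarrow> 0) at_top" "(F \<longlongrightarrow> 0) at_bot"
    by (rule Lim_null_comparison[OF _ lim(1)], use c in simp, rule Lim_null_comparison[OF _ lim(2)], use c in simp)
  then have "(LBINT x=-\<infinity>..\<infinity>. F' x) = 0 - 0"
    using F' by (intro interval_integral_FTC_integrable[of _ _ F])
      (auto simp: F ereal_tendsto_simps1 continuous_on_eq_continuous_at set_integrable_def einterval_def)
  then show ?thesis
    by (simp add: interval_lebesgue_integral_def set_lebesgue_integral_def einterval_def)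
qed

text \<open>Fubini with the direction \<open>v\<close> as inner variable. Sections are integrable
  only almost everywhere, and on each such line the fundamental theorem leaves boundary values that
  decay to zero.\<close>

lemma integral_partial_derivative_zero:
  fixes G :: "real \<times> real \<Rightarrow> complex"
  assumes v: "v \<in> Basis" and G: "\<And>h. G differentiable (at h)"
    and dec: "gaussian_decay G" "gaussian_decay (pd v G)"
  shows "(\<integral>h. pd v G h \<partial>lborel) = 0"
proof -
  obtain C c where c: "c > 0" "\<And>h. norm (G h) \<le> C * exp (- c * (norm h)^2)"
    using dec unfolding gaussian_decay_def by blast
  have C: "C \<ge> 0" using c(2)[of 0] norm_ge_zero[of "G 0"] by (simp del: norm_ge_zero)
  have int: "integrable (lborel \<Otimes>\<^sub>M lborel) (pd v G)"
    using gaussian_decay_integrable[OF dec(2)] unfolding lborel_prod .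
  have cont: "continuous_on UNIV (pd v G)" using dec unfolding gaussian_decay_def by blast
  have line: "((\<lambda>s. G (q + s *\<^sub>R v)) has_vector_derivative pd v G (q + s *\<^sub>R v)) (at s)" for q s
  proof -
    have 1: "((\<lambda>s. q + s *\<^sub>R v) has_derivative (\<lambda>s. s *\<^sub>R v)) (at s)"
      by (auto intro!: derivative_eq_intros)
    note dg = has_derivative_pd[OF G]
    show ?thesis using has_derivative_compose[OF 1 dg] linear_cmul[OF has_derivative_linear[OF dg]]
      by (simp add: has_vector_derivative_def)
  qed
  have bd: "norm (G q) \<le> C * exp (- c * x^2)" if "x^2 \<le> (norm q)^2" for q x
  proof -
    have "- c * (norm q)^2 \<le> - c * x^2" using that c(1) by simp
    then show ?thesis using c(2)[of q] C by (meson exp_le_cancel_iff mult_left_mono order_trans)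
  qed
  consider "v = (1, 0)" | "v = (0, 1)" using v by (auto simp: Basis_prod_def)
  then have "(\<integral>h. pd v G h \<partial>(lborel \<Otimes>\<^sub>M lborel)) = 0"
  proof cases
    case 1
    have int': "integrable (lborel \<Otimes>\<^sub>M lborel) (case_prod (\<lambda>x y. pd v G (x, y)))"
      using int by (simp add: case_prod_beta')
    have "AE y in lborel. (\<integral>x. pd v G (x, y) \<partial>lborel) = 0"
      using lborel_pair.AE_integrable_snd[OF int']
    proof eventually_elim
      fix y assume i: "integrable lborel (\<lambda>x. pd v G (x, y))"
      show "(\<integral>x. pd v G (x, y) \<partial>lborel) = 0"
      proof (rule line_integral_zero[OF _ _ i c(1)])
        show "((\<lambda>x. G (x, y)) has_vector_derivative pd v G (x, y)) (at x)" for x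
          using line[of "(0, y)" x] 1 by simp
        show "continuous_on UNIV (\<lambda>x. pd v G (x, y))"
          by (rule continuous_on_compose2[OF cont]) (auto intro!: continuous_intros)
        show "norm (G (x, y)) \<le> C * exp (- c * x^2)" for x
          by (rule bd) (simp add: norm_R2_sq)
      qed
    qed
    then have "(\<integral>y. (\<integral>x. pd v G (x, y) \<partial>lborel) \<partial>lborel) = 0"
      by (rule integral_eq_zero_AE)
    then show ?thesis
      using lborel_pair.integral_snd[OF int'] by (simp add: case_prod_beta')
  next
    case 2
    have "AE x in lborel. (\<integral>y. pd v G (x, y) \<partial>lborel) = 0"
      using lborel_pair.AE_integrable_fst'[OF int]
    proof eventually_elim
      fix x assume i: "integrable lborel (\<lambda>y. pd v G (x, y))"
      show "(\<integral>y. pd v G (x, y) \<partial>lborel) = 0"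
      proof (rule line_integral_zero[OF _ _ i c(1)])
        show "((\<lambda>y. G (x, y)) has_vector_derivative pd v G (x, y)) (at y)" for y
          using line[of "(x, 0)" y] 2 by simp
        show "continuous_on UNIV (\<lambda>y. pd v G (x, y))"
          by (rule continuous_on_compose2[OF cont]) (auto intro!: continuous_intros)
        show "norm (G (x, y)) \<le> C * exp (- c * y^2)" for y
          by (rule bd) (simp add: norm_R2_sq)
      qed
    qed
    then have "(\<integral>x. (\<integral>y. pd v G (x, y) \<partial>lborel) \<partial>lborel) = 0"
      by (rule integral_eq_zero_AE)
    then show ?thesis using lborel_pair.integral_fst'[OF int] by simp
  qed
  then show ?thesis unfolding lborel_prod .
qed

text \<open>The form h . Q h with Q = [[\<kappa> + i a, i b], [i b, \<kappa> - i a]]. The Hessian of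
  the phase has this shape up to a factor i because the Jacobian of the vector potential is real,
  symmetric and trace-free.\<close>

definition gquad :: "complex \<Rightarrow> real \<Rightarrow> real \<Rightarrow> real \<times> real \<Rightarrow> complex" where
  "gquad \<kappa> a b h = \<kappa> * of_real ((norm h)^2) + \<i> * of_real (a * ((fst h)^2 - (snd h)^2) + 2 * b * fst h * snd h)"

definition gauss :: "complex \<Rightarrow> real \<Rightarrow> real \<Rightarrow> real \<times> real \<Rightarrow> complex" where
  "gauss \<kappa> a b h = exp (- gquad \<kappa> a b h / 2)"

lemma norm_gauss: "norm (gauss \<kappa> a b h) = exp (- (Re \<kappa> / 2) * (norm h)^2)"
  by (simp add: gauss_def gquad_def)

lemma continuous_on_gauss: "continuous_on A (gauss \<kappa> a b)"
  unfolding gauss_def gquad_def by (intro continuous_intros) auto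

text \<open>Even powers of the norm match the Gaussian moments available above.\<close>

definition poly_growth :: "(real \<times> real \<Rightarrow> complex) \<Rightarrow> bool" where
  "poly_growth P \<longleftrightarrow> continuous_on UNIV P \<and> (\<exists>C n. \<forall>h. norm (P h) \<le> C * (1 + ((norm h)^2)^n))"

lemma gaussian_decay_gauss_mult:
  assumes k: "Re \<kappa> > 0" and P: "poly_growth P"
  shows "gaussian_decay (\<lambda>h. gauss \<kappa> a b h * P h)"
proof -
  obtain C n where C: "\<And>h. norm (P h) \<le> C * (1 + ((norm h)^2)^n)"
    using P unfolding poly_growth_def by blast
  have C0: "C \<ge> 0"
  proof -
    have "0 \<le> C * (1 + ((norm (0::real\<times>real))^2)^n)" using C[of 0] norm_ge_zero order_trans by blast
    then show ?thesis by (cases n) auto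
  qed
  define c where "c = Re \<kappa> / 2"
  have c: "c > 0" using k by (simp add: c_def)
  define C' where "C' = C * (1 + fact n * (2 / c)^n)"
  have "norm (gauss \<kappa> a b h * P h) \<le> C' * exp (- (c/2) * (norm h)^2)" for h
  proof -
    have "norm (gauss \<kappa> a b h * P h) \<le> exp (- c * (norm h)^2) * (C * (1 + ((norm h)^2)^n))"
      unfolding norm_mult norm_gauss c_def[symmetric] by (intro mult_left_mono C) auto
    also have "\<dots> = C * (exp (- c * (norm h)^2) + ((norm h)^2)^n * exp (- c * (norm h)^2))"
      by (simp add: algebra_simps)
    also have "\<dots> \<le> C * (exp (- (c/2) * (norm h)^2) + fact n * (2 / c)^n * exp (- (c/2) * (norm h)^2))"
      using c by (intro mult_left_mono add_mono gaussian_moment_pointwise C0) auto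
    also have "\<dots> = C' * exp (- (c/2) * (norm h)^2)" by (simp add: C'_def algebra_simps)
    finally show ?thesis .
  qed
  moreover have "continuous_on UNIV (\<lambda>h. gauss \<kappa> a b h * P h)"
    using P unfolding poly_growth_def by (intro continuous_intros continuous_on_gauss) auto
  ultimately show ?thesis using c unfolding gaussian_decay_def by (intro conjI exI[of _ C'] exI[of _ "c/2"]) auto
qed

lemma poly_growth_const: "poly_growth (\<lambda>_. c)"
  unfolding poly_growth_def by (intro conjI exI[of _ "norm c"] exI[of _ 0]) auto

lemma power_le_one_plus:
  fixes x :: real assumes "x \<ge> 0" "k \<le> n" shows "x ^ k \<le> 1 + x ^ n"
proof (cases "x \<le> 1")
  case True
  then show ?thesis using assms power_le_one[of x k] zero_le_power[of x n] by linarith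
next
  case False
  then have "x ^ k \<le> x ^ n" using assms by (intro power_increasing) auto
  then show ?thesis by linarith
qed

lemma poly_growth_add:
  assumes "poly_growth P" "poly_growth Q" shows "poly_growth (\<lambda>h. P h + Q h)"
proof -
  obtain C n D m where C: "\<And>h. norm (P h) \<le> C * (1 + ((norm h)^2)^n)" and D: "\<And>h. norm (Q h) \<le> D * (1 + ((norm h)^2)^m)"
    using assms unfolding poly_growth_def by metis
  have "norm (P h + Q h) \<le> (2 * \<bar>C\<bar> + 2 * \<bar>D\<bar>) * (1 + ((norm h)^2)^(n+m))" for h
  proof -
    let ?x = "(norm h)^2"
    have q: "?x ^ (n + m) \<ge> 0" "?x^n \<le> 1 + ?x^(n+m)" "?x^m \<le> 1 + ?x^(n+m)"
      by (simp_all add: power_le_one_plus)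
    have q': "1 + ?x^n \<le> 2 * (1 + ?x^(n+m))" "1 + ?x^m \<le> 2 * (1 + ?x^(n+m))"
      "1 + ?x^n + ?x^m + ?x^(n+m) \<le> 4 * (1 + ?x^(n+m))"
      using q by (simp_all only: distrib_left mult_1_right)
    have "norm (P h + Q h) \<le> \<bar>C\<bar> * (1 + ?x^n) + \<bar>D\<bar> * (1 + ?x^m)"
      using C[of h] D[of h] by (intro norm_triangle_mono) (meson abs_ge_self mult_right_mono order_trans add_nonneg_nonneg zero_le_one zero_le_power zero_le_power2)+
    also have "\<dots> \<le> \<bar>C\<bar> * (2 * (1 + ?x^(n+m))) + \<bar>D\<bar> * (2 * (1 + ?x^(n+m)))"
      by (intro add_mono mult_left_mono abs_ge_zero q')
    finally show ?thesis by (simp add: algebra_simps)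
  qed
  then show ?thesis using assms unfolding poly_growth_def
    by (intro conjI exI[of _ "2 * \<bar>C\<bar> + 2 * \<bar>D\<bar>"] exI[of _ "n+m"]) (auto intro: continuous_on_add)
qed

lemma poly_growth_mult:
  assumes "poly_growth P" "poly_growth Q" shows "poly_growth (\<lambda>h. P h * Q h)"
proof -
  obtain C n D m where C: "\<And>h. norm (P h) \<le> C * (1 + ((norm h)^2)^n)" and D: "\<And>h. norm (Q h) \<le> D * (1 + ((norm h)^2)^m)"
    using assms unfolding poly_growth_def by metis
  have "norm (P h * Q h) \<le> (4 * \<bar>C\<bar> * \<bar>D\<bar>) * (1 + ((norm h)^2)^(n+m))" for h
  proof -
    let ?x = "(norm h)^2"
    have q: "?x ^ (n + m) \<ge> 0" "?x^n \<le> 1 + ?x^(n+m)" "?x^m \<le> 1 + ?x^(n+m)"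
      by (simp_all add: power_le_one_plus)
    have q': "1 + ?x^n \<le> 2 * (1 + ?x^(n+m))" "1 + ?x^m \<le> 2 * (1 + ?x^(n+m))"
      "1 + ?x^n + ?x^m + ?x^(n+m) \<le> 4 * (1 + ?x^(n+m))"
      using q by (simp_all only: distrib_left mult_1_right)
    have "norm (P h * Q h) \<le> (\<bar>C\<bar> * (1 + ?x^n)) * (\<bar>D\<bar> * (1 + ?x^m))"
      unfolding norm_mult using C[of h] D[of h]
      by (intro mult_mono) (meson abs_ge_self mult_right_mono order_trans add_nonneg_nonneg zero_le_one zero_le_power zero_le_power2, meson abs_ge_self mult_right_mono order_trans add_nonneg_nonneg zero_le_one zero_le_power zero_le_power2, auto)
    also have "\<dots> = \<bar>C\<bar> * \<bar>D\<bar> * (1 + ?x^n + ?x^m + ?x^(n+m))"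
      by (simp add: algebra_simps power_add)
    also have "\<dots> \<le> \<bar>C\<bar> * \<bar>D\<bar> * (4 * (1 + ?x^(n+m)))"
      by (intro mult_left_mono q') simp
    finally show ?thesis by (simp add: algebra_simps)
  qed
  then show ?thesis using assms unfolding poly_growth_def
    by (intro conjI exI[of _ "4 * \<bar>C\<bar> * \<bar>D\<bar>"] exI[of _ "n+m"]) (auto intro: continuous_on_mult)
qed

lemma poly_growth_coord: "poly_growth (\<lambda>h. of_real (fst h))" "poly_growth (\<lambda>h. of_real (snd h))"
proof -
  have x: "\<bar>x\<bar> \<le> 1 + x^2" for x :: real
    using zero_le_power2[of "\<bar>x\<bar> - 1/2"] by (simp add: power2_eq_square algebra_simps abs_mult_self_eq)
  have b: "norm (complex_of_real (fst h)) \<le> 1 * (1 + ((norm h)^2)^1)" "norm (complex_of_real (snd h)) \<le> 1 * (1 + ((norm h)^2)^1)" for h :: "real \<times> real"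
    using x[of "fst h"] x[of "snd h"] zero_le_power2[of "fst h"] zero_le_power2[of "snd h"]
    unfolding norm_R2_sq norm_of_real power_one_right mult_1 by linarith+
  show "poly_growth (\<lambda>h. of_real (fst h))"
    unfolding poly_growth_def using b(1) by (intro conjI continuous_intros) blast
  show "poly_growth (\<lambda>h. of_real (snd h))"
    unfolding poly_growth_def using b(2) by (intro conjI continuous_intros) blast
qed

lemma gauss_derivative:
  "(gauss \<kappa> a b has_derivative (\<lambda>v. - gauss \<kappa> a b h *
     (of_real (fst v) * ((\<kappa> + \<i> * a) * of_real (fst h) + \<i> * b * of_real (snd h))
     + of_real (snd v) * (\<i> * b * of_real (fst h) + (\<kappa> - \<i> * a) * of_real (snd h))))) (at h)"
proof -
  have "((\<lambda>h. - gquad \<kappa> a b h / 2) has_derivative (\<lambda>v. -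
     (of_real (fst v) * ((\<kappa> + \<i> * a) * of_real (fst h) + \<i> * b * of_real (snd h))
     + of_real (snd v) * (\<i> * b * of_real (fst h) + (\<kappa> - \<i> * a) * of_real (snd h))))) (at h)"
    unfolding gquad_def norm_R2_sq
    by (rule derivative_eq_intros refl | simp add: fun_eq_iff field_simps)+
  then have "((\<lambda>h. exp (- gquad \<kappa> a b h / 2)) has_derivative (\<lambda>v. (-
     (of_real (fst v) * ((\<kappa> + \<i> * a) * of_real (fst h) + \<i> * b * of_real (snd h))
     + of_real (snd v) * (\<i> * b * of_real (fst h) + (\<kappa> - \<i> * a) * of_real (snd h)))) * exp (- gquad \<kappa> a b h / 2))) (at h)"
    using has_derivative_compose[where g = exp, OF _ DERIV_exp[unfolded has_field_derivative_def]]
    by (fastforce simp: mult.commute)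
  then show ?thesis unfolding gauss_def[abs_def] by (simp add: mult.commute algebra_simps)
qed

section \<open>Gaussian means and Wick's rule\<close>

definition gmean :: "complex \<Rightarrow> real \<Rightarrow> real \<Rightarrow> (real \<times> real \<Rightarrow> complex) \<Rightarrow> complex" where
  "gmean \<kappa> a b P = (\<integral>h. gauss \<kappa> a b h * P h \<partial>lborel)"

context
  fixes \<kappa> :: complex and a b :: real
  assumes kpos: "Re \<kappa> > 0"
begin

lemma gmean_integrable: "poly_growth P \<Longrightarrow> integrable lborel (\<lambda>h. gauss \<kappa> a b h * P h)"
  by (rule gaussian_decay_integrable[OF gaussian_decay_gauss_mult[OF kpos]])

lemma gmean_add: "poly_growth P \<Longrightarrow> poly_growth Q \<Longrightarrow> gmean \<kappa> a b (\<lambda>h. P h + Q h) = gmean \<kappa> a b P + gmean \<kappa> a b Q"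
  unfolding gmean_def distrib_left by (rule Bochner_Integration.integral_add[OF gmean_integrable gmean_integrable])

lemma gmean_cmult: "gmean \<kappa> a b (\<lambda>h. c * P h) = c * gmean \<kappa> a b P"
  unfolding gmean_def by (simp add: mult.left_commute)

text \<open>The total derivative of \<open>gauss * P\<close> integrates to zero, and differentiating
  the Gaussian produces the linear form v . Q h.\<close>

lemma gmean_by_parts:
  assumes P: "\<And>h. P differentiable (at h)" "poly_growth P" "poly_growth (pd v P)" and v: "v \<in> Basis"
  shows "gmean \<kappa> a b (pd v P) = gmean \<kappa> a b (\<lambda>h. (of_real (fst v) * ((\<kappa> + \<i> * a) * of_real (fst h) + \<i> * b * of_real (snd h))
     + of_real (snd v) * (\<i> * b * of_real (fst h) + (\<kappa> - \<i> * a) * of_real (snd h))) * P h)"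
    (is "_ = gmean _ _ _ (\<lambda>h. ?m h * P h)")
proof -
  have m: "poly_growth (\<lambda>h. ?m h * P h)"
    by (intro poly_growth_mult poly_growth_add poly_growth_const poly_growth_coord P)
  define G where "G h = gauss \<kappa> a b h * P h" for h
  have dG: "(G has_derivative (\<lambda>w. gauss \<kappa> a b h * pd w P h + (- gauss \<kappa> a b h *
     (of_real (fst w) * ((\<kappa> + \<i> * a) * of_real (fst h) + \<i> * b * of_real (snd h))
     + of_real (snd w) * (\<i> * b * of_real (fst h) + (\<kappa> - \<i> * a) * of_real (snd h)))) * P h)) (at h)" for h
    unfolding G_def[abs_def] by (rule has_derivative_mult[OF gauss_derivative has_derivative_pd[OF P(1)]])
  have pdG: "pd v G = (\<lambda>h. gauss \<kappa> a b h * (pd v P h + (-1) * (?m h * P h)))"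
    by (rule ext) (simp add: pd_eq[OF dG, where v = v] algebra_simps)
  have pg: "poly_growth (\<lambda>h. pd v P h + (-1) * (?m h * P h))"
    by (intro poly_growth_add[OF P(3)] poly_growth_mult[OF poly_growth_const m])
  have "(\<integral>h. pd v G h \<partial>lborel) = 0"
  proof (rule integral_partial_derivative_zero[OF v])
    show "G differentiable (at h)" for h using dG unfolding differentiable_def by blast
    show "gaussian_decay G" unfolding G_def[abs_def] by (rule gaussian_decay_gauss_mult[OF kpos P(2)])
    show "gaussian_decay (pd v G)" unfolding pdG by (rule gaussian_decay_gauss_mult[OF kpos pg])
  qed
  then have "gmean \<kappa> a b (\<lambda>h. pd v P h + (-1) * (?m h * P h)) = 0"
    unfolding pdG gmean_def .
  then show ?thesis
    using gmean_add[OF P(3) poly_growth_mult[OF poly_growth_const m], of "-1"] gmean_cmult[of "-1" "\<lambda>h. ?m h * P h"] by simp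
qed

text \<open>This number is det Q. Its vanishing would make \<kappa>^2 a nonpositive real, which is
  impossible for \<kappa> in the open right half-plane.\<close>

lemma kappa_det_nz: "\<kappa>^2 + of_real (a^2 + b^2) \<noteq> 0"
proof
  assume "\<kappa>^2 + of_real (a^2 + b^2) = 0"
  then have k2: "Im (\<kappa>^2) = 0" "Re (\<kappa>^2) = - (a^2 + b^2)" by (auto simp: complex_eq_iff simp del: of_real_add of_real_power)
  then have "Im \<kappa> = 0" using kpos by (simp add: power2_eq_square)
  then have "(Re \<kappa>)^2 = - (a^2 + b^2)" using k2(2) by (simp add: power2_eq_square)
  then show False using kpos zero_less_power[OF kpos, of 2] zero_le_power2[of a] zero_le_power2[of b] by linarith
qed

text \<open>The inverse of the quadratic form \<open>[[\<kappa> + i a, i b], [i b, \<kappa> - i a]]\<close> turns integration by parts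
  into Wick's rule.\<close>
lemma gmean_wick:
  assumes P: "\<And>h. P differentiable (at h)" "poly_growth P" "\<And>v. v \<in> Basis \<Longrightarrow> poly_growth (pd v P)"
  shows "(\<kappa>^2 + of_real (a^2 + b^2)) * gmean \<kappa> a b (\<lambda>h. of_real (fst h) * P h)
           = (\<kappa> - \<i> * a) * gmean \<kappa> a b (pd (1,0) P) - \<i> * b * gmean \<kappa> a b (pd (0,1) P)"
    "(\<kappa>^2 + of_real (a^2 + b^2)) * gmean \<kappa> a b (\<lambda>h. of_real (snd h) * P h)
           = (\<kappa> + \<i> * a) * gmean \<kappa> a b (pd (0,1) P) - \<i> * b * gmean \<kappa> a b (pd (1,0) P)"
proof -
  let ?E = "gmean \<kappa> a b"
  define X where "X = ?E (\<lambda>h. of_real (fst h) * P h)"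
  define Y where "Y = ?E (\<lambda>h. of_real (snd h) * P h)"
  have B: "(1,0) \<in> (Basis :: (real\<times>real) set)" "(0,1) \<in> (Basis :: (real\<times>real) set)" by (auto simp: Basis_prod_def)
  have pg: "poly_growth (\<lambda>h. c * (of_real (fst h) * P h))" "poly_growth (\<lambda>h. c * (of_real (snd h) * P h))" for c
    by (intro poly_growth_mult poly_growth_const poly_growth_coord P)+
  have lin: "?E (\<lambda>h. (c * of_real (fst h) + d * of_real (snd h)) * P h) = c * X + d * Y" for c d
    using gmean_add[OF pg(1)[of c] pg(2)[of d]] gmean_cmult by (simp add: X_def Y_def algebra_simps)
  \<comment> \<open>The two integrations by parts form a linear system for \<open>X\<close> and
    \<open>Y\<close> with matrix Q; Cramer's rule solves it.\<close>
  have 1: "?E (pd (1,0) P) = (\<kappa> + \<i> * a) * X + \<i> * b * Y"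
    using gmean_by_parts[OF P(1,2) P(3)[OF B(1)] B(1)] lin by simp
  have 2: "?E (pd (0,1) P) = \<i> * b * X + (\<kappa> - \<i> * a) * Y"
    using gmean_by_parts[OF P(1,2) P(3)[OF B(2)] B(2)] lin by simp
  have i: "\<i> * (\<i> * z) = - z" for z by (simp add: mult.assoc[symmetric])
  show "(\<kappa>^2 + of_real (a^2 + b^2)) * X = (\<kappa> - \<i> * a) * ?E (pd (1,0) P) - \<i> * b * ?E (pd (0,1) P)"
    unfolding 1 2 by (simp add: algebra_simps power2_eq_square i)
  show "(\<kappa>^2 + of_real (a^2 + b^2)) * Y = (\<kappa> + \<i> * a) * ?E (pd (0,1) P) - \<i> * b * ?E (pd (1,0) P)"
    unfolding 1 2 by (simp add: algebra_simps power2_eq_square i)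
qed

end

text \<open>If the value were a real r \<le> 0, then s = (r - 1) \<kappa>^2 would force \<kappa> to
  be real and s to be negative.\<close>

lemma branch_avoids_cut:
  assumes "Re \<kappa> > 0" "s \<ge> 0"
  shows "1 + of_real s / \<kappa>^2 \<notin> \<real>\<^sub>\<le>\<^sub>0"
proof
  assume "1 + of_real s / \<kappa>^2 \<in> \<real>\<^sub>\<le>\<^sub>0"
  then obtain r where r: "1 + of_real s / \<kappa>^2 = of_real r" "r \<le> 0" by (auto elim: nonpos_Reals_cases)
  have nz: "\<kappa> \<noteq> 0" using assms by auto
  have e: "of_real s = of_real (r - 1) * \<kappa>^2"
  proof -
    have "of_real s / \<kappa>^2 = of_real (r - 1)" using r(1) by (simp add: algebra_simps)
    then show ?thesis using nz by (simp add: divide_eq_eq)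
  qed
  have "(r - 1) * Im (\<kappa>^2) = 0" using arg_cong[OF e, of Im] by simp
  then have "Im (\<kappa>^2) = 0" using r(2) by simp
  then have "Im \<kappa> = 0" using assms by (simp add: power2_eq_square)
  moreover have "s = (r - 1) * Re (\<kappa>^2)" using arg_cong[OF e, of Re] by simp
  ultimately have "s = (r - 1) * (Re \<kappa>)^2" by (simp add: power2_eq_square)
  moreover have "(r - 1) * (Re \<kappa>)^2 < 0" using r(2) assms by (intro mult_neg_pos) auto
  ultimately show False using assms by simp
qed

text \<open>An explicit quadratic error bound is what differentiation under the Gaussian integral
  delivers directly.\<close>

lemma quadratic_error_derivative:
  fixes F :: "real \<Rightarrow> complex"
  assumes "\<And>y. norm (F y - F x - (y - x) *\<^sub>R D) \<le> C * (y - x)^2"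
  shows "(F has_vector_derivative D) (at x)"
  unfolding has_vector_derivative_def
proof (rule has_derivativeI_sandwich[of 1])
  show "bounded_linear (\<lambda>x. x *\<^sub>R D)" by (rule bounded_linear_scaleR_left)
  show "((\<lambda>y. C * \<bar>y - x\<bar>) \<longlongrightarrow> 0) (at x)"
    by (auto intro!: tendsto_eq_intros)
  show "norm (F y - F x - (y - x) *\<^sub>R D) / norm (y - x) \<le> C * \<bar>y - x\<bar>" if "y \<noteq> x" for y
    using assms[of y] that by (simp add: divide_le_eq power2_eq_square mult.assoc abs_mult_self_eq)
qed simp

text \<open>Wick's rule for the coordinate functions: the second moments are the entries of the
  inverse of Q times the total mass.\<close>

lemma gmean_second_moments:
  assumes "Re \<kappa> > 0"
  shows "(\<kappa>^2 + of_real (a^2 + b^2)) * gmean \<kappa> a b (\<lambda>h. of_real (fst h) * of_real (fst h)) = (\<kappa> - \<i> * a) * gmean \<kappa> a b (\<lambda>_. 1)"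
    "(\<kappa>^2 + of_real (a^2 + b^2)) * gmean \<kappa> a b (\<lambda>h. of_real (fst h) * of_real (snd h)) = - \<i> * b * gmean \<kappa> a b (\<lambda>_. 1)"
    "(\<kappa>^2 + of_real (a^2 + b^2)) * gmean \<kappa> a b (\<lambda>h. of_real (snd h) * of_real (snd h)) = (\<kappa> + \<i> * a) * gmean \<kappa> a b (\<lambda>_. 1)"
proof -
  have d: "((\<lambda>h::real\<times>real. complex_of_real (fst h)) has_derivative (\<lambda>v. of_real (fst v))) (at h)"
    "((\<lambda>h::real\<times>real. complex_of_real (snd h)) has_derivative (\<lambda>v. of_real (snd v))) (at h)" for h
    by (auto intro!: derivative_eq_intros)
  have p: "pd v (\<lambda>h::real\<times>real. complex_of_real (fst h)) = (\<lambda>_. of_real (fst v))"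
    "pd v (\<lambda>h::real\<times>real. complex_of_real (snd h)) = (\<lambda>_. of_real (snd v))" for v
    using pd_eq[OF d(1)] pd_eq[OF d(2)] by (auto simp: fun_eq_iff)
  have z: "gmean \<kappa> a b (\<lambda>_. 0) = 0" by (simp add: gmean_def)
  have df: "(\<lambda>h::real\<times>real. complex_of_real (fst h)) differentiable (at h)"
    "(\<lambda>h::real\<times>real. complex_of_real (snd h)) differentiable (at h)" for h
    using d(1)[of h] d(2)[of h] unfolding differentiable_def by blast+
  note w1 = gmean_wick[OF assms df(1) poly_growth_coord(1), unfolded p, OF poly_growth_const, of a b]
  note w2 = gmean_wick[OF assms df(2) poly_growth_coord(2), unfolded p, OF poly_growth_const, of a b]
  show "(\<kappa>^2 + of_real (a^2 + b^2)) * gmean \<kappa> a b (\<lambda>h. of_real (fst h) * of_real (fst h)) = (\<kappa> - \<i> * a) * gmean \<kappa> a b (\<lambda>_. 1)"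
    using w1(1) by (simp add: z)
  show "(\<kappa>^2 + of_real (a^2 + b^2)) * gmean \<kappa> a b (\<lambda>h. of_real (fst h) * of_real (snd h)) = - \<i> * b * gmean \<kappa> a b (\<lambda>_. 1)"
    using w2(1) by (simp add: z)
  show "(\<kappa>^2 + of_real (a^2 + b^2)) * gmean \<kappa> a b (\<lambda>h. of_real (snd h) * of_real (snd h)) = (\<kappa> + \<i> * a) * gmean \<kappa> a b (\<lambda>_. 1)"
    using w2(2) by (simp add: z)
qed

text \<open>Deform the form to a real multiple of the identity; along the path the integral and the
  reciprocal square root of the determinant satisfy the same linear differential equation.\<close>
lemma gmean_one:
  assumes kpos: "Re \<kappa> > 0"
  shows "gmean \<kappa> a b (\<lambda>_. 1) = 2 * pi / (\<kappa> * csqrt (1 + of_real (a^2 + b^2) / \<kappa>^2))"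
proof -
  define k0 k1 where "k0 = Re \<kappa>" and "k1 = Im \<kappa>"
  define s where "s = a^2 + b^2"
  have s0: "s \<ge> 0" by (simp add: s_def)
  \<comment> \<open>The deformation keeps the real part of \<kappa> and scales its imaginary part
    together with \<open>a\<close> and \<open>b\<close>. It is set up for complex z so that the root
    can be differentiated by complex calculus.\<close>
  define kz where "kz z = of_real k0 + \<i> * of_real k1 * z" for z
  define f where "f z = kz z * csqrt (1 + of_real s * z^2 / (kz z)^2)" for z
  define F where "F \<tau> = gmean (kz (of_real \<tau>)) (\<tau> * a) (\<tau> * b) (\<lambda>_. 1)" for \<tau> :: real
  \<comment> \<open>Along the deformation the form is k0 |h|^2 + i \<tau> r(h), so changing \<tau>
    only multiplies the Gaussian by a factor of modulus one.\<close>
  define r where "r h = k1 * (norm h)^2 + (a * ((fst h)^2 - (snd h)^2) + 2 * b * fst h * snd h)" for h :: "real \<times> real"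
  have Rek: "Re (kz (of_real \<tau>)) = k0" "k0 > 0" for \<tau> using kpos by (auto simp: kz_def k0_def)
  have rel: "gauss (kz (of_real \<tau>')) (\<tau>' * a) (\<tau>' * b) h = gauss (kz (of_real \<tau>)) (\<tau> * a) (\<tau> * b) h * iexp (- (\<tau>' - \<tau>) * r h / 2)" for \<tau> \<tau>' h
    unfolding gauss_def gquad_def kz_def r_def exp_add[symmetric]
    by (rule arg_cong[of _ _ exp]) (simp add: field_simps)
  have rb: "(r h)^2 \<le> (\<bar>k1\<bar> + \<bar>a\<bar> + \<bar>b\<bar>)^2 * ((norm h)^2)^2" for h
  proof -
    have 1: "\<bar>(fst h)^2 - (snd h)^2\<bar> \<le> (norm h)^2" unfolding norm_R2_sq
      using zero_le_power2[of "fst h"] zero_le_power2[of "snd h"] by linarith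
    have 2: "\<bar>2 * fst h * snd h\<bar> \<le> (norm h)^2" unfolding norm_R2_sq
      using sum_squares_bound[of "fst h" "snd h"] sum_squares_bound[of "fst h" "- snd h"] by (simp add: abs_le_iff)
    have "\<bar>r h\<bar> \<le> \<bar>k1 * (norm h)^2\<bar> + (\<bar>a * ((fst h)^2 - (snd h)^2)\<bar> + \<bar>b * (2 * fst h * snd h)\<bar>)"
      unfolding r_def by (simp add: mult.assoc mult.left_commute[of 2 b])
    also have "\<dots> \<le> \<bar>k1\<bar> * (norm h)^2 + (\<bar>a\<bar> * (norm h)^2 + \<bar>b\<bar> * (norm h)^2)"
      unfolding abs_mult by (intro add_mono mult_left_mono) (use 1 2[unfolded abs_mult] in auto)
    also have "\<dots> = (\<bar>k1\<bar> + \<bar>a\<bar> + \<bar>b\<bar>) * (norm h)^2" by (simp add: algebra_simps)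
    finally have "\<bar>r h\<bar>^2 \<le> ((\<bar>k1\<bar> + \<bar>a\<bar> + \<bar>b\<bar>) * (norm h)^2)^2" by (rule power_mono) simp
    then show ?thesis by (simp add: power_mult_distrib)
  qed
  have pgr: "poly_growth (\<lambda>h. complex_of_real (r h))"
  proof -
    have "complex_of_real (r h) = of_real k1 * (of_real (fst h) * of_real (fst h) + of_real (snd h) * of_real (snd h))
       + (of_real a * (of_real (fst h) * of_real (fst h) + (-1) * (of_real (snd h) * of_real (snd h))) + of_real (2 * b) * (of_real (fst h) * of_real (snd h)))" for h
      unfolding r_def norm_R2_sq by (simp add: power2_eq_square)
    then show ?thesis
      by (simp only:) (intro poly_growth_add poly_growth_mult poly_growth_const poly_growth_coord)
  qed
  \<comment> \<open>The second-order bound for that oscillating factor, together with |r(h)| \<le> A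
    |h|^2, gives an error (\<tau>' - \<tau>)^2 times a finite fourth moment.\<close>
  have dF: "(F has_vector_derivative (- \<i> / 2 * gmean (kz (of_real \<tau>)) (\<tau> * a) (\<tau> * b) (\<lambda>h. of_real (r h)))) (at \<tau>)" for \<tau>
  proof (rule quadratic_error_derivative)
    fix \<tau>' :: real
    let ?g = "\<lambda>\<tau>. gauss (kz (of_real \<tau>)) (\<tau> * a) (\<tau> * b)"
    let ?A = "\<bar>k1\<bar> + \<bar>a\<bar> + \<bar>b\<bar>"
    have i1: "integrable lborel (\<lambda>h. ?g t h * 1)" for t
      by (rule gmean_integrable[OF _ poly_growth_const]) (simp add: Rek)
    have i2: "integrable lborel (\<lambda>h. ?g \<tau> h * of_real (r h))"
      by (rule gmean_integrable[OF _ pgr]) (simp add: Rek)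
    have i3: "integrable lborel (\<lambda>h. (\<tau>' - \<tau>) *\<^sub>R (- \<i> / 2 * (?g \<tau> h * of_real (r h))))"
      using i2 by (intro integrable_scaleR_right integrable_mult_right) auto
    have eI: "F \<tau>' - F \<tau> - (\<tau>' - \<tau>) *\<^sub>R (- \<i> / 2 * gmean (kz (of_real \<tau>)) (\<tau> * a) (\<tau> * b) (\<lambda>h. of_real (r h)))
       = (\<integral>h. ?g \<tau>' h * 1 - ?g \<tau> h * 1 - (\<tau>' - \<tau>) *\<^sub>R (- \<i> / 2 * (?g \<tau> h * of_real (r h))) \<partial>lborel)"
      unfolding F_def gmean_def
      using i1[of \<tau>] i1[of \<tau>'] i2 i3 by (simp del: mult_1_right)
    have "norm (\<integral>h. ?g \<tau>' h * 1 - ?g \<tau> h * 1 - (\<tau>' - \<tau>) *\<^sub>R (- \<i> / 2 * (?g \<tau> h * of_real (r h))) \<partial>lborel)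
        \<le> (\<integral>h. (?A^2 * (\<tau>' - \<tau>)^2 / 8) * (((norm (h :: real \<times> real))^2)^2 * exp (- (k0 / 2) * (norm h)^2)) \<partial>lborel)"
    proof (rule Bochner_Integration.integral_norm_bound_integral)
      show "integrable lborel (\<lambda>h. ?g \<tau>' h * 1 - ?g \<tau> h * 1 - (\<tau>' - \<tau>) *\<^sub>R (- \<i> / 2 * (?g \<tau> h * of_real (r h))))"
        by (intro Bochner_Integration.integrable_diff i1 i3)
      show "integrable lborel (\<lambda>h::real\<times>real. (?A^2 * (\<tau>' - \<tau>)^2 / 8) * (((norm h)^2)^2 * exp (- (k0 / 2) * (norm h)^2)))"
        using Rek by (intro integrable_mult_right gaussian_moment_bound) simp
      fix h :: "real \<times> real"
      let ?x = "- (\<tau>' - \<tau>) * r h / 2"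
      have "?g \<tau>' h * 1 - ?g \<tau> h * 1 - (\<tau>' - \<tau>) *\<^sub>R (- \<i> / 2 * (?g \<tau> h * of_real (r h))) = ?g \<tau> h * (iexp ?x - (\<Sum>k\<le>1. (\<i> * ?x)^k / fact k))"
        unfolding rel[of \<tau>' h \<tau>] by (simp add: scaleR_conv_of_real field_simps)
      then have "norm (?g \<tau>' h * 1 - ?g \<tau> h * 1 - (\<tau>' - \<tau>) *\<^sub>R (- \<i> / 2 * (?g \<tau> h * of_real (r h)))) = exp (- (k0 / 2) * (norm h)^2) * norm (iexp ?x - (\<Sum>k\<le>1. (\<i> * ?x)^k / fact k))"
        by (simp only: norm_mult norm_gauss Rek)
      also have "\<dots> \<le> exp (- (k0 / 2) * (norm h)^2) * (\<bar>?x\<bar>^(Suc 1) / fact (Suc 1))"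
        by (intro mult_left_mono iexp_approx1) simp
      also have "\<bar>?x\<bar>^(Suc 1) / fact (Suc 1) = (\<tau>' - \<tau>)^2 / 8 * (r h)^2"
        by (simp add: power2_eq_square field_simps abs_mult_self_eq)
      also have "exp (- (k0 / 2) * (norm h)^2) * ((\<tau>' - \<tau>)^2 / 8 * (r h)^2) \<le> exp (- (k0 / 2) * (norm h)^2) * ((\<tau>' - \<tau>)^2 / 8 * (?A^2 * ((norm h)^2)^2))"
        by (intro mult_left_mono rb) auto
      finally show "norm (?g \<tau>' h * 1 - ?g \<tau> h * 1 - (\<tau>' - \<tau>) *\<^sub>R (- \<i> / 2 * (?g \<tau> h * of_real (r h)))) \<le> (?A^2 * (\<tau>' - \<tau>)^2 / 8) * (((norm h)^2)^2 * exp (- (k0 / 2) * (norm h)^2))"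
        by (simp add: mult_ac)
    qed
    then show "norm (F \<tau>' - F \<tau> - (\<tau>' - \<tau>) *\<^sub>R (- \<i> / 2 * gmean (kz (of_real \<tau>)) (\<tau> * a) (\<tau> * b) (\<lambda>h. of_real (r h)))) \<le> (?A^2 / 8 * (\<integral>h. ((norm h)^2)^2 * exp (- (k0 / 2) * (norm h)^2) \<partial>(lborel::(real\<times>real) measure))) * (\<tau>' - \<tau>)^2"
      unfolding eI integral_mult_right_zero by (simp only: times_divide_eq_right times_divide_eq_left mult_ac)
  qed
  have knz: "kz (of_real \<tau>) \<noteq> 0" for \<tau> using Rek(1)[of \<tau>] Rek(2) by auto
  have br: "1 + of_real s * (of_real \<tau>)^2 / (kz (of_real \<tau>))^2 \<notin> \<real>\<^sub>\<le>\<^sub>0" for \<tau> :: real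
    using branch_avoids_cut[of "kz (of_real \<tau>)" "s * \<tau>^2"] Rek s0 by simp
  \<comment> \<open>The square of \<open>f\<close> is the determinant of the deformed form.\<close>
  have ff: "(f (of_real \<tau>))^2 = (kz (of_real \<tau>))^2 + of_real s * (of_real \<tau>)^2" for \<tau> :: real
    using knz[of \<tau>] by (simp add: f_def power_mult_distrib field_simps)
  have fnz: "f (of_real \<tau>) \<noteq> 0" for \<tau> :: real
    using knz[of \<tau>] br[of \<tau>] by (auto simp: f_def)
  have df: "((\<lambda>\<tau>. f (of_real \<tau>)) has_vector_derivative ((\<i> * k1 * kz (of_real \<tau>) + of_real (s * \<tau>)) / f (of_real \<tau>))) (at \<tau>)" for \<tau> :: real
  proof -
    let ?z = "complex_of_real \<tau>"
    let ?g = "\<lambda>z. 1 + of_real s * z^2 / (kz z)^2"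
    let ?w = "csqrt (?g ?z)"
    have dk: "(kz has_field_derivative \<i> * k1) (at z)" for z
      unfolding kz_def[abs_def] by (auto intro!: derivative_eq_intros)
    have w2: "?w^2 = ?g ?z" by simp
    have wnz: "?w \<noteq> 0" using br[of \<tau>] by auto
    have dg: "(?g has_field_derivative (2 * of_real s * ?z / (kz ?z)^2 - 2 * of_real s * ?z^2 * (\<i> * k1) / (kz ?z)^3)) (at ?z)"
      using knz[of \<tau>] by (auto intro!: derivative_eq_intros dk simp: field_simps power2_eq_square power3_eq_cube)
    have "(f has_field_derivative ((\<i> * k1) * ?w + (inverse (2 * ?w) * (2 * of_real s * ?z / (kz ?z)^2 - 2 * of_real s * ?z^2 * (\<i> * k1) / (kz ?z)^3)) * kz ?z)) (at ?z)"
      unfolding f_def[abs_def] by (rule DERIV_mult[OF dk DERIV_chain2[OF has_field_derivative_csqrt[OF br] dg]])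
    moreover have "(\<i> * k1) * ?w + (inverse (2 * ?w) * (2 * of_real s * ?z / (kz ?z)^2 - 2 * of_real s * ?z^2 * (\<i> * k1) / (kz ?z)^3)) * kz ?z = (\<i> * k1 * kz ?z + of_real (s * \<tau>)) / f ?z"
    proof -
      have "((\<i> * k1) * ?w + (inverse (2 * ?w) * (2 * of_real s * ?z / (kz ?z)^2 - 2 * of_real s * ?z^2 * (\<i> * k1) / (kz ?z)^3)) * kz ?z) * (kz ?z * ?w)
         = \<i> * k1 * kz ?z * ?w^2 + (of_real s * ?z - of_real s * ?z^2 * (\<i> * k1) / kz ?z)"
        using wnz knz[of \<tau>] by (simp add: field_simps power2_eq_square power3_eq_cube del: power2_csqrt)
      also have "\<dots> = \<i> * k1 * kz ?z + of_real (s * \<tau>)"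
        unfolding w2 using knz[of \<tau>] by (simp add: field_simps power2_eq_square)
      finally show ?thesis using wnz knz[of \<tau>] unfolding f_def by (simp add: eq_divide_eq)
    qed
    ultimately show ?thesis using has_vector_derivative_real_field by metis
  qed
  \<comment> \<open>The second moments express the mean of \<open>r\<close> by the total mass
    \<open>F\<close>, which turns the formula for F' into F'/F = - f'/f.\<close>
  have "((\<lambda>\<tau>. F \<tau> * f (of_real \<tau>)) has_vector_derivative 0) (at \<tau>)" for \<tau>
  proof -
    let ?k = "kz (of_real \<tau>)"
    let ?E = "gmean ?k (\<tau> * a) (\<tau> * b)"
    let ?D = "?k^2 + of_real ((\<tau> * a)^2 + (\<tau> * b)^2)"
    have k: "Re ?k > 0" by (simp add: Rek)
    have D: "?D = (f (of_real \<tau>))^2" unfolding ff by (simp add: s_def algebra_simps power_mult_distrib)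
    have re: "complex_of_real (r h) = of_real (k1 + a) * (of_real (fst h) * of_real (fst h)) + (of_real (2 * b) * (of_real (fst h) * of_real (snd h))
         + of_real (k1 - a) * (of_real (snd h) * of_real (snd h)))" for h
      unfolding r_def norm_R2_sq by (simp add: power2_eq_square algebra_simps)
    have Er: "?E (\<lambda>h. of_real (r h)) = of_real (k1 + a) * ?E (\<lambda>h. of_real (fst h) * of_real (fst h))
        + (of_real (2 * b) * ?E (\<lambda>h. of_real (fst h) * of_real (snd h)) + of_real (k1 - a) * ?E (\<lambda>h. of_real (snd h) * of_real (snd h)))"
      unfolding re gmean_cmult[OF k, symmetric]
      by (subst gmean_add[OF k], (intro poly_growth_add poly_growth_mult poly_growth_const poly_growth_coord)+,
          subst gmean_add[OF k], (intro poly_growth_add poly_growth_mult poly_growth_const poly_growth_coord)+, simp)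
    have "?D * ?E (\<lambda>h. of_real (r h)) = of_real (k1 + a) * (?D * ?E (\<lambda>h. of_real (fst h) * of_real (fst h)))
        + (of_real (2 * b) * (?D * ?E (\<lambda>h. of_real (fst h) * of_real (snd h))) + of_real (k1 - a) * (?D * ?E (\<lambda>h. of_real (snd h) * of_real (snd h))))"
      unfolding Er by (simp only: distrib_left mult.left_commute)
    also have "\<dots> = (2 * k1 * ?k - 2 * \<i> * of_real (s * \<tau>)) * ?E (\<lambda>_. 1)"
      unfolding gmean_second_moments[OF k] by (simp add: s_def algebra_simps power2_eq_square)
    finally have Dr: "?D * ?E (\<lambda>h. of_real (r h)) = (2 * k1 * ?k - 2 * \<i> * of_real (s * \<tau>)) * F \<tau>" unfolding F_def .
    have "((\<lambda>\<tau>. F \<tau> * f (of_real \<tau>)) has_vector_derivative (F \<tau> * ((\<i> * k1 * ?k + of_real (s * \<tau>)) / f (of_real \<tau>)) + (- \<i> / 2 * ?E (\<lambda>h. of_real (r h))) * f (of_real \<tau>))) (at \<tau>)"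
      by (rule has_vector_derivative_mult[OF dF df])
    moreover have "F \<tau> * ((\<i> * k1 * ?k + of_real (s * \<tau>)) / f (of_real \<tau>)) + (- \<i> / 2 * ?E (\<lambda>h. of_real (r h))) * f (of_real \<tau>) = 0" (is "?L = 0")
    proof -
      have "?L * f (of_real \<tau>) = F \<tau> * (\<i> * k1 * ?k + of_real (s * \<tau>)) - \<i> / 2 * ((f (of_real \<tau>))^2 * ?E (\<lambda>h. of_real (r h)))"
        using fnz[of \<tau>] by (simp add: field_simps power2_eq_square)
      also have "\<dots> = 0" unfolding D[symmetric] Dr by (simp add: field_simps)
      finally show ?thesis using fnz[of \<tau>] by simp
    qed
    ultimately show ?thesis by (simp only:)
  qed
  then obtain c where c: "\<And>\<tau>. F \<tau> * f (of_real \<tau>) = c"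
    using has_vector_derivative_zero_constant[of UNIV "\<lambda>\<tau>. F \<tau> * f (of_real \<tau>)"] by auto
  \<comment> \<open>At \<tau> = 0 the form is a real multiple of the identity; F(0) = 2 pi / k0 and
    f(0) = k0 fix the constant product as 2 pi.\<close>
  have "F 0 = of_real (\<integral>h. exp (- (k0/2) * (norm h)^2) \<partial>(lborel :: (real\<times>real) measure))"
  proof -
    have "gauss (kz 0) 0 0 h * 1 = complex_of_real (exp (- (k0/2) * (norm h)^2))" for h :: "real \<times> real"
      by (simp add: gauss_def gquad_def kz_def exp_of_real[symmetric])
    then show ?thesis unfolding F_def gmean_def by simp
  qed
  also have "(\<integral>h. exp (- (k0/2) * (norm h)^2) \<partial>(lborel :: (real\<times>real) measure)) = pi / (k0/2)"
    using Rek by (intro real_gaussian_2D) simp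
  finally have "F 0 * f (of_real 0) = 2 * pi" using Rek(2) by (simp add: f_def kz_def)
  then have "F 1 * f (of_real 1) = 2 * pi" using c by metis
  moreover have "kz 1 = \<kappa>" by (simp add: kz_def k0_def k1_def complex_eq_iff)
  ultimately have "gmean \<kappa> a b (\<lambda>_. 1) * f 1 = 2 * pi" by (simp add: F_def)
  then have "gmean \<kappa> a b (\<lambda>_. 1) = 2 * pi / f 1" using fnz[of 1] by (simp add: eq_divide_eq)
  then show ?thesis using \<open>kz 1 = \<kappa>\<close> by (simp add: f_def s_def)
qed

section \<open>Gaussian means of Taylor terms\<close>

lemma sum_Basis_R2:
  fixes g :: "real \<times> real \<Rightarrow> 'b::comm_monoid_add"
  shows "(\<Sum>v\<in>Basis. g v) = g (1, 0) + g (0, 1)"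
proof -
  have B: "(Basis :: (real \<times> real) set) = {(1, 0), (0, 1)}" by (auto simp: Basis_prod_def)
  show ?thesis unfolding B by simp
qed

lemma Basis_R2: "(1, 0) \<in> (Basis :: (real \<times> real) set)" "(0, 1) \<in> (Basis :: (real \<times> real) set)"
  by (auto simp: Basis_prod_def)

lemma Qop_expand:
  assumes f: "usmooth {i} S f" and op: "open (S i)" and p: "p \<in> S i"
  shows "Qop N (f i) p = - (N 0 0 * pd (1,0) (pd (1,0) (f i)) p + N 0 1 * pd (1,0) (pd (0,1) (f i)) p
     + N 1 0 * pd (0,1) (pd (1,0) (f i)) p + N 1 1 * pd (0,1) (pd (0,1) (f i)) p)"
proof -
  have D: "Deta j (Deta k (f i)) p = - pd (e2 j) (pd (e2 k) (f i)) p" for j k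
  proof -
    have "e2 k \<in> Basis" by (simp add: e2_def Basis_R2)
    from usmooth_differentiable[OF usmooth_pd[OF f this] _ p]
    have d: "pd (e2 k) (f i) differentiable (at p)" by simp
    have "pd (e2 j) (\<lambda>\<eta>. - \<i> * pd (e2 k) (f i) \<eta>) p = - \<i> * pd (e2 j) (pd (e2 k) (f i)) p"
      by (rule pd_eq[OF bounded_linear.has_derivative[OF bounded_linear_mult_right has_derivative_pd[OF d]]])
    then show ?thesis unfolding Deta_def by simp
  qed
  show ?thesis unfolding Qop_def D by (simp add: numeral_2_eq_2 e2_def)
qed

lemma usmooth_const: "usmooth {i} S (\<lambda>_ _. c)"
  unfolding usmooth_def by (auto intro: unif_smooth_const)

lemma usmooth_Qop:
  assumes f: "usmooth {i} S f" and op: "open (S i)"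
  shows "usmooth {i} S (\<lambda>j. Qop N (f j))"
proof -
  have op': "open (S j)" if "j \<in> {i}" for j using op that by simp
  note B = Basis_R2
  have c: "usmooth {i} S (\<lambda>j q. N m n * pd v (pd w (f j)) q)" if "v \<in> Basis" "w \<in> Basis" for m n v w
    using op' by (intro usmooth_mult usmooth_const usmooth_pd f that) auto
  have "usmooth {i} S (\<lambda>j q. (-1) * (N 0 0 * pd (1,0) (pd (1,0) (f j)) q + N 0 1 * pd (1,0) (pd (0,1) (f j)) q
     + N 1 0 * pd (0,1) (pd (1,0) (f j)) q + N 1 1 * pd (0,1) (pd (0,1) (f j)) q))"
    by (intro usmooth_mult[of "{i}" S] usmooth_add[of "{i}" S] usmooth_const c B) (use op' in auto)
  then show ?thesis
  proof (rule usmooth_cong[of "{i}" S, rotated])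
    show "-1 * (N 0 0 * pd (1,0) (pd (1,0) (f j)) q + N 0 1 * pd (1,0) (pd (0,1) (f j)) q
     + N 1 0 * pd (0,1) (pd (1,0) (f j)) q + N 1 1 * pd (0,1) (pd (0,1) (f j)) q) = Qop N (f j) q"
      if "j \<in> {i}" "q \<in> S j" for j q
      using Qop_expand[OF f op, of q N] that by simp
  qed (use op' in auto)
qed

lemma poly_growth_dirpow:
  assumes f: "usmooth {i} S f" and op: "open (S i)" and p: "p \<in> S i"
  shows "poly_growth (\<lambda>h. dirpow k (f i) h p)"
proof -
  have op': "open (S j)" if "j \<in> {i}" for j using op that by simp
  obtain C where C: "C \<ge> 0" "\<And>h. norm (dirpow k (f i) h p) \<le> C * norm h ^ k"
    using dirpow_bound[of "{i}" S k f] op' f p unfolding usmooth_def by auto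
  have "norm (dirpow k (f i) h p) \<le> C * (1 + ((norm h)^2)^k)" for h
  proof -
    have "norm h ^ k \<le> 1 + norm h ^ (2 * k)" by (rule power_le_one_plus) auto
    then show ?thesis using C(2)[of h] mult_left_mono[OF _ C(1)] by (metis order_trans power_mult)
  qed
  then show ?thesis unfolding poly_growth_def using dirpow_continuous by blast
qed

lemma dirpow_add_cmult:
  fixes f g :: "'i \<Rightarrow> real \<times> real \<Rightarrow> complex"
  assumes "usmooth {i} S f" "usmooth {i} S g" "open (S i)" "p \<in> S i"
  shows "dirpow k (\<lambda>q. c * f i q + d * g i q) h p = c * dirpow k (f i) h p + d * dirpow k (g i) h p"
proof -
  have op': "open (S j)" if "j \<in> {i}" for j using assms(3) that by simp
  have u: "usmooth {i} S (\<lambda>j q. e * u j q)" if "usmooth {i} S u" for e and u :: "'i \<Rightarrow> real \<times> real \<Rightarrow> complex"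
    by (rule usmooth_mult[of "{i}" S "\<lambda>_ _. e" u]) (use op' usmooth_const[of i S e] that in auto)
  show ?thesis
    using dirpow_linear[of "{i}" S "\<lambda>j q. c * f j q" "\<lambda>j q. d * g j q" i p k h, OF _ u u]
      dirpow_cmult[of "{i}" S f i p k c h] dirpow_cmult[of "{i}" S g i p k d h] op' assms by simp
qed

text \<open>The matrix \<open>N\<close> is the inverse of the Hessian \<open>i [[\<kappa> + i a, i b], [i b, \<kappa> - i a]]\<close>.\<close>
lemma gmean_dirpow_step:
  fixes N :: "nat \<Rightarrow> nat \<Rightarrow> complex"
  assumes kpos: "Re \<kappa> > 0" and \<alpha>: "\<alpha> > 0"
    and f: "usmooth {i} S f" and op: "open (S i)" and p: "p \<in> S i"
    and N: "N 0 0 = - \<i> * (\<kappa> - \<i> * a) / (\<kappa>^2 + of_real (a^2 + b^2))"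
      "N 0 1 = - b / (\<kappa>^2 + of_real (a^2 + b^2))" "N 1 0 = - b / (\<kappa>^2 + of_real (a^2 + b^2))"
      "N 1 1 = - \<i> * (\<kappa> + \<i> * a) / (\<kappa>^2 + of_real (a^2 + b^2))"
  defines "E \<equiv> gmean (\<kappa> / of_real \<alpha>) (a / \<alpha>) (b / \<alpha>)"
  shows "E (\<lambda>h. dirpow (Suc (Suc k)) (f i) h p) = of_nat (Suc k) * (- \<i> * of_real \<alpha>) * E (\<lambda>h. dirpow k (Qop N (f i)) h p)"
    "E (\<lambda>h. dirpow (Suc 0) (f i) h p) = 0"
proof -
  have op': "open (S j)" if "j \<in> {i}" for j using op that by simp
  let ?\<kappa> = "\<kappa> / of_real \<alpha>" and ?a = "a / \<alpha>" and ?b = "b / \<alpha>"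
  let ?D = "\<kappa>^2 + of_real (a^2 + b^2)"
  have k: "Re ?\<kappa> > 0" using kpos \<alpha> by simp
  have Dnz: "?D \<noteq> 0" by (rule kappa_det_nz[OF kpos])
  have Ds: "?\<kappa>^2 + of_real (?a^2 + ?b^2) = ?D / (of_real \<alpha>)^2"
    by (simp add: power_divide add_divide_distrib)
  have f1: "usmooth {i} S (\<lambda>j. pd v (f j))" if "v \<in> Basis" for v by (rule usmooth_pd[OF f that])
  have f2: "usmooth {i} S (\<lambda>j. pd w (pd v (f j)))" if "v \<in> Basis" "w \<in> Basis" for v w
    by (rule usmooth_pd[OF f1[OF that(1)] that(2)])
  define P where "P k v h = dirpow k (pd v (f i)) h p" for k v h
  define R where "R k w v h = dirpow k (pd w (pd v (f i))) h p" for k w v h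
  have dP: "(P k v has_derivative (\<lambda>x. \<Sum>w\<in>Basis. (real k * (x \<bullet> w)) *\<^sub>R R (k - 1) w v h)) (at h)" if "v \<in> Basis" for k v h
    unfolding P_def[abs_def] R_def[abs_def]
    by (rule dirpow_derivative[of "{i}" S, OF _ f1[OF that]]) (use op' p in auto)
  have pdP: "pd (1,0) (P k v) = (\<lambda>h. of_nat k * R (k - 1) (1,0) v h)" "pd (0,1) (P k v) = (\<lambda>h. of_nat k * R (k - 1) (0,1) v h)"
    if "v \<in> Basis" for k v
    by (simp_all add: fun_eq_iff pd_eq[OF dP[OF that]] sum_Basis_R2 scaleR_conv_of_real)
  have Pd: "P k v differentiable (at h)" if "v \<in> Basis" for k v h
    using dP[OF that] unfolding differentiable_def by blast
  have Pg: "poly_growth (P k v)" if "v \<in> Basis" for k v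
    unfolding P_def by (rule poly_growth_dirpow[OF f1[OF that] op p])
  have Rg: "poly_growth (R k w v)" if "v \<in> Basis" "w \<in> Basis" for k w v
    unfolding R_def by (rule poly_growth_dirpow[OF f2[OF that] op p])
  have pdPg: "poly_growth (pd w (P k v))" if v: "v \<in> Basis" and w: "w \<in> Basis" for k v w
  proof -
    have "w = (1,0) \<or> w = (0,1)" using w by (auto simp: Basis_prod_def)
    then show ?thesis using pdP[OF v] Rg[OF v] Basis_R2 by (auto intro!: poly_growth_mult poly_growth_const)
  qed
  \<comment> \<open>Dividing the form by \<alpha> multiplies its inverse by \<alpha>. The factor k
    comes from differentiating a homogeneous polynomial of degree k in \<open>h\<close>.\<close>
  have wick: "E (\<lambda>h. of_real (fst h) * P k v h) = of_nat k * (of_real \<alpha> * ((\<kappa> - \<i> * a) * E (R (k-1) (1,0) v) - \<i> * b * E (R (k-1) (0,1) v)) / ?D)"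
    "E (\<lambda>h. of_real (snd h) * P k v h) = of_nat k * (of_real \<alpha> * ((\<kappa> + \<i> * a) * E (R (k-1) (0,1) v) - \<i> * b * E (R (k-1) (1,0) v)) / ?D)"
    if v: "v \<in> Basis" for k v
    using gmean_wick[OF k Pd[OF v] Pg[OF v] pdPg[OF v], of ?a ?b k, folded E_def] Dnz \<alpha>
    unfolding Ds pdP[OF v] gmean_cmult[OF k, of ?a ?b, folded E_def]
    by (simp_all add: field_simps power2_eq_square)
  \<comment> \<open>One linear factor in \<open>h\<close> is split off so that Wick's rule trades it
    for a derivative; what remains is of degree two lower, applied to a second derivative of
    \<open>f\<close>.\<close>
  have Edir: "E (\<lambda>h. dirpow (Suc k) (f i) h p) = E (\<lambda>h. of_real (fst h) * P k (1,0) h) + E (\<lambda>h. of_real (snd h) * P k (0,1) h)" for k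
  proof -
    have "dirpow (Suc k) (f i) h p = of_real (fst h) * P k (1,0) h + of_real (snd h) * P k (0,1) h" for h
      by (simp add: sum_Basis_R2 P_def scaleR_conv_of_real inner_prod_def)
    then show ?thesis unfolding E_def
      by (simp only:) (intro gmean_add[OF k] poly_growth_mult poly_growth_coord Pg Basis_R2)
  qed
  show "E (\<lambda>h. dirpow (Suc 0) (f i) h p) = 0"
    unfolding Edir wick[OF Basis_R2(1)] wick[OF Basis_R2(2)] by simp
  have Q: "dirpow k (Qop N (f i)) h p = (- N 0 0) * R k (1,0) (1,0) h + ((- N 0 1) * R k (1,0) (0,1) h + ((- N 1 0) * R k (0,1) (1,0) h + (- N 1 1) * R k (0,1) (0,1) h))" for h
  proof -
    define G1 where "G1 j q = (- N 1 0) * pd (0,1) (pd (1,0) (f j)) q + (- N 1 1) * pd (0,1) (pd (0,1) (f j)) q" for j q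
    define G2 where "G2 j q = (- N 0 1) * pd (1,0) (pd (0,1) (f j)) q + 1 * G1 j q" for j q
    have u: "usmooth {i} S (\<lambda>j q. c * u j q + d * w j q)" if "usmooth {i} S u" "usmooth {i} S w" for c d and u w :: "'a \<Rightarrow> real \<times> real \<Rightarrow> complex"
      by (intro usmooth_add[of "{i}" S] usmooth_mult[of "{i}" S] usmooth_const that) (use op' in auto)
    have g1: "usmooth {i} S G1" unfolding G1_def[abs_def] by (intro u f2 Basis_R2)
    have g2: "usmooth {i} S G2" unfolding G2_def[abs_def] by (intro u f2 Basis_R2 g1)
    have "dirpow k (Qop N (f i)) h p = dirpow k (\<lambda>q. (- N 0 0) * pd (1,0) (pd (1,0) (f i)) q + 1 * G2 i q) h p"
      by (rule dirpow_cong[OF op p]) (simp add: Qop_expand[OF f op] G1_def G2_def)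
    also have "\<dots> = (- N 0 0) * R k (1,0) (1,0) h + 1 * dirpow k (G2 i) h p"
      unfolding R_def by (rule dirpow_add_cmult[OF f2 g2 op p]) (rule Basis_R2)+
    also have "dirpow k (G2 i) h p = (- N 0 1) * R k (1,0) (0,1) h + 1 * dirpow k (G1 i) h p"
      unfolding R_def G2_def[abs_def] by (rule dirpow_add_cmult[OF f2 g1 op p]) (rule Basis_R2)+
    also have "dirpow k (G1 i) h p = (- N 1 0) * R k (0,1) (1,0) h + (- N 1 1) * R k (0,1) (0,1) h"
      unfolding R_def G1_def[abs_def] by (rule dirpow_add_cmult[OF f2 f2 op p]) (rule Basis_R2)+
    finally show ?thesis by simp
  qed
  have EQ: "E (\<lambda>h. dirpow k (Qop N (f i)) h p) = (- N 0 0) * E (R k (1,0) (1,0)) + ((- N 0 1) * E (R k (1,0) (0,1)) + ((- N 1 0) * E (R k (0,1) (1,0)) + (- N 1 1) * E (R k (0,1) (0,1))))"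
  proof -
    have g: "poly_growth (\<lambda>h. c * R k w v h)" if "v \<in> Basis" "w \<in> Basis" for c v w
      by (intro poly_growth_mult poly_growth_const Rg that)
    show ?thesis unfolding Q E_def gmean_cmult[OF k, symmetric]
      by (subst gmean_add[OF k], (intro g poly_growth_add Basis_R2)+)+ simp
  qed
  have i: "\<i> * (\<i> * z) = - z" for z by (simp add: mult.assoc[symmetric])
  define D' where "D' = ?D"
  show "E (\<lambda>h. dirpow (Suc (Suc k)) (f i) h p) = of_nat (Suc k) * (- \<i> * of_real \<alpha>) * E (\<lambda>h. dirpow k (Qop N (f i)) h p)"
    unfolding Edir wick[OF Basis_R2(1)] wick[OF Basis_R2(2)] EQ N D'_def[symmetric]
    using Dnz[folded D'_def] by (simp add: field_simps i)
qed

text \<open>Each reduction contributes an odd factor and one application of \<open>Qop N\<close>.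
  The odd factors multiply to (2\<nu>)! / (2^\<nu> \<nu>!), while odd degrees descend to degree one,
  whose mean is zero. The induction varies \<open>f\<close> because \<open>Qop N\<close> replaces
  it.\<close>

lemma gmean_dirpow:
  fixes N :: "nat \<Rightarrow> nat \<Rightarrow> complex"
  assumes kpos: "Re \<kappa> > 0" and \<alpha>: "\<alpha> > 0"
    and f: "usmooth {i} S f" and op: "open (S i)" and p: "p \<in> S i"
    and N: "N 0 0 = - \<i> * (\<kappa> - \<i> * a) / (\<kappa>^2 + of_real (a^2 + b^2))"
      "N 0 1 = - b / (\<kappa>^2 + of_real (a^2 + b^2))" "N 1 0 = - b / (\<kappa>^2 + of_real (a^2 + b^2))"
      "N 1 1 = - \<i> * (\<kappa> + \<i> * a) / (\<kappa>^2 + of_real (a^2 + b^2))"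
  defines "E \<equiv> gmean (\<kappa> / of_real \<alpha>) (a / \<alpha>) (b / \<alpha>)"
  shows "E (\<lambda>h. dirpow (2 * \<nu>) (f i) h p) = fact (2 * \<nu>) / (2^\<nu> * fact \<nu>) * (- \<i> * of_real \<alpha>)^\<nu> * (Qop N ^^ \<nu>) (f i) p * E (\<lambda>_. 1)"
    "E (\<lambda>h. dirpow (Suc (2 * \<nu>)) (f i) h p) = 0"
proof -
  have k: "Re (\<kappa> / of_real \<alpha>) > 0" using kpos \<alpha> by simp
  note step = gmean_dirpow_step[where i = i and S = S, OF kpos \<alpha> _ op p N, folded E_def]
  show "E (\<lambda>h. dirpow (2 * \<nu>) (f i) h p) = fact (2 * \<nu>) / (2^\<nu> * fact \<nu>) * (- \<i> * of_real \<alpha>)^\<nu> * (Qop N ^^ \<nu>) (f i) p * E (\<lambda>_. 1)"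
    using f
  proof (induction \<nu> arbitrary: f)
    case 0
    have "E (\<lambda>_. f i p * 1) = f i p * E (\<lambda>_. 1)" unfolding E_def by (rule gmean_cmult[OF k])
    then show ?case by simp
  next
    case (Suc \<nu>)
    have "E (\<lambda>h. dirpow (2 * Suc \<nu>) (f i) h p) = of_nat (Suc (2 * \<nu>)) * (- \<i> * of_real \<alpha>) * E (\<lambda>h. dirpow (2 * \<nu>) (Qop N (f i)) h p)"
      using step(1)[OF Suc.prems, of "2 * \<nu>"] by simp
    also have "E (\<lambda>h. dirpow (2 * \<nu>) (Qop N (f i)) h p) = fact (2 * \<nu>) / (2^\<nu> * fact \<nu>) * (- \<i> * of_real \<alpha>)^\<nu> * (Qop N ^^ \<nu>) (Qop N (f i)) p * E (\<lambda>_. 1)"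
      by (rule Suc.IH[OF usmooth_Qop[OF Suc.prems op]])
    also have "(Qop N ^^ \<nu>) (Qop N (f i)) = (Qop N ^^ Suc \<nu>) (f i)" by (simp add: funpow_swap1)
    also have "of_nat (Suc (2 * \<nu>)) * (- \<i> * of_real \<alpha>) * (fact (2 * \<nu>) / (2^\<nu> * fact \<nu>) * (- \<i> * of_real \<alpha>)^\<nu> * (Qop N ^^ Suc \<nu>) (f i) p * E (\<lambda>_. 1))
       = (of_nat (Suc (2 * \<nu>)) * (fact (2 * \<nu>) / (2^\<nu> * fact \<nu>))) * (- \<i> * of_real \<alpha>)^Suc \<nu> * (Qop N ^^ Suc \<nu>) (f i) p * E (\<lambda>_. 1)"
      by (simp only: power_Suc mult_ac)
    also have "of_nat (Suc (2 * \<nu>)) * (fact (2 * \<nu>) / (2^\<nu> * fact \<nu>)) = (fact (2 * Suc \<nu>) / (2^Suc \<nu> * fact (Suc \<nu>)) :: complex)"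
    proof -
      have n: "complex_of_nat (Suc \<nu>) \<noteq> 0" unfolding of_nat_eq_0_iff by simp
      have "(fact (2 * Suc \<nu>) :: complex) = of_nat (2 * Suc \<nu>) * (of_nat (Suc (2 * \<nu>)) * fact (2 * \<nu>))"
        by (simp add: algebra_simps)
      moreover have "(2^Suc \<nu> * fact (Suc \<nu>) :: complex) = of_nat (2 * Suc \<nu>) * (2^\<nu> * fact \<nu>)"
        by (simp add: algebra_simps)
      ultimately show ?thesis using n by (simp del: of_nat_Suc fact_Suc power_Suc of_nat_mult add: of_nat_eq_0_iff)
    qed
    finally show ?case .
  qed
  show "E (\<lambda>h. dirpow (Suc (2 * \<nu>)) (f i) h p) = 0"
    using f
  proof (induction \<nu> arbitrary: f)
    case 0
    then show ?case using step(2) by simp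
  next
    case (Suc \<nu>)
    show ?case using step(1)[OF Suc.prems, of "Suc (2 * \<nu>)"] Suc.IH[OF usmooth_Qop[OF Suc.prems op]] by simp
  qed
qed

subsection \<open>Stationary phase\<close>

text \<open>Gaussian means are Lebesgue integrals centred at 0, whereas the propagator is a gauge
  integral centred at the critical point; this passes from one to the other.\<close>

lemma has_integral_translate:
  fixes g :: "'a::euclidean_space \<Rightarrow> 'b::euclidean_space"
  assumes g: "integrable lborel g"
  shows "((\<lambda>\<eta>. g (\<eta> - e)) has_integral (\<integral>h. g h \<partial>lborel)) UNIV"
proof -
  have m: "g \<in> borel_measurable borel" using borel_measurable_integrable[OF g] by simp
  have "integrable (distr lborel borel ((+) (- e))) g" using g by (simp add: lborel_distr_plus)
  then have i: "integrable lborel (\<lambda>\<eta>. g (- e + \<eta>))"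
    using m by (subst (asm) integrable_distr_eq) auto
  have "(\<integral>h. g h \<partial>lborel) = (\<integral>h. g h \<partial>(distr lborel borel ((+) (- e))))" by (simp add: lborel_distr_plus)
  also have "\<dots> = (\<integral>\<eta>. g (- e + \<eta>) \<partial>lborel)" using m by (subst integral_distr) auto
  finally show ?thesis using has_integral_integral_lborel[OF i] by simp
qed

lemma gaussian_moment_has_integral:
  assumes c: "c > 0"
  obtains M where "((\<lambda>\<eta>::real\<times>real. ((norm (\<eta> - e))^2)^k * exp (- c * (norm (\<eta> - e))^2)) has_integral M) UNIV"
    "M \<le> fact k * (2 / c)^k * (2 * pi / c)"
  using has_integral_translate[OF gaussian_moment_bound(1)[OF c, of k], of e] gaussian_moment_bound(2)[OF c, of k] by blast

lemma sum_even_odd_pairs: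
  fixes g :: "nat \<Rightarrow> 'a::comm_monoid_add"
  shows "(\<Sum>k<2*n. g k) = (\<Sum>\<nu><n. g (2*\<nu>) + g (Suc (2*\<nu>)))"
  by (induction n) (simp_all add: ac_simps)

text \<open>A second-order operator lowers the order of vanishing by at most two.\<close>

lemma vanishes_Qop:
  assumes f: "usmooth {i} S f" and op: "open (S i)" and p: "p \<in> S i" and v: "vanishes (Suc (Suc n)) (f i) p"
  shows "vanishes n (Qop N (f i)) p"
proof -
  have op': "open (S j)" if "j \<in> {i}" for j using op that by simp
  have f2: "usmooth {i} S (\<lambda>j. pd w (pd v (f j)))" if "v \<in> Basis" "w \<in> Basis" for v w
    by (rule usmooth_pd[OF usmooth_pd[OF f that(1)] that(2)])
  have cv: "vanishes n (\<lambda>q. c * u i q + d * w i q) p \<and> usmooth {i} S (\<lambda>j q. c * u j q + d * w j q)"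
    if u: "usmooth {i} S u" "usmooth {i} S w" and vn: "vanishes n (u i) p" "vanishes n (w i) p"
    for c d and u w :: "'a \<Rightarrow> real \<times> real \<Rightarrow> complex"
  proof -
    have 1: "usmooth {i} S (\<lambda>j q. c * u j q)" if "usmooth {i} S u"
      for c and u :: "'a \<Rightarrow> real \<times> real \<Rightarrow> complex"
      by (rule usmooth_mult[of "{i}" S "\<lambda>_ _. c" u]) (use op' usmooth_const[of i S c] that in auto)
    have 2: "vanishes (0 + n) (\<lambda>q. c * u i q) p" if "usmooth {i} S u" "vanishes n (u i) p" for c and u :: "'a \<Rightarrow> real \<times> real \<Rightarrow> complex"
      by (rule vanishes_mult[of "{i}" S "\<lambda>_ _. c" u i p 0 n]) (use op' usmooth_const[of i S c] that p in auto)
    show ?thesis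
      using vanishes_add[of "{i}" S "\<lambda>j q. c * u j q" "\<lambda>j q. d * w j q" i p n]
        usmooth_add[of "{i}" S "\<lambda>j q. c * u j q" "\<lambda>j q. d * w j q"] 1[OF u(1)] 1[OF u(2)]
        2[OF u(1) vn(1), of c] 2[OF u(2) vn(2), of d] op' p by simp
  qed
  have v2: "vanishes n (pd w (pd v (f i))) p" if "v \<in> Basis" "w \<in> Basis" for v w
    using v that by simp
  note B = Basis_R2
  have s1: "vanishes n (\<lambda>q. (- N 1 0) * pd (0,1) (pd (1,0) (f i)) q + (- N 1 1) * pd (0,1) (pd (0,1) (f i)) q) p \<and>
     usmooth {i} S (\<lambda>j q. (- N 1 0) * pd (0,1) (pd (1,0) (f j)) q + (- N 1 1) * pd (0,1) (pd (0,1) (f j)) q)"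
    by (rule cv) (intro f2 v2 B)+
  have s2: "vanishes n (\<lambda>q. (- N 0 0) * pd (1,0) (pd (1,0) (f i)) q + (- N 0 1) * pd (1,0) (pd (0,1) (f i)) q) p \<and>
     usmooth {i} S (\<lambda>j q. (- N 0 0) * pd (1,0) (pd (1,0) (f j)) q + (- N 0 1) * pd (1,0) (pd (0,1) (f j)) q)"
    by (rule cv) (intro f2 v2 B)+
  have "vanishes n (\<lambda>q. 1 * ((- N 0 0) * pd (1,0) (pd (1,0) (f i)) q + (- N 0 1) * pd (1,0) (pd (0,1) (f i)) q)
      + 1 * ((- N 1 0) * pd (0,1) (pd (1,0) (f i)) q + (- N 1 1) * pd (0,1) (pd (0,1) (f i)) q)) p"
    using cv[of "\<lambda>j q. (- N 0 0) * pd (1,0) (pd (1,0) (f j)) q + (- N 0 1) * pd (1,0) (pd (0,1) (f j)) q"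
      "\<lambda>j q. (- N 1 0) * pd (0,1) (pd (1,0) (f j)) q + (- N 1 1) * pd (0,1) (pd (0,1) (f j)) q" 1 1] s1 s2 by blast
  then show ?thesis
    by (rule vanishes_cong[OF op p, rotated]) (simp add: Qop_expand[OF f op])
qed

lemma Qop_funpow_vanishes:
  assumes "usmooth {i} S f" and op: "open (S i)" and p: "p \<in> S i" and "vanishes m (f i) p" "2 * n < m"
  shows "(Qop N ^^ n) (f i) p = 0"
  using assms(1,4,5)
proof (induction n arbitrary: f m)
  case 0
  then show ?case by (cases m) auto
next
  case (Suc n)
  define m' where "m' = m - 2"
  have m: "m = Suc (Suc m')" using Suc.prems by (simp add: m'_def)
  have "(Qop N ^^ n) (Qop N (f i)) p = 0"
    by (rule Suc.IH[OF usmooth_Qop[OF Suc.prems(1) op] vanishes_Qop[OF Suc.prems(1) op p, of m']])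
      (use Suc.prems m in auto)
  then show ?case by (simp add: funpow_swap1)
qed

text \<open>A term with \<mu> remainder factors and \<nu> operator applications carries
  \<alpha>^(\<nu> - \<mu>), so j = \<nu> - \<mu> is its order. Third-order vanishing removes all
  terms with 2\<nu> < 3\<mu>, hence those of negative order and, at order j, those with \<mu> > 2j.
  The truncation leaves exactly the orders j \<le> J.\<close>

lemma stationary_reindex:
  fixes t :: "nat \<Rightarrow> nat \<Rightarrow> complex"
  assumes z: "\<And>\<mu> \<nu>. 2 * \<nu> < 3 * \<mu> \<Longrightarrow> t \<mu> \<nu> = 0"
  shows "(\<Sum>\<mu><2*J+2. \<Sum>\<nu><J+1+\<mu>. t \<mu> \<nu>) = (\<Sum>j\<le>J. \<Sum>\<mu>\<le>2*j. t \<mu> (j + \<mu>))"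
proof -
  have "(\<Sum>\<nu><J+1+\<mu>. t \<mu> \<nu>) = (\<Sum>j\<le>J. t \<mu> (j + \<mu>))" for \<mu>
  proof -
    have "(\<Sum>\<nu><J+1+\<mu>. t \<mu> \<nu>) = (\<Sum>\<nu>\<in>{\<mu>..<J+1+\<mu>}. t \<mu> \<nu>)"
    proof (rule sum.mono_neutral_right)
      have "t \<mu> \<nu> = 0" if "\<nu> < \<mu>" for \<nu> using that by (intro z) simp
      then show "\<forall>\<nu>\<in>{..<J+1+\<mu>} - {\<mu>..<J+1+\<mu>}. t \<mu> \<nu> = 0" by auto
    qed auto
    also have "\<dots> = (\<Sum>j\<in>{0..<J+1}. t \<mu> (j + \<mu>))"
      using sum.shift_bounds_nat_ivl[of "t \<mu>" 0 \<mu> "J+1"] by (simp add: add.commute)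
    also have "{0..<J+1} = {..J}" by auto
    finally show ?thesis .
  qed
  then have "(\<Sum>\<mu><2*J+2. \<Sum>\<nu><J+1+\<mu>. t \<mu> \<nu>) = (\<Sum>j\<le>J. \<Sum>\<mu><2*J+2. t \<mu> (j + \<mu>))"
    by (simp only: sum.swap[of _ "{..J}" "{..<2*J+2}"])
  also have "\<dots> = (\<Sum>j\<le>J. \<Sum>\<mu>\<le>2*j. t \<mu> (j + \<mu>))"
  proof (rule sum.cong[OF refl])
    fix j assume j: "j \<in> {..J}"
    show "(\<Sum>\<mu><2*J+2. t \<mu> (j + \<mu>)) = (\<Sum>\<mu>\<le>2*j. t \<mu> (j + \<mu>))"
    proof (rule sum.mono_neutral_right)
      show "\<forall>\<mu>\<in>{..<2*J+2} - {..2*j}. t \<mu> (j + \<mu>) = 0" by (auto intro: z)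
    qed (use j in auto)
  qed
  finally show ?thesis .
qed

text \<open>The phases i^\<mu> from the exponential series and (-i)^\<nu> from Wick's rule combine
  to one that depends on the order j only.\<close>

lemma inverse_i_power: "\<i>^\<mu> * (- \<i>)^(j + \<mu>) = inverse (\<i>^j)"
proof -
  have "\<i>^\<mu> * (- \<i>)^\<mu> = 1" by (simp add: power_mult_distrib[symmetric])
  moreover have "(- \<i>)^j = inverse (\<i>^j)" by (simp add: power_inverse[symmetric])
  ultimately show ?thesis by (simp add: power_add mult.left_commute)
qed

lemma vanishes_bound:
  fixes f :: "'i \<Rightarrow> 'a::euclidean_space \<Rightarrow> 'b::banach"
  assumes "usmooth K S f" "\<And>i. i \<in> K \<Longrightarrow> S i = ball (e i) \<delta>" "\<delta> > 0" "\<And>i. i \<in> K \<Longrightarrow> vanishes n (f i) (e i)"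
  shows "\<exists>C\<ge>0. \<forall>i\<in>K. \<forall>h. norm h < \<delta> \<longrightarrow> norm (f i (e i + h)) \<le> C * norm h ^ n"
proof -
  obtain C where C: "C \<ge> 0" "\<And>i h. i \<in> K \<Longrightarrow> norm h < \<delta> \<Longrightarrow>
     norm (f i (e i + h) - (\<Sum>k<n. (1 / fact k) *\<^sub>R dirpow k (f i) h (e i))) \<le> C * norm h ^ n"
    using usmooth_taylor[of K S f e \<delta> n, OF assms(1,2,3)] by auto
  have "(\<Sum>k<n. (1 / fact k) *\<^sub>R dirpow k (f i) h (e i)) = 0" if "i \<in> K" for i h
  proof (intro sum.neutral ballI)
    fix k assume "k \<in> {..<n}"
    then have "vanishes (Suc k) (f i) (e i)" by (intro vanishes_mono[OF assms(4)[OF that]]) auto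
    then show "(1 / fact k) *\<^sub>R dirpow k (f i) h (e i) = 0" by (simp only: dirpow_vanishes scaleR_zero_right)
  qed
  note z = this
  have "norm (f i (e i + h)) \<le> C * norm h ^ n" if "i \<in> K" "norm h < \<delta>" for i h
    using C(2)[OF that] z[OF that(1), of h] by simp
  then show ?thesis using C(1) by blast
qed

text \<open>At distance at least \<delta> low powers are dominated by high ones, so estimates in the
  far region can be given the same shape as those near the centre.\<close>

lemma power_le_far:
  fixes r :: real assumes "\<delta> > 0" "r \<ge> \<delta>" "k \<le> n"
  shows "r ^ k \<le> (1 / \<delta>)^(n - k) * r ^ n"
proof -
  have "1 \<le> (r / \<delta>)^(n - k)" using assms by (intro one_le_power) simp
  then have "r ^ k * 1 \<le> r ^ k * (r / \<delta>)^(n - k)" using assms by (intro mult_left_mono) auto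
  also have "\<dots> = (1 / \<delta>)^(n - k) * r ^ n"
    using assms by (simp add: power_divide field_simps flip: power_add)
  finally show ?thesis by simp
qed

text \<open>\<open>K\<close> indexes the phases and \<open>e i\<close> is the critical point. The Hessian there is
  \<open>i [[\<kappa> + i a, i b], [i b, \<kappa> - i a]]\<close> with inverse \<open>NN i\<close>, \<open>R i\<close> is the remainder beyond second order,
  and \<open>Nul i\<close> is a null set off which the phase is continuous.\<close>
locale phase_family =
  fixes K :: "'i set" and e :: "'i \<Rightarrow> real \<times> real" and \<delta> c0 :: real
    and \<kappa> :: "'i \<Rightarrow> complex" and a b :: "'i \<Rightarrow> real"
    and R :: "'i \<Rightarrow> real \<times> real \<Rightarrow> real" and Nul :: "'i \<Rightarrow> (real \<times> real) set"
    and NN :: "'i \<Rightarrow> nat \<Rightarrow> nat \<Rightarrow> complex"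
  assumes \<delta>: "\<delta> > 0" and c0: "c0 > 0" and \<kappa>: "\<And>i. i \<in> K \<Longrightarrow> Re (\<kappa> i) \<ge> c0"
    and R_smooth: "usmooth K (\<lambda>i. ball (e i) \<delta>) (\<lambda>i \<eta>. complex_of_real (R i \<eta>))"
    and R_vanishes: "\<And>i. i \<in> K \<Longrightarrow> vanishes 3 (\<lambda>\<eta>. complex_of_real (R i \<eta>)) (e i)"
    and R_cont: "\<And>i. i \<in> K \<Longrightarrow> continuous_on (- Nul i) (R i)"
    and Nul: "\<And>i. i \<in> K \<Longrightarrow> negligible (Nul i)"
    and NN: "\<And>i. i \<in> K \<Longrightarrow> NN i 0 0 = - \<i> * (\<kappa> i - \<i> * a i) / ((\<kappa> i)^2 + of_real ((a i)^2 + (b i)^2))"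
      "\<And>i. i \<in> K \<Longrightarrow> NN i 0 1 = - complex_of_real (b i) / ((\<kappa> i)^2 + of_real ((a i)^2 + (b i)^2))"
      "\<And>i. i \<in> K \<Longrightarrow> NN i 1 0 = - complex_of_real (b i) / ((\<kappa> i)^2 + of_real ((a i)^2 + (b i)^2))"
      "\<And>i. i \<in> K \<Longrightarrow> NN i 1 1 = - \<i> * (\<kappa> i + \<i> * a i) / ((\<kappa> i)^2 + of_real ((a i)^2 + (b i)^2))"
begin

definition ga :: "real \<Rightarrow> 'i \<Rightarrow> real \<times> real \<Rightarrow> complex" where
  "ga \<alpha> i h = gauss (\<kappa> i / of_real \<alpha>) (a i / \<alpha>) (b i / \<alpha>) h"

definition osc :: "('i \<Rightarrow> real \<times> real \<Rightarrow> complex) \<Rightarrow> real \<Rightarrow> 'i \<Rightarrow> real \<times> real \<Rightarrow> complex" where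
  "osc f \<alpha> i \<eta> = ga \<alpha> i (\<eta> - e i) * (iexp (R i \<eta> / \<alpha>) * f i \<eta>)"

text \<open>Smoothness is asked only near the critical point, where the expansion lives. Continuity
  off the null set supplies measurability, and polynomial growth in the far region lets the Gaussian
  win.\<close>

definition amplitude :: "('i \<Rightarrow> real \<times> real \<Rightarrow> complex) \<Rightarrow> bool" where
  "amplitude f \<longleftrightarrow> usmooth K (\<lambda>i. ball (e i) \<delta>) f \<and> (\<forall>i\<in>K. continuous_on (- Nul i) (f i))
    \<and> (\<exists>C n. \<forall>i\<in>K. \<forall>\<eta>. \<eta> \<notin> Nul i \<longrightarrow> \<delta> \<le> norm (\<eta> - e i) \<longrightarrow> norm (f i \<eta>) \<le> C * ((norm (\<eta> - e i))^2)^n)"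

lemma norm_ga_le:
  assumes "i \<in> K" "\<alpha> > 0"
  shows "norm (ga \<alpha> i h) \<le> exp (- (c0 / (2 * \<alpha>)) * (norm h)^2)"
proof -
  have "(c0 / (2 * \<alpha>)) * (norm h)^2 \<le> (Re (\<kappa> i) / (2 * \<alpha>)) * (norm h)^2"
    using \<kappa>[OF assms(1)] assms(2) by (intro mult_right_mono divide_right_mono) auto
  then show ?thesis unfolding ga_def norm_gauss by simp
qed

text \<open>The moment of order 2n is of size \<alpha>^(n+1). After division by \<alpha>^\<mu> at
  least \<alpha>^(J+2) is left, because n \<ge> J + 1 + \<mu> and \<alpha> < 1.\<close>

lemma gaussian_weighted_integral:
  assumes i: "i \<in> K" and \<alpha>: "0 < \<alpha>" "\<alpha> < 1" and n: "J + 1 + \<mu> \<le> n"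
  obtains M where "((\<lambda>\<eta>. exp (- (c0 / (2 * \<alpha>)) * (norm (\<eta> - e i))^2) * (inverse (\<alpha>^\<mu>) * ((norm (\<eta> - e i))^2)^n)) has_integral M) UNIV"
    "M \<le> fact n * (4 / c0)^n * (4 * pi / c0) * \<alpha>^(J + 2)"
proof -
  have c: "c0 / (2 * \<alpha>) > 0" using c0 \<alpha> by simp
  obtain M where M: "((\<lambda>\<eta>. ((norm (\<eta> - e i))^2)^n * exp (- (c0 / (2 * \<alpha>)) * (norm (\<eta> - e i))^2)) has_integral M) UNIV"
    "M \<le> fact n * (2 / (c0 / (2 * \<alpha>)))^n * (2 * pi / (c0 / (2 * \<alpha>)))"
    by (rule gaussian_moment_has_integral[OF c])
  have "((\<lambda>\<eta>. exp (- (c0 / (2 * \<alpha>)) * (norm (\<eta> - e i))^2) * (inverse (\<alpha>^\<mu>) * ((norm (\<eta> - e i))^2)^n)) has_integral inverse (\<alpha>^\<mu>) * M) UNIV"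
    using has_integral_mult_right[OF M(1), of "inverse (\<alpha>^\<mu>)"] by (simp only: mult_ac)
  moreover have "inverse (\<alpha>^\<mu>) * M \<le> fact n * (4 / c0)^n * (4 * pi / c0) * \<alpha>^(J + 2)"
  proof -
    have "inverse (\<alpha>^\<mu>) * M \<le> inverse (\<alpha>^\<mu>) * (fact n * (2 / (c0 / (2 * \<alpha>)))^n * (2 * pi / (c0 / (2 * \<alpha>))))"
      using M(2) \<alpha> by (intro mult_left_mono) auto
    also have "\<dots> = fact n * (4 / c0)^n * (4 * pi / c0) * (inverse (\<alpha>^\<mu>) * \<alpha>^(n + 1))"
      using c0 \<alpha> by (simp add: field_simps power_mult_distrib power_divide)
    also have "inverse (\<alpha>^\<mu>) * \<alpha>^(n + 1) = \<alpha>^(n + 1 - \<mu>)"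
      using n \<alpha> by (simp add: power_diff divide_inverse mult.commute)
    also have "fact n * (4 / c0)^n * (4 * pi / c0) * \<alpha>^(n + 1 - \<mu>) \<le> fact n * (4 / c0)^n * (4 * pi / c0) * \<alpha>^(J + 2)"
      using n \<alpha> c0 by (intro mult_left_mono power_decreasing) auto
    finally show ?thesis .
  qed
  ultimately show ?thesis using that by blast
qed

section \<open>Integrability and size of the oscillatory integrals\<close>

lemma osc_measurable:
  assumes "amplitude f" "i \<in> K"
  shows "osc f \<alpha> i \<in> borel_measurable (lebesgue_on (- Nul i))"
proof (rule continuous_imp_measurable_on_sets_lebesgue)
  show "- Nul i \<in> sets lebesgue"
    using negligible_imp_sets[OF Nul[OF assms(2)]] by (metis Compl_in_sets_lebesgue)
  have "continuous_on (- Nul i) (\<lambda>\<eta>. ga \<alpha> i (\<eta> - e i))"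
    unfolding ga_def by (rule continuous_on_compose2[OF continuous_on_gauss[of UNIV]]) (auto intro!: continuous_intros)
  moreover have "continuous_on (- Nul i) (\<lambda>\<eta>. iexp (R i \<eta> / \<alpha>))"
  proof -
    have c: "continuous_on (- Nul i) (\<lambda>x. R i x / \<alpha>)"
      using continuous_on_scaleR[OF continuous_on_const[of _ "1 / \<alpha>"] R_cont[OF assms(2)]] by simp
    show ?thesis by (rule continuous_on_exp[OF continuous_on_mult[OF continuous_on_const continuous_on_of_real[OF c]]])
  qed
  ultimately show "continuous_on (- Nul i) (osc f \<alpha> i)"
    unfolding osc_def[abs_def] using assms unfolding amplitude_def by (intro continuous_on_mult) blast+
qed

text \<open>Domination gives absolute integrability on the complement of the null set; that set is
  then restored without any information about the values on it.\<close>

lemma integrable_off_negligible: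
  fixes F :: "real \<times> real \<Rightarrow> complex"
  assumes i: "i \<in> K" and F: "F \<in> borel_measurable (lebesgue_on (- Nul i))"
    and g: "(g has_integral M) UNIV" and le: "\<And>\<eta>. \<eta> \<notin> Nul i \<Longrightarrow> norm (F \<eta>) \<le> g \<eta>"
  shows "F integrable_on UNIV"
proof -
  have S: "- Nul i \<in> sets lebesgue" using negligible_imp_sets[OF Nul[OF i]] by (metis Compl_in_sets_lebesgue)
  have n: "negligible (UNIV - - Nul i \<union> (- Nul i - UNIV))" using Nul[OF i] by (simp add: Compl_eq_Diff_UNIV Diff_Diff_Int)
  have "(g has_integral M) (- Nul i)"
    by (rule has_integral_spike_set_eq[THEN iffD1, OF _ _ g]) (auto intro: negligible_subset[OF Nul[OF i]])
  then have "g integrable_on (- Nul i)" by blast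
  then have "F absolutely_integrable_on (- Nul i)"
    by (intro measurable_bounded_by_integrable_imp_absolutely_integrable[OF F S]) (use le in auto)
  then have "F integrable_on (- Nul i)" by (rule absolutely_integrable_on_def[THEN iffD1, THEN conjunct1])
  then show ?thesis
    by (rule integrable_spike_set) (auto intro: negligible_subset[OF Nul[OF i]])
qed

lemma integral_norm_off_negligible:
  fixes F :: "real \<times> real \<Rightarrow> complex"
  assumes i: "i \<in> K" and F: "F integrable_on UNIV"
    and g: "(g has_integral M) UNIV" and g0: "\<And>\<eta>. g \<eta> \<ge> 0" and le: "\<And>\<eta>. \<eta> \<notin> Nul i \<Longrightarrow> norm (F \<eta>) \<le> g \<eta>"
  shows "norm (integral UNIV F) \<le> M"
proof -
  \<comment> \<open>Setting the function to zero on the null set makes the pointwise bound hold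
    everywhere without changing the integral.\<close>
  define F' where "F' \<eta> = (if \<eta> \<in> Nul i then 0 else F \<eta>)" for \<eta>
  have "integral UNIV F = integral UNIV F'"
    by (rule integral_spike[OF Nul[OF i]]) (simp add: F'_def)
  moreover have "F' integrable_on UNIV"
    by (rule integrable_spike[OF F Nul[OF i]]) (simp add: F'_def)
  ultimately show ?thesis
    using integral_norm_bound_integral[of F' UNIV g] g g0 le by (auto simp: F'_def has_integral_iff)
qed

lemma amplitude_bounded:
  assumes "amplitude f"
  obtains A C n where "A \<ge> 0" "C \<ge> 0"
    "\<And>i \<eta>. i \<in> K \<Longrightarrow> norm (\<eta> - e i) < \<delta> \<Longrightarrow> norm (f i \<eta>) \<le> A"
    "\<And>i \<eta>. i \<in> K \<Longrightarrow> \<eta> \<notin> Nul i \<Longrightarrow> \<delta> \<le> norm (\<eta> - e i) \<Longrightarrow> norm (f i \<eta>) \<le> C * ((norm (\<eta> - e i))^2)^n"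
proof -
  obtain C n where C: "\<And>i \<eta>. i \<in> K \<Longrightarrow> \<eta> \<notin> Nul i \<Longrightarrow> \<delta> \<le> norm (\<eta> - e i) \<Longrightarrow> norm (f i \<eta>) \<le> C * ((norm (\<eta> - e i))^2)^n"
    using assms unfolding amplitude_def by metis
  obtain A where A: "\<And>i \<eta>. i \<in> K \<Longrightarrow> \<eta> \<in> ball (e i) \<delta> \<Longrightarrow> norm (f i \<eta>) \<le> A"
    using assms unif_smooth_bounded[of 0 K "\<lambda>i. ball (e i) \<delta>" f] unfolding amplitude_def usmooth_def by blast
  show ?thesis
  proof (rule that[of "\<bar>A\<bar>" "\<bar>C\<bar>" n])
    show "norm (f i \<eta>) \<le> \<bar>A\<bar>" if "i \<in> K" "norm (\<eta> - e i) < \<delta>" for i \<eta>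
      using A[of i \<eta>] that by (simp add: dist_norm norm_minus_commute)
    show "norm (f i \<eta>) \<le> \<bar>C\<bar> * ((norm (\<eta> - e i))^2)^n" if "i \<in> K" "\<eta> \<notin> Nul i" "\<delta> \<le> norm (\<eta> - e i)" for i \<eta>
      using C[OF that] by (rule order_trans) (intro mult_right_mono, auto)
  qed auto
qed

lemma norm_osc_le:
  assumes "i \<in> K" "\<alpha> > 0" "norm (f i \<eta>) \<le> B"
  shows "norm (osc f \<alpha> i \<eta>) \<le> exp (- (c0 / (2 * \<alpha>)) * (norm (\<eta> - e i))^2) * B"
proof -
  have "norm (osc f \<alpha> i \<eta>) = norm (ga \<alpha> i (\<eta> - e i)) * norm (f i \<eta>)"
    by (simp add: osc_def norm_mult)
  also have "\<dots> \<le> exp (- (c0 / (2 * \<alpha>)) * (norm (\<eta> - e i))^2) * B"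
    by (intro mult_mono norm_ga_le assms) auto
  finally show ?thesis .
qed

text \<open>A planar Gaussian of width sqrt \<alpha> has mass of order \<alpha>, and polynomial
  factors only add powers of \<alpha>. Besides integrability this controls the amplitudes of
  positive order in the leading-term estimate.\<close>

lemma osc_integral_bound:
  assumes f: "amplitude f"
  shows "\<exists>C. \<forall>i\<in>K. \<forall>\<alpha>. 0 < \<alpha> \<longrightarrow> \<alpha> < 1 \<longrightarrow> osc f \<alpha> i integrable_on UNIV \<and> norm (integral UNIV (osc f \<alpha> i)) \<le> C * \<alpha>"
proof -
  obtain A C n where A: "A \<ge> 0" "C \<ge> 0"
    "\<And>i \<eta>. i \<in> K \<Longrightarrow> norm (\<eta> - e i) < \<delta> \<Longrightarrow> norm (f i \<eta>) \<le> A"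
    "\<And>i \<eta>. i \<in> K \<Longrightarrow> \<eta> \<notin> Nul i \<Longrightarrow> \<delta> \<le> norm (\<eta> - e i) \<Longrightarrow> norm (f i \<eta>) \<le> C * ((norm (\<eta> - e i))^2)^n"
    using amplitude_bounded[OF f] by blast
  define m where "m k = fact k * (4 / c0)^k * (4 * pi / c0)" for k :: nat
  have m0: "m k \<ge> 0" for k using c0 by (simp add: m_def)
  show ?thesis
  proof (intro exI[of _ "A * m 0 + C * m n"] ballI allI impI)
    fix i \<alpha> assume i: "i \<in> K" and \<alpha>: "0 < \<alpha>" "\<alpha> < (1::real)"
    have c: "c0 / (2 * \<alpha>) > 0" using c0 \<alpha> by simp
    have mom: "\<exists>M. ((\<lambda>\<eta>. ((norm (\<eta> - e i))^2)^k * exp (- (c0 / (2 * \<alpha>)) * (norm (\<eta> - e i))^2)) has_integral M) UNIV \<and> M \<le> m k * \<alpha>" for k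
    proof -
      obtain M where M: "((\<lambda>\<eta>. ((norm (\<eta> - e i))^2)^k * exp (- (c0 / (2 * \<alpha>)) * (norm (\<eta> - e i))^2)) has_integral M) UNIV"
        "M \<le> fact k * (2 / (c0 / (2 * \<alpha>)))^k * (2 * pi / (c0 / (2 * \<alpha>)))"
        by (rule gaussian_moment_has_integral[OF c])
      have "fact k * (2 / (c0 / (2 * \<alpha>)))^k * (2 * pi / (c0 / (2 * \<alpha>))) = m k * (\<alpha>^k * \<alpha>)"
        using c0 \<alpha> by (simp add: m_def field_simps power_mult_distrib power_divide)
      also have "\<dots> \<le> m k * (1 * \<alpha>)"
        using \<alpha> m0[of k] by (intro mult_left_mono mult_right_mono power_le_one) auto
      finally show ?thesis using M by auto
    qed
    obtain M0 M1 where M: "((\<lambda>\<eta>. ((norm (\<eta> - e i))^2)^0 * exp (- (c0 / (2 * \<alpha>)) * (norm (\<eta> - e i))^2)) has_integral M0) UNIV" "M0 \<le> m 0 * \<alpha>"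
      "((\<lambda>\<eta>. ((norm (\<eta> - e i))^2)^n * exp (- (c0 / (2 * \<alpha>)) * (norm (\<eta> - e i))^2)) has_integral M1) UNIV" "M1 \<le> m n * \<alpha>"
      using mom[of 0] mom[of n] by blast
    define g where "g \<eta> = A * (((norm (\<eta> - e i))^2)^0 * exp (- (c0 / (2 * \<alpha>)) * (norm (\<eta> - e i))^2))
        + C * (((norm (\<eta> - e i))^2)^n * exp (- (c0 / (2 * \<alpha>)) * (norm (\<eta> - e i))^2))" for \<eta>
    have g: "(g has_integral A * M0 + C * M1) UNIV"
      unfolding g_def[abs_def] by (intro has_integral_add has_integral_mult_right M)
    have g0: "g \<eta> \<ge> 0" for \<eta> using A by (simp add: g_def)
    have le: "norm (osc f \<alpha> i \<eta>) \<le> g \<eta>" if "\<eta> \<notin> Nul i" for \<eta>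
    proof -
      have "norm (f i \<eta>) \<le> A + C * ((norm (\<eta> - e i))^2)^n"
        using A(3)[OF i, of \<eta>] A(4)[OF i that] A(1,2) by (cases "norm (\<eta> - e i) < \<delta>") (auto intro: add_increasing add_increasing2)
      from norm_osc_le[where f = f, OF i \<alpha>(1) this] show ?thesis by (simp add: g_def algebra_simps)
    qed
    have int: "osc f \<alpha> i integrable_on UNIV"
      by (rule integrable_off_negligible[OF i osc_measurable[OF f i] g le])
    have "norm (integral UNIV (osc f \<alpha> i)) \<le> A * M0 + C * M1"
      by (rule integral_norm_off_negligible[OF i int g g0 le])
    also have "\<dots> \<le> A * (m 0 * \<alpha>) + C * (m n * \<alpha>)" using M A by (intro add_mono mult_left_mono) auto
    finally show "osc f \<alpha> i integrable_on UNIV \<and> norm (integral UNIV (osc f \<alpha> i)) \<le> (A * m 0 + C * m n) * \<alpha>"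
      using int by (simp add: algebra_simps)
  qed
qed


section \<open>Taylor polynomial of the integrand and its Gaussian mean\<close>

definition stat_coeff :: "'i \<Rightarrow> ('i \<Rightarrow> real \<times> real \<Rightarrow> complex) \<Rightarrow> nat \<Rightarrow> complex" where
  "stat_coeff i f j = (\<Sum>\<mu>\<le>2*j. inverse (\<i>^j) * complex_of_real ((1/2)^(j + \<mu>) / (fact (j + \<mu>) * fact \<mu>))
     * ((Qop (NN i) ^^ (j + \<mu>)) (\<lambda>\<eta>. (complex_of_real (R i \<eta>))^\<mu> * f i \<eta>)) (e i))"

text \<open>The two truncations are matched: with m = 2J + 2 the first omitted exponential term is
  of size |h|^(3m) / \<alpha>^m = |h|^(2(J+1+m)) / \<alpha>^m, and stopping the \<mu>-th Taylor
  polynomial below degree 2(J+1+\<mu>) gives an error of the same form. On the scale |h|^2 ~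
  \<alpha> each of them is \<alpha>^(J+1).\<close>

definition taylor_part :: "('i \<Rightarrow> real \<times> real \<Rightarrow> complex) \<Rightarrow> nat \<Rightarrow> real \<Rightarrow> 'i \<Rightarrow> real \<times> real \<Rightarrow> complex" where
  "taylor_part f J \<alpha> i h = (\<Sum>\<mu><2*J+2. (\<i> / of_real \<alpha>)^\<mu> / fact \<mu> *
     (\<Sum>k<2*(J+1+\<mu>). of_real (1 / fact k) * dirpow k (\<lambda>\<eta>. (complex_of_real (R i \<eta>))^\<mu> * f i \<eta>) h (e i)))"

lemma amplitude_mult_smooth:
  assumes "amplitude f"
  shows "usmooth K (\<lambda>i. ball (e i) \<delta>) (\<lambda>i \<eta>. (complex_of_real (R i \<eta>))^\<mu> * f i \<eta>)"
  using assms R_smooth unfolding amplitude_def by (intro usmooth_mult usmooth_power) auto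

lemma gmean_sum:
  assumes k: "Re k > 0" and "finite A" "\<And>x. x \<in> A \<Longrightarrow> poly_growth (F x)"
  shows "gmean k a' b' (\<lambda>h. \<Sum>x\<in>A. c x * F x h) = (\<Sum>x\<in>A. c x * gmean k a' b' (F x)) \<and> poly_growth (\<lambda>h. \<Sum>x\<in>A. c x * F x h)"
  using assms(2,3)
proof (induction A)
  case empty
  show ?case by (simp add: gmean_def poly_growth_const)
next
  case (insert x A)
  have 1: "poly_growth (\<lambda>h. c x * F x h)" using insert by (intro poly_growth_mult poly_growth_const) auto
  have 2: "gmean k a' b' (\<lambda>h. \<Sum>x\<in>A. c x * F x h) = (\<Sum>x\<in>A. c x * gmean k a' b' (F x))" "poly_growth (\<lambda>h. \<Sum>x\<in>A. c x * F x h)"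
    using insert by auto
  show ?case using insert(1,2) gmean_add[OF k 1 2(2)] 2 gmean_cmult[OF k, of a' b' "c x" "F x"] poly_growth_add[OF 1 2(2)] by simp
qed

lemma taylor_part_integral:
  assumes f: "amplitude f" and i: "i \<in> K" and \<alpha>: "\<alpha> > 0"
  shows "gmean (\<kappa> i / of_real \<alpha>) (a i / \<alpha>) (b i / \<alpha>) (taylor_part f J \<alpha> i)
     = 2 * pi * \<alpha> / (\<kappa> i * csqrt (1 + of_real ((a i)^2 + (b i)^2) / (\<kappa> i)^2)) * (\<Sum>j\<le>J. of_real (\<alpha>^j) * stat_coeff i f j)" (is "_ = ?c * _")
    "poly_growth (taylor_part f J \<alpha> i)"
proof -
  let ?E = "gmean (\<kappa> i / of_real \<alpha>) (a i / \<alpha>) (b i / \<alpha>)"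
  let ?g = "\<lambda>\<mu> j \<eta>. (complex_of_real (R j \<eta>))^\<mu> * f j \<eta>"
  let ?S = "\<lambda>i. ball (e i) \<delta>"
  have kpos: "Re (\<kappa> i) > 0" using \<kappa>[OF i] c0 by simp
  then have k: "Re (\<kappa> i / of_real \<alpha>) > 0" using \<alpha> by simp
  have us: "usmooth {i} ?S (?g \<mu>)" for \<mu> by (rule usmooth_single[OF amplitude_mult_smooth[OF f] i])
  have p: "e i \<in> ?S i" using \<delta> by simp
  have op: "open (?S i)" by simp
  have pg: "poly_growth (\<lambda>h. dirpow k (?g \<mu> i) h (e i))" for k \<mu> by (rule poly_growth_dirpow[OF us op p])
  note gm = gmean_dirpow[where i = i and S = ?S, OF kpos \<alpha> us op p NN[OF i]]
  \<comment> \<open>The quotient under the root is invariant under scaling of the form, so \<alpha>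
    appears only as an overall factor.\<close>
  have one: "?E (\<lambda>_. 1) = ?c"
  proof -
    have sc: "of_real ((a i / \<alpha>)^2 + (b i / \<alpha>)^2) / (\<kappa> i / of_real \<alpha>)^2 = of_real ((a i)^2 + (b i)^2) / (\<kappa> i)^2"
      using \<alpha> by (simp add: power_divide flip: add_divide_distrib)
    show ?thesis unfolding gmean_one[OF k] sc using \<alpha> by simp
  qed
  define q where "q \<mu> \<nu> = (Qop (NN i) ^^ \<nu>) (?g \<mu> i) (e i)" for \<mu> \<nu>
  define t where "t \<mu> \<nu> = (\<i> / of_real \<alpha>)^\<mu> / fact \<mu> * (1 / (2^\<nu> * fact \<nu>) * (- \<i> * of_real \<alpha>)^\<nu> * q \<mu> \<nu>)" for \<mu> \<nu>
  have inner: "?E (\<lambda>h. \<Sum>k<2*n. of_real (1 / fact k) * dirpow k (?g \<mu> i) h (e i)) = (\<Sum>\<nu><n. 1 / (2^\<nu> * fact \<nu>) * (- \<i> * of_real \<alpha>)^\<nu> * q \<mu> \<nu>) * ?c"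
    (is "?l = _") "poly_growth (\<lambda>h. \<Sum>k<2*n. of_real (1 / fact k) * dirpow k (?g \<mu> i) h (e i))" for n \<mu>
  proof -
    note s = gmean_sum[OF k, of "{..<2*n}" "\<lambda>k h. dirpow k (?g \<mu> i) h (e i)" "a i / \<alpha>" "b i / \<alpha>" "\<lambda>k. of_real (1 / fact k)", OF _ pg]
    show "poly_growth (\<lambda>h. \<Sum>k<2*n. of_real (1 / fact k) * dirpow k (?g \<mu> i) h (e i))" using s by simp
    have "?l = (\<Sum>k<2*n. of_real (1 / fact k) * ?E (\<lambda>h. dirpow k (?g \<mu> i) h (e i)))" using s by simp
    \<comment> \<open>Odd moments vanish, and the factorial of 2\<nu> cancels against the one from
      Wick's rule.\<close>
    also have "\<dots> = (\<Sum>\<nu><n. of_real (1 / fact (2*\<nu>)) * ?E (\<lambda>h. dirpow (2*\<nu>) (?g \<mu> i) h (e i)) + of_real (1 / fact (Suc (2*\<nu>))) * ?E (\<lambda>h. dirpow (Suc (2*\<nu>)) (?g \<mu> i) h (e i)))"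
      by (rule sum_even_odd_pairs)
    also have "\<dots> = (\<Sum>\<nu><n. (1 / (2^\<nu> * fact \<nu>) * (- \<i> * of_real \<alpha>)^\<nu> * q \<mu> \<nu>) * ?c)"
      unfolding gm one q_def by (intro sum.cong refl) (simp del: fact_Suc add: field_simps)
    finally show "?l = (\<Sum>\<nu><n. 1 / (2^\<nu> * fact \<nu>) * (- \<i> * of_real \<alpha>)^\<nu> * q \<mu> \<nu>) * ?c" by (simp only: sum_distrib_right)
  qed
  have tp: "taylor_part f J \<alpha> i = (\<lambda>h. \<Sum>\<mu><2*J+2. (\<i> / of_real \<alpha>)^\<mu> / fact \<mu> * (\<Sum>k<2*(J+1+\<mu>). of_real (1 / fact k) * dirpow k (?g \<mu> i) h (e i)))"
    unfolding taylor_part_def[abs_def] ..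
  note s = gmean_sum[OF k, of "{..<2*J+2}" "\<lambda>\<mu> h. \<Sum>k<2*(J+1+\<mu>). of_real (1 / fact k) * dirpow k (?g \<mu> i) h (e i)"
     "a i / \<alpha>" "b i / \<alpha>" "\<lambda>\<mu>. (\<i> / of_real \<alpha>)^\<mu> / fact \<mu>", OF _ inner(2)]
  show "poly_growth (taylor_part f J \<alpha> i)" unfolding tp using s by simp
  have "?E (taylor_part f J \<alpha> i) = (\<Sum>\<mu><2*J+2. (\<i> / of_real \<alpha>)^\<mu> / fact \<mu> * ?E (\<lambda>h. \<Sum>k<2*(J+1+\<mu>). of_real (1 / fact k) * dirpow k (?g \<mu> i) h (e i)))"
    unfolding tp using s by simp
  also have "\<dots> = ?c * (\<Sum>\<mu><2*J+2. \<Sum>\<nu><J+1+\<mu>. t \<mu> \<nu>)"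
    unfolding inner(1) t_def sum_distrib_left sum_distrib_right by (simp only: mult_ac)
  \<comment> \<open>The \<mu>-th power of the remainder vanishes to order 3\<mu>, which \<nu>
    second-order operators cannot undo when 2\<nu> < 3\<mu>.\<close>
  also have "(\<Sum>\<mu><2*J+2. \<Sum>\<nu><J+1+\<mu>. t \<mu> \<nu>) = (\<Sum>j\<le>J. \<Sum>\<mu>\<le>2*j. t \<mu> (j + \<mu>))"
  proof (rule stationary_reindex)
    fix \<mu> \<nu> :: nat assume lt: "2 * \<nu> < 3 * \<mu>"
    have op': "open (ball (e j) \<delta>)" for j by simp
    have v: "vanishes (3 * \<mu>) (\<lambda>\<eta>. (complex_of_real (R i \<eta>))^\<mu>) (e i)"
      by (rule vanishes_power[of K ?S, OF op' R_smooth i p R_vanishes[OF i]])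
    have "vanishes (3 * \<mu> + 0) (?g \<mu> i) (e i)"
      by (rule vanishes_mult[of K ?S, OF op' usmooth_power[of K ?S, OF op' R_smooth] _ i p v])
        (use f in \<open>auto simp: amplitude_def\<close>)
    then have "q \<mu> \<nu> = 0" unfolding q_def
      by (intro Qop_funpow_vanishes[where m = "3 * \<mu>" and f = "?g \<mu>" and S = ?S, OF us op p]) (use lt in auto)
    then show "t \<mu> \<nu> = 0" by (simp add: t_def)
  qed
  also have "(\<Sum>j\<le>J. \<Sum>\<mu>\<le>2*j. t \<mu> (j + \<mu>)) = (\<Sum>j\<le>J. of_real (\<alpha>^j) * stat_coeff i f j)"
  proof (rule sum.cong[OF refl])
    fix j
    have "t \<mu> (j + \<mu>) = of_real (\<alpha>^j) * (inverse (\<i>^j) * complex_of_real ((1/2)^(j + \<mu>) / (fact (j + \<mu>) * fact \<mu>)) * q \<mu> (j + \<mu>))" for \<mu>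
    proof -
      have a: "(\<i> / of_real \<alpha>)^\<mu> * (- \<i> * of_real \<alpha>)^(j + \<mu>) = of_real (\<alpha>^j) * inverse (\<i>^j)"
      proof -
        have "(\<i> / of_real \<alpha>)^\<mu> * (- \<i> * of_real \<alpha>)^(j + \<mu>) = (\<i>^\<mu> * (- \<i>)^(j + \<mu>)) * (of_real \<alpha>^(j + \<mu>) / of_real \<alpha>^\<mu>)"
          by (simp only: power_divide power_mult_distrib times_divide_eq_left times_divide_eq_right mult_ac)
        also have "(of_real \<alpha>^(j + \<mu>) / of_real \<alpha>^\<mu> :: complex) = of_real (\<alpha>^j)" using \<alpha> by (simp add: power_add)
        finally show ?thesis unfolding inverse_i_power by (simp only: mult_ac)
      qed
      have "t \<mu> (j + \<mu>) = ((\<i> / of_real \<alpha>)^\<mu> * (- \<i> * of_real \<alpha>)^(j + \<mu>)) * (1 / (2^(j + \<mu>) * fact (j + \<mu>) * fact \<mu>) * q \<mu> (j + \<mu>))"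
        unfolding t_def by (simp only: times_divide_eq_left times_divide_eq_right mult_1 divide_divide_eq_left mult_ac)
      then show ?thesis unfolding a by (simp add: power_divide mult.assoc)
    qed
    then show "(\<Sum>\<mu>\<le>2*j. t \<mu> (j + \<mu>)) = of_real (\<alpha>^j) * stat_coeff i f j"
      unfolding stat_coeff_def q_def sum_distrib_left by simp
  qed
  finally show "?E (taylor_part f J \<alpha> i) = ?c * (\<Sum>j\<le>J. of_real (\<alpha>^j) * stat_coeff i f j)" .
qed

text \<open>Every contribution is brought to the form |h|^(2(J+1+\<mu>)) / \<alpha>^\<mu>, near the
  centre by Taylor's formula and far away by comparing powers of |h|, so that one Gaussian estimate
  covers all of them.\<close>

lemma taylor_part_error:
  assumes f: "amplitude f"
  obtains D D' n where "\<And>\<mu>. D \<mu> \<ge> 0" "D' \<ge> 0"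
    "\<And>i \<alpha> \<eta>. i \<in> K \<Longrightarrow> 0 < \<alpha> \<Longrightarrow> \<alpha> < 1 \<Longrightarrow> \<eta> \<notin> Nul i \<Longrightarrow>
       norm (iexp (R i \<eta> / \<alpha>) * f i \<eta> - taylor_part f J \<alpha> i (\<eta> - e i))
       \<le> (\<Sum>\<mu>\<le>2*J+2. D \<mu> * (inverse (\<alpha>^\<mu>) * ((norm (\<eta> - e i))^2)^(J+1+\<mu>))) + D' * (inverse (\<alpha>^0) * ((norm (\<eta> - e i))^2)^(J+1+n))"
proof -
  let ?g = "\<lambda>\<mu> j \<eta>. (complex_of_real (R j \<eta>))^\<mu> * f j \<eta>"
  let ?S = "\<lambda>i. ball (e i) \<delta>"
  define m where "m = 2*J+2"
  define T where "T \<mu> i h = (\<Sum>k<2*(J+1+\<mu>). of_real (1 / fact k) * dirpow k (?g \<mu> i) h (e i))" for \<mu> i h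
  have op: "open (?S i)" for i by simp
  obtain A C n where A: "A \<ge> 0" "C \<ge> 0"
    "\<And>i \<eta>. i \<in> K \<Longrightarrow> norm (\<eta> - e i) < \<delta> \<Longrightarrow> norm (f i \<eta>) \<le> A"
    "\<And>i \<eta>. i \<in> K \<Longrightarrow> \<eta> \<notin> Nul i \<Longrightarrow> \<delta> \<le> norm (\<eta> - e i) \<Longrightarrow> norm (f i \<eta>) \<le> C * ((norm (\<eta> - e i))^2)^n"
    using amplitude_bounded[OF f] by blast
  obtain CR where CR: "CR \<ge> 0" "\<And>i h. i \<in> K \<Longrightarrow> norm h < \<delta> \<Longrightarrow> \<bar>R i (e i + h)\<bar> \<le> CR * norm h ^ 3"
    using vanishes_bound[of K ?S "\<lambda>i \<eta>. complex_of_real (R i \<eta>)" e \<delta> 3, OF R_smooth refl \<delta> R_vanishes] by auto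
  have "\<exists>C\<ge>0. \<forall>i\<in>K. \<forall>h. norm h < \<delta> \<longrightarrow> norm (?g \<mu> i (e i + h) - T \<mu> i h) \<le> C * norm h ^ (2*(J+1+\<mu>))" for \<mu>
    using usmooth_taylor[of K ?S "?g \<mu>" e \<delta> "2*(J+1+\<mu>)", OF amplitude_mult_smooth[OF f] refl \<delta>]
    unfolding T_def by (simp add: scaleR_conv_of_real)
  then obtain CT where CT: "\<And>\<mu>. CT \<mu> \<ge> 0" "\<And>\<mu> i h. i \<in> K \<Longrightarrow> norm h < \<delta> \<Longrightarrow> norm (?g \<mu> i (e i + h) - T \<mu> i h) \<le> CT \<mu> * norm h ^ (2*(J+1+\<mu>))"
    by metis
  have dpex: "\<exists>C. C \<ge> 0 \<and> (\<forall>i\<in>K. \<forall>h. norm (dirpow k (?g \<mu> i) h (e i)) \<le> C * norm h ^ k)" for \<mu> k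
  proof -
    have "unif_smooth k K ?S (?g \<mu>)" using amplitude_mult_smooth[OF f] unfolding usmooth_def by blast
    from dirpow_bound[of K ?S, OF op this] obtain C where "C \<ge> 0" "\<And>i p h. i \<in> K \<Longrightarrow> p \<in> ?S i \<Longrightarrow> norm (dirpow k (?g \<mu> i) h p) \<le> C * norm h ^ k"
      by blast
    then show ?thesis using \<delta> by (intro exI[of _ C]) auto
  qed
  define dp where "dp \<mu> k = (SOME C. C \<ge> 0 \<and> (\<forall>i\<in>K. \<forall>h. norm (dirpow k (?g \<mu> i) h (e i)) \<le> C * norm h ^ k))" for \<mu> k
  have dp: "dp \<mu> k \<ge> 0" "i \<in> K \<Longrightarrow> norm (dirpow k (?g \<mu> i) h (e i)) \<le> dp \<mu> k * norm h ^ k" for \<mu> k i h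
    using someI_ex[OF dpex[of k \<mu>]] unfolding dp_def by blast+
  \<comment> \<open>\<open>DO\<close> bounds the Taylor polynomials in the far region, where each
    lower-degree term is raised to the common degree.\<close>
  define DO where "DO \<mu> = (\<Sum>k<2*(J+1+\<mu>). dp \<mu> k * (1 / \<delta>)^(2*(J+1+\<mu>) - k))" for \<mu>
  have DO0: "DO \<mu> \<ge> 0" for \<mu> unfolding DO_def using dp \<delta> by (intro sum_nonneg) auto
  have outT: "norm (T \<mu> i h) \<le> DO \<mu> * norm h ^ (2*(J+1+\<mu>))" if "i \<in> K" "\<delta> \<le> norm h" for \<mu> i h
  proof -
    have "norm (T \<mu> i h) \<le> (\<Sum>k<2*(J+1+\<mu>). dp \<mu> k * ((1 / \<delta>)^(2*(J+1+\<mu>) - k) * norm h ^ (2*(J+1+\<mu>))))"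
      unfolding T_def
    proof (rule sum_norm_le)
      fix k assume k: "k \<in> {..<2*(J+1+\<mu>)}"
      have "norm (of_real (1 / fact k) * dirpow k (?g \<mu> i) h (e i)) \<le> 1 * (dp \<mu> k * norm h ^ k)"
        unfolding norm_mult norm_of_real by (intro mult_mono dp that) (auto simp: divide_le_eq fact_ge_1)
      also have "\<dots> \<le> 1 * (dp \<mu> k * ((1 / \<delta>)^(2*(J+1+\<mu>) - k) * norm h ^ (2*(J+1+\<mu>))))"
        using k by (intro mult_left_mono power_le_far \<delta> that dp) auto
      finally show "norm (of_real (1 / fact k) * dirpow k (?g \<mu> i) h (e i)) \<le> dp \<mu> k * ((1 / \<delta>)^(2*(J+1+\<mu>) - k) * norm h ^ (2*(J+1+\<mu>)))" by simp
    qed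
    then show ?thesis unfolding DO_def sum_distrib_right by (simp only: mult.assoc)
  qed
  \<comment> \<open>The last index m accounts for the truncated exponential, the smaller ones for
    the Taylor errors near the centre and the polynomials far from it.\<close>
  define D where "D \<mu> = (if \<mu> = m then CR^m * A else CT \<mu> + DO \<mu>)" for \<mu>
  have D0: "D \<mu> \<ge> 0" for \<mu> using CR A CT DO0 by (simp add: D_def)
  define D' where "D' = C * (1 / \<delta>)^(2*(J+1))"
  have D'0: "D' \<ge> 0" using A \<delta> by (simp add: D'_def)
  have coef: "norm ((\<i> / of_real \<alpha>)^\<mu> / fact \<mu>) \<le> inverse (\<alpha>^\<mu>)" if "\<alpha> > 0" for \<alpha> :: real and \<mu>
  proof -
    have "norm ((\<i> / of_real \<alpha>)^\<mu> / fact \<mu>) = inverse (\<alpha>^\<mu>) / fact \<mu>"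
      using that by (simp add: norm_divide norm_power power_divide norm_mult inverse_eq_divide)
    also have "\<dots> \<le> inverse (\<alpha>^\<mu>) / 1" using that by (intro divide_left_mono fact_ge_1) auto
    finally show ?thesis by simp
  qed
  have sq: "norm (h::real\<times>real) ^ (2*n) = ((norm h)^2)^n" for h n by (simp add: power_mult)
  have main: "norm (iexp (R i \<eta> / \<alpha>) * f i \<eta> - taylor_part f J \<alpha> i (\<eta> - e i))
       \<le> (\<Sum>\<mu>\<le>2*J+2. D \<mu> * (inverse (\<alpha>^\<mu>) * ((norm (\<eta> - e i))^2)^(J+1+\<mu>))) + D' * (inverse (\<alpha>^0) * ((norm (\<eta> - e i))^2)^(J+1+n))"
    if i: "i \<in> K" and \<alpha>: "0 < \<alpha>" "\<alpha> < 1" and N: "\<eta> \<notin> Nul i" for i \<alpha> \<eta>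
  proof -
    define h where "h = \<eta> - e i"
    have \<eta>: "\<eta> = e i + h" by (simp add: h_def)
    let ?x = "(norm h)^2"
    let ?B = "\<lambda>\<mu>. inverse (\<alpha>^\<mu>) * ?x^(J+1+\<mu>)"
    have B0: "?B \<mu> \<ge> 0" for \<mu> using \<alpha> by simp
    have tp: "taylor_part f J \<alpha> i h = (\<Sum>\<mu><m. (\<i> / of_real \<alpha>)^\<mu> / fact \<mu> * T \<mu> i h)"
      unfolding taylor_part_def T_def m_def ..
    have split: "(\<Sum>\<mu>\<le>2*J+2. D \<mu> * ?B \<mu>) = (\<Sum>\<mu><m. (CT \<mu> + DO \<mu>) * ?B \<mu>) + CR^m * A * ?B m"
    proof -
      have "{..2*J+2} = insert m {..<m}" by (auto simp: m_def)
      then show ?thesis by (simp add: D_def)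
    qed
    have last0: "D' * (inverse (\<alpha>^0) * ?x^(J+1+n)) \<ge> 0" using D'0 by simp
    have "norm (iexp (R i \<eta> / \<alpha>) * f i \<eta> - taylor_part f J \<alpha> i h)
       \<le> (\<Sum>\<mu><m. (CT \<mu> + DO \<mu>) * ?B \<mu>) + CR^m * A * ?B m + D' * (inverse (\<alpha>^0) * ?x^(J+1+n))"
    proof (cases "norm h < \<delta>")
      case True
      let ?r = "R i \<eta> / \<alpha>"
      let ?e = "\<Sum>\<mu><m. (\<i> * of_real ?r)^\<mu> / fact \<mu>"
      have tm: "(\<i> * of_real ?r)^\<mu> / fact \<mu> * f i \<eta> = (\<i> / of_real \<alpha>)^\<mu> / fact \<mu> * ?g \<mu> i \<eta>" for \<mu>
        by (simp add: power_mult_distrib power_divide mult_ac)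
      \<comment> \<open>Two separate errors: cutting the exponential series after m terms, and
        replacing each retained product of \<open>f\<close> with a power of the remainder by its
        Taylor polynomial.\<close>
      have "iexp ?r * f i \<eta> - taylor_part f J \<alpha> i h = (iexp ?r - ?e) * f i \<eta> + (\<Sum>\<mu><m. (\<i> / of_real \<alpha>)^\<mu> / fact \<mu> * (?g \<mu> i \<eta> - T \<mu> i h))"
        unfolding tp right_diff_distrib sum_subtractf tm[symmetric] sum_distrib_right[symmetric] by (simp add: algebra_simps)
      also have "norm \<dots> \<le> CR^m * A * ?B m + (\<Sum>\<mu><m. CT \<mu> * ?B \<mu>)"
      proof (rule norm_triangle_mono)
        have me: "m = Suc (2*J+1)" by (simp add: m_def)
        have ee: "?e = (\<Sum>\<mu>\<le>2*J+1. (\<i> * of_real ?r)^\<mu> / fact \<mu>)" unfolding me lessThan_Suc_atMost ..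
        have "norm (iexp ?r - ?e) \<le> \<bar>?r\<bar>^m / fact m"
          unfolding ee unfolding me by (rule iexp_approx1)
        also have "\<dots> \<le> \<bar>?r\<bar>^m / 1" by (intro divide_left_mono fact_ge_1) auto
        also have "\<bar>?r\<bar>^m = inverse (\<alpha>^m) * \<bar>R i \<eta>\<bar>^m" using \<alpha> by (simp add: abs_divide power_divide) (simp add: divide_inverse mult.commute)
        also have "inverse (\<alpha>^m) * \<bar>R i \<eta>\<bar>^m / 1 \<le> inverse (\<alpha>^m) * (CR * norm h ^ 3)^m"
          using CR(2)[OF i True] \<alpha> \<eta> by (auto intro!: mult_left_mono power_mono)
        also have "(CR * norm h ^ 3)^m = CR^m * ?x^(J+1+m)"
        proof -
          \<comment> \<open>This is the identity that dictates m = 2J + 2.\<close>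
          have "3 * m = 2 * (J+1+m)" by (simp add: m_def)
          then show ?thesis by (simp only: power_mult_distrib power_mult[symmetric])
        qed
        finally have "norm (iexp ?r - ?e) \<le> inverse (\<alpha>^m) * (CR^m * ?x^(J+1+m))" .
        then have "norm ((iexp ?r - ?e) * f i \<eta>) \<le> inverse (\<alpha>^m) * (CR^m * ?x^(J+1+m)) * A"
          unfolding norm_mult using A(3)[OF i, of \<eta>] True h_def \<alpha> CR(1) by (intro mult_mono) auto
        then show "norm ((iexp ?r - ?e) * f i \<eta>) \<le> CR^m * A * ?B m" by (simp only: mult_ac)
        show "norm (\<Sum>\<mu><m. (\<i> / of_real \<alpha>)^\<mu> / fact \<mu> * (?g \<mu> i \<eta> - T \<mu> i h)) \<le> (\<Sum>\<mu><m. CT \<mu> * ?B \<mu>)"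
        proof (rule sum_norm_le)
          fix \<mu>
          have "norm ((\<i> / of_real \<alpha>)^\<mu> / fact \<mu> * (?g \<mu> i \<eta> - T \<mu> i h)) \<le> inverse (\<alpha>^\<mu>) * (CT \<mu> * norm h ^ (2*(J+1+\<mu>)))"
            unfolding norm_mult using CT(2)[OF i True, of \<mu>] \<eta> \<alpha> by (intro mult_mono coef) auto
          then show "norm ((\<i> / of_real \<alpha>)^\<mu> / fact \<mu> * (?g \<mu> i \<eta> - T \<mu> i h)) \<le> CT \<mu> * ?B \<mu>"
            unfolding sq by (simp only: mult_ac)
        qed
      qed
      also have "(\<Sum>\<mu><m. CT \<mu> * ?B \<mu>) \<le> (\<Sum>\<mu><m. (CT \<mu> + DO \<mu>) * ?B \<mu>)"
        using DO0 B0 by (intro sum_mono mult_right_mono) auto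
      finally show ?thesis using last0 by linarith
    next
      case False
      then have far: "\<delta> \<le> norm h" by simp
      \<comment> \<open>No cancellation is sought in the far region; the function and the polynomial
        are bounded separately.\<close>
      have "norm (iexp (R i \<eta> / \<alpha>) * f i \<eta> - taylor_part f J \<alpha> i h) \<le> D' * (inverse (\<alpha>^0) * ?x^(J+1+n)) + (\<Sum>\<mu><m. DO \<mu> * ?B \<mu>)"
      proof (rule norm_triangle_le_diff, rule add_mono)
        have "norm (iexp (R i \<eta> / \<alpha>) * f i \<eta>) \<le> C * ?x^n"
          using A(4)[OF i N] far by (simp add: norm_mult h_def)
        also have "\<dots> = C * norm h ^ (2*n)" by (simp only: sq)
        also have "\<dots> \<le> C * ((1 / \<delta>)^(2*(J+1+n) - 2*n) * norm h ^ (2*(J+1+n)))"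
          by (intro mult_left_mono power_le_far \<delta> far A) simp_all
        also have "2*(J+1+n) - 2*n = 2*(J+1)" by simp
        finally show "norm (iexp (R i \<eta> / \<alpha>) * f i \<eta>) \<le> D' * (inverse (\<alpha>^0) * ?x^(J+1+n))"
          unfolding sq D'_def by (simp add: mult.assoc)
        show "norm (taylor_part f J \<alpha> i h) \<le> (\<Sum>\<mu><m. DO \<mu> * ?B \<mu>)"
          unfolding tp
        proof (rule sum_norm_le)
          fix \<mu>
          have "norm ((\<i> / of_real \<alpha>)^\<mu> / fact \<mu> * T \<mu> i h) \<le> inverse (\<alpha>^\<mu>) * (DO \<mu> * norm h ^ (2*(J+1+\<mu>)))"
            unfolding norm_mult using outT[OF i far, of \<mu>] \<alpha> by (intro mult_mono coef) auto
          then show "norm ((\<i> / of_real \<alpha>)^\<mu> / fact \<mu> * T \<mu> i h) \<le> DO \<mu> * ?B \<mu>"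
            unfolding sq by (simp only: mult_ac)
        qed
      qed
      also have "(\<Sum>\<mu><m. DO \<mu> * ?B \<mu>) \<le> (\<Sum>\<mu><m. (CT \<mu> + DO \<mu>) * ?B \<mu>)"
        using CT(1) B0 by (intro sum_mono mult_right_mono) auto
      finally show ?thesis using CR(1) A(1) B0[of m] by (smt (verit) mult_nonneg_nonneg zero_le_power)
    qed
    then show ?thesis unfolding split[folded h_def] h_def[symmetric] by simp
  qed
  show ?thesis by (rule that[OF D0 D'0 main])
qed

text \<open>The polynomial part is integrated exactly by Wick's rule. The pointwise error,
  multiplied by the Gaussian, consists of terms that each integrate to O(\<alpha>^(J+2)).\<close>

lemma stationary_phase:
  assumes f: "amplitude f"
  shows "\<exists>C. \<forall>i\<in>K. \<forall>\<alpha>. 0 < \<alpha> \<longrightarrow> \<alpha> < 1 \<longrightarrow>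
    norm (integral UNIV (osc f \<alpha> i) - 2 * pi * \<alpha> / (\<kappa> i * csqrt (1 + of_real ((a i)^2 + (b i)^2) / (\<kappa> i)^2))
       * (\<Sum>j\<le>J. of_real (\<alpha>^j) * stat_coeff i f j)) \<le> C * \<alpha>^(J+2)"
proof -
  obtain D D' n where D: "\<And>\<mu>. D \<mu> \<ge> 0" "D' \<ge> 0"
    "\<And>i \<alpha> \<eta>. i \<in> K \<Longrightarrow> 0 < \<alpha> \<Longrightarrow> \<alpha> < 1 \<Longrightarrow> \<eta> \<notin> Nul i \<Longrightarrow>
       norm (iexp (R i \<eta> / \<alpha>) * f i \<eta> - taylor_part f J \<alpha> i (\<eta> - e i))
       \<le> (\<Sum>\<mu>\<le>2*J+2. D \<mu> * (inverse (\<alpha>^\<mu>) * ((norm (\<eta> - e i))^2)^(J+1+\<mu>))) + D' * (inverse (\<alpha>^0) * ((norm (\<eta> - e i))^2)^(J+1+n))"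
    using taylor_part_error[OF f] by blast
  have CI: "osc f \<alpha> i integrable_on UNIV" if "i \<in> K" "0 < \<alpha>" "\<alpha> < 1" for i \<alpha>
    using osc_integral_bound[OF f] that by blast
  define w where "w k = fact k * (4 / c0)^k * (4 * pi / c0)" for k :: nat
  show ?thesis
  proof (intro exI[of _ "(\<Sum>\<mu>\<le>2*J+2. D \<mu> * w (J+1+\<mu>)) + D' * w (J+1+n)"] ballI allI impI)
    fix i \<alpha> assume i: "i \<in> K" and \<alpha>: "0 < \<alpha>" "\<alpha> < (1::real)"
    have k: "Re (\<kappa> i / of_real \<alpha>) > 0" using \<kappa>[OF i] c0 \<alpha> by simp
    note tpi = taylor_part_integral[OF f i \<alpha>(1), of J]
    have P: "((\<lambda>\<eta>. ga \<alpha> i (\<eta> - e i) * taylor_part f J \<alpha> i (\<eta> - e i)) has_integral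
        gmean (\<kappa> i / of_real \<alpha>) (a i / \<alpha>) (b i / \<alpha>) (taylor_part f J \<alpha> i)) UNIV"
      unfolding ga_def gmean_def
      by (rule has_integral_translate[OF gmean_integrable[OF k tpi(2)]])
    define G where "G \<eta> = osc f \<alpha> i \<eta> - ga \<alpha> i (\<eta> - e i) * taylor_part f J \<alpha> i (\<eta> - e i)" for \<eta>
    have G: "(G has_integral (integral UNIV (osc f \<alpha> i) - gmean (\<kappa> i / of_real \<alpha>) (a i / \<alpha>) (b i / \<alpha>) (taylor_part f J \<alpha> i))) UNIV"
      unfolding G_def[abs_def] by (intro has_integral_diff P integrable_integral CI i \<alpha>)
    define ex where "ex \<eta> = exp (- (c0 / (2 * \<alpha>)) * (norm (\<eta> - e i))^2)" for \<eta>
    define M where "M \<mu> k = integral UNIV (\<lambda>\<eta>. ex \<eta> * (inverse (\<alpha>^\<mu>) * ((norm (\<eta> - e i))^2)^k))" for \<mu> k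
    have M: "((\<lambda>\<eta>. ex \<eta> * (inverse (\<alpha>^\<mu>) * ((norm (\<eta> - e i))^2)^k)) has_integral M \<mu> k) UNIV"
        "M \<mu> k \<le> w k * \<alpha>^(J+2)" if le: "J+1+\<mu> \<le> k" for \<mu> k
    proof -
      obtain m where m: "((\<lambda>\<eta>. ex \<eta> * (inverse (\<alpha>^\<mu>) * ((norm (\<eta> - e i))^2)^k)) has_integral m) UNIV" "m \<le> w k * \<alpha>^(J+2)"
        using gaussian_weighted_integral[OF i \<alpha> le] unfolding ex_def w_def by blast
      moreover from m(1) have "M \<mu> k = m" unfolding M_def by (rule integral_unique)
      ultimately show "((\<lambda>\<eta>. ex \<eta> * (inverse (\<alpha>^\<mu>) * ((norm (\<eta> - e i))^2)^k)) has_integral M \<mu> k) UNIV"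
        "M \<mu> k \<le> w k * \<alpha>^(J+2)" by simp_all
    qed
    define g where "g \<eta> = (\<Sum>\<mu>\<le>2*J+2. D \<mu> * (ex \<eta> * (inverse (\<alpha>^\<mu>) * ((norm (\<eta> - e i))^2)^(J+1+\<mu>)))) + D' * (ex \<eta> * (inverse (\<alpha>^0) * ((norm (\<eta> - e i))^2)^(J+1+n)))" for \<eta>
    have g: "(g has_integral ((\<Sum>\<mu>\<le>2*J+2. D \<mu> * M \<mu> (J+1+\<mu>)) + D' * M 0 (J+1+n))) UNIV"
      unfolding g_def[abs_def] by (intro has_integral_add has_integral_sum has_integral_mult_right M) auto
    have ex0: "ex \<eta> \<ge> 0" for \<eta> by (simp add: ex_def)
    have g0: "g \<eta> \<ge> 0" for \<eta> unfolding g_def using D(1,2) ex0 \<alpha> by (intro add_nonneg_nonneg sum_nonneg mult_nonneg_nonneg) auto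
    have le: "norm (G \<eta>) \<le> g \<eta>" if N: "\<eta> \<notin> Nul i" for \<eta>
    proof -
      have "G \<eta> = ga \<alpha> i (\<eta> - e i) * (iexp (R i \<eta> / \<alpha>) * f i \<eta> - taylor_part f J \<alpha> i (\<eta> - e i))"
        by (simp add: G_def osc_def algebra_simps)
      also have "norm \<dots> \<le> ex \<eta> * ((\<Sum>\<mu>\<le>2*J+2. D \<mu> * (inverse (\<alpha>^\<mu>) * ((norm (\<eta> - e i))^2)^(J+1+\<mu>))) + D' * (inverse (\<alpha>^0) * ((norm (\<eta> - e i))^2)^(J+1+n)))"
        unfolding norm_mult ex_def by (intro mult_mono norm_ga_le[OF i \<alpha>(1)] D(3)[OF i \<alpha> N]) auto
      also have "\<dots> = g \<eta>" unfolding g_def distrib_left sum_distrib_left by (simp only: mult.left_commute)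
      finally show ?thesis .
    qed
    have "norm (integral UNIV G) \<le> (\<Sum>\<mu>\<le>2*J+2. D \<mu> * M \<mu> (J+1+\<mu>)) + D' * M 0 (J+1+n)"
      by (rule integral_norm_off_negligible[OF i _ g g0 le]) (use G in blast)
    also have "\<dots> \<le> (\<Sum>\<mu>\<le>2*J+2. D \<mu> * (w (J+1+\<mu>) * \<alpha>^(J+2))) + D' * (w (J+1+n) * \<alpha>^(J+2))"
      by (intro add_mono sum_mono mult_left_mono M D) auto
    also have "\<dots> = ((\<Sum>\<mu>\<le>2*J+2. D \<mu> * w (J+1+\<mu>)) + D' * w (J+1+n)) * \<alpha>^(J+2)"
      by (simp add: sum_distrib_right distrib_right mult.assoc)
    finally show "norm (integral UNIV (osc f \<alpha> i) - 2 * pi * \<alpha> / (\<kappa> i * csqrt (1 + of_real ((a i)^2 + (b i)^2) / (\<kappa> i)^2))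
       * (\<Sum>j\<le>J. of_real (\<alpha>^j) * stat_coeff i f j)) \<le> ((\<Sum>\<mu>\<le>2*J+2. D \<mu> * w (J+1+\<mu>)) + D' * w (J+1+n)) * \<alpha>^(J+2)"
      using G tpi(1) by (simp add: integral_unique)
  qed
qed

end

subsection \<open>Classical trajectories and the action\<close>

text \<open>The momentum derivative of the position is this multiple of the identity.\<close>

definition sg :: "real \<Rightarrow> real \<Rightarrow> real" where "sg om t = sin (om * t) / om"

text \<open>\<open>det Z = m\<^sup>2 - (s b / |x|\<^sup>2)\<^sup>2\<close>, where \<open>s\<close> and \<open>m\<close> are the values of \<open>sg\<close> and \<open>mm\<close>.\<close>
definition mm :: "real \<Rightarrow> real \<Rightarrow> real \<Rightarrow> complex" where
  "mm om B t = of_real (cos (om * t)) - \<i> * of_real (B * sg om t)"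

text \<open>The Jacobian of \<open>A\<close> at \<open>x \<noteq> 0\<close> is the symmetric trace-free matrix \<open>[[dA1, dA2], [dA2, - dA1]]\<close>.\<close>
definition dA1 :: "real \<Rightarrow> R2 \<Rightarrow> real" where
  "dA1 b x = 2 * b * fst x * snd x / ((fst x)^2 + (snd x)^2)^2"

definition dA2 :: "real \<Rightarrow> R2 \<Rightarrow> real" where
  "dA2 b x = b * ((snd x)^2 - (fst x)^2) / ((fst x)^2 + (snd x)^2)^2"

definition wedge :: "R2 \<Rightarrow> R2 \<Rightarrow> real" where "wedge u v = fst u * snd v - snd u * fst v"

lemma R2_sq_nonzero: "(x::R2) \<noteq> 0 \<Longrightarrow> (fst x)^2 + (snd x)^2 \<noteq> 0"
  by (cases x) (auto simp: sum_power2_eq_zero_iff zero_prod_def)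

lemma Avec_eq: "Avec b x = (- b * snd x / ((fst x)^2 + (snd x)^2), b * fst x / ((fst x)^2 + (snd x)^2))"
  by (cases x) (auto simp: Avec_def norm_R2_sq zero_prod_def)

text \<open>Minus the determinant of the trace-free Jacobian of A, whose eigenvalues are b/|x|^2 and
  -b/|x|^2. This is why det Z and the Hessian determinant depend on the position only through its
  norm.\<close>

lemma dA_square_sum:
  assumes "x \<noteq> 0" shows "(dA1 b x)^2 + (dA2 b x)^2 = (b / (norm x)^2)^2"
proof -
  define r where "r = (fst x)^2 + (snd x)^2"
  have r: "r \<noteq> 0" using R2_sq_nonzero[OF assms] by (simp add: r_def)
  have "(dA1 b x)^2 + (dA2 b x)^2 = b^2 * ((2 * fst x * snd x)^2 + ((snd x)^2 - (fst x)^2)^2) / r^4"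
    unfolding dA1_def dA2_def r_def[symmetric] by (simp add: power_divide power_mult_distrib distrib_left add_divide_distrib)
  also have "(2 * fst x * snd x)^2 + ((snd x)^2 - (fst x)^2)^2 = r^2"
    unfolding r_def by (simp add: power2_eq_square algebra_simps)
  finally show ?thesis using r unfolding norm_R2_sq r_def[symmetric] by (simp add: power_divide field_simps power2_eq_square power4_eq_xxxx)
qed

lemma Avec_derivative:
  assumes "x \<noteq> 0"
  shows "(Avec b has_derivative (\<lambda>v. (dA1 b x * fst v + dA2 b x * snd v, dA2 b x * fst v - dA1 b x * snd v))) (at x)"
proof -
  have nz: "(fst x)^2 + (snd x)^2 \<noteq> 0" by (rule R2_sq_nonzero[OF assms])
  have d: "((\<lambda>x::R2. (fst x)^2 + (snd x)^2) has_derivative (\<lambda>v. 2 * fst x * fst v + 2 * snd x * snd v)) (at x)"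
    by (auto intro!: derivative_eq_intros)
  have a: "((\<lambda>x::R2. - b * snd x / ((fst x)^2 + (snd x)^2)) has_derivative (\<lambda>v. dA1 b x * fst v + dA2 b x * snd v)) (at x)"
  proof (rule has_derivative_eq_rhs)
    show "((\<lambda>x::R2. - b * snd x / ((fst x)^2 + (snd x)^2)) has_derivative
      (\<lambda>v. (- b * snd v * ((fst x)^2 + (snd x)^2) - (- b * snd x) * (2 * fst x * fst v + 2 * snd x * snd v)) / (((fst x)^2 + (snd x)^2) * ((fst x)^2 + (snd x)^2)))) (at x)"
      by (rule has_derivative_divide'[OF _ d nz]) (auto intro!: derivative_eq_intros)
    show "(\<lambda>v. (- b * snd v * ((fst x)^2 + (snd x)^2) - (- b * snd x) * (2 * fst x * fst v + 2 * snd x * snd v)) / (((fst x)^2 + (snd x)^2) * ((fst x)^2 + (snd x)^2)))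
       = (\<lambda>v. dA1 b x * fst v + dA2 b x * snd v)"
      unfolding dA1_def dA2_def power2_eq_square[of "(fst x)^2 + (snd x)^2"] times_divide_eq_left add_divide_distrib[symmetric]
      by (rule ext, rule arg_cong2[of _ _ _ _ "(/)"]) (simp_all add: algebra_simps power2_eq_square)
  qed
  have c: "((\<lambda>x::R2. b * fst x / ((fst x)^2 + (snd x)^2)) has_derivative (\<lambda>v. dA2 b x * fst v - dA1 b x * snd v)) (at x)"
  proof (rule has_derivative_eq_rhs)
    show "((\<lambda>x::R2. b * fst x / ((fst x)^2 + (snd x)^2)) has_derivative
      (\<lambda>v. (b * fst v * ((fst x)^2 + (snd x)^2) - (b * fst x) * (2 * fst x * fst v + 2 * snd x * snd v)) / (((fst x)^2 + (snd x)^2) * ((fst x)^2 + (snd x)^2)))) (at x)"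
      by (rule has_derivative_divide'[OF _ d nz]) (auto intro!: derivative_eq_intros)
    show "(\<lambda>v. (b * fst v * ((fst x)^2 + (snd x)^2) - (b * fst x) * (2 * fst x * fst v + 2 * snd x * snd v)) / (((fst x)^2 + (snd x)^2) * ((fst x)^2 + (snd x)^2)))
       = (\<lambda>v. dA2 b x * fst v - dA1 b x * snd v)"
      unfolding dA1_def dA2_def power2_eq_square[of "(fst x)^2 + (snd x)^2"] times_divide_eq_left diff_divide_distrib[symmetric]
      by (rule ext, rule arg_cong2[of _ _ _ _ "(/)"]) (simp_all add: algebra_simps power2_eq_square)
  qed
  show ?thesis unfolding Avec_eq[abs_def] by (rule has_derivative_Pair[OF a c])
qed

lemma continuous_on_Avec: "continuous_on (- {0}) (Avec b)"
  by (intro continuous_at_imp_continuous_on ballI, rule has_derivative_continuous[OF Avec_derivative]) simp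

lemma sg_cos: assumes "om > 0" shows "(cos (om * t))^2 + om^2 * (sg om t)^2 = 1"
  using assms by (simp add: sg_def power_divide)

lemma xt_eq: "xt om b t y \<eta> = cos (om * t) *\<^sub>R y + sg om t *\<^sub>R (\<eta> - Avec b y)"
  by (simp add: xt_def sg_def)

lemma xdot_eq: "om > 0 \<Longrightarrow> xdot om b t y \<eta> = (- (om^2) * sg om t) *\<^sub>R y + cos (om * t) *\<^sub>R (\<eta> - Avec b y)"
  by (simp add: xdot_def sg_def power2_eq_square)

lemma xt_zero: "xt om b 0 y \<eta> = y" by (simp add: xt_def)

text \<open>Position and velocity arise from their initial values by one 2x2 coefficient matrix of
  determinant one, acting alike on both components.\<close>

lemma wedge_conserved:
  assumes "om > 0"
  shows "wedge (xt om b t y \<eta>) (xdot om b t y \<eta>) = wedge y (\<eta> - Avec b y)"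
proof -
  define w where "w = \<eta> - Avec b y"
  have "wedge (xt om b t y \<eta>) (xdot om b t y \<eta>) = ((cos (om * t))^2 + om^2 * (sg om t)^2) * wedge y w"
    unfolding xt_eq xdot_eq[OF assms] w_def[symmetric] wedge_def by (simp add: power2_eq_square algebra_simps)
  then show ?thesis unfolding sg_cos[OF assms] w_def by simp
qed

text \<open>A passage through the origin would force the conserved angular momentum to
  vanish.\<close>

lemma xt_nonzero:
  assumes om: "om > 0" and "wedge y (\<eta> - Avec b y) \<noteq> 0"
  shows "xt om b t y \<eta> \<noteq> 0"
  using assms(2) wedge_conserved[OF om, of b t y \<eta>] by (auto simp: wedge_def)

lemma wedge_affine_negligible:
  assumes "y \<noteq> 0" shows "negligible {\<eta>. wedge y (\<eta> - c) = 0}"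
proof -
  have "{\<eta>. wedge y (\<eta> - c) = 0} = {\<eta>. (- snd y, fst y) \<bullet> \<eta> = wedge y c}"
    by (auto simp: wedge_def inner_prod_def algebra_simps)
  moreover have "(- snd y, fst y) \<noteq> 0" using assms by (cases y) (auto simp: zero_prod_def)
  ultimately show ?thesis using negligible_hyperplane by metis
qed

lemma xt_time_derivative:
  assumes "om > 0"
  shows "((\<lambda>s. xt om b s y \<eta>) has_vector_derivative xdot om b s y \<eta>) (at s within T)"
  unfolding xt_def[abs_def] xdot_def
  by (rule has_vector_derivative_eq_rhs, (rule has_vector_derivative_add has_vector_derivative_scaleR has_vector_derivative_const DERIV_cos DERIV_sin derivative_eq_intros refl)+) (use assms in \<open>auto simp: algebra_simps\<close>)

lemma continuous_on_xt: "continuous_on T (\<lambda>s. xt om b s y \<eta>)"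
  unfolding xt_def[abs_def] divide_inverse by (intro continuous_intros)

lemma continuous_on_xdot: "continuous_on T (\<lambda>s. xdot om b s y \<eta>)"
  unfolding xdot_def[abs_def] by (intro continuous_intros)

text \<open>The polar angle swept out by the trajectory, by conservation of angular momentum.\<close>
definition swept :: "real \<Rightarrow> real \<Rightarrow> real \<Rightarrow> R2 \<Rightarrow> R2 \<Rightarrow> real" where
  "swept om b t y \<eta> = integral {0..1} (\<lambda>\<tau>. t * (wedge y (\<eta> - Avec b y) / (norm (xt om b (t * \<tau>) y \<eta>))^2))"

text \<open>The vector potential contributes b times the angular velocity, which is angular momentum
  over |x|^2; the rest is the Lagrangian of the harmonic oscillator.\<close>

lemma lagr_eq:
  assumes "om > 0"
  shows "lagr om b (xt om b s y \<eta>) (xit om b s y \<eta>)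
   = ((norm (xdot om b s y \<eta>))^2 - om^2 * (norm (xt om b s y \<eta>))^2) / 2 + b * (wedge y (\<eta> - Avec b y) / (norm (xt om b s y \<eta>))^2)"
proof -
  let ?x = "xt om b s y \<eta>" and ?v = "xdot om b s y \<eta>"
  have "lagr om b ?x (xit om b s y \<eta>) = ?v \<bullet> ?v + ?v \<bullet> Avec b ?x - ((norm ?v)^2 / 2 + om^2 / 2 * (norm ?x)^2)"
    by (simp add: lagr_def ham_def xit_def inner_add_right)
  also have "?v \<bullet> Avec b ?x = b * (wedge ?x ?v / (norm ?x)^2)"
    unfolding Avec_eq norm_R2_sq wedge_def inner_prod_def
    by (simp add: diff_divide_distrib algebra_simps)
  finally show ?thesis unfolding wedge_conserved[OF assms] power2_norm_eq_inner[symmetric] by (simp add: field_simps)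
qed

lemma closed_segment_zero_eq: "closed_segment 0 t = (\<lambda>\<tau>. t * \<tau>) ` {0..1::real}"
  unfolding closed_segment_def by (auto simp: mult.commute image_iff)

text \<open>Rescaling to the unit interval treats both signs of t at once and makes the domain of
  integration independent of t.\<close>

lemma signed_integral_rescale:
  fixes f :: "real \<Rightarrow> real"
  assumes "continuous_on (closed_segment 0 t) f"
  shows "((\<lambda>\<tau>. t * f (t * \<tau>)) has_integral (if 0 \<le> t then integral {0..t} f else - integral {t..0} f)) {0..1}"
proof -
  let ?I = "\<lambda>u v. integral {u..v} f"
  have c: "continuous_on {min 0 t..max 0 t} f" using assms by (simp add: closed_segment_eq_real_ivl min_def max_def split: if_splits)
  have sub: "(\<lambda>\<tau>. t * \<tau>) ` {0..1} \<subseteq> {min 0 t..max 0 t}"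
  proof -
    have "closed_segment 0 t = {min 0 t..max 0 t}" by (simp add: closed_segment_eq_real_ivl min_def max_def)
    then show ?thesis unfolding closed_segment_zero_eq by simp
  qed
  have "((\<lambda>\<tau>. t *\<^sub>R f (t * \<tau>)) has_integral (?I (t * 0) (t * 1) - ?I (t * 1) (t * 0))) {0..1}"
    by (rule has_integral_substitution_general[of "{}", OF _ _ sub c]) (auto intro!: continuous_intros derivative_eq_intros)
  then show ?thesis by (cases "t = 0") auto
qed

text \<open>By the oscillator equation the nonmagnetic part of the Lagrangian is half the time
  derivative of x . v, so only the swept angle stays an integral.\<close>

lemma action_eq:
  assumes om: "om > 0" and nz: "\<And>s. s \<in> closed_segment 0 t \<Longrightarrow> xt om b s y \<eta> \<noteq> 0"
  shows "action om b t y \<eta> = (xt om b t y \<eta> \<bullet> xdot om b t y \<eta> - y \<bullet> (\<eta> - Avec b y)) / 2 + b * swept om b t y \<eta>"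
proof -
  let ?x = "\<lambda>s. xt om b s y \<eta>" and ?v = "\<lambda>s. xdot om b s y \<eta>" and ?W = "wedge y (\<eta> - Avec b y)"
  let ?l = "\<lambda>s. ((norm (?v s))^2 - om^2 * (norm (?x s))^2) / 2 + b * (?W / (norm (?x s))^2)"
  have cont: "continuous_on (closed_segment 0 t) ?l" "continuous_on (closed_segment 0 t) (\<lambda>s. ?W / (norm (?x s))^2)"
    using nz by (auto intro!: continuous_intros continuous_on_xt continuous_on_xdot)
  have "action om b t y \<eta> = integral {0..1} (\<lambda>\<tau>. t * ?l (t * \<tau>))"
    unfolding action_def lagr_eq[OF om] by (rule integral_unique[OF signed_integral_rescale[OF cont(1)], symmetric])
  also have "\<dots> = integral {0..1} (\<lambda>\<tau>. t * (((norm (?v (t * \<tau>)))^2 - om^2 * (norm (?x (t * \<tau>)))^2) / 2) + b * (t * (?W / (norm (?x (t * \<tau>)))^2)))"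
    by (intro integral_cong) (simp add: algebra_simps)
  also have "\<dots> = (?x t \<bullet> ?v t - ?x 0 \<bullet> ?v 0) / 2 + b * swept om b t y \<eta>"
  proof (rule integral_unique, rule has_integral_add)
    have dv: "(?v has_vector_derivative (- (om^2)) *\<^sub>R ?x s) (at s within T)" for s T
      unfolding xt_def xdot_def[abs_def]
      by (rule has_vector_derivative_eq_rhs, (rule has_vector_derivative_add has_vector_derivative_scaleR has_vector_derivative_const DERIV_cos DERIV_sin derivative_eq_intros refl)+)
        (use om in \<open>auto simp: algebra_simps power2_eq_square\<close>)
    have "((\<lambda>\<tau>. (?x (t * \<tau>) \<bullet> ?v (t * \<tau>)) / 2) has_vector_derivative t * (((norm (?v (t * \<tau>)))^2 - om^2 * (norm (?x (t * \<tau>)))^2) / 2)) (at \<tau> within {0..1})" for \<tau>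
    proof -
      have m: "((\<lambda>\<tau>. t * \<tau>) has_vector_derivative t) (at \<tau> within {0..1})"
        by (auto intro!: derivative_eq_intros simp: has_real_derivative_iff_has_vector_derivative[symmetric])
      have 1: "((\<lambda>\<tau>. ?x (t * \<tau>)) has_vector_derivative t *\<^sub>R ?v (t * \<tau>)) (at \<tau> within {0..1})"
        using vector_diff_chain_within[OF m xt_time_derivative[OF om]] by (simp add: o_def)
      have 2: "((\<lambda>\<tau>. ?v (t * \<tau>)) has_vector_derivative t *\<^sub>R ((- (om^2)) *\<^sub>R ?x (t * \<tau>))) (at \<tau> within {0..1})"
        using vector_diff_chain_within[OF m dv] by (simp add: o_def)
      have "((\<lambda>\<tau>. ?x (t * \<tau>) \<bullet> ?v (t * \<tau>)) has_vector_derivative ?x (t * \<tau>) \<bullet> (t *\<^sub>R ((- (om^2)) *\<^sub>R ?x (t * \<tau>))) + (t *\<^sub>R ?v (t * \<tau>)) \<bullet> ?v (t * \<tau>)) (at \<tau> within {0..1})"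
        by (rule bounded_bilinear.has_vector_derivative[OF bounded_bilinear_inner 1 2])
      from has_vector_derivative_divide[OF this, of 2] show ?thesis
        by (simp add: power2_norm_eq_inner algebra_simps)
    qed
    from fundamental_theorem_of_calculus[OF zero_le_one this]
    show "((\<lambda>\<tau>. t * (((norm (?v (t * \<tau>)))^2 - om^2 * (norm (?x (t * \<tau>)))^2) / 2)) has_integral (?x t \<bullet> ?v t - ?x 0 \<bullet> ?v 0) / 2) {0..1}"
      by (simp add: diff_divide_distrib)
    have "(\<lambda>\<tau>. t * (?W / (norm (?x (t * \<tau>)))^2)) integrable_on {0..1}"
      using signed_integral_rescale[OF cont(2)] by blast
    then show "((\<lambda>\<tau>. b * (t * (?W / (norm (?x (t * \<tau>)))^2))) has_integral b * swept om b t y \<eta>) {0..1}"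
      unfolding swept_def by (intro has_integral_mult_right integrable_integral)
  qed
  finally show ?thesis by (simp add: xt_def xdot_def)
qed

text \<open>The \<open>\<eta>\<close>-gradient of the angular velocity is a total time derivative because mixed
  partials of the polar angle commute.\<close>
lemma swept_derivative:
  assumes om: "om > 0" and U: "open U" "convex U" "\<eta>0 \<in> U"
    and nz: "\<And>s \<eta>. s \<in> closed_segment 0 t \<Longrightarrow> \<eta> \<in> U \<Longrightarrow> xt om b s y \<eta> \<noteq> 0"
  shows "(swept om b t y has_derivative (\<lambda>d. sg om t * wedge (xt om b t y \<eta>0) d / (norm (xt om b t y \<eta>0))^2)) (at \<eta>0)"
proof -
  let ?x = "\<lambda>\<tau> \<eta>. xt om b (t * \<tau>) y \<eta>" and ?w = "\<lambda>\<eta>. \<eta> - Avec b y"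
  have nz': "?x \<tau> \<eta> \<noteq> 0" if "\<tau> \<in> {0..1}" "\<eta> \<in> U" for \<tau> \<eta>
    by (rule nz[OF _ that(2)]) (use that in \<open>auto simp: closed_segment_zero_eq\<close>)
  have xder: "(?x \<tau> has_derivative (\<lambda>d. sg om (t * \<tau>) *\<^sub>R d)) (at \<eta> within U)" for \<tau> \<eta>
    unfolding xt_eq by (auto intro!: derivative_eq_intros)
  \<comment> \<open>The \<eta>-gradient of the rescaled angular velocity, from the quotient
    rule.\<close>
  define g where "g \<eta> \<tau> = (t / (norm (?x \<tau> \<eta>))^2) *\<^sub>R (- snd y, fst y)
      - (t * (wedge y (?w \<eta>) * (2 * sg om (t * \<tau>))) / ((norm (?x \<tau> \<eta>))^2)^2) *\<^sub>R ?x \<tau> \<eta>" for \<eta> \<tau>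
  have ginner: "g \<eta> \<tau> \<bullet> d = t * (wedge y d * (norm (?x \<tau> \<eta>))^2 - wedge y (?w \<eta>) * (2 * sg om (t * \<tau>) * (?x \<tau> \<eta> \<bullet> d))) / ((norm (?x \<tau> \<eta>))^2)^2"
    if "?x \<tau> \<eta> \<noteq> 0" for \<eta> \<tau> d
    using that unfolding g_def inner_diff_left by (simp add: wedge_def inner_prod_def field_simps power2_eq_square)
  have contx: "continuous_on (U \<times> cbox 0 1) (\<lambda>(\<eta>, \<tau>). ?x \<tau> \<eta>)"
    unfolding xt_eq sg_def divide_inverse case_prod_beta' by (intro continuous_intros)
  have contg: "continuous_on (U \<times> cbox 0 1) (\<lambda>(\<eta>, \<tau>). g \<eta> \<tau>)"
    unfolding g_def case_prod_beta' sg_def wedge_def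
    by (intro continuous_intros contx[unfolded case_prod_beta']) (use om nz' in auto)
  have "((\<lambda>\<eta>. integral (cbox 0 1) (\<lambda>\<tau>. t * (wedge y (?w \<eta>) / (norm (?x \<tau> \<eta>))^2))) has_derivative
      blinfun_apply (integral (cbox 0 1) (\<lambda>\<tau>. blinfun_inner_right (g \<eta>0 \<tau>)))) (at \<eta>0 within U)"
  proof (rule leibniz_rule[OF _ _ _ U(3,2)])
    fix \<eta> \<tau> assume h: "\<eta> \<in> U" "\<tau> \<in> cbox (0::real) 1"
    have nzx: "?x \<tau> \<eta> \<noteq> 0" using nz' h by simp
    have dn: "((\<lambda>\<eta>. (norm (?x \<tau> \<eta>))^2) has_derivative (\<lambda>d. 2 * sg om (t * \<tau>) * (?x \<tau> \<eta> \<bullet> d))) (at \<eta> within U)"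
      unfolding power2_norm_eq_inner
      by (rule has_derivative_eq_rhs[OF has_derivative_inner[OF xder xder]]) (simp add: fun_eq_iff inner_commute)
    have dw: "((\<lambda>\<eta>. wedge y (?w \<eta>)) has_derivative (\<lambda>d. wedge y d)) (at \<eta> within U)"
      unfolding wedge_def by (auto intro!: derivative_eq_intros)
    have "((\<lambda>\<eta>. t * (wedge y (?w \<eta>) / (norm (?x \<tau> \<eta>))^2)) has_derivative
        (\<lambda>d. t * ((wedge y d * (norm (?x \<tau> \<eta>))^2 - wedge y (?w \<eta>) * (2 * sg om (t * \<tau>) * (?x \<tau> \<eta> \<bullet> d))) / ((norm (?x \<tau> \<eta>))^2 * (norm (?x \<tau> \<eta>))^2)))) (at \<eta> within U)"
      by (rule has_derivative_mult_right[OF has_derivative_divide'[OF dw dn]]) (use nzx in simp)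
    then show "((\<lambda>\<eta>. t * (wedge y (?w \<eta>) / (norm (?x \<tau> \<eta>))^2)) has_derivative blinfun_apply (blinfun_inner_right (g \<eta> \<tau>))) (at \<eta> within U)"
      by (rule has_derivative_eq_rhs) (simp add: fun_eq_iff ginner[OF nzx] power2_eq_square)
  next
    fix \<eta> assume h: "\<eta> \<in> U"
    show "(\<lambda>\<tau>. t * (wedge y (?w \<eta>) / (norm (?x \<tau> \<eta>))^2)) integrable_on cbox 0 1"
    proof (rule integrable_continuous)
      have "continuous_on (cbox 0 1) (\<lambda>\<tau>. ?x \<tau> \<eta>)"
        by (rule continuous_on_compose2[OF continuous_on_xt[of UNIV]]) (auto intro!: continuous_intros)
      then show "continuous_on (cbox 0 1) (\<lambda>\<tau>. t * (wedge y (?w \<eta>) / (norm (?x \<tau> \<eta>))^2))"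
        by (intro continuous_intros) (use nz' h in auto)
    qed
  next
    show "continuous_on (U \<times> cbox 0 1) (\<lambda>(\<eta>, \<tau>). blinfun_inner_right (g \<eta> \<tau>))"
      using bounded_linear.continuous_on[OF bounded_linear_blinfun_inner_right contg] by (simp add: case_prod_beta')
  qed
  moreover have app: "blinfun_apply (integral (cbox 0 1) (\<lambda>\<tau>. blinfun_inner_right (g \<eta>0 \<tau>))) d = sg om t * wedge (xt om b t y \<eta>0) d / (norm (xt om b t y \<eta>0))^2" for d
  proof -
    have cg: "continuous_on (cbox 0 1) (\<lambda>\<tau>. blinfun_inner_right (g \<eta>0 \<tau>))"
    proof -
      have "continuous_on (cbox 0 1) (g \<eta>0)"
      proof -
        have "continuous_on (cbox 0 1) (\<lambda>\<tau>. (\<lambda>(\<eta>, \<tau>). g \<eta> \<tau>) (\<eta>0, \<tau>))"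
          by (rule continuous_on_compose2[OF contg]) (use U(3) in \<open>auto intro!: continuous_intros\<close>)
        then show ?thesis by simp
      qed
      then show ?thesis by (rule bounded_linear.continuous_on[OF bounded_linear_blinfun_inner_right])
    qed
    have "blinfun_apply (integral (cbox 0 1) (\<lambda>\<tau>. blinfun_inner_right (g \<eta>0 \<tau>))) d = integral (cbox 0 1) (\<lambda>\<tau>. g \<eta>0 \<tau> \<bullet> d)"
      using integral_linear[OF integrable_continuous[OF cg] blinfun.bounded_linear_left[of d]] by (simp add: o_def)
    also have "\<dots> = integral {0..1} (\<lambda>\<tau>. g \<eta>0 \<tau> \<bullet> d)" by simp
    \<comment> \<open>The primitive is the variation of the polar angle: varying \<eta> by
      \<open>d\<close> moves the position by \<open>sg\<close> times \<open>d\<close>. It vanishes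
      at the start because y is held fixed.\<close>
    also have "\<dots> = (\<lambda>\<tau>. sg om (t * \<tau>) * wedge (?x \<tau> \<eta>0) d / (norm (?x \<tau> \<eta>0))^2) 1 - (\<lambda>\<tau>. sg om (t * \<tau>) * wedge (?x \<tau> \<eta>0) d / (norm (?x \<tau> \<eta>0))^2) 0"
    proof (rule integral_unique, rule fundamental_theorem_of_calculus[OF zero_le_one])
      fix \<tau> :: real assume \<tau>: "\<tau> \<in> {0..1}"
      let ?X = "?x \<tau> \<eta>0" and ?V = "xdot om b (t * \<tau>) y \<eta>0" and ?c = "cos (om * (t * \<tau>))" and ?s = "sg om (t * \<tau>)"
      have nzx: "?X \<noteq> 0" by (rule nz'[OF \<tau> U(3)])
      have m: "((\<lambda>\<tau>. t * \<tau>) has_vector_derivative t) (at \<tau> within {0..1})"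
        by (auto intro!: derivative_eq_intros simp: has_real_derivative_iff_has_vector_derivative[symmetric])
      have dx: "((\<lambda>\<tau>. ?x \<tau> \<eta>0) has_vector_derivative t *\<^sub>R ?V) (at \<tau> within {0..1})"
        using vector_diff_chain_within[OF m xt_time_derivative[OF om]] by (simp add: o_def)
      have ds: "((\<lambda>\<tau>. sg om (t * \<tau>)) has_field_derivative t * ?c) (at \<tau> within {0..1})"
        unfolding sg_def using om by (auto intro!: derivative_eq_intros)
      have bl: "bounded_linear (\<lambda>u. wedge u d)" unfolding wedge_def
        by (intro bounded_linear_sub bounded_linear_mult_const bounded_linear_fst bounded_linear_snd)
      have dwg: "((\<lambda>\<tau>. wedge (?x \<tau> \<eta>0) d) has_field_derivative t * wedge ?V d) (at \<tau> within {0..1})"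
        using bounded_linear.has_vector_derivative[OF bl dx]
        by (simp add: has_real_derivative_iff_has_vector_derivative wedge_def algebra_simps)
      have dn: "((\<lambda>\<tau>. (norm (?x \<tau> \<eta>0))^2) has_field_derivative t * (2 * (?X \<bullet> ?V))) (at \<tau> within {0..1})"
        unfolding power2_norm_eq_inner
        using bounded_bilinear.has_vector_derivative[OF bounded_bilinear_inner dx dx]
        by (simp add: has_real_derivative_iff_has_vector_derivative inner_commute algebra_simps)
      have "((\<lambda>\<tau>. sg om (t * \<tau>) * wedge (?x \<tau> \<eta>0) d / (norm (?x \<tau> \<eta>0))^2) has_field_derivative
         ((t * ?c * wedge ?X d + t * wedge ?V d * ?s) * (norm ?X)^2 - ?s * wedge ?X d * (t * (2 * (?X \<bullet> ?V)))) / ((norm ?X)^2 * (norm ?X)^2)) (at \<tau> within {0..1})"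
        by (rule DERIV_divide[OF DERIV_mult[OF ds dwg] dn]) (use nzx in simp)
      moreover have "((t * ?c * wedge ?X d + t * wedge ?V d * ?s) * (norm ?X)^2 - ?s * wedge ?X d * (t * (2 * (?X \<bullet> ?V)))) / ((norm ?X)^2 * (norm ?X)^2) = g \<eta>0 \<tau> \<bullet> d"
      proof -
        \<comment> \<open>Running the flow backwards eliminates y, and the identity becomes a
          polynomial one in \<open>?X\<close>, \<open>?V\<close> and \<open>d\<close>.\<close>
        have y: "y = ?c *\<^sub>R ?X - ?s *\<^sub>R ?V"
        proof -
          have "?c *\<^sub>R ?X - ?s *\<^sub>R ?V = (?c^2 + om^2 * ?s^2) *\<^sub>R y"
            unfolding xt_eq xdot_eq[OF om] by (simp add: algebra_simps power2_eq_square)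
          then show ?thesis unfolding sg_cos[OF om] by simp
        qed
        have yd: "wedge y d = ?c * wedge ?X d - ?s * wedge ?V d" by (subst y) (simp add: wedge_def algebra_simps)
        have W: "wedge y (?w \<eta>0) = wedge ?X ?V" by (rule wedge_conserved[OF om, symmetric])
        show ?thesis unfolding ginner[OF nzx] yd W power2_eq_square[of "(norm ?X)^2"]
          unfolding norm_R2_sq
          by (rule arg_cong2[of _ _ _ _ "(/)"]) (simp_all add: wedge_def inner_prod_def power2_eq_square algebra_simps)
      qed
      ultimately show "((\<lambda>\<tau>. sg om (t * \<tau>) * wedge (?x \<tau> \<eta>0) d / (norm (?x \<tau> \<eta>0))^2) has_vector_derivative g \<eta>0 \<tau> \<bullet> d) (at \<tau> within {0..1})"
        by (simp add: has_real_derivative_iff_has_vector_derivative)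
    qed
    finally show ?thesis by (simp add: sg_def)
  qed
  ultimately show ?thesis
    unfolding swept_def[abs_def] at_within_open[OF U(3,1)] app[abs_def] by simp
qed

text \<open>The quotient of two continuous roots takes only the values 1 and -1 and is therefore
  constant on a connected set.\<close>

lemma continuous_root_unique:
  fixes g1 g2 :: "'a::topological_space \<Rightarrow> complex"
  assumes S: "connected S" "p \<in> S" "q \<in> S" and c: "continuous_on S g1" "continuous_on S g2"
    and sq: "\<And>s. s \<in> S \<Longrightarrow> (g1 s)^2 = (g2 s)^2" and nz: "\<And>s. s \<in> S \<Longrightarrow> g2 s \<noteq> 0" and eq: "g1 p = g2 p"
  shows "g1 q = g2 q"
proof -
  have "(\<lambda>s. g1 s / g2 s) ` S \<subseteq> {1, -1}"
  proof
    fix z assume "z \<in> (\<lambda>s. g1 s / g2 s) ` S"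
    then obtain s where s: "s \<in> S" "z = g1 s / g2 s" by blast
    then have "z^2 = 1" using sq[OF s(1)] nz[OF s(1)] by (simp add: power_divide)
    then show "z \<in> {1, -1}" by (simp add: power2_eq_1_iff)
  qed
  then have "finite ((\<lambda>s. g1 s / g2 s) ` S)" by (rule finite_subset) simp
  moreover have "continuous_on S (\<lambda>s. g1 s / g2 s)" using c nz by (intro continuous_intros) auto
  ultimately have "(\<lambda>s. g1 s / g2 s) constant_on S" using continuous_finite_range_constant[OF S(1)] by blast
  then have "g1 q / g2 q = g1 p / g2 p" using S unfolding constant_on_def by metis
  then show ?thesis using eq nz[OF S(2)] nz[OF S(3)] by (simp add: field_simps)
qed

section \<open>Derivatives of the flow and the determinant of Z\<close>

lemma xt_derivative: "(xt om b t y has_derivative (\<lambda>d. sg om t *\<^sub>R d)) (at \<eta> within U)"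
  unfolding xt_eq[abs_def] by (auto intro!: derivative_eq_intros)

definition DAv :: "real \<Rightarrow> R2 \<Rightarrow> R2 \<Rightarrow> R2" where
  "DAv b x v = (dA1 b x * fst v + dA2 b x * snd v, dA2 b x * fst v - dA1 b x * snd v)"

lemma xit_derivative:
  assumes "xt om b t y \<eta> \<noteq> 0"
  shows "(xit om b t y has_derivative (\<lambda>d. cos (om * t) *\<^sub>R d + sg om t *\<^sub>R DAv b (xt om b t y \<eta>) d)) (at \<eta>)"
proof -
  have "(xdot om b t y has_derivative (\<lambda>d. cos (om * t) *\<^sub>R d)) (at \<eta>)"
    unfolding xdot_def[abs_def] by (auto intro!: derivative_eq_intros)
  moreover have "((\<lambda>\<eta>. Avec b (xt om b t y \<eta>)) has_derivative (\<lambda>d. DAv b (xt om b t y \<eta>) (sg om t *\<^sub>R d))) (at \<eta>)"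
    using has_derivative_compose[OF xt_derivative Avec_derivative[OF assms]] by (simp add: DAv_def)
  ultimately have "((\<lambda>\<eta>. xdot om b t y \<eta> + Avec b (xt om b t y \<eta>)) has_derivative (\<lambda>d. cos (om * t) *\<^sub>R d + DAv b (xt om b t y \<eta>) (sg om t *\<^sub>R d))) (at \<eta>)"
    by (rule has_derivative_add)
  moreover have "DAv b x (r *\<^sub>R d) = r *\<^sub>R DAv b x d" for x r d by (simp add: DAv_def algebra_simps)
  ultimately show ?thesis unfolding xit_def[abs_def] by simp
qed

text \<open>Z equals m times the identity plus s times the Jacobian of A, which is symmetric and
  trace-free with square (b/|x|^2)^2.\<close>

lemma detZ_eq:
  assumes "xt om b t y \<eta> \<noteq> 0"
  shows "detZ om b B t y \<eta> = (mm om B t)^2 - (of_real (sg om t * (b / (norm (xt om b t y \<eta>))^2)))^2"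
proof -
  let ?x = "xt om b t y \<eta>"
  have Z: "Zent om b B t y \<eta> i j = of_real (comp2 i (cos (om * t) *\<^sub>R e2 j + sg om t *\<^sub>R DAv b ?x (e2 j))) - \<i> * of_real B * of_real (comp2 i (sg om t *\<^sub>R e2 j))" for i j
    unfolding Zent_def pd_eq[OF xit_derivative[OF assms]] pd_eq[OF xt_derivative] ..
  have "detZ om b B t y \<eta> = (mm om B t)^2 - of_real ((sg om t)^2 * ((dA1 b ?x)^2 + (dA2 b ?x)^2))"
    unfolding detZ_def Z mm_def comp2_def e2_def DAv_def by (simp add: algebra_simps power2_eq_square)
  also have "\<dots> = (mm om B t)^2 - (of_real (sg om t * (b / (norm ?x)^2)))^2"
    unfolding dA_square_sum[OF assms] by (simp only: power_mult_distrib of_real_mult of_real_power)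
  finally show ?thesis .
qed

lemma mm_nonzero:
  assumes "om > 0" "B > 0" shows "mm om B t \<noteq> 0"
proof
  assume "mm om B t = 0"
  then have "cos (om * t) = 0" "sg om t = 0" using assms by (auto simp: mm_def complex_eq_iff)
  then show False using sg_cos[OF assms(1), of t] by simp
qed

text \<open>For \<open>s \<noteq> 0\<close> the number \<open>i s m\<close> has positive real part, so \<open>1 - (s\<beta>/m)\<^sup>2\<close> avoids the cut of
  the principal square root: a global formula for the branch that is continuous in time.\<close>
lemma root_branch:
  assumes om: "om > 0" and B: "B > 0"
  shows "1 - (of_real (sg om t * \<beta>) / mm om B t)^2 \<notin> \<real>\<^sub>\<le>\<^sub>0"
proof (cases "sg om t = 0")
  case True
  then show ?thesis by simp
next
  case False
  define \<kappa> where "\<kappa> = \<i> * of_real (sg om t) * mm om B t"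
  have "Re \<kappa> = B * (sg om t)^2" by (simp add: \<kappa>_def mm_def power2_eq_square)
  then have k: "Re \<kappa> > 0" using B False by simp
  have "1 + of_real ((sg om t)^2 * \<beta>)^2 / \<kappa>^2 = 1 - (of_real (sg om t * \<beta>) / mm om B t)^2"
    using False mm_nonzero[OF om B, of t] by (simp add: \<kappa>_def field_simps power2_eq_square)
  then show ?thesis using branch_avoids_cut[OF k, of "((sg om t)^2 * \<beta>)^2"] by simp
qed

text \<open>The definite description needs existence and uniqueness of a continuous root starting at
  1. The principal-root formula is such a root because its argument never meets the cut;
  connectedness of the time segment excludes any other.\<close>

lemma sqrtdetZ_eq:
  assumes om: "om > 0" and B: "B > 0" and nz: "\<And>s. s \<in> closed_segment 0 t \<Longrightarrow> xt om b s y \<eta> \<noteq> 0"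
  shows "sqrtdetZ om b B t y \<eta> = mm om B t * csqrt (1 - (of_real (sg om t * (b / (norm (xt om b t y \<eta>))^2)) / mm om B t)^2)"
proof -
  define G where "G s = mm om B s * csqrt (1 - (of_real (sg om s * (b / (norm (xt om b s y \<eta>))^2)) / mm om B s)^2)" for s
  have Gsq: "(G s)^2 = detZ om b B s y \<eta>" if "s \<in> closed_segment 0 t" for s
    unfolding detZ_eq[OF nz[OF that]] G_def using mm_nonzero[OF om B, of s] by (simp add: power_mult_distrib field_simps)
  have G0: "G 0 = 1" by (simp add: G_def mm_def sg_def)
  have Gnz: "G s \<noteq> 0" for s using root_branch[OF om B, of s "b / (norm (xt om b s y \<eta>))^2"] mm_nonzero[OF om B, of s]
    by (auto simp: G_def)
  have csg: "continuous_on A (sg om)" for A unfolding sg_def[abs_def] divide_inverse by (intro continuous_intros)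
  have cmm: "continuous_on A (mm om B)" for A unfolding mm_def[abs_def] by (intro continuous_intros csg)
  have Gc: "continuous_on (closed_segment 0 t) G"
    unfolding G_def[abs_def]
  proof (intro continuous_on_mult cmm)
    have "continuous_on (- \<real>\<^sub>\<le>\<^sub>0) csqrt"
      by (intro continuous_at_imp_continuous_on ballI) (use continuous_at_csqrt in auto)
    then show "continuous_on (closed_segment 0 t) (\<lambda>s. csqrt (1 - (of_real (sg om s * (b / (norm (xt om b s y \<eta>))^2)) / mm om B s)^2))"
    proof (rule continuous_on_compose2)
      show "continuous_on (closed_segment 0 t) (\<lambda>s. 1 - (of_real (sg om s * (b / (norm (xt om b s y \<eta>))^2)) / mm om B s)^2)"
        using mm_nonzero[OF om B] nz by (auto intro!: continuous_intros csg cmm continuous_on_xt)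
    qed (use root_branch[OF om B] in blast)
  qed
  show ?thesis unfolding sqrtdetZ_def
  proof (rule the_equality)
    show "\<exists>g. continuous_on (closed_segment 0 t) g \<and> g 0 = 1 \<and> (\<forall>s\<in>closed_segment 0 t. (g s)\<^sup>2 = detZ om b B s y \<eta>) \<and>
        g t = mm om B t * csqrt (1 - (of_real (sg om t * (b / (norm (xt om b t y \<eta>))^2)) / mm om B t)^2)"
      using Gc G0 Gsq by (intro exI[of _ G]) (auto simp: G_def)
  next
    fix w assume "\<exists>g. continuous_on (closed_segment 0 t) g \<and> g 0 = 1 \<and> (\<forall>s\<in>closed_segment 0 t. (g s)\<^sup>2 = detZ om b B s y \<eta>) \<and> g t = w"
    then obtain g where g: "continuous_on (closed_segment 0 t) g" "g 0 = 1" "\<And>s. s \<in> closed_segment 0 t \<Longrightarrow> (g s)\<^sup>2 = detZ om b B s y \<eta>" "g t = w"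
      by blast
    have "g t = G t"
      by (rule continuous_root_unique[of "closed_segment 0 t" 0 t]) (use g Gc G0 Gsq Gnz in auto)
    then show "w = mm om B t * csqrt (1 - (of_real (sg om t * (b / (norm (xt om b t y \<eta>))^2)) / mm om B t)^2)"
      using g by (simp add: G_def)
  qed
qed

section \<open>Derivatives of the action and of the phase\<close>

lemma initial_from_final:
  assumes "om > 0"
  shows "y = cos (om * t) *\<^sub>R xt om b t y \<eta> - sg om t *\<^sub>R xdot om b t y \<eta>"
proof -
  have "cos (om * t) *\<^sub>R xt om b t y \<eta> - sg om t *\<^sub>R xdot om b t y \<eta> = ((cos (om * t))^2 + om^2 * (sg om t)^2) *\<^sub>R y"
    unfolding xt_eq xdot_eq[OF assms] by (simp add: algebra_simps power2_eq_square)
  then show ?thesis unfolding sg_cos[OF assms] by simp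
qed

text \<open>The classical identity that the action varies by the final momentum paired with the
  displacement of the end point, for fixed initial position. The swept angle supplies the
  vector-potential part of the momentum.\<close>

lemma action_derivative:
  assumes om: "om > 0" and U: "open U" "convex U" "\<eta>0 \<in> U"
    and nz: "\<And>s \<eta>. s \<in> closed_segment 0 t \<Longrightarrow> \<eta> \<in> U \<Longrightarrow> xt om b s y \<eta> \<noteq> 0"
  shows "(action om b t y has_derivative (\<lambda>d. sg om t * (xit om b t y \<eta>0 \<bullet> d))) (at \<eta>0)"
proof -
  let ?x = "xt om b t y" and ?v = "xdot om b t y"
  have dv: "(?v has_derivative (\<lambda>d. cos (om * t) *\<^sub>R d)) (at \<eta>0)"
    unfolding xdot_def[abs_def] by (auto intro!: derivative_eq_intros)
  have dy: "((\<lambda>\<eta>. y \<bullet> (\<eta> - Avec b y)) has_derivative (\<lambda>d. y \<bullet> d)) (at \<eta>0)"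
    by (auto intro!: derivative_eq_intros)
  have "((\<lambda>\<eta>. (?x \<eta> \<bullet> ?v \<eta> - y \<bullet> (\<eta> - Avec b y)) * (1/2) + b * swept om b t y \<eta>) has_derivative
     (\<lambda>d. (?x \<eta>0 \<bullet> (cos (om * t) *\<^sub>R d) + (sg om t *\<^sub>R d) \<bullet> ?v \<eta>0 - y \<bullet> d) * (1/2) + b * (sg om t * wedge (?x \<eta>0) d / (norm (?x \<eta>0))^2))) (at \<eta>0)"
    by (intro has_derivative_add has_derivative_mult_left has_derivative_mult_right has_derivative_diff
        has_derivative_inner xt_derivative dv dy swept_derivative[OF om U nz])
  moreover have "(?x \<eta>0 \<bullet> (cos (om * t) *\<^sub>R d) + (sg om t *\<^sub>R d) \<bullet> ?v \<eta>0 - y \<bullet> d) * (1/2) + b * (sg om t * wedge (?x \<eta>0) d / (norm (?x \<eta>0))^2)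
     = sg om t * (xit om b t y \<eta>0 \<bullet> d)" for d
  proof -
    have "y \<bullet> d = cos (om * t) * (?x \<eta>0 \<bullet> d) - sg om t * (?v \<eta>0 \<bullet> d)"
      by (subst initial_from_final[OF om, of y t b \<eta>0]) (simp add: inner_diff_left)
    moreover have "b * (sg om t * wedge (?x \<eta>0) d / (norm (?x \<eta>0))^2) = sg om t * (Avec b (?x \<eta>0) \<bullet> d)"
      unfolding Avec_eq norm_R2_sq by (simp add: wedge_def inner_prod_def diff_divide_distrib algebra_simps)
    ultimately show ?thesis by (simp add: xit_def inner_add_left inner_commute algebra_simps)
  qed
  ultimately have d: "((\<lambda>\<eta>. (?x \<eta> \<bullet> ?v \<eta> - y \<bullet> (\<eta> - Avec b y)) * (1/2) + b * swept om b t y \<eta>) has_derivative (\<lambda>d. sg om t * (xit om b t y \<eta>0 \<bullet> d))) (at \<eta>0)"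
    by simp
  show ?thesis
    by (rule has_derivative_transform_within_open[OF d U(1,3)]) (use action_eq[OF om] nz in auto)
qed

text \<open>The variation of the action cancels against the momentum paired with the moving end
  point. What remains is (x - \<open>x\<^sup>t\<close>) . Z d, so the gradient vanishes where the
  trajectory ends at x.\<close>

lemma phi_derivative:
  assumes om: "om > 0" and U: "open U" "convex U" "\<eta>0 \<in> U"
    and nz: "\<And>s \<eta>. s \<in> closed_segment 0 t \<Longrightarrow> \<eta> \<in> U \<Longrightarrow> xt om b s y \<eta> \<noteq> 0"
  shows "(phi om b B t x y has_derivative (\<lambda>d. mm om B t * of_real ((x - xt om b t y \<eta>0) \<bullet> d)
     + of_real (sg om t * ((x - xt om b t y \<eta>0) \<bullet> DAv b (xt om b t y \<eta>0) d)))) (at \<eta>0)"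
proof -
  let ?x = "xt om b t y" and ?xi = "xit om b t y"
  have nz0: "?x \<eta>0 \<noteq> 0" by (rule nz[OF _ U(3)]) simp
  have dx: "((\<lambda>\<eta>. x - ?x \<eta>) has_derivative (\<lambda>d. - (sg om t *\<^sub>R d))) (at \<eta>0)"
    by (rule has_derivative_eq_rhs[OF has_derivative_diff[OF has_derivative_const xt_derivative]]) simp
  have "(phi om b B t x y has_derivative (\<lambda>d. of_real (sg om t * (?xi \<eta>0 \<bullet> d))
     + of_real ((x - ?x \<eta>0) \<bullet> (cos (om * t) *\<^sub>R d + sg om t *\<^sub>R DAv b (?x \<eta>0) d) + (- (sg om t *\<^sub>R d)) \<bullet> ?xi \<eta>0)
     + \<i> * of_real B * of_real ((x - ?x \<eta>0) \<bullet> (- (sg om t *\<^sub>R d)) + (- (sg om t *\<^sub>R d)) \<bullet> (x - ?x \<eta>0)) / 2)) (at \<eta>0)"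
    unfolding phi_def[abs_def] power2_norm_eq_inner divide_inverse
    by (intro has_derivative_add has_derivative_of_real has_derivative_mult_left has_derivative_mult_right
        action_derivative[OF om U nz] has_derivative_inner dx xit_derivative[OF nz0])
  then show ?thesis
    by (rule has_derivative_eq_rhs) (simp add: fun_eq_iff mm_def inner_add_right inner_commute field_simps)
qed

lemma etastar_offset:
  assumes "om > 0" "sin (om * t) \<noteq> 0"
  shows "xt om b t y \<eta> = x + sg om t *\<^sub>R (\<eta> - etastar om b t x y)"
proof -
  have "sg om t *\<^sub>R (etastar om b t x y - Avec b y) = x - cos (om * t) *\<^sub>R y"
    using assms by (simp add: sg_def etastar_def)
  then have "cos (om * t) *\<^sub>R y = x - sg om t *\<^sub>R (etastar om b t x y - Avec b y)" by (simp add: algebra_simps)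
  then show ?thesis unfolding xt_eq by (simp add: algebra_simps)
qed

text \<open>A given lift is compared with the one obtained by integrating the angular velocity.
  Their difference takes values in the integer multiples of pi and is continuous, hence constant, so
  the swept angle is the increment of the lift.\<close>

lemma action_lift_formula:
  assumes om: "om > 0" and sin: "sin (om * t) \<noteq> 0"
    and nz: "\<And>s. s \<in> closed_segment 0 t \<Longrightarrow> xt om b s y (etastar om b t x y) \<noteq> 0"
    and lift: "continuous_on (closed_segment 0 t) lift"
      "\<And>s. s \<in> closed_segment 0 t \<Longrightarrow> xt om b s y (etastar om b t x y)
            = norm (xt om b s y (etastar om b t x y)) *\<^sub>R (cos (lift s), sin (lift s))"
  shows "action om b t y (etastar om b t x y)
          = om / (2 * sin (om * t)) * (cos (om * t) * ((norm x)^2 + (norm y)^2) - 2 * inner x y)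
            + b * (lift t - lift 0)"
proof -
  define \<eta> where "\<eta> = etastar om b t x y"
  let ?x = "\<lambda>s. xt om b s y \<eta>" and ?v = "\<lambda>s. xdot om b s y \<eta>" and ?W = "wedge y (\<eta> - Avec b y)"
  note nz = nz[folded \<eta>_def] and lift = lift[folded \<eta>_def]
  have seg: "t * \<tau> \<in> closed_segment 0 t" if "\<tau> \<in> {0..1}" for \<tau> using that by (auto simp: closed_segment_zero_eq)
  have xt: "?x t = x" using etastar_offset[OF om sin, of b y \<eta> x] by (simp add: \<eta>_def)
  define f where "f \<tau> = t * (?W / (norm (?x (t * \<tau>)))^2)" for \<tau>
  \<comment> \<open>The candidate lift: the initial angle plus the swept angle up to rescaled time
    \<tau>.\<close>
  define l where "l \<tau> = lift 0 + integral {0..\<tau>} f" for \<tau>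
  have cx: "continuous_on {0..1} (\<lambda>\<tau>. ?x (t * \<tau>))"
    by (rule continuous_on_compose2[OF continuous_on_xt[of UNIV]]) (auto intro!: continuous_intros)
  have cf: "continuous_on {0..1} f"
    unfolding f_def by (intro continuous_intros cx) (use nz seg in auto)
  have dl: "(l has_vector_derivative f \<tau>) (at \<tau> within {0..1})" if "\<tau> \<in> {0..1}" for \<tau>
    unfolding l_def[abs_def]
    using has_vector_derivative_add[OF has_vector_derivative_const integral_has_vector_derivative[OF cf that]] by simp
  define z where "z \<tau> = complex_of_real (fst (?x (t * \<tau>))) + \<i> * of_real (snd (?x (t * \<tau>)))" for \<tau>
  define n where "n \<tau> = (norm (?x (t * \<tau>)))^2" for \<tau>
  \<comment> \<open>The squared direction of the position, rotated back by twice the candidate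
    angle. Squaring allows |x|^2 to be used in place of |x|, at the price of determining angles only
    modulo pi.\<close>
  define V where "V \<tau> = z \<tau> * z \<tau> * (exp (- 2 * \<i> * of_real (l \<tau>)) * of_real (inverse (n \<tau>)))" for \<tau>
  have "(V has_vector_derivative 0) (at \<tau> within {0..1})" if \<tau>: "\<tau> \<in> {0..1}" for \<tau>
  proof -
    let ?X = "?x (t * \<tau>)" and ?Y = "?v (t * \<tau>)"
    let ?E = "exp (- 2 * \<i> * of_real (l \<tau>))"
    have nz0: "n \<tau> \<noteq> 0" using nz[OF seg[OF \<tau>]] by (simp add: n_def)
    have m: "((\<lambda>\<tau>. t * \<tau>) has_vector_derivative t) (at \<tau> within {0..1})"
      by (auto intro!: derivative_eq_intros simp: has_real_derivative_iff_has_vector_derivative[symmetric])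
    have dx: "((\<lambda>\<tau>. ?x (t * \<tau>)) has_vector_derivative t *\<^sub>R ?Y) (at \<tau> within {0..1})"
      using vector_diff_chain_within[OF m xt_time_derivative[OF om]] by (simp add: o_def)
    have bl: "bounded_linear (\<lambda>u::R2. complex_of_real (fst u) + \<i> * of_real (snd u))"
      by (intro bounded_linear_add bounded_linear_const_mult bounded_linear_of_real[THEN bounded_linear_compose] bounded_linear_fst bounded_linear_snd)
    have dz: "(z has_vector_derivative (of_real (t * fst ?Y) + \<i> * of_real (t * snd ?Y))) (at \<tau> within {0..1})"
      unfolding z_def[abs_def] using bounded_linear.has_vector_derivative[OF bl dx] by simp
    have dn: "(n has_field_derivative t * (2 * (?X \<bullet> ?Y))) (at \<tau> within {0..1})"
      unfolding n_def[abs_def] power2_norm_eq_inner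
      using bounded_bilinear.has_vector_derivative[OF bounded_bilinear_inner dx dx]
      by (simp add: has_real_derivative_iff_has_vector_derivative inner_commute algebra_simps)
    have di: "((\<lambda>\<tau>. complex_of_real (inverse (n \<tau>))) has_vector_derivative of_real (- (inverse (n \<tau>) * (t * (2 * (?X \<bullet> ?Y))) * inverse (n \<tau>)))) (at \<tau> within {0..1})"
      by (rule has_vector_derivative_of_real[OF DERIV_inverse'[OF dn nz0]])
    have dE: "((\<lambda>\<tau>. exp (- 2 * \<i> * of_real (l \<tau>))) has_vector_derivative (- 2 * \<i> * of_real (f \<tau>)) * ?E) (at \<tau> within {0..1})"
    proof -
      have "((\<lambda>\<tau>. - 2 * \<i> * of_real (l \<tau>)) has_vector_derivative (- 2 * \<i> * of_real (f \<tau>))) (at \<tau> within {0..1})"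
        by (intro has_vector_derivative_mult_right has_vector_derivative_of_real)
          (simp only: has_real_derivative_iff_has_vector_derivative, rule dl[OF \<tau>])
      from field_vector_diff_chain_within[OF this, of exp ?E] show ?thesis
        by (simp add: o_def DERIV_subset[OF DERIV_exp])
    qed
    have dV: "(V has_vector_derivative ((z \<tau> * z \<tau>) * (?E * of_real (- (inverse (n \<tau>) * (t * (2 * (?X \<bullet> ?Y))) * inverse (n \<tau>))) + ((- 2 * \<i> * of_real (f \<tau>)) * ?E) * of_real (inverse (n \<tau>)))
        + (z \<tau> * (of_real (t * fst ?Y) + \<i> * of_real (t * snd ?Y)) + (of_real (t * fst ?Y) + \<i> * of_real (t * snd ?Y)) * z \<tau>) * (?E * of_real (inverse (n \<tau>))))) (at \<tau> within {0..1})"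
      unfolding V_def[abs_def] by (intro has_vector_derivative_mult dz dE di)
    \<comment> \<open>The logarithmic derivative of the complex position: its real part is radial
      and its imaginary part is the angular velocity, by conservation of angular momentum.\<close>
    have conv: "of_real (n \<tau>) * (of_real (t * fst ?Y) + \<i> * of_real (t * snd ?Y)) = of_real t * (of_real (?X \<bullet> ?Y) + \<i> * of_real ?W) * z \<tau>"
      unfolding wedge_conserved[OF om, of b "t * \<tau>" y \<eta>, symmetric] n_def z_def norm_R2_sq
      by (simp add: complex_eq_iff wedge_def inner_prod_def power2_eq_square algebra_simps)
    have fn: "f \<tau> = t * ?W / n \<tau>" by (simp add: f_def n_def)
    define D where "D = of_real (t * fst ?Y) + \<i> * complex_of_real (t * snd ?Y)"
    define N where "N = complex_of_real (n \<tau>)"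
    have Nnz: "N \<noteq> 0" using nz0 by (simp add: N_def)
    have "N * D = of_real t * (of_real (?X \<bullet> ?Y) + \<i> * of_real ?W) * z \<tau>" using conv by (simp only: N_def D_def)
    then have D: "D = of_real t * (of_real (?X \<bullet> ?Y) + \<i> * of_real ?W) * z \<tau> / N" using Nnz by (simp add: field_simps)
    have "(z \<tau> * z \<tau>) * (?E * of_real (- (inverse (n \<tau>) * (t * (2 * (?X \<bullet> ?Y))) * inverse (n \<tau>))) + ((- 2 * \<i> * of_real (f \<tau>)) * ?E) * of_real (inverse (n \<tau>)))
        + (z \<tau> * D + D * z \<tau>) * (?E * of_real (inverse (n \<tau>))) = 0"
      unfolding D fn of_real_minus of_real_mult of_real_inverse of_real_divide N_def[symmetric] of_real_numeral
      using Nnz by (simp add: field_simps)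
    then show ?thesis using dV unfolding D_def by simp
  qed
  then have V: "V \<tau> = V 0" if "\<tau> \<in> {0..1}" for \<tau>
    using has_vector_derivative_zero_constant[of "{0..1::real}" V] that by (metis atLeastAtMost_iff convex_real_interval(5) order_refl zero_le_one)
  have Ve: "V \<tau> = exp (2 * \<i> * of_real (lift (t * \<tau>) - l \<tau>))" if \<tau>: "\<tau> \<in> {0..1}" for \<tau>
  proof -
    let ?L = "lift (t * \<tau>)" and ?r = "norm (?x (t * \<tau>))"
    have r: "?r \<noteq> 0" using nz[OF seg[OF \<tau>]] by simp
    have "fst (?x (t * \<tau>)) = ?r * cos ?L" "snd (?x (t * \<tau>)) = ?r * sin ?L"
      using arg_cong[OF lift(2)[OF seg[OF \<tau>]], of fst] arg_cong[OF lift(2)[OF seg[OF \<tau>]], of snd] by simp_all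
    then have "z \<tau> = of_real ?r * exp (\<i> * of_real ?L)"
      unfolding z_def exp_Euler by (simp add: algebra_simps cos_of_real sin_of_real)
    then have "V \<tau> = (of_real ?r * of_real ?r * of_real (inverse (?r^2))) * (exp (\<i> * of_real ?L) * exp (\<i> * of_real ?L) * exp (- 2 * \<i> * of_real (l \<tau>)))"
      unfolding V_def n_def by (simp only: mult_ac)
    also have "of_real ?r * of_real ?r * of_real (inverse (?r^2)) = (1 :: complex)"
      using r by (simp add: power2_eq_square field_simps)
    also have "1 * (exp (\<i> * of_real ?L) * exp (\<i> * of_real ?L) * exp (- 2 * \<i> * of_real (l \<tau>))) = exp (2 * \<i> * of_real (?L - l \<tau>))"
      unfolding exp_add[symmetric] by (simp add: algebra_simps)
    finally show ?thesis .
  qed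
  have l0: "l 0 = lift 0" by (simp add: l_def)
  have one: "exp (2 * \<i> * of_real (lift (t * \<tau>) - l \<tau>)) = 1" if \<tau>: "\<tau> \<in> {0..1}" for \<tau>
    using V[OF \<tau>] Ve[OF \<tau>] Ve[of 0] l0 by simp
  have disc: "\<exists>k::int. lift (t * \<tau>) - l \<tau> = of_int k * pi" if \<tau>: "\<tau> \<in> {0..1}" for \<tau>
  proof -
    obtain k :: int where k: "Im (2 * \<i> * of_real (lift (t * \<tau>) - l \<tau>)) = of_int (2 * k) * pi"
      using one[OF \<tau>] unfolding exp_eq_1 by blast
    then show ?thesis by (intro exI[of _ k]) simp
  qed
  \<comment> \<open>Distinct multiples of pi are at least pi apart, so the range is discrete and
    continuity forces a constant.\<close>
  have "(\<lambda>\<tau>. lift (t * \<tau>) - l \<tau>) constant_on {0..1}"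
  proof (rule continuous_discrete_range_constant)
    have "continuous_on {0..1} l" using dl has_vector_derivative_continuous continuous_on_eq_continuous_within by blast
    moreover have "continuous_on {0..1} (\<lambda>\<tau>. lift (t * \<tau>))"
      by (rule continuous_on_compose2[OF lift(1)]) (use seg in \<open>auto intro!: continuous_intros\<close>)
    ultimately show "continuous_on {0..1} (\<lambda>\<tau>. lift (t * \<tau>) - l \<tau>)" by (intro continuous_intros)
    show "\<exists>e>0. \<forall>\<tau>'. \<tau>' \<in> {0..1} \<and> lift (t * \<tau>') - l \<tau>' \<noteq> lift (t * \<tau>) - l \<tau> \<longrightarrow> e \<le> norm (lift (t * \<tau>') - l \<tau>' - (lift (t * \<tau>) - l \<tau>))"
      if \<tau>: "\<tau> \<in> {0..1}" for \<tau>
    proof (intro exI[of _ pi] conjI allI impI)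
      fix \<tau>' assume h: "\<tau>' \<in> {0..1} \<and> lift (t * \<tau>') - l \<tau>' \<noteq> lift (t * \<tau>) - l \<tau>"
      obtain j k :: int where jk: "lift (t * \<tau>) - l \<tau> = of_int j * pi" "lift (t * \<tau>') - l \<tau>' = of_int k * pi"
        using disc[OF \<tau>] disc[of \<tau>'] h by blast
      then have "k \<noteq> j" using h by auto
      then have "1 \<le> \<bar>real_of_int (k - j)\<bar>" by linarith
      then have "1 * pi \<le> \<bar>real_of_int (k - j)\<bar> * pi" by (intro mult_right_mono) auto
      then show "pi \<le> norm (lift (t * \<tau>') - l \<tau>' - (lift (t * \<tau>) - l \<tau>))"
        unfolding jk by (simp add: abs_mult left_diff_distrib[symmetric] del: of_int_diff flip: of_int_diff)
    qed simp
  qed simp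
  then have "lift (t * 1) - l 1 = lift (t * 0) - l 0" unfolding constant_on_def by (metis atLeastAtMost_iff order_refl zero_le_one)
  then have "integral {0..1} f = lift t - lift 0" unfolding l_def by simp
  then have sw: "swept om b t y \<eta> = lift t - lift 0" unfolding swept_def f_def .
  have w: "\<eta> - Avec b y = (om / sin (om * t)) *\<^sub>R (x - cos (om * t) *\<^sub>R y)" by (simp add: \<eta>_def etastar_def)
  have "(x \<bullet> ?v t - y \<bullet> (\<eta> - Avec b y)) / 2 = om / (2 * sin (om * t)) * (cos (om * t) * ((norm x)^2 + (norm y)^2) - 2 * inner x y)"
  proof -
    define S C where "S = sin (om * t)" and "C = cos (om * t)"
    have SC: "S * S + C * C = 1" unfolding S_def C_def by (metis power2_eq_square sin_cos_squared_add)
    have Snz: "S \<noteq> 0" using sin by (simp add: S_def)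
    have "x \<bullet> ?v t - y \<bullet> (\<eta> - Avec b y) = - om * S * (x \<bullet> y) + C * (om / S * (x \<bullet> x - C * (x \<bullet> y))) - om / S * (y \<bullet> x - C * (y \<bullet> y))"
      unfolding xdot_def w S_def[symmetric] C_def[symmetric] by (simp add: inner_add_right inner_diff_right algebra_simps)
    also have "\<dots> = om / S * (C * (x \<bullet> x + y \<bullet> y) - (S * S + C * C + 1) * (x \<bullet> y))"
      using Snz by (simp add: inner_commute field_simps)
    finally show ?thesis unfolding SC power2_norm_eq_inner S_def[symmetric] C_def[symmetric] using Snz by (simp add: field_simps)
  qed
  then show ?thesis using action_eq[OF om nz, of t] sw unfolding xt \<eta>_def[symmetric] by simp
qed

subsection \<open>The phase near its critical point\<close>

lemma dA_differentiable:
  assumes "x \<noteq> 0" shows "dA1 b differentiable (at x)" "dA2 b differentiable (at x)"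
  unfolding dA1_def[abs_def] dA2_def[abs_def]
  by (intro differentiable_divide differentiable_mult differentiable_power differentiable_add differentiable_diff
      differentiable_const bounded_linear_imp_differentiable bounded_linear_fst bounded_linear_snd;
      use R2_sq_nonzero[OF assms] in simp)+

lemma DAv_norm:
  assumes "x \<noteq> 0" shows "norm (DAv b x v) = \<bar>b\<bar> / (norm x)^2 * norm v"
proof -
  have "(norm (DAv b x v))^2 = ((dA1 b x)^2 + (dA2 b x)^2) * (norm v)^2"
    unfolding norm_R2_sq DAv_def by (simp add: power2_eq_square algebra_simps)
  also have "\<dots> = (\<bar>b\<bar> / (norm x)^2 * norm v)^2"
    unfolding dA_square_sum[OF assms] by (simp add: power_mult_distrib power_divide)
  finally show ?thesis by (rule power2_eq_imp_eq) auto
qed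

text \<open>The zero angular momentum set \<open>Nu i\<close> below contains every initial momentum whose trajectory
  meets the origin; elsewhere, and on the \<open>\<delta>\<close>-ball around \<open>\<eta>\<^sub>*\<close>, all objects are smooth.\<close>
locale caustic_free =
  fixes om b B \<delta> \<rho> X s0 :: real and K :: "(real \<times> R2 \<times> R2) set"
  assumes om: "om > 0" and B: "B > 0" and \<delta>: "\<delta> > 0" and \<rho>: "\<rho> > 0" and s0: "s0 > 0"
    and away: "\<And>t x y s \<eta>. (t, x, y) \<in> K \<Longrightarrow> s \<in> closed_segment 0 t \<Longrightarrow> norm (\<eta> - etastar om b t x y) < \<delta> \<Longrightarrow> \<rho> \<le> norm (xt om b s y \<eta>)"
    and sg_lower: "\<And>t x y. (t, x, y) \<in> K \<Longrightarrow> s0 \<le> \<bar>sg om t\<bar>"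
    and bounds: "\<And>t x y. (t, x, y) \<in> K \<Longrightarrow> \<bar>t\<bar> \<le> X \<and> norm x \<le> X \<and> norm y \<le> X \<and> norm (etastar om b t x y) \<le> X"
begin

definition ctr :: "real \<times> R2 \<times> R2 \<Rightarrow> R2" where "ctr i = etastar om b (fst i) (fst (snd i)) (snd (snd i))"
definition sgi :: "real \<times> R2 \<times> R2 \<Rightarrow> real" where "sgi i = sg om (fst i)"
definition mmi :: "real \<times> R2 \<times> R2 \<Rightarrow> complex" where "mmi i = mm om B (fst i)"
definition px :: "real \<times> R2 \<times> R2 \<Rightarrow> R2" where "px i = fst (snd i)"
definition py :: "real \<times> R2 \<times> R2 \<Rightarrow> R2" where "py i = snd (snd i)"
definition pos :: "real \<times> R2 \<times> R2 \<Rightarrow> R2 \<Rightarrow> R2" where "pos i \<eta> = xt om b (fst i) (py i) \<eta>"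
definition nbhd :: "real \<times> R2 \<times> R2 \<Rightarrow> R2 set" where "nbhd i = ball (ctr i) \<delta>"
definition ph :: "real \<times> R2 \<times> R2 \<Rightarrow> R2 \<Rightarrow> complex" where "ph i = phi om b B (fst i) (px i) (py i)"
definition Rr :: "real \<times> R2 \<times> R2 \<Rightarrow> R2 \<Rightarrow> real" where "Rr i \<eta> = Re (phi3 om b B (fst i) (px i) (py i) \<eta>)"
text \<open>With \<open>kap\<close>, \<open>aa\<close> and \<open>bb\<close> the Hessian -s (m + s
  DA(x)) takes the form i [[kap + i aa, i bb], [i bb, kap - i aa]] of the abstract phase
  family.\<close>

definition kap :: "real \<times> R2 \<times> R2 \<Rightarrow> complex" where "kap i = \<i> * of_real (sgi i) * mmi i"
definition aa :: "real \<times> R2 \<times> R2 \<Rightarrow> real" where "aa i = (sgi i)^2 * dA1 b (px i)"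
definition bb :: "real \<times> R2 \<times> R2 \<Rightarrow> real" where "bb i = (sgi i)^2 * dA2 b (px i)"
definition Nu :: "real \<times> R2 \<times> R2 \<Rightarrow> R2 set" where "Nu i = {\<eta>. wedge (py i) (\<eta> - Avec b (py i)) = 0}"
definition Ni :: "real \<times> R2 \<times> R2 \<Rightarrow> nat \<Rightarrow> nat \<Rightarrow> complex" where "Ni i = inv2 (hess om b B (fst i) (px i) (py i))"

lemma open_nbhd: "open (nbhd i)" by (simp add: nbhd_def)

lemma nbhd_iff: "\<eta> \<in> nbhd i \<longleftrightarrow> norm (\<eta> - ctr i) < \<delta>"
  by (simp add: nbhd_def dist_norm norm_minus_commute)

lemma ctr_nbhd: "ctr i \<in> nbhd i" using \<delta> by (simp add: nbhd_def)

lemma away_i: "i \<in> K \<Longrightarrow> s \<in> closed_segment 0 (fst i) \<Longrightarrow> \<eta> \<in> nbhd i \<Longrightarrow> \<rho> \<le> norm (xt om b s (py i) \<eta>)"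
  using away[of "fst i" "fst (snd i)" "snd (snd i)"] by (simp add: nbhd_iff ctr_def py_def)

lemma pos_lower: "i \<in> K \<Longrightarrow> \<eta> \<in> nbhd i \<Longrightarrow> \<rho> \<le> norm (pos i \<eta>)"
  unfolding pos_def by (rule away_i) auto

lemma nz_i: "i \<in> K \<Longrightarrow> s \<in> closed_segment 0 (fst i) \<Longrightarrow> \<eta> \<in> nbhd i \<Longrightarrow> xt om b s (py i) \<eta> \<noteq> 0"
  using away_i \<rho> by fastforce

lemma pos_nz: "i \<in> K \<Longrightarrow> \<eta> \<in> nbhd i \<Longrightarrow> pos i \<eta> \<noteq> 0"
  using pos_lower \<rho> by fastforce

lemma sgi_lower: "i \<in> K \<Longrightarrow> s0 \<le> \<bar>sgi i\<bar>"
  using sg_lower[of "fst i" "fst (snd i)" "snd (snd i)"] by (simp add: sgi_def)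

lemma sgi_nz: "i \<in> K \<Longrightarrow> sgi i \<noteq> 0" using sgi_lower s0 by fastforce

lemma sgi_upper: "\<bar>sgi i\<bar> \<le> 1 / om"
  using om by (simp add: sgi_def sg_def abs_divide divide_right_mono)

lemma mmi_nz: "mmi i \<noteq> 0" unfolding mmi_def by (rule mm_nonzero[OF om B])

lemma mmi_upper: "norm (mmi i) \<le> 1 + B / om"
proof -
  have "norm (mmi i) \<le> \<bar>cos (om * fst i)\<bar> + \<bar>B * sgi i\<bar>"
    unfolding mmi_def mm_def sgi_def by (rule order_trans[OF norm_triangle_ineq4]) (simp add: norm_mult)
  also have "\<dots> \<le> 1 + B * (1 / om)"
    unfolding abs_mult using B sgi_upper by (intro add_mono mult_mono) auto
  finally show ?thesis by simp
qed

lemma mmi_lower: assumes "i \<in> K" shows "B * s0 \<le> norm (mmi i)"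
proof -
  have "B * s0 \<le> B * \<bar>sgi i\<bar>" using sgi_lower[OF assms] B by simp
  also have "\<dots> = \<bar>Im (mmi i)\<bar>" using B by (simp add: mmi_def mm_def sgi_def abs_mult)
  also have "\<dots> \<le> norm (mmi i)" by (rule abs_Im_le_cmod)
  finally show ?thesis .
qed

lemma bounds_i: "i \<in> K \<Longrightarrow> \<bar>fst i\<bar> \<le> X \<and> norm (px i) \<le> X \<and> norm (py i) \<le> X \<and> norm (ctr i) \<le> X"
  using bounds[of "fst i" "fst (snd i)" "snd (snd i)"] by (simp add: px_def py_def ctr_def)

lemma pos_eq: "i \<in> K \<Longrightarrow> pos i \<eta> = px i + sgi i *\<^sub>R (\<eta> - ctr i)"
  using etastar_offset[OF om, of "fst i" b "py i" \<eta> "px i"] sgi_nz[of i]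
  by (simp add: pos_def ctr_def px_def py_def sgi_def sg_def)

lemma pos_upper: assumes "i \<in> K" "\<eta> \<in> nbhd i" shows "norm (pos i \<eta>) \<le> X + \<delta> / om"
proof -
  have "norm (pos i \<eta>) \<le> norm (px i) + \<bar>sgi i\<bar> * norm (\<eta> - ctr i)"
    unfolding pos_eq[OF assms(1)] by (rule order_trans[OF norm_triangle_ineq]) simp
  also have "\<dots> \<le> X + 1 / om * \<delta>"
    using bounds_i[OF assms(1)] sgi_upper assms(2) om by (intro add_mono mult_mono) (auto simp: nbhd_iff)
  finally show ?thesis by simp
qed

section \<open>Uniform smoothness near the critical point\<close>

lemma usmooth_family_const:
  assumes "\<And>i. i \<in> K \<Longrightarrow> norm (c i) \<le> C"
  shows "usmooth K nbhd (\<lambda>i _. c i)"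
  unfolding usmooth_def by (intro allI unif_smooth_const[where C = C] assms)

lemma usm_mult:
  fixes f g :: "_ \<Rightarrow> R2 \<Rightarrow> complex"
  shows "usmooth K nbhd f \<Longrightarrow> usmooth K nbhd g \<Longrightarrow> usmooth K nbhd (\<lambda>i p. f i p * g i p)"
  by (rule usmooth_mult) (rule open_nbhd)

lemma usm_add: "usmooth K nbhd f \<Longrightarrow> usmooth K nbhd g \<Longrightarrow> usmooth K nbhd (\<lambda>i p. f i p + g i p)"
  by (rule usmooth_add) (rule open_nbhd)

lemma usm_diff: "usmooth K nbhd f \<Longrightarrow> usmooth K nbhd g \<Longrightarrow> usmooth K nbhd (\<lambda>i p. f i p - g i p)"
  unfolding usmooth_def by (intro allI unif_smooth_diff open_nbhd) auto

lemma usm_cong: "usmooth K nbhd f \<Longrightarrow> (\<And>i p. i \<in> K \<Longrightarrow> p \<in> nbhd i \<Longrightarrow> f i p = g i p) \<Longrightarrow> usmooth K nbhd g"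
  by (rule usmooth_cong[of K nbhd f g]) (auto intro: open_nbhd)

lemma usm_bounded: "usmooth K nbhd f \<Longrightarrow> \<exists>C. \<forall>i\<in>K. \<forall>p\<in>nbhd i. norm (f i p) \<le> C"
  unfolding usmooth_def using unif_smooth_bounded by blast

lemma usm_from_derivative:
  fixes g :: "real \<times> R2 \<times> R2 \<Rightarrow> R2 \<Rightarrow> complex"
  assumes "\<And>i p. i \<in> K \<Longrightarrow> p \<in> nbhd i \<Longrightarrow> norm (g i p) \<le> C"
    and "\<And>i p. i \<in> K \<Longrightarrow> p \<in> nbhd i \<Longrightarrow> (g i has_derivative (\<lambda>v. D v i p)) (at p)"
    and "\<And>v. v \<in> Basis \<Longrightarrow> usmooth K nbhd (D v)"
  shows "usmooth K nbhd g"
  unfolding usmooth_def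
proof
  fix n show "unif_smooth n K nbhd g"
  proof (rule unif_smooth_bootstrap[where D = D])
    show "open (nbhd i)" for i by (rule open_nbhd)
    show "unif_smooth 0 K nbhd g" unfolding unif_smooth.simps using assms(1) by blast
  qed (use assms in \<open>auto simp: usmooth_def\<close>)
qed

lemma usm_coord:
  "usmooth K nbhd (\<lambda>i \<eta>. of_real (fst (pos i \<eta>)) :: complex)" "usmooth K nbhd (\<lambda>i \<eta>. of_real (snd (pos i \<eta>)) :: complex)"
  "usmooth K nbhd (\<lambda>i \<eta>. of_real (fst (\<eta> - ctr i)) :: complex)" "usmooth K nbhd (\<lambda>i \<eta>. of_real (snd (\<eta> - ctr i)) :: complex)"
proof -
  have dp: "(pos i has_derivative (\<lambda>d. sgi i *\<^sub>R d)) (at \<eta>)" for i \<eta>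
    unfolding pos_def[abs_def] sgi_def by (rule xt_derivative)
  have c: "usmooth K nbhd (\<lambda>i _. complex_of_real (sgi i * r))" for r
  proof (rule usmooth_family_const[where C = "1 / om * \<bar>r\<bar>"])
    show "norm (complex_of_real (sgi i * r)) \<le> 1 / om * \<bar>r\<bar>" for i
      unfolding norm_of_real abs_mult by (intro mult_right_mono sgi_upper) simp
  qed
  have c1: "usmooth K nbhd (\<lambda>i _. complex_of_real r)" for r by (rule usmooth_family_const[where C = "\<bar>r\<bar>"]) simp
  have fs: "\<bar>fst (z::R2)\<bar> \<le> norm z" "\<bar>snd (z::R2)\<bar> \<le> norm z" for z
    using norm_fst_le[of "fst z" "snd z"] norm_snd_le[of "snd z" "fst z"] by simp_all
  show "usmooth K nbhd (\<lambda>i \<eta>. of_real (fst (pos i \<eta>)) :: complex)"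
  proof (rule usm_from_derivative[where C = "X + \<delta> / om" and D = "\<lambda>v i _. of_real (sgi i * fst v)"])
    show "norm (complex_of_real (fst (pos i p))) \<le> X + \<delta> / om" if "i \<in> K" "p \<in> nbhd i" for i p
      unfolding norm_of_real by (rule order_trans[OF fs(1) pos_upper[OF that]])
    show "((\<lambda>\<eta>. complex_of_real (fst (pos i \<eta>))) has_derivative (\<lambda>v. of_real (sgi i * fst v))) (at p)" for i p
      using has_derivative_of_real[OF has_derivative_fst[OF dp]] by simp
  qed (rule c)
  show "usmooth K nbhd (\<lambda>i \<eta>. of_real (snd (pos i \<eta>)) :: complex)"
  proof (rule usm_from_derivative[where C = "X + \<delta> / om" and D = "\<lambda>v i _. of_real (sgi i * snd v)"])
    show "norm (complex_of_real (snd (pos i p))) \<le> X + \<delta> / om" if "i \<in> K" "p \<in> nbhd i" for i p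
      unfolding norm_of_real by (rule order_trans[OF fs(2) pos_upper[OF that]])
    show "((\<lambda>\<eta>. complex_of_real (snd (pos i \<eta>))) has_derivative (\<lambda>v. of_real (sgi i * snd v))) (at p)" for i p
      using has_derivative_of_real[OF has_derivative_snd[OF dp]] by simp
  qed (rule c)
  have dh: "((\<lambda>\<eta>. \<eta> - ctr i) has_derivative (\<lambda>d. d)) (at \<eta>)" for i \<eta>
    by (auto intro!: derivative_eq_intros)
  show "usmooth K nbhd (\<lambda>i \<eta>. of_real (fst (\<eta> - ctr i)) :: complex)"
  proof (rule usm_from_derivative[where C = \<delta> and D = "\<lambda>v i _. of_real (fst v)"])
    show "norm (complex_of_real (fst (p - ctr i))) \<le> \<delta>" if "p \<in> nbhd i" for i p
      using fs(1)[of "p - ctr i"] that unfolding nbhd_iff norm_of_real by linarith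
  qed (rule has_derivative_of_real[OF has_derivative_fst[OF dh]], rule c1)
  show "usmooth K nbhd (\<lambda>i \<eta>. of_real (snd (\<eta> - ctr i)) :: complex)"
  proof (rule usm_from_derivative[where C = \<delta> and D = "\<lambda>v i _. of_real (snd v)"])
    show "norm (complex_of_real (snd (p - ctr i))) \<le> \<delta>" if "p \<in> nbhd i" for i p
      using fs(2)[of "p - ctr i"] that unfolding nbhd_iff norm_of_real by linarith
  qed (rule has_derivative_of_real[OF has_derivative_snd[OF dh]], rule c1)
qed

lemma usm_inverse_square: "usmooth K nbhd (\<lambda>i \<eta>. inverse (of_real ((norm (pos i \<eta>))^2)) :: complex)"
proof -
  have n: "usmooth K nbhd (\<lambda>i \<eta>. of_real ((norm (pos i \<eta>))^2) :: complex)"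
  proof (rule usm_cong)
    show "usmooth K nbhd (\<lambda>i \<eta>. of_real (fst (pos i \<eta>)) * of_real (fst (pos i \<eta>)) + of_real (snd (pos i \<eta>)) * of_real (snd (pos i \<eta>)) :: complex)"
      by (intro usm_add usm_mult usm_coord)
    show "of_real (fst (pos i p)) * of_real (fst (pos i p)) + of_real (snd (pos i p)) * of_real (snd (pos i p)) = complex_of_real ((norm (pos i p))^2)" for i p
      unfolding norm_R2_sq by (simp add: power2_eq_square)
  qed
  show ?thesis unfolding usmooth_def
  proof
    fix m
    show "unif_smooth m K nbhd (\<lambda>i \<eta>. inverse (of_real ((norm (pos i \<eta>))^2)) :: complex)"
    proof (rule unif_smooth_inverse[where c = "\<rho>^2"])
      show "\<rho>^2 \<le> norm (complex_of_real ((norm (pos i p))^2))" if "i \<in> K" "p \<in> nbhd i" for i p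
        using power_mono[OF pos_lower[OF that], of 2] \<rho> by (simp add: norm_power)
    qed (use n \<rho> open_nbhd in \<open>auto simp: usmooth_def\<close>)
  qed
qed

lemma usm_dA:
  "usmooth K nbhd (\<lambda>i \<eta>. of_real (dA1 b (pos i \<eta>)) :: complex)" "usmooth K nbhd (\<lambda>i \<eta>. of_real (dA2 b (pos i \<eta>)) :: complex)"
proof -
  let ?I = "\<lambda>i \<eta>. inverse (of_real ((norm (pos i \<eta>))^2)) :: complex"
  have c: "usmooth K nbhd (\<lambda>i _. complex_of_real r)" for r by (rule usmooth_family_const[where C = "\<bar>r\<bar>"]) simp
  have I2: "inverse ((of_real r :: complex)^2) = inverse (of_real r) * inverse (of_real r)" for r by (simp add: power2_eq_square)
  show "usmooth K nbhd (\<lambda>i \<eta>. of_real (dA1 b (pos i \<eta>)) :: complex)"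
  proof (rule usm_cong)
    show "usmooth K nbhd (\<lambda>i \<eta>. of_real (2 * b) * (of_real (fst (pos i \<eta>)) * of_real (snd (pos i \<eta>))) * (?I i \<eta> * ?I i \<eta>))"
      by (intro usm_mult usm_coord usm_inverse_square c)
  qed (simp add: dA1_def norm_R2_sq divide_inverse power2_eq_square[of "_ + _"])
  show "usmooth K nbhd (\<lambda>i \<eta>. of_real (dA2 b (pos i \<eta>)) :: complex)"
  proof (rule usm_cong)
    show "usmooth K nbhd (\<lambda>i \<eta>. of_real b * (of_real (snd (pos i \<eta>)) * of_real (snd (pos i \<eta>)) - of_real (fst (pos i \<eta>)) * of_real (fst (pos i \<eta>))) * (?I i \<eta> * ?I i \<eta>))"
      by (intro usm_mult usm_diff usm_coord usm_inverse_square c)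
  qed (unfold dA2_def norm_R2_sq, simp add: divide_inverse power2_eq_square)
qed

section \<open>Hessian and third-order remainder of the phase\<close>

lemma px_eq: "i \<in> K \<Longrightarrow> pos i (ctr i) = px i" by (simp add: pos_eq)

lemma px_nz: "i \<in> K \<Longrightarrow> px i \<noteq> 0" using pos_nz[OF _ ctr_nbhd] px_eq by fastforce

lemma ph_derivative:
  assumes "i \<in> K" "\<eta> \<in> nbhd i"
  shows "(ph i has_derivative (\<lambda>d. - of_real (sgi i) * (mmi i * of_real ((\<eta> - ctr i) \<bullet> d) + of_real (sgi i * ((\<eta> - ctr i) \<bullet> DAv b (pos i \<eta>) d))))) (at \<eta>)"
proof -
  have "(ph i has_derivative (\<lambda>d. mmi i * of_real ((px i - pos i \<eta>) \<bullet> d) + of_real (sgi i * ((px i - pos i \<eta>) \<bullet> DAv b (pos i \<eta>) d)))) (at \<eta>)"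
    unfolding ph_def mmi_def sgi_def pos_def
    by (rule phi_derivative[OF om open_nbhd _ assms(2)]) (use nz_i assms in \<open>auto simp: nbhd_def\<close>)
  moreover have "px i - pos i \<eta> = - (sgi i *\<^sub>R (\<eta> - ctr i))" using pos_eq[OF assms(1)] by simp
  ultimately show ?thesis by (simp add: algebra_simps)
qed

text \<open>In the derivative of the gradient the factor \<eta> - \<open>\<eta>\<^sub>*\<close>
  vanishes at the centre, so derivatives of the Jacobian of A drop out.\<close>

lemma hess_eq:
  assumes i: "i \<in> K"
  shows "hess om b B (fst i) (px i) (py i) j k = - of_real (sgi i) * (mmi i * of_real (e2 j \<bullet> e2 k) + of_real (sgi i * (e2 j \<bullet> DAv b (px i) (e2 k))))"
proof -
  have c: "etastar om b (fst i) (px i) (py i) = ctr i" by (simp add: ctr_def px_def py_def)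
  let ?F = "\<lambda>\<eta>. - of_real (sgi i) * (mmi i * of_real ((\<eta> - ctr i) \<bullet> e2 k) + of_real (sgi i * ((\<eta> - ctr i) \<bullet> DAv b (pos i \<eta>) (e2 k))))"
  have "hess om b B (fst i) (px i) (py i) j k = pd (e2 j) (pd (e2 k) (ph i)) (ctr i)"
    unfolding hess_def c ph_def ..
  also have "\<dots> = pd (e2 j) ?F (ctr i)"
    by (rule pd_cong[OF open_nbhd ctr_nbhd]) (rule pd_eq[OF ph_derivative[OF i]])
  also have "\<dots> = - of_real (sgi i) * (mmi i * of_real (e2 j \<bullet> e2 k) + of_real (sgi i * (e2 j \<bullet> DAv b (px i) (e2 k))))"
  proof (rule pd_eq)
    have dpos: "pos i differentiable (at (ctr i))"
      unfolding pos_def[abs_def] differentiable_def using xt_derivative by blast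
    have "(\<lambda>\<eta>. dA1 b (pos i \<eta>)) differentiable (at (ctr i))" "(\<lambda>\<eta>. dA2 b (pos i \<eta>)) differentiable (at (ctr i))"
      by (intro differentiable_compose[OF _ dpos] dA_differentiable pos_nz[OF i ctr_nbhd])+
    then obtain L1 L2 where L: "((\<lambda>\<eta>. dA1 b (pos i \<eta>)) has_derivative L1) (at (ctr i))" "((\<lambda>\<eta>. dA2 b (pos i \<eta>)) has_derivative L2) (at (ctr i))"
      unfolding differentiable_def by blast
    have "((\<lambda>\<eta>. DAv b (pos i \<eta>) (e2 k)) has_derivative (\<lambda>d. (L1 d * fst (e2 k) + L2 d * snd (e2 k), L2 d * fst (e2 k) - L1 d * snd (e2 k)))) (at (ctr i))"
      unfolding DAv_def by (intro has_derivative_Pair has_derivative_add has_derivative_diff has_derivative_mult_left L)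
    moreover have dh: "((\<lambda>\<eta>. \<eta> - ctr i) has_derivative (\<lambda>d. d)) (at (ctr i))" by (auto intro!: derivative_eq_intros)
    ultimately have "((\<lambda>\<eta>. (\<eta> - ctr i) \<bullet> DAv b (pos i \<eta>) (e2 k)) has_derivative (\<lambda>d. (ctr i - ctr i) \<bullet> (L1 d * fst (e2 k) + L2 d * snd (e2 k), L2 d * fst (e2 k) - L1 d * snd (e2 k)) + d \<bullet> DAv b (pos i (ctr i)) (e2 k))) (at (ctr i))"
      by (rule has_derivative_inner[rotated])
    then have d1: "((\<lambda>\<eta>. (\<eta> - ctr i) \<bullet> DAv b (pos i \<eta>) (e2 k)) has_derivative (\<lambda>d. d \<bullet> DAv b (px i) (e2 k))) (at (ctr i))"
      by (simp add: px_eq[OF i])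
    have d2: "((\<lambda>\<eta>. (\<eta> - ctr i) \<bullet> e2 k) has_derivative (\<lambda>d. d \<bullet> e2 k)) (at (ctr i))" by (intro has_derivative_inner_left dh)
    show "(?F has_derivative (\<lambda>d. - of_real (sgi i) * (mmi i * of_real (d \<bullet> e2 k) + of_real (sgi i * (d \<bullet> DAv b (px i) (e2 k)))))) (at (ctr i))"
      by (intro has_derivative_mult_right has_derivative_add has_derivative_of_real d1 d2)
  qed
  finally show ?thesis .
qed

lemma hess_entries:
  assumes i: "i \<in> K"
  defines "H \<equiv> hess om b B (fst i) (px i) (py i)"
  shows "H 0 0 = - of_real (sgi i) * mmi i - of_real (aa i)" "H 0 1 = - of_real (bb i)"
    "H 1 0 = - of_real (bb i)" "H 1 1 = - of_real (sgi i) * mmi i + of_real (aa i)"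
  unfolding H_def hess_eq[OF i] by (simp_all add: e2_def DAv_def inner_prod_def aa_def bb_def power2_eq_square algebra_simps)

lemma kap_Re: "Re (kap i) = B * (sgi i)^2"
  by (simp add: kap_def mmi_def mm_def sgi_def power2_eq_square)

lemma kap_lower: assumes "i \<in> K" shows "B * s0^2 \<le> Re (kap i)"
proof -
  have "s0^2 \<le> \<bar>sgi i\<bar>^2" using sgi_lower[OF assms] s0 by (intro power_mono) auto
  then show ?thesis unfolding kap_Re using B by simp
qed

lemma Ni_eq:
  assumes i: "i \<in> K"
  shows "Ni i 0 0 = - \<i> * (kap i - \<i> * aa i) / ((kap i)^2 + of_real ((aa i)^2 + (bb i)^2))"
    "Ni i 0 1 = - complex_of_real (bb i) / ((kap i)^2 + of_real ((aa i)^2 + (bb i)^2))"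
    "Ni i 1 0 = - complex_of_real (bb i) / ((kap i)^2 + of_real ((aa i)^2 + (bb i)^2))"
    "Ni i 1 1 = - \<i> * (kap i + \<i> * aa i) / ((kap i)^2 + of_real ((aa i)^2 + (bb i)^2))"
proof -
  define m where "m = of_real (sgi i) * mmi i"
  have k: "kap i = \<i> * m" by (simp add: kap_def m_def)
  have sm: "- of_real (sgi i) * mmi i = - m" by (simp add: m_def)
  note H = hess_entries[OF i, unfolded sm]
  define D where "D = (kap i)^2 + complex_of_real ((aa i)^2 + (bb i)^2)"
  have d: "(- m - of_real (aa i)) * (- m + of_real (aa i)) - (- of_real (bb i)) * (- of_real (bb i)) = - D"
    unfolding k D_def by (simp add: power2_eq_square algebra_simps)
  have ii: "\<i> * (\<i> * z) = - z" for z by (simp add: mult.assoc[symmetric])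
  have n: "- \<i> * (kap i - \<i> * aa i) = - (- m + of_real (aa i))" "- \<i> * (kap i + \<i> * aa i) = - (- m - of_real (aa i))"
    unfolding k by (simp_all add: algebra_simps ii)
  show "Ni i 0 0 = - \<i> * (kap i - \<i> * aa i) / ((kap i)^2 + of_real ((aa i)^2 + (bb i)^2))"
    "Ni i 0 1 = - complex_of_real (bb i) / ((kap i)^2 + of_real ((aa i)^2 + (bb i)^2))"
    "Ni i 1 0 = - complex_of_real (bb i) / ((kap i)^2 + of_real ((aa i)^2 + (bb i)^2))"
    "Ni i 1 1 = - \<i> * (kap i + \<i> * aa i) / ((kap i)^2 + of_real ((aa i)^2 + (bb i)^2))"
    unfolding Ni_def inv2_def Let_def H d n D_def[symmetric] by (simp_all, simp_all add: minus_divide_left)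
qed

lemma quad_eq:
  assumes i: "i \<in> K"
  shows "(\<Sum>j<2. \<Sum>k<2. complex_of_real (comp2 j h) * hess om b B (fst i) (px i) (py i) j k * complex_of_real (comp2 k h)) = \<i> * gquad (kap i) (aa i) (bb i) h"
  unfolding gquad_def norm_R2_sq kap_def
  by (simp add: numeral_2_eq_2 comp2_def hess_entries[OF i, unfolded One_nat_def] algebra_simps power2_eq_square)

lemma phi3_real:
  assumes i: "i \<in> K"
  shows "phi3 om b B (fst i) (px i) (py i) \<eta> = of_real (Rr i \<eta>)"
    "ph i \<eta> = of_real (action om b (fst i) (py i) (ctr i)) + \<i> / 2 * gquad (kap i) (aa i) (bb i) (\<eta> - ctr i) + of_real (Rr i \<eta>)"
proof -
  have c: "etastar om b (fst i) (px i) (py i) = ctr i" by (simp add: ctr_def px_def py_def)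
  have off: "px i - xt om b (fst i) (py i) \<eta> = - (sgi i *\<^sub>R (\<eta> - ctr i))" for \<eta>
    using pos_eq[OF i, of \<eta>] by (simp add: pos_def)
  have pc: "ph i (ctr i) = of_real (action om b (fst i) (py i) (ctr i))"
    unfolding ph_def phi_def off by simp
  have p3: "phi3 om b B (fst i) (px i) (py i) \<eta> = ph i \<eta> - ph i (ctr i) - \<i> * gquad (kap i) (aa i) (bb i) (\<eta> - ctr i) / 2"
    unfolding phi3_def c quad_eq[OF i] ph_def ..
  have "Im (ph i \<eta>) = B * (sgi i)^2 * (norm (\<eta> - ctr i))^2 / 2"
    unfolding ph_def phi_def off by (simp add: power_mult_distrib)
  moreover have "Im (\<i> * gquad (kap i) (aa i) (bb i) (\<eta> - ctr i) / 2) = B * (sgi i)^2 * (norm (\<eta> - ctr i))^2 / 2"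
    by (simp add: gquad_def kap_Re)
  ultimately have "Im (phi3 om b B (fst i) (px i) (py i) \<eta>) = 0" unfolding p3 pc by simp
  then show r: "phi3 om b B (fst i) (px i) (py i) \<eta> = of_real (Rr i \<eta>)" by (simp add: Rr_def complex_eq_iff)
  show "ph i \<eta> = of_real (action om b (fst i) (py i) (ctr i)) + \<i> / 2 * gquad (kap i) (aa i) (bb i) (\<eta> - ctr i) + of_real (Rr i \<eta>)"
    using p3 unfolding r pc by simp
qed

text \<open>The gradient of the remainder is -s^2 (\<eta> - \<open>\<eta>\<^sub>*\<close>) .
  (DA(\<open>x\<^sup>t\<close>) - DA(x)). Written out in coordinates it is a combination of products
  from which uniform smoothness and the order of vanishing can be read off.\<close>

definition dR :: "R2 \<Rightarrow> real \<times> R2 \<times> R2 \<Rightarrow> R2 \<Rightarrow> complex" where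
  "dR v i \<eta> = - of_real ((sgi i)^2) * (of_real (fst (\<eta> - ctr i)) * ((of_real (dA1 b (pos i \<eta>)) - of_real (dA1 b (px i))) * of_real (fst v) + (of_real (dA2 b (pos i \<eta>)) - of_real (dA2 b (px i))) * of_real (snd v))
     + of_real (snd (\<eta> - ctr i)) * ((of_real (dA2 b (pos i \<eta>)) - of_real (dA2 b (px i))) * of_real (fst v) - (of_real (dA1 b (pos i \<eta>)) - of_real (dA1 b (px i))) * of_real (snd v)))"

lemma dR_eq: "dR v i \<eta> = of_real (- ((sgi i)^2) * ((\<eta> - ctr i) \<bullet> (DAv b (pos i \<eta>) v - DAv b (px i) v)))"
  unfolding dR_def DAv_def inner_prod_def by (simp add: algebra_simps)

lemma Rr_derivative:
  assumes i: "i \<in> K" and \<eta>: "\<eta> \<in> nbhd i"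
  shows "((\<lambda>\<eta>. complex_of_real (Rr i \<eta>)) has_derivative (\<lambda>v. dR v i \<eta>)) (at \<eta>)"
proof -
  let ?S = "action om b (fst i) (py i) (ctr i)"
  have dq: "((\<lambda>\<eta>. \<i> / 2 * gquad (kap i) (aa i) (bb i) (\<eta> - ctr i)) has_derivative
     (\<lambda>d. - of_real (sgi i) * mmi i * of_real ((\<eta> - ctr i) \<bullet> d) - of_real ((sgi i)^2 * ((\<eta> - ctr i) \<bullet> DAv b (px i) d)))) (at \<eta>)"
    unfolding gquad_def norm_R2_sq
    by (rule derivative_eq_intros refl | simp add: fun_eq_iff kap_def aa_def bb_def DAv_def inner_prod_def field_simps)+
  have "((\<lambda>\<eta>. ph i \<eta> - of_real ?S - \<i> / 2 * gquad (kap i) (aa i) (bb i) (\<eta> - ctr i)) has_derivative (\<lambda>d. - of_real (sgi i) * (mmi i * of_real ((\<eta> - ctr i) \<bullet> d) + of_real (sgi i * ((\<eta> - ctr i) \<bullet> DAv b (pos i \<eta>) d)))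
      - 0 - (- of_real (sgi i) * mmi i * of_real ((\<eta> - ctr i) \<bullet> d) - of_real ((sgi i)^2 * ((\<eta> - ctr i) \<bullet> DAv b (px i) d))))) (at \<eta>)"
    by (intro has_derivative_diff ph_derivative[OF i \<eta>] has_derivative_const dq)
  moreover have "ph i \<eta> - of_real ?S - \<i> / 2 * gquad (kap i) (aa i) (bb i) (\<eta> - ctr i) = of_real (Rr i \<eta>)" for \<eta>
    using phi3_real(2)[OF i, of \<eta>] by simp
  moreover have "- of_real (sgi i) * (mmi i * of_real ((\<eta> - ctr i) \<bullet> d) + of_real (sgi i * ((\<eta> - ctr i) \<bullet> DAv b (pos i \<eta>) d)))
      - 0 - (- of_real (sgi i) * mmi i * of_real ((\<eta> - ctr i) \<bullet> d) - of_real ((sgi i)^2 * ((\<eta> - ctr i) \<bullet> DAv b (px i) d))) = dR d i \<eta>" for d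
    unfolding dR_eq by (simp add: inner_diff_right power2_eq_square algebra_simps)
  ultimately show ?thesis by simp
qed

lemma Rr_ctr: assumes "i \<in> K" shows "Rr i (ctr i) = 0"
proof -
  have c: "etastar om b (fst i) (px i) (py i) = ctr i" by (simp add: ctr_def px_def py_def)
  have "comp2 j 0 = 0" for j by (simp add: comp2_def)
  then show ?thesis unfolding Rr_def phi3_def c by simp
qed

lemma usm_dA_diff:
  "usmooth K nbhd (\<lambda>i \<eta>. of_real (dA1 b (pos i \<eta>)) - of_real (dA1 b (px i)) :: complex)"
  "usmooth K nbhd (\<lambda>i \<eta>. of_real (dA2 b (pos i \<eta>)) - of_real (dA2 b (px i)) :: complex)"
proof -
  obtain C1 where "\<And>i. i \<in> K \<Longrightarrow> norm (complex_of_real (dA1 b (px i))) \<le> C1"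
    using usm_bounded[OF usm_dA(1)] ctr_nbhd px_eq by metis
  then show "usmooth K nbhd (\<lambda>i \<eta>. of_real (dA1 b (pos i \<eta>)) - of_real (dA1 b (px i)) :: complex)"
    by (intro usm_diff usm_dA usmooth_family_const)
  obtain C2 where "\<And>i. i \<in> K \<Longrightarrow> norm (complex_of_real (dA2 b (px i))) \<le> C2"
    using usm_bounded[OF usm_dA(2)] ctr_nbhd px_eq by metis
  then show "usmooth K nbhd (\<lambda>i \<eta>. of_real (dA2 b (pos i \<eta>)) - of_real (dA2 b (px i)) :: complex)"
    by (intro usm_diff usm_dA usmooth_family_const)
qed

lemma usm_const: "usmooth K nbhd (\<lambda>i _. c :: complex)"
  by (rule usmooth_family_const[where C = "norm c"]) simp

lemma usm_sq: "usmooth K nbhd (\<lambda>i _. - complex_of_real ((sgi i)^2))"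
proof (rule usmooth_family_const[where C = "(1 / om)^2"])
  show "norm (- complex_of_real ((sgi i)^2)) \<le> (1 / om)^2" for i
    using power_mono[OF sgi_upper[of i], of 2] by (simp add: norm_power)
qed

lemma usm_dR: "usmooth K nbhd (dR v)"
  unfolding dR_def[abs_def] by (intro usm_mult usm_add usm_diff usm_coord usm_dA_diff usm_const usm_sq)

text \<open>Each product pairs a coordinate of \<eta> - \<open>\<eta>\<^sub>*\<close> with a
  difference of Jacobian entries, and both vanish at the centre.\<close>

lemma vanishes_dR: assumes i: "i \<in> K" shows "vanishes 2 (dR v i) (ctr i)"
proof -
  note op = open_nbhd
  let ?A1 = "\<lambda>i \<eta>. of_real (dA1 b (pos i \<eta>)) - of_real (dA1 b (px i)) :: complex"
  let ?A2 = "\<lambda>i \<eta>. of_real (dA2 b (pos i \<eta>)) - of_real (dA2 b (px i)) :: complex"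
  let ?u = "\<lambda>i \<eta>. ?A1 i \<eta> * of_real (fst v) + ?A2 i \<eta> * of_real (snd v)"
  let ?w = "\<lambda>i \<eta>. ?A2 i \<eta> * of_real (fst v) - ?A1 i \<eta> * of_real (snd v)"
  have u: "usmooth K nbhd ?u" "usmooth K nbhd ?w"
    by (intro usm_mult usm_add usm_diff usm_dA_diff usm_const)+
  have v1: "vanishes 1 g p" if "g p = 0" for g :: "R2 \<Rightarrow> complex" and p using that by simp
  have p1: "vanishes (1 + 1) (\<lambda>\<eta>. of_real (fst (\<eta> - ctr i)) * ?u i \<eta>) (ctr i)"
    by (rule vanishes_mult[of K nbhd, OF op usm_coord(3) u(1) i ctr_nbhd]; rule v1) (simp_all add: px_eq[OF i])
  have p2: "vanishes (1 + 1) (\<lambda>\<eta>. of_real (snd (\<eta> - ctr i)) * ?w i \<eta>) (ctr i)"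
    by (rule vanishes_mult[of K nbhd, OF op usm_coord(4) u(2) i ctr_nbhd]; rule v1) (simp_all add: px_eq[OF i])
  have p3: "vanishes (1 + 1) (\<lambda>\<eta>. of_real (fst (\<eta> - ctr i)) * ?u i \<eta> + of_real (snd (\<eta> - ctr i)) * ?w i \<eta>) (ctr i)"
    by (rule vanishes_add[of K nbhd, OF op usm_mult[OF usm_coord(3) u(1)] usm_mult[OF usm_coord(4) u(2)] i ctr_nbhd p1 p2])
  have "vanishes (0 + (1 + 1)) (\<lambda>\<eta>. - of_real ((sgi i)^2) * (of_real (fst (\<eta> - ctr i)) * ?u i \<eta> + of_real (snd (\<eta> - ctr i)) * ?w i \<eta>)) (ctr i)"
    by (rule vanishes_mult[of K nbhd, OF op usm_sq usm_add[OF usm_mult[OF usm_coord(3) u(1)] usm_mult[OF usm_coord(4) u(2)]] i ctr_nbhd _ p3]) simp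
  then show ?thesis unfolding dR_def[abs_def] by (simp add: numeral_2_eq_2)
qed

lemma Rr_vanishes: assumes i: "i \<in> K" shows "vanishes 3 (\<lambda>\<eta>. complex_of_real (Rr i \<eta>)) (ctr i)"
proof -
  have "vanishes 2 (pd v (\<lambda>\<eta>. complex_of_real (Rr i \<eta>))) (ctr i)" for v
    by (rule vanishes_cong[OF open_nbhd ctr_nbhd _ vanishes_dR[OF i, of v]]) (rule pd_eq[OF Rr_derivative[OF i], symmetric])
  then show ?thesis by (simp add: numeral_3_eq_3 numeral_2_eq_2 Rr_ctr[OF i])
qed

lemma usm_Rr: "usmooth K nbhd (\<lambda>i \<eta>. complex_of_real (Rr i \<eta>))"
proof (rule usm_from_derivative[where D = dR])
  fix i p assume i: "i \<in> K" and p: "p \<in> nbhd i"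
  \<comment> \<open>A Lipschitz constant for the remainder: |s| \<le> 1/om, the radius \<delta>, and
    the norm |b|/|x|^2 \<le> |b|/\<rho>^2 of the Jacobian at the moving and at the central
    point.\<close>
  define C where "C = (1 / om)^2 * (\<delta> * (\<bar>b\<bar> / \<rho>^2 + \<bar>b\<bar> / \<rho>^2))"
  have D: "norm (DAv b (pos i \<eta>) v) \<le> \<bar>b\<bar> / \<rho>^2 * norm v" if "\<eta> \<in> nbhd i" for \<eta> v
  proof -
    have "\<bar>b\<bar> / (norm (pos i \<eta>))^2 \<le> \<bar>b\<bar> / \<rho>^2"
    proof (rule divide_left_mono)
      have "0 < norm (pos i \<eta>)" using pos_lower[OF i that] \<rho> by linarith
      then show "0 < (norm (pos i \<eta>))^2 * \<rho>^2" using \<rho> by (intro mult_pos_pos zero_less_power)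
    qed (use pos_lower[OF i that] \<rho> in \<open>auto intro: power_mono\<close>)
    then show ?thesis unfolding DAv_norm[OF pos_nz[OF i that]] by (rule mult_right_mono) simp
  qed
  have "norm (complex_of_real (Rr i p) - complex_of_real (Rr i (ctr i))) \<le> C * norm (p - ctr i)"
  proof (rule differentiable_bound[of "nbhd i"])
    show "((\<lambda>\<eta>. complex_of_real (Rr i \<eta>)) has_derivative (\<lambda>v. dR v i \<eta>)) (at \<eta> within nbhd i)" if "\<eta> \<in> nbhd i" for \<eta>
      by (rule has_derivative_at_withinI[OF Rr_derivative[OF i that]])
    show "onorm (\<lambda>v. dR v i \<eta>) \<le> C" if \<eta>: "\<eta> \<in> nbhd i" for \<eta>
    proof (rule onorm_le)
      fix v
      have "norm (dR v i \<eta>) = \<bar>sgi i\<bar>^2 * \<bar>(\<eta> - ctr i) \<bullet> (DAv b (pos i \<eta>) v - DAv b (px i) v)\<bar>"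
        unfolding dR_eq norm_of_real by (simp add: abs_mult)
      also have "\<dots> \<le> (1 / om)^2 * (\<delta> * (\<bar>b\<bar> / \<rho>^2 * norm v + \<bar>b\<bar> / \<rho>^2 * norm v))"
      proof (intro mult_mono power_mono sgi_upper)
        have "\<bar>(\<eta> - ctr i) \<bullet> (DAv b (pos i \<eta>) v - DAv b (px i) v)\<bar> \<le> norm (\<eta> - ctr i) * norm (DAv b (pos i \<eta>) v - DAv b (px i) v)"
          by (rule Cauchy_Schwarz_ineq2)
        also have "\<dots> \<le> \<delta> * (\<bar>b\<bar> / \<rho>^2 * norm v + \<bar>b\<bar> / \<rho>^2 * norm v)"
        proof (rule mult_mono)
          show "norm (\<eta> - ctr i) \<le> \<delta>" using \<eta> by (simp add: nbhd_iff)
          show "norm (DAv b (pos i \<eta>) v - DAv b (px i) v) \<le> \<bar>b\<bar> / \<rho>^2 * norm v + \<bar>b\<bar> / \<rho>^2 * norm v"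
            using D[OF \<eta>, of v] D[OF ctr_nbhd, of v] unfolding px_eq[OF i] by (intro norm_triangle_le_diff add_mono)
        qed (use \<delta> in auto)
        finally show "\<bar>(\<eta> - ctr i) \<bullet> (DAv b (pos i \<eta>) v - DAv b (px i) v)\<bar> \<le> \<delta> * (\<bar>b\<bar> / \<rho>^2 * norm v + \<bar>b\<bar> / \<rho>^2 * norm v)" .
      qed auto
      also have "\<dots> = C * norm v" by (simp add: C_def algebra_simps)
      finally show "norm (dR v i \<eta>) \<le> C * norm v" .
    qed
  qed (use p ctr_nbhd in \<open>auto simp: nbhd_def\<close>)
  also have "\<dots> \<le> C * \<delta>" using p \<delta> by (intro mult_left_mono) (auto simp: nbhd_iff C_def)
  finally show "norm (complex_of_real (Rr i p)) \<le> (1 / om)^2 * (\<delta> * (\<bar>b\<bar> / \<rho>^2 + \<bar>b\<bar> / \<rho>^2)) * \<delta>"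
    by (simp add: Rr_ctr[OF i] C_def)
qed (auto intro: Rr_derivative usm_dR)

section \<open>Momenta with nonzero angular momentum\<close>

lemma open_compl_Nu: "open (- Nu i)"
proof -
  have "- Nu i = (\<lambda>\<eta>. wedge (py i) (\<eta> - Avec b (py i))) -` (- {0})" by (auto simp: Nu_def)
  moreover have "open ((\<lambda>\<eta>. wedge (py i) (\<eta> - Avec b (py i))) -` (- {0}))"
    unfolding wedge_def by (intro open_vimage continuous_intros)
  ultimately show ?thesis by simp
qed

lemma xt_nz_off_Nu: "\<eta> \<notin> Nu i \<Longrightarrow> xt om b s (py i) \<eta> \<noteq> 0"
  unfolding Nu_def by (intro xt_nonzero[OF om]) auto

text \<open>Around a momentum off the null line a whole ball has trajectories avoiding the origin,
  so the phase is differentiable there. Only continuity is asked, hence the radius need not be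
  uniform.\<close>

lemma Rr_continuous: assumes i: "i \<in> K" shows "continuous_on (- Nu i) (Rr i)"
proof -
  have "isCont (ph i) \<eta>" if \<eta>: "\<eta> \<in> - Nu i" for \<eta>
  proof -
    obtain r where r: "r > 0" "ball \<eta> r \<subseteq> - Nu i" using open_compl_Nu[of i] \<eta> by (meson open_contains_ball)
    show ?thesis unfolding ph_def
    proof (rule has_derivative_continuous[OF phi_derivative[OF om, of "ball \<eta> r"]])
      show "xt om b s (py i) \<eta>' \<noteq> 0" if "\<eta>' \<in> ball \<eta> r" for s \<eta>'
        by (rule xt_nz_off_Nu) (use r that in blast)
    qed (use r in auto)
  qed
  then have "continuous_on (- Nu i) (ph i)" by (simp add: continuous_at_imp_continuous_on)
  then have "continuous_on (- Nu i) (\<lambda>\<eta>. Re (ph i \<eta> - of_real (action om b (fst i) (py i) (ctr i)) - \<i> / 2 * gquad (kap i) (aa i) (bb i) (\<eta> - ctr i)))"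
    unfolding gquad_def by (intro continuous_intros) auto
  moreover have "Re (ph i \<eta> - of_real (action om b (fst i) (py i) (ctr i)) - \<i> / 2 * gquad (kap i) (aa i) (bb i) (\<eta> - ctr i)) = Rr i \<eta>" for \<eta>
    unfolding phi3_real(2)[OF i, of \<eta>] by simp
  ultimately show ?thesis by simp
qed

lemma py_nz: assumes "i \<in> K" shows "py i \<noteq> 0"
  using nz_i[OF assms, of 0, OF _ ctr_nbhd] by (simp add: xt_zero)

sublocale PF: phase_family K ctr \<delta> "B * s0^2" kap aa bb Rr Nu Ni
proof
  show "\<delta> > 0" by (rule \<delta>)
  show "B * s0^2 > 0" using B s0 by simp
  show "i \<in> K \<Longrightarrow> negligible (Nu i)" for i unfolding Nu_def by (rule wedge_affine_negligible[OF py_nz])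
  show "usmooth K (\<lambda>i. ball (ctr i) \<delta>) (\<lambda>i \<eta>. complex_of_real (Rr i \<eta>))" using usm_Rr unfolding nbhd_def[abs_def] .
  show "B * s0^2 \<le> Re (kap i)" "vanishes 3 (\<lambda>\<eta>. complex_of_real (Rr i \<eta>)) (ctr i)" "continuous_on (- Nu i) (Rr i)"
    "Ni i 0 0 = - \<i> * (kap i - \<i> * aa i) / ((kap i)^2 + of_real ((aa i)^2 + (bb i)^2))"
    "Ni i 0 1 = - complex_of_real (bb i) / ((kap i)^2 + of_real ((aa i)^2 + (bb i)^2))"
    "Ni i 1 0 = - complex_of_real (bb i) / ((kap i)^2 + of_real ((aa i)^2 + (bb i)^2))"
    "Ni i 1 1 = - \<i> * (kap i + \<i> * aa i) / ((kap i)^2 + of_real ((aa i)^2 + (bb i)^2))" if "i \<in> K" for i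
    by (rule kap_lower[OF that] Rr_vanishes[OF that] Rr_continuous[OF that] Ni_eq[OF that])+
qed

end

subsection \<open>Asymptotics of the propagator\<close>

lemma sum_triangle_reindex:
  fixes F :: "nat \<Rightarrow> nat \<Rightarrow> 'a::comm_monoid_add"
  shows "(\<Sum>m\<le>N. \<Sum>k\<le>m. F k (m - k)) = (\<Sum>k\<le>N. \<Sum>j\<le>N-k. F k j)"
proof (induction N)
  case (Suc N)
  have "(\<Sum>k\<le>N. \<Sum>j\<le>Suc N - k. F k j) = (\<Sum>k\<le>N. (\<Sum>j\<le>N-k. F k j) + F k (Suc N - k))"
    by (rule sum.cong) (simp_all add: Suc_diff_le)
  then show ?case using Suc by (simp add: sum.distrib add.assoc)
qed simp

context caustic_free
begin

section \<open>The root of det Z and the admissible amplitudes\<close>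

lemma ctr_conv: "etastar om b (fst i) (px i) (py i) = ctr i"
  by (simp add: ctr_def px_def py_def)

definition root :: "real \<times> R2 \<times> R2 \<Rightarrow> R2 \<Rightarrow> complex" where
  "root i \<eta> = mmi i * csqrt (1 - (of_real (sgi i * (b / (norm (pos i \<eta>))^2)) / mmi i)^2)"

lemma sqrtdetZ_root:
  assumes "i \<in> K" "\<eta> \<in> nbhd i \<or> \<eta> \<notin> Nu i"
  shows "sqrtdetZ om b B (fst i) (py i) \<eta> = root i \<eta>"
  unfolding root_def mmi_def sgi_def pos_def
  by (rule sqrtdetZ_eq[OF om B]) (use nz_i xt_nz_off_Nu assms in blast)

lemma branch_i: "1 - (of_real (sgi i * \<beta>) / mmi i)^2 \<notin> \<real>\<^sub>\<le>\<^sub>0"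
  unfolding mmi_def sgi_def by (rule root_branch[OF om B])

lemma root_nz: "root i \<eta> \<noteq> 0"
  using branch_i[of i "b / (norm (pos i \<eta>))^2"] mmi_nz[of i] by (auto simp: root_def)

lemma root_square: "(root i \<eta>)^2 = (mmi i)^2 - (of_real (sgi i * (b / (norm (pos i \<eta>))^2)))^2"
  using mmi_nz[of i] by (simp add: root_def power_mult_distrib power_divide right_diff_distrib)

text \<open>Factor m^2 - r^2 = (m + r)(m - r) with r real: each factor keeps the imaginary part of
  m, of size at least B s0. The bound is uniform in \<beta>.\<close>

lemma branch_lower:
  assumes i: "i \<in> K"
  shows "(B * s0)^2 / (1 + B / om)^2 \<le> norm (1 - (of_real (sgi i * \<beta>) / mmi i)^2)"
proof -
  define z where "z = complex_of_real (sgi i * \<beta>)"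
  have im: "B * s0 \<le> norm (mmi i + of_real r)" for r
  proof -
    have "B * s0 \<le> B * \<bar>sgi i\<bar>" using sgi_lower[OF i] B by simp
    also have "\<dots> = \<bar>Im (mmi i + of_real r)\<bar>" using B by (simp add: mmi_def mm_def sgi_def abs_mult)
    also have "\<dots> \<le> norm (mmi i + of_real r)" by (rule abs_Im_le_cmod)
    finally show ?thesis .
  qed
  have "(B * s0)^2 \<le> norm (mmi i + of_real (sgi i * \<beta>)) * norm (mmi i + of_real (- (sgi i * \<beta>)))"
    unfolding power2_eq_square using B s0 by (intro mult_mono im) auto
  also have "\<dots> = norm (1 - (z / mmi i)^2) * (norm (mmi i))^2"
    unfolding norm_mult[symmetric] norm_power[symmetric]
    using mmi_nz[of i] by (intro arg_cong[of _ _ norm]) (simp add: z_def field_simps power2_eq_square)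
  also have "\<dots> \<le> norm (1 - (z / mmi i)^2) * (1 + B / om)^2"
    by (intro mult_left_mono power_mono mmi_upper) auto
  finally show ?thesis using B om unfolding z_def by (simp add: divide_le_eq)
qed

lemma usm_root: "usmooth K nbhd root"
proof -
  let ?I = "\<lambda>i \<eta>. inverse (of_real ((norm (pos i \<eta>))^2)) :: complex"
  have mm: "usmooth K nbhd (\<lambda>i _. mmi i)" by (rule usmooth_family_const[where C = "1 + B / om"]) (rule mmi_upper)
  have c: "usmooth K nbhd (\<lambda>i _. of_real (sgi i * b) / mmi i)"
  proof (rule usmooth_family_const[where C = "(1 / om * \<bar>b\<bar>) / (B * s0)"])
    show "norm (complex_of_real (sgi i * b) / mmi i) \<le> (1 / om * \<bar>b\<bar>) / (B * s0)" if "i \<in> K" for i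
      unfolding norm_divide norm_of_real abs_mult
      using B s0 om mmi_lower[OF that] sgi_upper by (intro frac_le mult_right_mono) auto
  qed
  have g: "usmooth K nbhd (\<lambda>i \<eta>. 1 - (of_real (sgi i * (b / (norm (pos i \<eta>))^2)) / mmi i)^2)"
  proof (rule usm_cong)
    show "usmooth K nbhd (\<lambda>i \<eta>. 1 - (of_real (sgi i * b) / mmi i * ?I i \<eta>) * (of_real (sgi i * b) / mmi i * ?I i \<eta>))"
      by (intro usm_diff usm_mult usm_const c usm_inverse_square)
  qed (simp add: power2_eq_square divide_inverse mult_ac)
  have "usmooth K nbhd (\<lambda>i \<eta>. csqrt (1 - (of_real (sgi i * (b / (norm (pos i \<eta>))^2)) / mmi i)^2))"
    unfolding usmooth_def
  proof
    fix n
    show "unif_smooth n K nbhd (\<lambda>i \<eta>. csqrt (1 - (of_real (sgi i * (b / (norm (pos i \<eta>))^2)) / mmi i)^2))"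
    proof (rule unif_smooth_csqrt[OF open_nbhd, where c = "(B * s0)^2 / (1 + B / om)^2"])
      show "0 < (B * s0)^2 / (1 + B / om)^2" using B s0 om by (intro divide_pos_pos zero_less_power mult_pos_pos add_pos_pos) auto
      show "unif_smooth m K nbhd (\<lambda>i \<eta>. 1 - (of_real (sgi i * (b / (norm (pos i \<eta>))^2)) / mmi i)^2)" for m
        using g unfolding usmooth_def by blast
    qed (rule branch_lower branch_i | assumption)+
  qed
  then show ?thesis unfolding root_def[abs_def] by (intro usm_mult mm)
qed

lemma root_continuous: "continuous_on (- Nu i) (root i)"
proof -
  have nz: "pos i \<eta> \<noteq> 0" if "\<eta> \<in> - Nu i" for \<eta> using xt_nz_off_Nu that by (simp add: pos_def)
  have cp: "continuous_on (- Nu i) (pos i)" unfolding pos_def[abs_def] xt_eq[abs_def] by (intro continuous_intros)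
  have "continuous_on (- \<real>\<^sub>\<le>\<^sub>0) csqrt"
    by (intro continuous_at_imp_continuous_on ballI) (use continuous_at_csqrt in auto)
  then have "continuous_on (- Nu i) (\<lambda>\<eta>. csqrt (1 - (of_real (sgi i * (b / (norm (pos i \<eta>))^2)) / mmi i)^2))"
  proof (rule continuous_on_compose2)
    show "continuous_on (- Nu i) (\<lambda>\<eta>. 1 - (of_real (sgi i * (b / (norm (pos i \<eta>))^2)) / mmi i)^2)"
      using nz mmi_nz[of i] by (auto intro!: continuous_intros cp)
  qed (use branch_i in blast)
  then show ?thesis unfolding root_def[abs_def] by (intro continuous_intros)
qed

text \<open>The root of det Z may grow like |\<open>x\<^sup>t\<close>|^(-2) as the end point
  approaches the origin. The cut-off vanishes there, and elsewhere the root is bounded.\<close>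

lemma amplitude_uzero:
  assumes sm: "smooth_fun \<theta>" and th1: "\<And>x. norm x > 2 \<Longrightarrow> \<theta> x = 1" and th0: "\<And>x. norm x < 1 \<Longrightarrow> \<theta> x = 0" and e: "\<epsilon> > 0"
  shows "PF.amplitude (\<lambda>i \<eta>. uzero om b B \<theta> \<epsilon> (fst i, py i, \<eta>))"
proof -
  have "compact (\<theta> ` cball 0 2)" by (intro compact_continuous_image smooth_fun_continuous[OF sm] compact_cball)
  then obtain c where c: "\<And>x. x \<in> cball 0 2 \<Longrightarrow> \<bar>\<theta> x\<bar> \<le> c"
    by (metis bounded_iff compact_imp_bounded image_eqI real_norm_def)
  \<comment> \<open>The cut-off is bounded by compactness on the closed ball of radius 2 and equals
    1 outside it.\<close>
  define \<Theta> where "\<Theta> = max c 1"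
  have \<Theta>: "\<bar>\<theta> x\<bar> \<le> \<Theta>" for x
    using c[of x] th1[of x] by (cases "norm x \<le> 2") (auto simp: \<Theta>_def)
  have \<Theta>0: "\<Theta> \<ge> 0" by (simp add: \<Theta>_def)
  let ?f = "\<lambda>i \<eta>. of_real (theta_eps \<theta> \<epsilon> (pos i \<eta>)) * (of_real (theta_eps \<theta> \<epsilon> (py i)) * root i \<eta>) :: complex"
  have eq: "uzero om b B \<theta> \<epsilon> (fst i, py i, \<eta>) = ?f i \<eta>" if "i \<in> K" "\<eta> \<in> nbhd i \<or> \<eta> \<notin> Nu i" for i \<eta>
    using sqrtdetZ_root[OF that] by (simp add: uzero_def pos_def)
  have "usmooth K nbhd (\<lambda>i \<eta>. complex_of_real (theta_eps \<theta> \<epsilon> (pos i \<eta>)))"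
    unfolding usmooth_def
  proof
    fix n
    let ?q = "\<lambda>i. (1 / \<epsilon>) *\<^sub>R (px i - sgi i *\<^sub>R ctr i)" and ?r = "\<lambda>i. sgi i / \<epsilon>"
    have arg: "(1 / \<epsilon>) *\<^sub>R pos i \<eta> = ?q i + ?r i *\<^sub>R id \<eta>" if "i \<in> K" for i \<eta>
      unfolding pos_eq[OF that] by (simp add: algebra_simps)
    have "unif_smooth n K nbhd (\<lambda>i \<eta>. \<theta> (?q i + ?r i *\<^sub>R id \<eta>))"
    proof (rule unif_smooth_compose[OF open_nbhd sm, where C = "cball 0 ((1 / \<epsilon>) * (X + \<delta> / om))" and q = ?q and r = ?r and J = id and R = "1 / om / \<epsilon>"])
      show "?q i + ?r i *\<^sub>R id p \<in> cball 0 ((1 / \<epsilon>) * (X + \<delta> / om))" if "i \<in> K" "p \<in> nbhd i" for i p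
        unfolding arg[OF that(1), symmetric] using pos_upper[OF that] e by (simp add: divide_right_mono)
      show "\<bar>?r i\<bar> \<le> 1 / om / \<epsilon>" for i
        using divide_right_mono[OF sgi_upper[of i], of \<epsilon>] e by (simp add: abs_divide)
      show "bounded_linear (id :: R2 \<Rightarrow> R2)" unfolding id_def by (rule bounded_linear_ident)
    qed auto
    then have "unif_smooth n K nbhd (\<lambda>i \<eta>. complex_of_real (\<theta> (?q i + ?r i *\<^sub>R id \<eta>)))"
      by (rule unif_smooth_linear[OF open_nbhd bounded_linear_of_real])
    then show "unif_smooth n K nbhd (\<lambda>i \<eta>. complex_of_real (theta_eps \<theta> \<epsilon> (pos i \<eta>)))"
      by (rule unif_smooth_cong[OF open_nbhd]) (simp_all add: theta_eps_def arg del: id_apply)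
  qed
  moreover have "usmooth K nbhd (\<lambda>i _. complex_of_real (theta_eps \<theta> \<epsilon> (py i)))"
    by (rule usmooth_family_const[where C = \<Theta>]) (simp add: theta_eps_def \<Theta>)
  ultimately have "usmooth K nbhd ?f" by (intro usm_mult usm_root)
  then have us: "usmooth K nbhd (\<lambda>i \<eta>. uzero om b B \<theta> \<epsilon> (fst i, py i, \<eta>))"
    by (rule usm_cong) (use eq in auto)
  have cont: "continuous_on (- Nu i) (\<lambda>\<eta>. uzero om b B \<theta> \<epsilon> (fst i, py i, \<eta>))" if i: "i \<in> K" for i
  proof (rule continuous_on_eq)
    have "continuous_on (- Nu i) (\<lambda>\<eta>. \<theta> ((1 / \<epsilon>) *\<^sub>R pos i \<eta>))"
      by (rule continuous_on_compose2[OF smooth_fun_continuous[OF sm, of UNIV]])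
        (auto simp: pos_def xt_eq intro!: continuous_intros)
    then show "continuous_on (- Nu i) (?f i)" unfolding theta_eps_def by (intro continuous_intros root_continuous)
  qed (use eq i in auto)
  \<comment> \<open>A bound for the squared root of det Z when the end point is at distance at least
    \<epsilon> from the origin.\<close>
  define Q where "Q = (1 + B / om)^2 + (1 / om * (\<bar>b\<bar> / \<epsilon>^2))^2"
  have growth: "norm (uzero om b B \<theta> \<epsilon> (fst i, py i, \<eta>)) \<le> (\<Theta> * (\<Theta> * sqrt Q)) * ((norm (\<eta> - ctr i))^2)^0"
    if i: "i \<in> K" and N: "\<eta> \<notin> Nu i" for i \<eta>
  proof (cases "norm (pos i \<eta>) < \<epsilon>")
    case True
    then have "theta_eps \<theta> \<epsilon> (pos i \<eta>) = 0" unfolding theta_eps_def using e by (intro th0) (simp add: divide_less_eq)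
    then show ?thesis using eq[OF i] N \<Theta>0 by (simp add: Q_def)
  next
    case False
    have "(norm (root i \<eta>))^2 = norm ((mmi i)^2 - (of_real (sgi i * (b / (norm (pos i \<eta>))^2)))^2)"
      unfolding root_square[symmetric] by (rule norm_power[symmetric])
    also have "\<dots> \<le> (norm (mmi i))^2 + \<bar>sgi i * (b / (norm (pos i \<eta>))^2)\<bar>^2"
      by (rule order_trans[OF norm_triangle_ineq4]) (simp add: norm_power norm_mult norm_divide abs_mult abs_divide)
    also have "\<dots> \<le> Q"
      unfolding Q_def
    proof (intro add_mono power_mono mmi_upper)
      have "\<bar>b\<bar> / (norm (pos i \<eta>))^2 \<le> \<bar>b\<bar> / \<epsilon>^2"
        using False e by (intro frac_le power_mono) auto
      then show "\<bar>sgi i * (b / (norm (pos i \<eta>))^2)\<bar> \<le> 1 / om * (\<bar>b\<bar> / \<epsilon>^2)"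
        unfolding abs_mult abs_divide using om by (intro mult_mono sgi_upper) auto
    qed auto
    finally have r: "norm (root i \<eta>) \<le> sqrt Q" by (rule real_le_rsqrt)
    have "norm (?f i \<eta>) \<le> \<Theta> * (\<Theta> * sqrt Q)"
      unfolding norm_mult norm_of_real using \<Theta>0 by (intro mult_mono r) (auto simp: theta_eps_def \<Theta>)
    then show ?thesis using eq[OF i] N by simp
  qed
  show ?thesis unfolding PF.amplitude_def nbhd_def[abs_def, symmetric]
    using us[unfolded nbhd_def[abs_def]] cont growth unfolding nbhd_def[abs_def] by blast
qed

text \<open>Growth in |\<eta>| is turned into growth in the distance from the critical point, which
  is possible in the far region because the critical points are uniformly bounded.\<close>

lemma amplitude_smooth_fun:
  assumes sm: "smooth_fun (F :: real \<times> R2 \<times> R2 \<Rightarrow> complex)"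
    and gr: "\<And>C. compact C \<Longrightarrow> \<exists>c M. \<forall>t y \<eta>. (t, y) \<in> C \<longrightarrow> norm (F (t, y, \<eta>)) \<le> c * (1 + norm \<eta>) ^ M"
  shows "PF.amplitude (\<lambda>i \<eta>. F (fst i, py i, \<eta>))"
proof -
  have us: "usmooth K nbhd (\<lambda>i \<eta>. F (fst i, py i, \<eta>))"
    unfolding usmooth_def
  proof
    fix n
    let ?J = "\<lambda>\<eta>::R2. (0::real, 0::R2, \<eta>)"
    have "unif_smooth n K nbhd (\<lambda>i \<eta>. F ((fst i, py i, 0) + 1 *\<^sub>R ?J \<eta>))"
    proof (rule unif_smooth_compose[OF open_nbhd sm, where C = "cball 0 (X + (X + (X + \<delta>)))" and q = "\<lambda>i. (fst i, py i, 0)" and r = "\<lambda>_. 1" and J = ?J and R = 1])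
      show "(fst i, py i, 0) + 1 *\<^sub>R ?J p \<in> cball 0 (X + (X + (X + \<delta>)))" if "i \<in> K" "p \<in> nbhd i" for i p
      proof -
        have "norm p \<le> norm (ctr i) + norm (p - ctr i)" using norm_triangle_ineq[of "ctr i" "p - ctr i"] by simp
        then have "norm p \<le> X + \<delta>" using bounds_i[OF that(1)] that(2) by (simp add: nbhd_iff)
        then have "norm (fst i, py i, p) \<le> X + (X + (X + \<delta>))"
          using norm_Pair_le[of "fst i" "(py i, p)"] norm_Pair_le[of "py i" p] bounds_i[OF that(1)] by simp
        then show ?thesis by simp
      qed
      show "bounded_linear ?J" by (intro bounded_linear_Pair bounded_linear_zero bounded_linear_ident)
      show "?J ` Basis \<subseteq> Basis" by (auto simp: Basis_prod_def)
    qed auto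
    then show "unif_smooth n K nbhd (\<lambda>i \<eta>. F (fst i, py i, \<eta>))" by simp
  qed
  have cont: "continuous_on (- Nu i) (\<lambda>\<eta>. F (fst i, py i, \<eta>))" for i
    by (rule continuous_on_compose2[OF smooth_fun_continuous[OF sm, of UNIV]]) (auto intro!: continuous_intros)
  obtain c M where cM: "\<And>t y \<eta>. (t, y) \<in> {-X..X} \<times> cball 0 X \<Longrightarrow> norm (F (t, y, \<eta>)) \<le> c * (1 + norm \<eta>) ^ M"
    using gr[OF compact_Times[OF compact_Icc compact_cball], of "-X" X 0 X] by blast
  \<comment> \<open>Chosen so that 1 + |\<eta>| \<le> L |\<eta> - \<open>\<eta>\<^sub>*\<close>| in
    the far region: X bounds the critical point, and 1 + X is absorbed using distance at least
    \<delta>.\<close>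
  define L where "L = (1 + X) / \<delta> + 1"
  have growth: "norm (F (fst i, py i, \<eta>)) \<le> (\<bar>c\<bar> * (L^M * (1 / \<delta>)^M)) * ((norm (\<eta> - ctr i))^2)^M"
    if i: "i \<in> K" and far: "\<delta> \<le> norm (\<eta> - ctr i)" for i \<eta>
  proof -
    let ?h = "norm (\<eta> - ctr i)"
    have X0: "X \<ge> 0" using bounds_i[OF i] by (meson abs_ge_zero order_trans)
    have L0: "L \<ge> 0" using X0 \<delta> by (simp add: L_def)
    have "1 + norm \<eta> \<le> 1 + X + ?h"
      using norm_triangle_ineq[of "ctr i" "\<eta> - ctr i"] bounds_i[OF i] by simp
    also have "1 + X = (1 + X) / \<delta> * \<delta>" using \<delta> by simp
    also have "\<dots> + ?h \<le> (1 + X) / \<delta> * ?h + ?h" using far X0 \<delta> by (intro add_mono mult_left_mono) auto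
    also have "\<dots> = L * ?h" by (simp add: L_def distrib_right)
    finally have lin: "1 + norm \<eta> \<le> L * ?h" .
    have "norm (F (fst i, py i, \<eta>)) \<le> c * (1 + norm \<eta>) ^ M"
      using bounds_i[OF i] by (intro cM) (auto simp: abs_le_iff)
    also have "\<dots> \<le> \<bar>c\<bar> * (L * ?h) ^ M"
      by (intro mult_mono power_mono lin) auto
    also have "\<dots> = \<bar>c\<bar> * (L^M * ?h ^ M)" by (simp add: power_mult_distrib)
    also have "\<dots> \<le> \<bar>c\<bar> * (L^M * ((1 / \<delta>)^(2 * M - M) * ?h ^ (2 * M)))"
      using L0 by (intro mult_left_mono power_le_far \<delta> far) auto
    finally show ?thesis by (simp add: power_mult mult.assoc)
  qed
  show ?thesis unfolding PF.amplitude_def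
    using us[unfolded nbhd_def[abs_def]] cont growth by blast
qed

section \<open>From oscillatory integrals to the propagator\<close>

lemma exp_phase:
  assumes i: "i \<in> K" and \<alpha>: "\<alpha> > 0"
  shows "exp (\<i> * ph i \<eta> / of_real \<alpha>) = exp (\<i> * of_real (action om b (fst i) (py i) (ctr i)) / of_real \<alpha>) * (PF.ga \<alpha> i (\<eta> - ctr i) * iexp (Rr i \<eta> / \<alpha>))"
proof -
  have g: "gquad (kap i / of_real \<alpha>) (aa i / \<alpha>) (bb i / \<alpha>) h = gquad (kap i) (aa i) (bb i) h / of_real \<alpha>" for h
    using \<alpha> by (simp add: gquad_def field_simps)
  show ?thesis
    unfolding PF.ga_def gauss_def g phi3_real(2)[OF i, of \<eta>] exp_add[symmetric]
    by (rule arg_cong[of _ _ exp]) (simp add: distrib_left add_divide_distrib diff_divide_distrib mult.commute)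
qed

lemma stat_coeff_Lop:
  assumes i: "i \<in> K"
  shows "PF.stat_coeff i f j = Lop om b B (fst i) (px i) (py i) j (f i)"
proof -
  have "phi3 om b B (fst i) (px i) (py i) = (\<lambda>\<eta>. of_real (Rr i \<eta>))" using phi3_real(1)[OF i] by blast
  then show ?thesis unfolding PF.stat_coeff_def Lop_def ctr_conv Ni_def by simp
qed

text \<open>Because \<open>kap\<close> is i s m and the Hessian parameters satisfy aa^2 + bb^2 = s^4
  (b/|x|^2)^2, both principal roots have the same argument. This matches the branch from the
  Gaussian integral with the branch continuous in time.\<close>

lemma det_factor:
  assumes i: "i \<in> K"
  shows "kap i * csqrt (1 + of_real ((aa i)^2 + (bb i)^2) / (kap i)^2) = \<i> * of_real (sgi i) * sqrtdetZ om b B (fst i) (py i) (ctr i)"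
proof -
  define d where "d = b / (norm (px i))^2"
  have "(aa i)^2 + (bb i)^2 = ((sgi i)^2)^2 * ((dA1 b (px i))^2 + (dA2 b (px i))^2)"
    unfolding aa_def bb_def power_mult_distrib distrib_left ..
  also have "(dA1 b (px i))^2 + (dA2 b (px i))^2 = d^2"
    unfolding d_def by (rule dA_square_sum[OF px_nz[OF i]])
  finally have ab: "(aa i)^2 + (bb i)^2 = (sgi i)^4 * d^2" by simp
  have "1 + of_real ((aa i)^2 + (bb i)^2) / (kap i)^2 = 1 - (of_real (sgi i * d) / mmi i)^2"
    unfolding ab using sgi_nz[OF i] mmi_nz[of i]
    by (simp add: kap_def power_mult_distrib power_divide field_simps flip: power_add)
  then show ?thesis
    unfolding sqrtdetZ_root[OF i disjI1[OF ctr_nbhd]] root_def px_eq[OF i] d_def by (simp add: kap_def)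
qed

lemma Uprop_osc:
  assumes amp: "\<forall>k\<le>N. PF.amplitude (\<lambda>i \<eta>. u k (fst i, py i, \<eta>))"
    and i: "i \<in> K" and \<alpha>: "0 < \<alpha>" "\<alpha> < 1"
  shows "Uprop om b B N u \<alpha> (fst i) (px i) (py i) = of_real (1 / (2 * pi * \<alpha>)^2) * (exp (\<i> * of_real (action om b (fst i) (py i) (ctr i)) / of_real \<alpha>)
     * (\<Sum>k\<le>N. of_real (\<alpha>^k) * integral UNIV (PF.osc (\<lambda>i \<eta>. u k (fst i, py i, \<eta>)) \<alpha> i)))"
proof -
  let ?E = "exp (\<i> * of_real (action om b (fst i) (py i) (ctr i)) / of_real \<alpha>)"
  let ?o = "\<lambda>k. PF.osc (\<lambda>i \<eta>. u k (fst i, py i, \<eta>)) \<alpha> i"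
  have int: "?o k integrable_on UNIV" if "k \<le> N" for k
    using PF.osc_integral_bound[OF amp[rule_format, OF that]] i \<alpha> by blast
  have "(\<lambda>\<eta>. exp (\<i> * phi om b B (fst i) (px i) (py i) \<eta> / of_real \<alpha>) * (\<Sum>k\<le>N. of_real (\<alpha>^k) * u k (fst i, py i, \<eta>)))
      = (\<lambda>\<eta>. ?E * (\<Sum>k\<le>N. of_real (\<alpha>^k) * ?o k \<eta>))"
    unfolding exp_phase[OF i \<alpha>(1), unfolded ph_def] PF.osc_def sum_distrib_left
    by (intro ext sum.cong refl) (simp only: mult_ac)
  moreover have "integral UNIV (\<lambda>\<eta>. ?E * (\<Sum>k\<le>N. of_real (\<alpha>^k) * ?o k \<eta>)) = ?E * (\<Sum>k\<le>N. of_real (\<alpha>^k) * integral UNIV (?o k))"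
    by (rule integral_unique) (intro has_integral_mult_right has_integral_sum, auto intro: integrable_integral int)
  moreover have "(2 * pi * \<alpha>) powr (-2) = 1 / (2 * pi * \<alpha>)^2"
    using \<alpha> by (simp add: powr_minus_divide)
  ultimately show ?thesis unfolding Uprop_def by simp
qed

text \<open>The k-th amplitude is expanded only to order N - k, so that all remainders are
  \<alpha>^k \<alpha>^(N-k+2) = \<alpha>^(N+2); the normalisation of the propagator removes
  \<alpha>^2.\<close>

lemma Uprop_expansion:
  assumes amp: "\<forall>k\<le>N. PF.amplitude (\<lambda>i \<eta>. u k (fst i, py i, \<eta>))"
  shows "\<exists>C. \<forall>i\<in>K. \<forall>\<alpha>. 0 < \<alpha> \<longrightarrow> \<alpha> < 1 \<longrightarrow>
     norm (Uprop om b B N u \<alpha> (fst i) (px i) (py i) - prefac om b \<alpha> (fst i) (px i) (py i) * (\<Sum>k\<le>N. complex_of_real (\<alpha>^k) * Ccoef om b B u k (fst i) (px i) (py i))) \<le> C * \<alpha>^N"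
proof -
  let ?f = "\<lambda>k i \<eta>. u k (fst i, py i, \<eta>)"
  let ?c = "\<lambda>\<alpha> i. 2 * pi * \<alpha> / (kap i * csqrt (1 + of_real ((aa i)^2 + (bb i)^2) / (kap i)^2))"
  let ?s = "\<lambda>k \<alpha> i. \<Sum>j\<le>N-k. of_real (\<alpha>^j) * PF.stat_coeff i (?f k) j"
  have "\<forall>k. \<exists>C. k \<le> N \<longrightarrow> (\<forall>i\<in>K. \<forall>\<alpha>. 0 < \<alpha> \<longrightarrow> \<alpha> < 1 \<longrightarrow> norm (integral UNIV (PF.osc (?f k) \<alpha> i) - ?c \<alpha> i * ?s k \<alpha> i) \<le> C * \<alpha>^(N-k+2))"
  proof
    fix k
    show "\<exists>C. k \<le> N \<longrightarrow> (\<forall>i\<in>K. \<forall>\<alpha>. 0 < \<alpha> \<longrightarrow> \<alpha> < 1 \<longrightarrow> norm (integral UNIV (PF.osc (?f k) \<alpha> i) - ?c \<alpha> i * ?s k \<alpha> i) \<le> C * \<alpha>^(N-k+2))"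
    proof (cases "k \<le> N")
      case True
      from PF.stationary_phase[OF amp[rule_format, OF True], of "N - k"]
      obtain C where "\<forall>i\<in>K. \<forall>\<alpha>. 0 < \<alpha> \<longrightarrow> \<alpha> < 1 \<longrightarrow> norm (integral UNIV (PF.osc (?f k) \<alpha> i) - ?c \<alpha> i * ?s k \<alpha> i) \<le> C * \<alpha>^(N-k+2)" ..
      then show ?thesis by (intro exI[of _ C] impI)
    qed simp
  qed
  from choice[OF this] obtain C where "\<forall>k. k \<le> N \<longrightarrow> (\<forall>i\<in>K. \<forall>\<alpha>. 0 < \<alpha> \<longrightarrow> \<alpha> < 1 \<longrightarrow> norm (integral UNIV (PF.osc (?f k) \<alpha> i) - ?c \<alpha> i * ?s k \<alpha> i) \<le> C k * \<alpha>^(N-k+2))" ..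
  then have C: "norm (integral UNIV (PF.osc (?f k) \<alpha> i) - ?c \<alpha> i * ?s k \<alpha> i) \<le> C k * \<alpha>^(N-k+2)" if "k \<le> N" "i \<in> K" "0 < \<alpha>" "\<alpha> < 1" for k i \<alpha>
    using that by blast
  show ?thesis
  \<comment> \<open>The factor 1 / (4 pi^2) is what the normalisation leaves after its \<alpha>^2
    has been cancelled.\<close>
  proof (intro exI[of _ "(\<Sum>k\<le>N. C k) / (4 * pi^2)"] ballI allI impI)
    fix i \<alpha> assume i: "i \<in> K" and \<alpha>: "0 < \<alpha>" "\<alpha> < (1::real)"
    let ?E = "exp (\<i> * of_real (action om b (fst i) (py i) (ctr i)) / of_real \<alpha>)"
    let ?P = "1 / (2 * pi * \<alpha>)^2"
    define q where "q = sqrtdetZ om b B (fst i) (py i) (ctr i)"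
    have qnz: "q \<noteq> 0" unfolding q_def sqrtdetZ_root[OF i disjI1[OF ctr_nbhd]] by (rule root_nz)
    \<comment> \<open>(2 pi \<alpha>)^(-2) times the Gaussian mass 2 pi \<alpha> / (i s q) gives om
      / (2 pi i \<alpha> sin(om t) q), since s = sin(om t) / om.\<close>
    have pre: "prefac om b \<alpha> (fst i) (px i) (py i) * inverse q = of_real ?P * ?E * ?c \<alpha> i"
      unfolding det_factor[OF i] prefac_def ctr_conv q_def[symmetric]
      using qnz \<alpha> om sgi_nz[OF i] by (simp add: sgi_def sg_def field_simps power2_eq_square)
    have e1: "(\<Sum>m\<le>N. complex_of_real (\<alpha>^m) * Ccoef om b B u m (fst i) (px i) (py i))
       = inverse q * (\<Sum>m\<le>N. \<Sum>k\<le>m. of_real (\<alpha>^k * \<alpha>^(m - k)) * PF.stat_coeff i (?f k) (m - k))"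
      unfolding Ccoef_def ctr_conv q_def[symmetric] sum_distrib_left
      by (intro sum.cong refl) (simp add: stat_coeff_Lop[OF i] flip: power_add of_real_power)
    \<comment> \<open>The coefficients are grouped by total order m, the integrals by amplitude
      index k.\<close>
    have e2: "(\<Sum>m\<le>N. \<Sum>k\<le>m. of_real (\<alpha>^k * \<alpha>^(m - k)) * PF.stat_coeff i (?f k) (m - k)) = (\<Sum>k\<le>N. \<Sum>j\<le>N-k. of_real (\<alpha>^k * \<alpha>^j) * PF.stat_coeff i (?f k) j)"
      by (rule sum_triangle_reindex)
    have e3: "(\<Sum>k\<le>N. \<Sum>j\<le>N-k. of_real (\<alpha>^k * \<alpha>^j) * PF.stat_coeff i (?f k) j) = (\<Sum>k\<le>N. of_real (\<alpha>^k) * ?s k \<alpha> i)"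
      by (simp add: sum_distrib_left mult.assoc)
    have "prefac om b \<alpha> (fst i) (px i) (py i) * (\<Sum>m\<le>N. complex_of_real (\<alpha>^m) * Ccoef om b B u m (fst i) (px i) (py i))
       = (of_real ?P * ?E * ?c \<alpha> i) * (\<Sum>k\<le>N. of_real (\<alpha>^k) * ?s k \<alpha> i)"
      unfolding pre[symmetric] e1 e2 e3 by (simp only: mult.assoc)
    note pr = this
    have gen: "p * (e * (\<Sum>k\<le>N. a k * I k)) - (p * e * c) * (\<Sum>k\<le>N. a k * s k) = p * (e * (\<Sum>k\<le>N. a k * (I k - c * s k)))"
      for p e c :: complex and a I s :: "nat \<Rightarrow> complex"
      by (simp only: right_diff_distrib sum_subtractf sum_distrib_left mult_ac)
    have eX: "Uprop om b B N u \<alpha> (fst i) (px i) (py i) - prefac om b \<alpha> (fst i) (px i) (py i) * (\<Sum>m\<le>N. complex_of_real (\<alpha>^m) * Ccoef om b B u m (fst i) (px i) (py i))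
       = of_real ?P * (?E * (\<Sum>k\<le>N. of_real (\<alpha>^k) * (integral UNIV (PF.osc (?f k) \<alpha> i) - ?c \<alpha> i * ?s k \<alpha> i)))"
      unfolding Uprop_osc[where N = N and u = u, OF amp i \<alpha>] pr
      by (rule gen)
    have "norm (of_real ?P * (?E * (\<Sum>k\<le>N. of_real (\<alpha>^k) * (integral UNIV (PF.osc (?f k) \<alpha> i) - ?c \<alpha> i * ?s k \<alpha> i)))) = ?P * norm (\<Sum>k\<le>N. of_real (\<alpha>^k) * (integral UNIV (PF.osc (?f k) \<alpha> i) - ?c \<alpha> i * ?s k \<alpha> i))"
    proof -
      have "norm ?E = 1" by (simp add: norm_exp_eq_Re Re_divide_of_real)
      then show ?thesis by (simp only: norm_mult norm_of_real mult_1) simp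
    qed
    also have "\<dots> \<le> ?P * (\<Sum>k\<le>N. C k * \<alpha>^(N+2))"
    proof (intro mult_left_mono sum_norm_le)
      fix k assume "k \<in> {..N}"
      then have k: "k \<le> N" by simp
      have "norm (of_real (\<alpha>^k) * (integral UNIV (PF.osc (?f k) \<alpha> i) - ?c \<alpha> i * ?s k \<alpha> i)) \<le> \<alpha>^k * (C k * \<alpha>^(N-k+2))"
        unfolding norm_mult using C[OF k i \<alpha>] \<alpha> by (intro mult_mono) (auto simp: norm_power)
      also have "\<dots> = C k * \<alpha>^(k + (N-k+2))" by (simp only: power_add mult_ac)
      also have "k + (N-k+2) = N+2" using k by simp
      finally show "norm (of_real (\<alpha>^k) * (integral UNIV (PF.osc (?f k) \<alpha> i) - ?c \<alpha> i * ?s k \<alpha> i)) \<le> C k * \<alpha>^(N+2)" .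
    qed simp
    also have "\<dots> = (\<Sum>k\<le>N. C k) / (4 * pi^2) * \<alpha>^N"
      unfolding sum_distrib_right[symmetric] using \<alpha> by (simp add: power_add power2_eq_square)
    finally show "norm (Uprop om b B N u \<alpha> (fst i) (px i) (py i) - prefac om b \<alpha> (fst i) (px i) (py i) * (\<Sum>k\<le>N. complex_of_real (\<alpha>^k) * Ccoef om b B u k (fst i) (px i) (py i)))
       \<le> (\<Sum>k\<le>N. C k) / (4 * pi^2) * \<alpha>^N" unfolding eX .
  qed
qed

text \<open>The prefactor is at least of size 1/\<alpha>, so a bounded error is already a relative
  O(\<alpha>). The expansion with N = 0 has a bounded error, and each amplitude of index k \<ge> 1
  contributes at most \<alpha>^(-2) \<alpha> \<alpha>.\<close>

lemma Uprop_leading: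
  assumes amp: "\<forall>k\<le>N. PF.amplitude (\<lambda>i \<eta>. u k (fst i, py i, \<eta>))"
    and u0: "\<forall>i\<in>K. u 0 (fst i, py i, ctr i) = sqrtdetZ om b B (fst i) (py i) (ctr i)"
  shows "\<exists>C. \<forall>i\<in>K. \<forall>\<alpha>. 0 < \<alpha> \<longrightarrow> \<alpha> < 1 \<longrightarrow>
     norm (Uprop om b B N u \<alpha> (fst i) (px i) (py i) - prefac om b \<alpha> (fst i) (px i) (py i)) \<le> C * \<alpha> * norm (prefac om b \<alpha> (fst i) (px i) (py i))"
proof -
  let ?f = "\<lambda>k i \<eta>. u k (fst i, py i, \<eta>)"
  obtain C0 where C0: "\<And>i \<alpha>. i \<in> K \<Longrightarrow> 0 < \<alpha> \<Longrightarrow> \<alpha> < 1 \<Longrightarrow>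
     norm (Uprop om b B 0 u \<alpha> (fst i) (px i) (py i) - prefac om b \<alpha> (fst i) (px i) (py i) * (\<Sum>k\<le>0. complex_of_real (\<alpha>^k) * Ccoef om b B u k (fst i) (px i) (py i))) \<le> C0 * \<alpha>^0"
    using Uprop_expansion[of 0 u] amp by auto
  \<comment> \<open>The operator of order 0 is evaluation at the critical point, where the amplitude
    is exactly the root in the denominator.\<close>
  have lead: "Ccoef om b B u 0 (fst i) (px i) (py i) = 1" if i: "i \<in> K" for i
  proof -
    have "sqrtdetZ om b B (fst i) (py i) (ctr i) \<noteq> 0"
      unfolding sqrtdetZ_root[OF i disjI1[OF ctr_nbhd]] by (rule root_nz)
    then show ?thesis unfolding Ccoef_def Lop_def ctr_conv using u0 i by simp
  qed
  have "\<forall>k. \<exists>C. k \<le> N \<longrightarrow> (\<forall>i\<in>K. \<forall>\<alpha>. 0 < \<alpha> \<longrightarrow> \<alpha> < 1 \<longrightarrow> norm (integral UNIV (PF.osc (?f k) \<alpha> i)) \<le> C * \<alpha>)"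
  proof
    fix k
    show "\<exists>C. k \<le> N \<longrightarrow> (\<forall>i\<in>K. \<forall>\<alpha>. 0 < \<alpha> \<longrightarrow> \<alpha> < 1 \<longrightarrow> norm (integral UNIV (PF.osc (?f k) \<alpha> i)) \<le> C * \<alpha>)"
    proof (cases "k \<le> N")
      case True
      from PF.osc_integral_bound[OF amp[rule_format, OF True]]
      obtain C where "\<forall>i\<in>K. \<forall>\<alpha>. 0 < \<alpha> \<longrightarrow> \<alpha> < 1 \<longrightarrow> PF.osc (?f k) \<alpha> i integrable_on UNIV \<and> norm (integral UNIV (PF.osc (?f k) \<alpha> i)) \<le> C * \<alpha>" ..
      then show ?thesis by (intro exI[of _ C] impI ballI allI) simp
    qed simp
  qed
  from choice[OF this] obtain D where "\<forall>k. k \<le> N \<longrightarrow> (\<forall>i\<in>K. \<forall>\<alpha>. 0 < \<alpha> \<longrightarrow> \<alpha> < 1 \<longrightarrow> norm (integral UNIV (PF.osc (?f k) \<alpha> i)) \<le> D k * \<alpha>)" ..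
  then have D: "norm (integral UNIV (PF.osc (?f k) \<alpha> i)) \<le> D k * \<alpha>" if "k \<le> N" "i \<in> K" "0 < \<alpha>" "\<alpha> < 1" for k i \<alpha>
    using that by blast
  define D1 where "D1 = (\<Sum>k\<in>{1..N}. \<bar>D k\<bar>) / (4 * pi^2)"
  have D1: "D1 \<ge> 0" unfolding D1_def by (intro divide_nonneg_nonneg sum_nonneg) auto
  show ?thesis
  proof (intro exI[of _ "(\<bar>C0\<bar> + D1) * (2 * pi / om)"] ballI allI impI)
    fix i \<alpha> assume i: "i \<in> K" and \<alpha>: "0 < \<alpha>" "\<alpha> < (1::real)"
    let ?E = "exp (\<i> * of_real (action om b (fst i) (py i) (ctr i)) / of_real \<alpha>)"
    let ?P = "1 / (2 * pi * \<alpha>)^2"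
    let ?U = "\<lambda>N. Uprop om b B N u \<alpha> (fst i) (px i) (py i)" and ?p = "prefac om b \<alpha> (fst i) (px i) (py i)"
    have E1: "norm ?E = 1" by (simp add: norm_exp_eq_Re Re_divide_of_real)
    have "norm (?U 0 - ?p) \<le> C0" using C0[OF i \<alpha>] lead[OF i] by simp
    moreover have "norm (?U N - ?U 0) \<le> D1"
    proof -
      have amp0: "\<forall>k\<le>0. PF.amplitude (?f k)" using amp by simp
      have split: "{..N} = insert 0 {1..N}" by auto
      have eY: "?U N - ?U 0 = of_real ?P * (?E * (\<Sum>k\<in>{1..N}. of_real (\<alpha>^k) * integral UNIV (PF.osc (?f k) \<alpha> i)))"
        unfolding Uprop_osc[where N = N and u = u, OF amp i \<alpha>] Uprop_osc[where N = 0 and u = u, OF amp0 i \<alpha>] split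
        by (simp add: distrib_left)
      have "norm (of_real ?P * (?E * (\<Sum>k\<in>{1..N}. of_real (\<alpha>^k) * integral UNIV (PF.osc (?f k) \<alpha> i)))) = ?P * norm (\<Sum>k\<in>{1..N}. of_real (\<alpha>^k) * integral UNIV (PF.osc (?f k) \<alpha> i))"
        using E1 by (simp only: norm_mult norm_of_real mult_1) simp
      also have "\<dots> \<le> ?P * (\<Sum>k\<in>{1..N}. \<alpha> * (\<bar>D k\<bar> * \<alpha>))"
      proof (intro mult_left_mono sum_norm_le)
        fix k assume "k \<in> {1..N}"
        then have k: "1 \<le> k" "k \<le> N" by auto
        have "\<alpha>^k \<le> \<alpha>^1" using \<alpha> k by (intro power_decreasing) auto
        moreover have "norm (integral UNIV (PF.osc (?f k) \<alpha> i)) \<le> \<bar>D k\<bar> * \<alpha>"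
          using D[OF k(2) i \<alpha>] \<alpha> by (meson abs_ge_self mult_right_mono less_imp_le order_trans)
        ultimately show "norm (of_real (\<alpha>^k) * integral UNIV (PF.osc (?f k) \<alpha> i)) \<le> \<alpha> * (\<bar>D k\<bar> * \<alpha>)"
          unfolding norm_mult using \<alpha> by (intro mult_mono) (auto simp: norm_power)
      qed simp
      also have "(\<Sum>k\<in>{1..N}. \<alpha> * (\<bar>D k\<bar> * \<alpha>)) = (\<alpha> * \<alpha>) * (\<Sum>k\<in>{1..N}. \<bar>D k\<bar>)"
        by (simp add: sum_distrib_left mult_ac)
      also have "?P * ((\<alpha> * \<alpha>) * (\<Sum>k\<in>{1..N}. \<bar>D k\<bar>)) = D1" using \<alpha> by (simp add: D1_def power2_eq_square)
      finally show ?thesis unfolding eY .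
    qed
    ultimately have "norm (?U N - ?p) \<le> \<bar>C0\<bar> + D1"
      using norm_triangle_ineq[of "?U N - ?U 0" "?U 0 - ?p"] by simp
    also have "\<dots> \<le> (\<bar>C0\<bar> + D1) * ((2 * pi / om) * \<alpha> * norm ?p)"
    proof -
      \<comment> \<open>The exponential has modulus one, and |sin| \<le> 1 turns this equality into
        the lower bound om / (2 pi \<alpha>) for the prefactor.\<close>
      have "norm ?p = om / (2 * pi * \<alpha> * \<bar>sin (om * fst i)\<bar>)"
        unfolding prefac_def ctr_conv using E1 om \<alpha> by (simp add: norm_mult norm_divide abs_mult)
      moreover have "sin (om * fst i) \<noteq> 0" using sgi_nz[OF i] by (auto simp: sgi_def sg_def)
      ultimately have "(2 * pi / om) * \<alpha> * norm ?p = 1 / \<bar>sin (om * fst i)\<bar>" using \<alpha> om by simp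
      moreover have "1 \<le> 1 / \<bar>sin (om * fst i)\<bar>" using \<open>sin (om * fst i) \<noteq> 0\<close> by simp
      ultimately have "1 \<le> (2 * pi / om) * \<alpha> * norm ?p" by simp
      then have "(\<bar>C0\<bar> + D1) * 1 \<le> (\<bar>C0\<bar> + D1) * ((2 * pi / om) * \<alpha> * norm ?p)"
        using D1 by (intro mult_left_mono) auto
      then show ?thesis by (simp only: mult_1_right)
    qed
    finally show "norm (?U N - ?p) \<le> (\<bar>C0\<bar> + D1) * (2 * pi / om) * \<alpha> * norm ?p" by (simp only: mult.assoc)
  qed
qed

end

section \<open>Uniform constants from compactness\<close>

lemma compact_away_from_zero:
  fixes g :: "'a::topological_space \<Rightarrow> 'b::real_normed_vector"
  assumes "compact S" "continuous_on S g" "\<And>p. p \<in> S \<Longrightarrow> g p \<noteq> 0"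
  shows "\<exists>d>0. \<forall>p\<in>S. d \<le> norm (g p)"
proof -
  have "closed (g ` S)" using assms by (intro compact_imp_closed compact_continuous_image)
  moreover have "0 \<notin> g ` S" using assms(3) by force
  ultimately obtain d where d: "d > 0" "ball 0 d \<subseteq> - g ` S"
    by (metis Compl_iff open_Compl open_contains_ball)
  have "d \<le> norm (g p)" if "p \<in> S" for p
  proof (rule ccontr)
    assume "\<not> d \<le> norm (g p)"
    then have "g p \<in> ball 0 d" by simp
    then show False using d(2) that by blast
  qed
  then show ?thesis using d(1) by blast
qed

text \<open>With rescaled time the trajectories form one continuous image of the compact set K
  \<times> [0, 1], so avoiding the origin pointwise gives a uniform distance.\<close>

lemma caustic_free_exists:
  assumes om: "om > 0" and B: "B > 0" and K: "compact K"
    and K_sub: "\<And>t x y. (t, x, y) \<in> K \<Longrightarrow> sin (om * t) \<noteq> 0 \<and> y \<noteq> 0 \<and>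
                  (\<forall>s\<in>closed_segment 0 t. xt om b s y (etastar om b t x y) \<noteq> 0)"
  obtains \<delta> \<rho> X s0 where "caustic_free om b B \<delta> \<rho> X s0 K"
proof -
  have nz: "sin (om * fst p) \<noteq> 0" "snd (snd p) \<noteq> 0" if "p \<in> K" for p
    using K_sub[of "fst p" "fst (snd p)" "snd (snd p)"] that by auto
  have cA: "continuous_on K (\<lambda>p. Avec b (snd (snd p)))"
    by (rule continuous_on_compose2[OF continuous_on_Avec]) (use nz in \<open>auto intro!: continuous_intros\<close>)
  have ce: "continuous_on K (\<lambda>p. etastar om b (fst p) (fst (snd p)) (snd (snd p)))"
    unfolding etastar_def by (intro continuous_intros cA) (use nz in auto)
  have "continuous_on K (\<lambda>p. sg om (fst p))" unfolding sg_def divide_inverse by (intro continuous_intros)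
  then have "\<exists>d>0. \<forall>p\<in>K. d \<le> norm (sg om (fst p))"
    by (rule compact_away_from_zero[OF K]) (use nz om in \<open>auto simp: sg_def\<close>)
  then obtain s0 where s0: "s0 > 0" "\<And>p. p \<in> K \<Longrightarrow> s0 \<le> norm (sg om (fst p))" by blast
  define G where "G q = xt om b (fst (fst q) * snd q) (snd (snd (fst q))) (etastar om b (fst (fst q)) (fst (snd (fst q))) (snd (snd (fst q))))" for q :: "(real \<times> R2 \<times> R2) \<times> real"
  have "\<exists>d>0. \<forall>q\<in>K \<times> {0..1}. d \<le> norm (G q)"
  proof (rule compact_away_from_zero[of "K \<times> {0..1}" G])
    show "compact (K \<times> {0..1::real})" using K by (intro compact_Times) auto
    have e: "continuous_on (K \<times> {0..1}) (\<lambda>q. etastar om b (fst (fst q)) (fst (snd (fst q))) (snd (snd (fst q))))"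
      by (rule continuous_on_compose2[OF ce]) (auto intro!: continuous_intros)
    have a: "continuous_on (K \<times> {0..1}) (\<lambda>q. Avec b (snd (snd (fst q))))"
      by (rule continuous_on_compose2[OF cA]) (auto intro!: continuous_intros)
    show "continuous_on (K \<times> {0..1}) G"
      unfolding G_def[abs_def] xt_def divide_inverse by (intro continuous_intros e a)
    show "G q \<noteq> 0" if "q \<in> K \<times> {0..1}" for q
    proof -
      have "fst (fst q) * snd q \<in> closed_segment 0 (fst (fst q))" using that by (auto simp: closed_segment_zero_eq)
      then show ?thesis using K_sub[of "fst (fst q)" "fst (snd (fst q))" "snd (snd (fst q))"] that by (auto simp: G_def)
    qed
  qed
  then obtain r where r: "r > 0" "\<And>q. q \<in> K \<times> {0..1} \<Longrightarrow> r \<le> norm (G q)" by blast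
  have bd: "\<exists>X. \<forall>p\<in>K. norm (g p) \<le> X" if "continuous_on K g" for g :: "real \<times> R2 \<times> R2 \<Rightarrow> 'c::real_normed_vector"
    using compact_imp_bounded[OF compact_continuous_image[OF that K]] by (simp add: bounded_iff)
  obtain X1 X2 where X: "\<And>p. p \<in> K \<Longrightarrow> norm p \<le> X1" "\<And>p. p \<in> K \<Longrightarrow> norm (etastar om b (fst p) (fst (snd p)) (snd (snd p))) \<le> X2"
    using bd[OF continuous_on_id] bd[OF ce] by (auto simp: id_def)
  \<comment> \<open>Changing the momentum by less than \<delta> moves every point of the trajectory
    by at most \<delta> / om = r/2, leaving half of the distance r.\<close>
  define \<delta> where "\<delta> = om * (r / 2)"
  have "caustic_free om b B \<delta> (r / 2) (max X1 X2) s0 K"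
  proof
    fix t x y assume p: "(t, x, y) \<in> K"
    show "s0 \<le> \<bar>sg om t\<bar>" using s0(2)[OF p] by simp
    have n: "norm (t, x, y) \<le> X1" by (rule X(1)[OF p])
    have "norm t \<le> norm (t, x, y)" "norm (x, y) \<le> norm (t, x, y)" "norm x \<le> norm (x, y)" "norm y \<le> norm (x, y)"
      by (rule norm_fst_le norm_snd_le)+
    then show "\<bar>t\<bar> \<le> max X1 X2 \<and> norm x \<le> max X1 X2 \<and> norm y \<le> max X1 X2 \<and> norm (etastar om b t x y) \<le> max X1 X2"
      using n X(2)[OF p] by auto
  next
    fix t x y s \<eta> assume p: "(t, x, y) \<in> K" and s: "s \<in> closed_segment 0 t" and h: "norm (\<eta> - etastar om b t x y) < \<delta>"
    let ?e = "etastar om b t x y"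
    obtain \<tau> where \<tau>: "\<tau> \<in> {0..1}" "s = t * \<tau>" using s by (auto simp: closed_segment_zero_eq)
    have "r \<le> norm (xt om b s y ?e)" using r(2)[of "((t, x, y), \<tau>)"] p \<tau> by (simp add: G_def)
    also have "xt om b s y ?e = xt om b s y \<eta> - sg om s *\<^sub>R (\<eta> - ?e)" by (simp add: xt_eq algebra_simps)
    also have "norm \<dots> \<le> norm (xt om b s y \<eta>) + \<bar>sg om s\<bar> * norm (\<eta> - ?e)"
      by (rule order_trans[OF norm_triangle_ineq4]) simp
    also have "\<bar>sg om s\<bar> * norm (\<eta> - ?e) \<le> (1 / om) * \<delta>"
      using h om by (intro mult_mono) (auto simp: sg_def abs_divide divide_right_mono)
    also have "(1 / om) * \<delta> = r / 2" using om by (simp add: \<delta>_def)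
    finally show "r / 2 \<le> norm (xt om b s y \<eta>)" by simp
  qed (use om B r s0 in \<open>auto simp: \<delta>_def\<close>)
  then show ?thesis by (rule that)
qed

theorem theorem5p1:
  fixes om b B \<epsilon> :: real and N :: nat and \<theta> :: "R2 \<Rightarrow> real"
    and u :: "nat \<Rightarrow> real \<times> R2 \<times> R2 \<Rightarrow> complex"
    and K :: "(real \<times> R2 \<times> R2) set"
  assumes om: "om > 0" and BB: "B > 0" and eps: "\<epsilon> > 0"
    and th_smooth: "smooth_fun \<theta>"
    and th1: "\<And>x. norm x > 2 \<Longrightarrow> \<theta> x = 1"
    and th0: "\<And>x. norm x < 1 \<Longrightarrow> \<theta> x = 0"
    and u0: "u 0 = uzero om b B \<theta> \<epsilon>"
    and u_smooth: "\<And>k. 1 \<le> k \<Longrightarrow> k \<le> N \<Longrightarrow> smooth_fun (u k)"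
    and u_growth: "\<And>k C. 1 \<le> k \<Longrightarrow> k \<le> N \<Longrightarrow> compact C \<Longrightarrow>
                     \<exists>c M. \<forall>t y \<eta>. (t, y) \<in> C \<longrightarrow> norm (u k (t, y, \<eta>)) \<le> c * (1 + norm \<eta>) ^ M"
    and K_compact: "compact K"
    and K_sub: "\<And>t x y. (t, x, y) \<in> K \<Longrightarrow>
                  sin (om * t) \<noteq> 0 \<and> y \<noteq> 0 \<and>
                  (\<forall>s\<in>closed_segment 0 t. xt om b s y (etastar om b t x y) \<noteq> 0)"
  shows
    "(\<forall>t x y lift. (t, x, y) \<in> K \<longrightarrow> continuous_on (closed_segment 0 t) lift \<longrightarrow>
        (\<forall>s\<in>closed_segment 0 t. xt om b s y (etastar om b t x y)
            = norm (xt om b s y (etastar om b t x y)) *\<^sub>R (cos (lift s), sin (lift s))) \<longrightarrow>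
        action om b t y (etastar om b t x y)
          = om / (2 * sin (om * t)) * (cos (om * t) * ((norm x)^2 + (norm y)^2) - 2 * inner x y)
            + b * (lift t - lift 0))
     \<and> (\<exists>C \<alpha>0. \<alpha>0 > 0 \<and> (\<forall>\<alpha> t x y. 0 < \<alpha> \<longrightarrow> \<alpha> < \<alpha>0 \<longrightarrow> (t, x, y) \<in> K \<longrightarrow>
          norm (Uprop om b B N u \<alpha> t x y
                - prefac om b \<alpha> t x y * (\<Sum>k\<le>N. complex_of_real (\<alpha>^k) * Ccoef om b B u k t x y))
          \<le> C * \<alpha>^N))
     \<and> ((\<forall>t x y. (t, x, y) \<in> K \<longrightarrow> norm x > 2 * \<epsilon> \<and> norm y > 2 * \<epsilon>) \<longrightarrow>
        (\<exists>C \<alpha>0. \<alpha>0 > 0 \<and> (\<forall>\<alpha> t x y. 0 < \<alpha> \<longrightarrow> \<alpha> < \<alpha>0 \<longrightarrow> (t, x, y) \<in> K \<longrightarrow>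
          norm (Uprop om b B N u \<alpha> t x y - prefac om b \<alpha> t x y)
          \<le> C * \<alpha> * norm (prefac om b \<alpha> t x y))))"
proof -
  obtain \<delta> \<rho> X s0 where cf: "caustic_free om b B \<delta> \<rho> X s0 K"
    using caustic_free_exists[OF om BB K_compact K_sub] by blast
  interpret caustic_free om b B \<delta> \<rho> X s0 K by (rule cf)
  have amp: "\<forall>k\<le>N. PF.amplitude (\<lambda>i \<eta>. u k (fst i, py i, \<eta>))"
  proof (intro allI impI)
    fix k assume k: "k \<le> N"
    show "PF.amplitude (\<lambda>i \<eta>. u k (fst i, py i, \<eta>))"
    proof (cases "k = 0")
      case True
      show ?thesis unfolding True u0 by (rule amplitude_uzero[OF th_smooth th1 th0 eps])
    next
      case False
      then show ?thesis using k by (intro amplitude_smooth_fun u_smooth u_growth) auto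
    qed
  qed
  have idx: "fst (t, x, y) = t" "px (t, x, y) = x" "py (t, x, y) = y" for t x y by (simp_all add: px_def py_def)
  have part1: "action om b t y (etastar om b t x y)
          = om / (2 * sin (om * t)) * (cos (om * t) * ((norm x)^2 + (norm y)^2) - 2 * inner x y) + b * (lift t - lift 0)"
    if "(t, x, y) \<in> K" "continuous_on (closed_segment 0 t) lift"
      "\<forall>s\<in>closed_segment 0 t. xt om b s y (etastar om b t x y) = norm (xt om b s y (etastar om b t x y)) *\<^sub>R (cos (lift s), sin (lift s))"
    for t x y lift
    by (rule action_lift_formula[OF om]) (use K_sub[OF that(1)] that(2,3) in auto)
  from Uprop_expansion[where N = N and u = u, OF amp]
  obtain C where C: "\<forall>i\<in>K. \<forall>\<alpha>. 0 < \<alpha> \<longrightarrow> \<alpha> < 1 \<longrightarrow>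
     norm (Uprop om b B N u \<alpha> (fst i) (px i) (py i) - prefac om b \<alpha> (fst i) (px i) (py i) * (\<Sum>k\<le>N. complex_of_real (\<alpha>^k) * Ccoef om b B u k (fst i) (px i) (py i))) \<le> C * \<alpha>^N" ..
  have part2: "\<exists>C \<alpha>0. \<alpha>0 > 0 \<and> (\<forall>\<alpha> t x y. 0 < \<alpha> \<longrightarrow> \<alpha> < \<alpha>0 \<longrightarrow> (t, x, y) \<in> K \<longrightarrow>
          norm (Uprop om b B N u \<alpha> t x y - prefac om b \<alpha> t x y * (\<Sum>k\<le>N. complex_of_real (\<alpha>^k) * Ccoef om b B u k t x y)) \<le> C * \<alpha>^N)"
  proof (rule exI[of _ C], rule exI[of _ 1], intro conjI allI impI)
    fix \<alpha> t x y assume "0 < \<alpha>" "\<alpha> < (1::real)" "(t, x, y) \<in> K"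
    then show "norm (Uprop om b B N u \<alpha> t x y - prefac om b \<alpha> t x y * (\<Sum>k\<le>N. complex_of_real (\<alpha>^k) * Ccoef om b B u k t x y)) \<le> C * \<alpha>^N"
      using C[rule_format, of "(t, x, y)" \<alpha>] unfolding idx by blast
  qed simp
  have part3: "\<exists>C \<alpha>0. \<alpha>0 > 0 \<and> (\<forall>\<alpha> t x y. 0 < \<alpha> \<longrightarrow> \<alpha> < \<alpha>0 \<longrightarrow> (t, x, y) \<in> K \<longrightarrow>
          norm (Uprop om b B N u \<alpha> t x y - prefac om b \<alpha> t x y) \<le> C * \<alpha> * norm (prefac om b \<alpha> t x y))"
    if far: "\<forall>t x y. (t, x, y) \<in> K \<longrightarrow> norm x > 2 * \<epsilon> \<and> norm y > 2 * \<epsilon>"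
  proof -
    \<comment> \<open>The cut-offs enter the leading coefficient only through their values at x and
      y, which are 1 when both norms exceed 2 \<epsilon>.\<close>
    have "\<forall>i\<in>K. u 0 (fst i, py i, ctr i) = sqrtdetZ om b B (fst i) (py i) (ctr i)"
    proof
      fix i assume i: "i \<in> K"
      have "norm (px i) > 2 * \<epsilon>" "norm (py i) > 2 * \<epsilon>"
        using far i by (cases i, auto simp: px_def py_def)+
      then have "theta_eps \<theta> \<epsilon> (px i) = 1" "theta_eps \<theta> \<epsilon> (py i) = 1"
        unfolding theta_eps_def using eps by (auto intro!: th1 simp: less_divide_eq)
      moreover have "xt om b (fst i) (py i) (ctr i) = px i" using px_eq[OF i] by (simp add: pos_def)
      ultimately show "u 0 (fst i, py i, ctr i) = sqrtdetZ om b B (fst i) (py i) (ctr i)" unfolding u0 uzero_def by simp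
    qed
    from Uprop_leading[where N = N and u = u, OF amp this] obtain C where C: "\<forall>i\<in>K. \<forall>\<alpha>. 0 < \<alpha> \<longrightarrow> \<alpha> < 1 \<longrightarrow>
       norm (Uprop om b B N u \<alpha> (fst i) (px i) (py i) - prefac om b \<alpha> (fst i) (px i) (py i)) \<le> C * \<alpha> * norm (prefac om b \<alpha> (fst i) (px i) (py i))" ..
    show ?thesis
    proof (rule exI[of _ C], rule exI[of _ 1], intro conjI allI impI)
      fix \<alpha> t x y assume "0 < \<alpha>" "\<alpha> < (1::real)" "(t, x, y) \<in> K"
      then show "norm (Uprop om b B N u \<alpha> t x y - prefac om b \<alpha> t x y) \<le> C * \<alpha> * norm (prefac om b \<alpha> t x y)"
        using C[rule_format, of "(t, x, y)" \<alpha>] unfolding idx by blast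
    qed simp
  qed
  show ?thesis using part1 part2 part3 by blast
qed

end
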